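(* Let $K$ be an algebraically closed field, let $n\ge2$ and let $B=B(n,1,1,\dots,1)$. Then $B$ is a higher Auslander algebra with $gldim(B)=domdim(B)=2n-2$, and $F(\Delta)=Dom_{n-1}=Proj_{n-1}$. The characteristic tilting module of $B$ is $T=eB\oplus S_1$, where $eB$ is the minimal faithful projective-injective $B$-module and $S_1$ is the simple module corresponding to vertex $1$.
   Context: Modules are finite dimensional right modules; $D=Hom_K(-,K)$; paths are composed from left to right. For $n\ge2$, $B(n,1,1,\dots,1)$ (with $n-2$ ones) is the quiver algebra over $K$ with vertices $1,\dots,n$, arrows $a_i:i\to i+1$ and $b_i:i+1\to i$ for $1\le i\le n-1$, and relations $b_{n-1}a_{n-1}=0$ and, for $i=2,\dots,n-1$, $b_{i-1}a_{i-1}=a_ib_i$, $a_{i-1}a_i=0$, $b_ib_{i-1}=0$. For a module $M$ with minimal injective resolution $0\to M\to I_0\to I_1\to\cdots$, the dominant dimension $domdim(M)$ is $\sup\{k\mid I_i \text{ is projective for } i=0,\dots,k\}+1$ if $I_0$ is projective, and $0$ otherwise; the dominant dimension of an algebra is that of its regular module. $Dom_i$ is the full subcategory of modules with dominant dimension at least $i$ and $Proj_i$ that of modules of projective dimension at most $i$. A higher Auslander algebra is an algebra of finite global dimension equal to its dominant dimension $d$, with $d\ge 2$. $B$ is quasi-hereditary with respect to the ordered sequence $(e_1,\dots,e_n)$ of idempotents corresponding to the vertices $1,\dots,n$: with $J$ the Jacobson radical, the standard modules are $\Delta(i)=e_iB/e_iJ(e_{i+1}+\cdots+e_n)B$ and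 the costandard modules are $\nabla(i)=D(\Delta^{o}(i))$, where $\Delta^o(i)=Be_i/B(e_{i+1}+\cdots+e_n)Je_i$. $F(\Delta)$ (resp. $F(\nabla)$) is the full subcategory of modules having a finite filtration with all subquotients isomorphic to standard (resp. costandard) modules. The characteristic tilting module is the unique basic tilting module $T$ with $add(T)=F(\Delta)\cap F(\nabla)$. *)

theory Defs
  imports
    "HOL-Algebra.Algebraic_Closure_Type"
    "HOL-Algebra.QuotRing"
    "HOL-Library.Extended_Nat"
    "Graph_Theory.Arc_Walk"
begin

section \<open>Finite-dimensional algebras\<close>

text \<open>
  The field is a type \<open>'k\<close>. A \<open>'k\<close>-algebra is stored in the library record \<open>('k, 'a) module\<close>,
  whose fields are those of a ring together with a scalar multiplication. (The locale
  \<open>algebra\<close> of the library is restricted to commutative algebras.)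
\<close>

locale fd_algebra = ring A + Module.module "ring_of_type_algebra :: 'k ring" A
  for A :: "('k::field, 'a) module" (structure) +
  assumes smult_mult_left:
      "x \<in> carrier A \<Longrightarrow> y \<in> carrier A \<Longrightarrow> (c \<odot> x) \<otimes> y = c \<odot> (x \<otimes> y)"
    and smult_mult_right:
      "x \<in> carrier A \<Longrightarrow> y \<in> carrier A \<Longrightarrow> x \<otimes> (c \<odot> y) = c \<odot> (x \<otimes> y)"
    and finite_dim:
      "\<exists>S. finite S \<and> S \<subseteq> carrier A \<and>
         (\<forall>x\<in>carrier A. \<exists>c. x = finsum A (\<lambda>s. c s \<odot> s) S)"

definition opposite :: "('k, 'a) module \<Rightarrow> ('k, 'a) module" where
  "opposite A = A\<lparr>monoid.mult := \<lambda>x y. y \<otimes>\<^bsub>A\<^esub> x\<rparr>"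

definition quotient_algebra :: "('k, 'a) module \<Rightarrow> 'a set \<Rightarrow> ('k, 'a set) module" where
  "quotient_algebra A I =
     \<lparr>carrier = carrier (A Quot I), monoid.mult = monoid.mult (A Quot I),
      one = one (A Quot I), ring.zero = ring.zero (A Quot I), add = add (A Quot I),
      module.smult = (\<lambda>c L. \<Union>x\<in>L. I +>\<^bsub>A\<^esub> (c \<odot>\<^bsub>A\<^esub> x))\<rparr>"


section \<open>Path algebras of quivers\<close>

text \<open>
  A quiver is a \<open>pre_digraph\<close> of the library. A path is a triple consisting of its source, its
  list of arrows and its target; the trivial path at \<open>u\<close> is \<open>(u, [], u)\<close>. Elements of the path
  algebra are the finitely supported functions on paths, and the product of two paths \<open>p\<close>, \<open>q\<close> is
  \<open>p\<close> followed by \<open>q\<close>. The quiver is assumed to have finitely many vertices.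
\<close>

definition paths :: "('v, 'e) pre_digraph \<Rightarrow> ('v \<times> 'e list \<times> 'v) set" where
  "paths Q = {(u, p, v). pre_digraph.awalk Q u p v}"

definition path_algebra ::
  "('v, 'e) pre_digraph \<Rightarrow> ('k::field, 'v \<times> 'e list \<times> 'v \<Rightarrow> 'k) module" where
  "path_algebra Q =
     \<lparr>carrier = {f. finite {p. f p \<noteq> 0} \<and> {p. f p \<noteq> 0} \<subseteq> paths Q},
      monoid.mult = (\<lambda>f g (u, p, v). \<Sum>(q, r)\<in>{(q, r). q @ r = p}.
                       \<Sum>w\<in>verts Q. f (u, q, w) * g (w, r, v)),
      one = (\<lambda>(u, p, v). if u \<in> verts Q \<and> p = [] \<and> u = v then 1 else 0),
      ring.zero = (\<lambda>_. 0),
      add = (\<lambda>f g p. f p + g p),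
      module.smult = (\<lambda>c f p. c * f p)\<rparr>"

definition path_element :: "'v \<times> 'e list \<times> 'v \<Rightarrow> ('v \<times> 'e list \<times> 'v \<Rightarrow> 'k::field)" where
  "path_element p = (\<lambda>q. if q = p then 1 else 0)"

definition arrow_element ::
  "('v, 'e) pre_digraph \<Rightarrow> 'e \<Rightarrow> ('v \<times> 'e list \<times> 'v \<Rightarrow> 'k::field)" where
  "arrow_element Q a = path_element (tail Q a, [a], head Q a)"


section \<open>The algebra $B(n,1,\dots,1)$\<close>

datatype arrow = Arrow_a nat | Arrow_b nat

definition B_quiver :: "nat \<Rightarrow> (nat, arrow) pre_digraph" where
  "B_quiver n =
     \<lparr>verts = {1..n},
      arcs = Arrow_a ` {1..n-1} \<union> Arrow_b ` {1..n-1},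
      tail = (\<lambda>x. case x of Arrow_a i \<Rightarrow> i | Arrow_b i \<Rightarrow> i + 1),
      head = (\<lambda>x. case x of Arrow_a i \<Rightarrow> i + 1 | Arrow_b i \<Rightarrow> i)\<rparr>"

type_synonym 'k B_path = "nat \<times> arrow list \<times> nat \<Rightarrow> 'k"

definition B_relations :: "nat \<Rightarrow> 'k::field B_path set" where
  "B_relations n =
     (let KQ = path_algebra (B_quiver n) :: ('k, 'k B_path) module;
          a = (\<lambda>i. arrow_element (B_quiver n) (Arrow_a i));
          b = (\<lambda>i. arrow_element (B_quiver n) (Arrow_b i))
      in {b (n-1) \<otimes>\<^bsub>KQ\<^esub> a (n-1)}
         \<union> {b (i-1) \<otimes>\<^bsub>KQ\<^esub> a (i-1) \<ominus>\<^bsub>KQ\<^esub> a i \<otimes>\<^bsub>KQ\<^esub> b i | i. i \<in> {2..n-1}}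
         \<union> {a (i-1) \<otimes>\<^bsub>KQ\<^esub> a i | i. i \<in> {2..n-1}}
         \<union> {b i \<otimes>\<^bsub>KQ\<^esub> b (i-1) | i. i \<in> {2..n-1}})"

definition B_ideal :: "nat \<Rightarrow> 'k::field B_path set" where
  "B_ideal n = genideal (path_algebra (B_quiver n) :: ('k, 'k B_path) module) (B_relations n)"

definition B_algebra :: "nat \<Rightarrow> ('k::field, 'k B_path set) module" where
  "B_algebra n = quotient_algebra (path_algebra (B_quiver n)) (B_ideal n)"

definition B_idempotent :: "nat \<Rightarrow> nat \<Rightarrow> 'k::field B_path set" where
  "B_idempotent n i =
     B_ideal n +>\<^bsub>path_algebra (B_quiver n) :: ('k, 'k B_path) module\<^esub> path_element (i, [], i)"


section \<open>Finite-dimensional right modules\<close>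

text \<open>
  As for modules in the library, the fields \<open>mult\<close> and \<open>one\<close> inherited from \<open>ring\<close> are irrelevant.
  The action of the field on a module \<open>M\<close> over \<open>A\<close> is that of the multiples of the unit of \<open>A\<close>.
\<close>

record ('a, 'm) rmodule = "'m ring" +
  ract :: "'m \<Rightarrow> 'a \<Rightarrow> 'm" (infixl \<open>\<lhd>\<index>\<close> 70)

locale fd_right_module = A: ring A + M: abelian_group M
  for A :: "('k::field, 'a) module" and M :: "('a, 'm) rmodule" (structure) +
  assumes ract_closed: "x \<in> carrier M \<Longrightarrow> a \<in> carrier A \<Longrightarrow> x \<lhd> a \<in> carrier M"
    and ract_add_left:
      "x \<in> carrier M \<Longrightarrow> y \<in> carrier M \<Longrightarrow> a \<in> carrier A \<Longrightarrow> (x \<oplus> y) \<lhd> a = x \<lhd> a \<oplus> y \<lhd> a"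
    and ract_add_right:
      "x \<in> carrier M \<Longrightarrow> a \<in> carrier A \<Longrightarrow> b \<in> carrier A \<Longrightarrow> x \<lhd> (a \<oplus>\<^bsub>A\<^esub> b) = x \<lhd> a \<oplus> x \<lhd> b"
    and ract_mult:
      "x \<in> carrier M \<Longrightarrow> a \<in> carrier A \<Longrightarrow> b \<in> carrier A \<Longrightarrow> x \<lhd> (a \<otimes>\<^bsub>A\<^esub> b) = (x \<lhd> a) \<lhd> b"
    and ract_one: "x \<in> carrier M \<Longrightarrow> x \<lhd> \<one>\<^bsub>A\<^esub> = x"
    and finite_dim:
      "\<exists>S. finite S \<and> S \<subseteq> carrier M \<and>
         (\<forall>x\<in>carrier M. \<exists>c. x = finsum M (\<lambda>s. s \<lhd> (c s \<odot>\<^bsub>A\<^esub> \<one>\<^bsub>A\<^esub>)) S)"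

text \<open>
  The definitions below that range over all modules let the elements of these modules be taken from
  \<open>nat \<Rightarrow> 'k\<close>. Since the coordinate space of any finite dimension embeds into this type, every
  finite-dimensional module is isomorphic to one of these.
\<close>

type_synonym ('k, 'a) umodule = "('a, nat \<Rightarrow> 'k) rmodule"

definition modules :: "('k::field, 'a) module \<Rightarrow> ('k, 'a) umodule set" where
  "modules A = {M. fd_right_module A M}"

definition regular_module :: "('k, 'a) module \<Rightarrow> ('a, 'a) rmodule" where
  "regular_module A =
     \<lparr>carrier = carrier A, monoid.mult = monoid.mult A, one = one A, ring.zero = ring.zero A,
      add = add A, ract = monoid.mult A\<rparr>"

definition zero_module :: "('a, 'm) rmodule \<Rightarrow> bool" where
  "zero_module M \<longleftrightarrow> carrier M = {\<zero>\<^bsub>M\<^esub>}"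

definition module_hom ::
  "('k, 'a) module \<Rightarrow> ('a, 'm) rmodule \<Rightarrow> ('a, 'n) rmodule \<Rightarrow> ('m \<Rightarrow> 'n) \<Rightarrow> bool" where
  "module_hom A M N f \<longleftrightarrow>
     f \<in> carrier M \<rightarrow> carrier N \<and>
     (\<forall>x\<in>carrier M. \<forall>y\<in>carrier M. f (x \<oplus>\<^bsub>M\<^esub> y) = f x \<oplus>\<^bsub>N\<^esub> f y) \<and>
     (\<forall>x\<in>carrier M. \<forall>a\<in>carrier A. f (x \<lhd>\<^bsub>M\<^esub> a) = f x \<lhd>\<^bsub>N\<^esub> a)"

definition module_iso ::
  "('k, 'a) module \<Rightarrow> ('a, 'm) rmodule \<Rightarrow> ('a, 'n) rmodule \<Rightarrow> bool" where
  "module_iso A M N \<longleftrightarrow> (\<exists>f. module_hom A M N f \<and> bij_betw f (carrier M) (carrier N))"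

definition rsubmodule :: "('k, 'a) module \<Rightarrow> 'm set \<Rightarrow> ('a, 'm) rmodule \<Rightarrow> bool" where
  "rsubmodule A U M \<longleftrightarrow>
     U \<subseteq> carrier M \<and> \<zero>\<^bsub>M\<^esub> \<in> U \<and> (\<forall>x\<in>U. \<forall>y\<in>U. x \<oplus>\<^bsub>M\<^esub> y \<in> U) \<and>
     (\<forall>x\<in>U. \<forall>a\<in>carrier A. x \<lhd>\<^bsub>M\<^esub> a \<in> U)"

definition generated_submodule ::
  "('k, 'a) module \<Rightarrow> ('a, 'm) rmodule \<Rightarrow> 'm set \<Rightarrow> 'm set" where
  "generated_submodule A M S = \<Inter>{U. rsubmodule A U M \<and> S \<subseteq> U}"

definition quotient_module :: "('a, 'm) rmodule \<Rightarrow> 'm set \<Rightarrow> ('a, 'm set) rmodule" where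
  "quotient_module M U =
     \<lparr>carrier = a_rcosets\<^bsub>M\<^esub> U, monoid.mult = undefined, one = undefined, ring.zero = U,
      add = set_add M, ract = (\<lambda>L a. \<Union>x\<in>L. U +>\<^bsub>M\<^esub> (x \<lhd>\<^bsub>M\<^esub> a))\<rparr>"

definition direct_sum ::
  "('a, 'm) rmodule \<Rightarrow> ('a, 'n) rmodule \<Rightarrow> ('a, 'm \<times> 'n) rmodule" where
  "direct_sum M N =
     \<lparr>carrier = carrier M \<times> carrier N, monoid.mult = undefined, one = undefined,
      ring.zero = (\<zero>\<^bsub>M\<^esub>, \<zero>\<^bsub>N\<^esub>),
      add = (\<lambda>(x, y) (x', y'). (x \<oplus>\<^bsub>M\<^esub> x', y \<oplus>\<^bsub>N\<^esub> y')),
      ract = (\<lambda>(x, y) a. (x \<lhd>\<^bsub>M\<^esub> a, y \<lhd>\<^bsub>N\<^esub> a))\<rparr>"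

definition direct_power :: "nat \<Rightarrow> ('a, 'm) rmodule \<Rightarrow> ('a, nat \<Rightarrow> 'm) rmodule" where
  "direct_power k M =
     \<lparr>carrier = {..<k} \<rightarrow>\<^sub>E carrier M, monoid.mult = undefined, one = undefined,
      ring.zero = (\<lambda>i\<in>{..<k}. \<zero>\<^bsub>M\<^esub>),
      add = (\<lambda>x y. \<lambda>i\<in>{..<k}. x i \<oplus>\<^bsub>M\<^esub> y i),
      ract = (\<lambda>x a. \<lambda>i\<in>{..<k}. x i \<lhd>\<^bsub>M\<^esub> a)\<rparr>"

definition direct_summand ::
  "('k::field, 'a) module \<Rightarrow> ('a, 'm) rmodule \<Rightarrow> ('a, 'n) rmodule \<Rightarrow> bool" where
  "direct_summand A L M \<longleftrightarrow> (\<exists>Y\<in>modules A. module_iso A M (direct_sum L Y))"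

definition add_closure ::
  "('k::field, 'a) module \<Rightarrow> ('a, 'm) rmodule \<Rightarrow> ('k, 'a) umodule set" where
  "add_closure A M = {L \<in> modules A. \<exists>k. direct_summand A L (direct_power k M)}"

definition indecomposable :: "('k::field, 'a) module \<Rightarrow> ('a, 'm) rmodule \<Rightarrow> bool" where
  "indecomposable A M \<longleftrightarrow>
     \<not> zero_module M \<and>
     (\<forall>L\<in>modules A. \<forall>Y\<in>modules A.
        module_iso A M (direct_sum L Y) \<longrightarrow> zero_module L \<or> zero_module Y)"

definition basic_module :: "('k::field, 'a) module \<Rightarrow> ('a, 'm) rmodule \<Rightarrow> bool" where
  "basic_module A M \<longleftrightarrow>
     (\<forall>L\<in>modules A. indecomposable A L \<longrightarrow> \<not> direct_summand A (direct_sum L L) M)"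

definition faithful_module :: "('k, 'a) module \<Rightarrow> ('a, 'm) rmodule \<Rightarrow> bool" where
  "faithful_module A M \<longleftrightarrow>
     (\<forall>a\<in>carrier A. (\<forall>x\<in>carrier M. x \<lhd>\<^bsub>M\<^esub> a = \<zero>\<^bsub>M\<^esub>) \<longrightarrow> a = \<zero>\<^bsub>A\<^esub>)"

text \<open>
  The dual of a right module \<open>N\<close> over the opposite algebra, that is, of a left module over \<open>A\<close>,
  is a right module over \<open>A\<close>.
\<close>

definition dual_module ::
  "('k::field, 'a) module \<Rightarrow> ('a, 'm) rmodule \<Rightarrow> ('a, 'm \<Rightarrow> 'k) rmodule" where
  "dual_module A N =
     \<lparr>carrier = {f \<in> extensional (carrier N).
        (\<forall>x\<in>carrier N. \<forall>y\<in>carrier N. f (x \<oplus>\<^bsub>N\<^esub> y) = f x + f y) \<and>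
        (\<forall>x\<in>carrier N. \<forall>c. f (x \<lhd>\<^bsub>N\<^esub> (c \<odot>\<^bsub>A\<^esub> \<one>\<^bsub>A\<^esub>)) = c * f x)},
      monoid.mult = undefined, one = undefined,
      ring.zero = (\<lambda>x\<in>carrier N. 0),
      add = (\<lambda>f g. \<lambda>x\<in>carrier N. f x + g x),
      ract = (\<lambda>f a. \<lambda>x\<in>carrier N. f (x \<lhd>\<^bsub>N\<^esub> a))\<rparr>"


section \<open>Homological dimensions\<close>

definition projective_module :: "('k::field, 'a) module \<Rightarrow> ('a, 'm) rmodule \<Rightarrow> bool" where
  "projective_module A P \<longleftrightarrow>
     fd_right_module A P \<and>
     (\<forall>L\<in>modules A. \<forall>Y\<in>modules A. \<forall>g f.
        module_hom A L Y g \<and> g ` carrier L = carrier Y \<and> module_hom A P Y f \<longrightarrow>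
        (\<exists>h. module_hom A P L h \<and> (\<forall>x\<in>carrier P. g (h x) = f x)))"

definition injective_module :: "('k::field, 'a) module \<Rightarrow> ('a, 'm) rmodule \<Rightarrow> bool" where
  "injective_module A I \<longleftrightarrow>
     fd_right_module A I \<and>
     (\<forall>L\<in>modules A. \<forall>Y\<in>modules A. \<forall>g f.
        module_hom A L Y g \<and> inj_on g (carrier L) \<and> module_hom A L I f \<longrightarrow>
        (\<exists>h. module_hom A Y I h \<and> (\<forall>x\<in>carrier L. h (g x) = f x)))"

text \<open>Exactness of $\dots \to P_1 \to P_0 \to M \to 0$, where \<open>d i\<close> maps \<open>P (Suc i)\<close> to \<open>P i\<close>.\<close>

definition exact_left_resolution ::
  "('k::field, 'a) module \<Rightarrow> ('a, 'm) rmodule \<Rightarrow> (nat \<Rightarrow> ('k, 'a) umodule) \<Rightarrow>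
   ((nat \<Rightarrow> 'k) \<Rightarrow> 'm) \<Rightarrow> (nat \<Rightarrow> (nat \<Rightarrow> 'k) \<Rightarrow> (nat \<Rightarrow> 'k)) \<Rightarrow> bool" where
  "exact_left_resolution A M P p d \<longleftrightarrow>
     (\<forall>i. P i \<in> modules A) \<and>
     module_hom A (P 0) M p \<and> (\<forall>i. module_hom A (P (Suc i)) (P i) (d i)) \<and>
     p ` carrier (P 0) = carrier M \<and>
     d 0 ` carrier (P 1) = a_kernel (P 0) M p \<and>
     (\<forall>i. d (Suc i) ` carrier (P (Suc (Suc i))) = a_kernel (P (Suc i)) (P i) (d i))"

definition projective_resolution ::
  "('k::field, 'a) module \<Rightarrow> ('a, 'm) rmodule \<Rightarrow> (nat \<Rightarrow> ('k, 'a) umodule) \<Rightarrow>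
   ((nat \<Rightarrow> 'k) \<Rightarrow> 'm) \<Rightarrow> (nat \<Rightarrow> (nat \<Rightarrow> 'k) \<Rightarrow> (nat \<Rightarrow> 'k)) \<Rightarrow> bool" where
  "projective_resolution A M P p d \<longleftrightarrow>
     exact_left_resolution A M P p d \<and> (\<forall>i. projective_module A (P i))"

definition projdim :: "('k::field, 'a) module \<Rightarrow> ('a, 'm) rmodule \<Rightarrow> enat" where
  "projdim A M =
     Inf {enat k | k. \<exists>P p d. projective_resolution A M P p d \<and> (\<forall>i>k. zero_module (P i))}"

definition gldim :: "('k::field, 'a) module \<Rightarrow> enat" where
  "gldim A = (SUP M\<in>modules A. projdim A M)"

text \<open>Exactness of $0 \to M \to I_0 \to I_1 \to \dots$, where \<open>d i\<close> maps \<open>I i\<close> to \<open>I (Suc i)\<close>.\<close>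

definition exact_right_resolution ::
  "('k::field, 'a) module \<Rightarrow> ('a, 'm) rmodule \<Rightarrow> (nat \<Rightarrow> ('k, 'a) umodule) \<Rightarrow>
   ('m \<Rightarrow> (nat \<Rightarrow> 'k)) \<Rightarrow> (nat \<Rightarrow> (nat \<Rightarrow> 'k) \<Rightarrow> (nat \<Rightarrow> 'k)) \<Rightarrow> bool" where
  "exact_right_resolution A M I j d \<longleftrightarrow>
     (\<forall>i. I i \<in> modules A) \<and>
     module_hom A M (I 0) j \<and> (\<forall>i. module_hom A (I i) (I (Suc i)) (d i)) \<and>
     inj_on j (carrier M) \<and>
     j ` carrier M = a_kernel (I 0) (I 1) (d 0) \<and>
     (\<forall>i. d i ` carrier (I i) = a_kernel (I (Suc i)) (I (Suc (Suc i))) (d (Suc i)))"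

definition essential_submodule :: "('k, 'a) module \<Rightarrow> 'm set \<Rightarrow> ('a, 'm) rmodule \<Rightarrow> bool" where
  "essential_submodule A U M \<longleftrightarrow>
     rsubmodule A U M \<and> (\<forall>V. rsubmodule A V M \<and> U \<inter> V = {\<zero>\<^bsub>M\<^esub>} \<longrightarrow> V = {\<zero>\<^bsub>M\<^esub>})"

definition minimal_injective_resolution ::
  "('k::field, 'a) module \<Rightarrow> ('a, 'm) rmodule \<Rightarrow> (nat \<Rightarrow> ('k, 'a) umodule) \<Rightarrow>
   ('m \<Rightarrow> (nat \<Rightarrow> 'k)) \<Rightarrow> (nat \<Rightarrow> (nat \<Rightarrow> 'k) \<Rightarrow> (nat \<Rightarrow> 'k)) \<Rightarrow> bool" where
  "minimal_injective_resolution A M I j d \<longleftrightarrow>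
     exact_right_resolution A M I j d \<and> (\<forall>i. injective_module A (I i)) \<and>
     essential_submodule A (j ` carrier M) (I 0) \<and>
     (\<forall>i. essential_submodule A (d i ` carrier (I i)) (I (Suc i)))"

text \<open>
  Minimal injective resolutions exist and are unique up to isomorphism, so the choice made here
  is irrelevant.
\<close>

definition domdim :: "('k::field, 'a) module \<Rightarrow> ('a, 'm) rmodule \<Rightarrow> enat" where
  "domdim A M =
     (let I = (SOME I. \<exists>j d. minimal_injective_resolution A M I j d)
      in if projective_module A (I 0)
         then Sup {enat k | k. \<forall>i\<le>k. projective_module A (I i)} + 1 else 0)"

definition Dom :: "('k::field, 'a) module \<Rightarrow> nat \<Rightarrow> ('k, 'a) umodule set" where
  "Dom A i = {M \<in> modules A. enat i \<le> domdim A M}"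

definition Proj :: "('k::field, 'a) module \<Rightarrow> nat \<Rightarrow> ('k, 'a) umodule set" where
  "Proj A i = {M \<in> modules A. projdim A M \<le> enat i}"

definition higher_Auslander_algebra :: "('k::field, 'a) module \<Rightarrow> bool" where
  "higher_Auslander_algebra A \<longleftrightarrow>
     fd_algebra A \<and>
     (\<exists>d::nat. d \<ge> 2 \<and> gldim A = enat d \<and> domdim A (regular_module A) = enat d)"


section \<open>Standard and costandard modules\<close>

definition idempotent_module :: "('k, 'a) module \<Rightarrow> 'a \<Rightarrow> ('a, 'a) rmodule" where
  "idempotent_module A e = (regular_module A)\<lparr>carrier := {e \<otimes>\<^bsub>A\<^esub> a | a. a \<in> carrier A}\<rparr>"

definition maximal_right_ideal :: "('k, 'a) module \<Rightarrow> 'a set \<Rightarrow> bool" where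
  "maximal_right_ideal A U \<longleftrightarrow>
     rsubmodule A U (regular_module A) \<and> U \<noteq> carrier A \<and>
     (\<forall>V. rsubmodule A V (regular_module A) \<and> U \<subseteq> V \<longrightarrow> V = U \<or> V = carrier A)"

definition jacobson_radical :: "('k, 'a) module \<Rightarrow> 'a set" where
  "jacobson_radical A = carrier A \<inter> \<Inter>{U. maximal_right_ideal A U}"

definition simple_module :: "('k, 'a) module \<Rightarrow> (nat \<Rightarrow> 'a) \<Rightarrow> nat \<Rightarrow> ('a, 'a set) rmodule" where
  "simple_module A e i =
     quotient_module (idempotent_module A (e i)) {e i \<otimes>\<^bsub>A\<^esub> x | x. x \<in> jacobson_radical A}"

text \<open>
  The submodule $e_iJ(e_{i+1}+\dots+e_n)A$ consists of sums of products, hence it is generated by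
  the products in $e_iJ(e_{i+1}+\dots+e_n)$.
\<close>

definition standard_module ::
  "('k, 'a) module \<Rightarrow> nat \<Rightarrow> (nat \<Rightarrow> 'a) \<Rightarrow> nat \<Rightarrow> ('a, 'a set) rmodule" where
  "standard_module A n e i =
     quotient_module (idempotent_module A (e i))
       (generated_submodule A (regular_module A)
         {e i \<otimes>\<^bsub>A\<^esub> x \<otimes>\<^bsub>A\<^esub> finsum A e {i<..n} | x. x \<in> jacobson_radical A})"

text \<open>
  $\Delta^o(i) = Ae_i/A(e_{i+1}+\dots+e_n)Je_i$. Left modules over \<open>A\<close> are written as right modules
  over the opposite algebra, in which \<open>idempotent_module\<close> yields the left ideal $Ae_i$.
\<close>

definition left_standard_module ::
  "('k, 'a) module \<Rightarrow> nat \<Rightarrow> (nat \<Rightarrow> 'a) \<Rightarrow> nat \<Rightarrow> ('a, 'a set) rmodule" where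
  "left_standard_module A n e i =
     quotient_module (idempotent_module (opposite A) (e i))
       (generated_submodule (opposite A) (regular_module (opposite A))
         {finsum A e {i<..n} \<otimes>\<^bsub>A\<^esub> x \<otimes>\<^bsub>A\<^esub> e i | x. x \<in> jacobson_radical A})"

definition costandard_module ::
  "('k::field, 'a) module \<Rightarrow> nat \<Rightarrow> (nat \<Rightarrow> 'a) \<Rightarrow> nat \<Rightarrow> ('a, 'a set \<Rightarrow> 'k) rmodule" where
  "costandard_module A n e i = dual_module A (left_standard_module A n e i)"

definition filtered_modules ::
  "('k::field, 'a) module \<Rightarrow> nat \<Rightarrow> (nat \<Rightarrow> ('a, 'm) rmodule) \<Rightarrow> ('k, 'a) umodule set" where
  "filtered_modules A n \<Theta> = {M \<in> modules A.
     \<exists>r (U :: nat \<Rightarrow> (nat \<Rightarrow> 'k) set).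
       U 0 = {\<zero>\<^bsub>M\<^esub>} \<and> U r = carrier M \<and> (\<forall>t\<le>r. rsubmodule A (U t) M) \<and>
       (\<forall>t<r. U t \<subseteq> U (Suc t) \<and>
          (\<exists>i\<in>{1..n}. module_iso A (quotient_module (M\<lparr>carrier := U (Suc t)\<rparr>) (U t)) (\<Theta> i)))}"


section \<open>Tilting modules\<close>

text \<open>
  $\mathrm{Ext}^{i+1}(M,N) = 0$, computed from a projective resolution of \<open>M\<close>: every
  $(i+1)$-cocycle with values in \<open>N\<close> is a coboundary. This does not depend on the resolution.
\<close>

definition Ext_Suc_vanishes ::
  "('k::field, 'a) module \<Rightarrow> nat \<Rightarrow> ('a, 'm) rmodule \<Rightarrow> ('a, 'n) rmodule \<Rightarrow> bool" where
  "Ext_Suc_vanishes A i M N \<longleftrightarrow>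
     (\<exists>P p d. projective_resolution A M P p d \<and>
        (\<forall>f. module_hom A (P (Suc i)) N f \<and>
             (\<forall>x\<in>carrier (P (Suc (Suc i))). f (d (Suc i) x) = \<zero>\<^bsub>N\<^esub>) \<longrightarrow>
           (\<exists>g. module_hom A (P i) N g \<and> (\<forall>x\<in>carrier (P (Suc i)). f x = g (d i x)))))"

text \<open>Tilting modules may have any finite projective dimension, not just at most one.\<close>

definition tilting_module :: "('k::field, 'a) module \<Rightarrow> ('a, 'm) rmodule \<Rightarrow> bool" where
  "tilting_module A T \<longleftrightarrow>
     fd_right_module A T \<and> projdim A T \<noteq> \<infinity> \<and> (\<forall>i. Ext_Suc_vanishes A i T T) \<and>
     (\<exists>I j d. exact_right_resolution A (regular_module A) I j d \<and>
        (\<forall>i. I i \<in> add_closure A T) \<and> (\<exists>r. \<forall>i>r. zero_module (I i)))"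

definition is_characteristic_tilting ::
  "('k::field, 'a) module \<Rightarrow> nat \<Rightarrow> (nat \<Rightarrow> 'a) \<Rightarrow> ('a, 'm) rmodule \<Rightarrow> bool" where
  "is_characteristic_tilting A n e T \<longleftrightarrow>
     tilting_module A T \<and> basic_module A T \<and>
     add_closure A T = filtered_modules A n (standard_module A n e)
                       \<inter> filtered_modules A n (costandard_module A n e)"

definition characteristic_tilting_module ::
  "('k::field, 'a) module \<Rightarrow> nat \<Rightarrow> (nat \<Rightarrow> 'a) \<Rightarrow> ('a, 'm) rmodule \<Rightarrow> bool" where
  "characteristic_tilting_module A n e T \<longleftrightarrow>
     is_characteristic_tilting A n e T \<and>
     (\<forall>T'\<in>modules A. is_characteristic_tilting A n e T' \<longrightarrow> module_iso A T' T)"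

text \<open>Minimality is that of Thrall: being a direct summand of every faithful module.\<close>

definition minimal_faithful_projective_injective ::
  "('k::field, 'a) module \<Rightarrow> ('a, 'm) rmodule \<Rightarrow> bool" where
  "minimal_faithful_projective_injective A M \<longleftrightarrow>
     faithful_module A M \<and> projective_module A M \<and> injective_module A M \<and>
     (\<forall>N\<in>modules A. faithful_module A N \<longrightarrow> direct_summand A M N)"

end

(*
Consider, for a module M, the sequence of right multiplications
M e_n -> ... -> M e_1 -> M e_1 -> ... -> M e_n by b_{n-1}, ..., b_1, c_1 = a_1 b_1, a_1, ..., a_{n-1},
and let H j M be its exactness at the place j. A short exact sequence whose middle term is exact shifts
exactness by one place, injective modules that satisfy H 0 satisfy every H j, and the projective modules
are those with H j for all j < 2n-2: a vector x with x c_i nonzero splits off e_i A by means of a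
Frobenius form, and e_n A splits off when all c_i act as zero. Hence the dominant dimension of M is at
least k iff H j M for all j < k, and its projective dimension is at most k iff H j M for all j < 2n-2-k.
Exactness in the first half (j < n-1) is what is needed to build a filtration by standard modules from
below, and exactness in the second half (j > n) gives one by costandard modules. A module that is exact
in both halves is a direct sum of copies of e_i A with i < n and of the simple module at the vertex 1.
The quotient of the path algebra enters only through the multiplication table of its basis
e_i, a_i, b_i, c_i = a_i b_i.
*)
theory Submission
  imports Defs
begin

text \<open>The sequence comes from the simple module \<open>S_n\<close> at the vertex n, the only
  simple module whose injective hull is not projective: M has dominant dimension at least k exactly
  if Ext^j(\<open>S_n\<close>, M) = 0 for all j < k. \<open>H 0 M\<close> says that M has no
  submodule isomorphic to \<open>S_n\<close>, and if M is exact at all places before j, then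
  exactness at j is equivalent to Ext^j(\<open>S_n\<close>, M) = 0. The maps are not those of the
  minimal projective resolution of \<open>S_n\<close>: each place imposes a single equation, and the
  further equations of the resolution follow from exactness at the earlier places. In this form
  every homological statement is an implication between equations in M that can be checked in
  coordinates. The vertex n is exceptional because \<open>b_{n-1} a_{n-1} = 0\<close>;
  \<open>e_n A\<close> is the only indecomposable projective that is not injective. A second
  obstacle is one of types: the definitions quantify over modules on one fixed type, whereas
  quotients, sums, duals and right ideals live on others. They are replaced by isomorphic copies,
  and direct summands are handled as retracts, which compose across types.\<close>

abbreviation (input) act_in (\<open>_ *[_] _\<close> [70, 0, 71] 70) where "x *[M] a \<equiv> x \<lhd>\<^bsub>M\<^esub> a"
abbreviation (input) add_in (\<open>_ +[_] _\<close> [65, 0, 66] 65) where "x +[M] y \<equiv> x \<oplus>\<^bsub>M\<^esub> y"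
abbreviation (input) minus_in (\<open>_ -[_] _\<close> [65, 0, 66] 65) where "x -[M] y \<equiv> x \<ominus>\<^bsub>M\<^esub> y"
abbreviation (input) uminus_in (\<open>-[_] _\<close> [0, 81] 80) where "-[M] x \<equiv> \<ominus>\<^bsub>M\<^esub> x"
abbreviation (input) zero_in (\<open>\<zero>[_]\<close>) where "\<zero>[M] \<equiv> \<zero>\<^bsub>M\<^esub>"
abbreviation (input) mult_in (\<open>_ \<otimes>[_] _\<close> [70, 0, 71] 70) where "x \<otimes>[M] y \<equiv> x \<otimes>\<^bsub>M\<^esub> y"
abbreviation (input) smult_in (\<open>_ \<odot>[_] _\<close> [70, 0, 71] 70) where "c \<odot>[M] x \<equiv> c \<odot>\<^bsub>M\<^esub> x"
abbreviation (input) restricted (infixl \<open>|.\<close> 100) where "M |. U \<equiv> M\<lparr>carrier := U\<rparr>"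
abbreviation (input) carrier_of (\<open>$_\<close> [1000] 999) where "$M \<equiv> carrier M"

section \<open>Modules over a finite-dimensional algebra\<close>

context abelian_group
begin

lemma minus_add_cancel: "x \<in> $G ==> y \<in> $G ==> (x \<ominus> y) \<oplus> y = x"
 by (simp add: minus_eq a_assoc l_neg)

lemma add_minus_cancel: "x \<in> $G ==> y \<in> $G ==> y \<oplus> (x \<ominus> y) = x"
 by (metis minus_add_cancel a_comm minus_closed)

lemma add_diff_cancel: "x \<in> $G ==> y \<in> $G ==> (x \<oplus> y) \<ominus> y = x"
 by (simp add: minus_eq a_assoc r_neg)

lemma add_diff_cancel_left: "x \<in> $G ==> y \<in> $G ==> (y \<oplus> x) \<ominus> y = x"
 by (metis add_diff_cancel a_comm)

lemma diff_eq_iff: "x \<in> $G ==> y \<in> $G ==> z \<in> $G ==> x \<ominus> y = z \<longleftrightarrow> x = z \<oplus> y"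
 using minus_add_cancel add_diff_cancel by metis

lemma diff_self [simp]: "x \<in> $G ==> x \<ominus> x = \<zero>" by (simp add: minus_eq r_neg)

lemma diff_zero [simp]: "x \<in> $G ==> x \<ominus> \<zero> = x" by (simp add: minus_eq)

lemma diff_split:
 "x \<in> $G ==> y \<in> $G ==> z \<in> $G ==> x \<ominus> z = (x \<ominus> y) \<oplus> (y \<ominus> z)"
 by (simp add: minus_eq a_assoc r_neg1)

lemma diff_diff:
 "x \<in> $G ==> y \<in> $G ==> z \<in> $G ==> (x \<ominus> z) \<ominus> (x \<ominus> y) = y \<ominus> z"
 using diff_split[of x y z] add_diff_cancel_left[of "y \<ominus> z" "x \<ominus> y"] by simp

lemma add_diff_add:
 "[|x \<in> $G; y \<in> $G; z \<in> $G; w \<in> $G|]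
  ==> (x \<oplus> y) \<ominus> (z \<oplus> w) = (x \<ominus> z) \<oplus> (y \<ominus> w)"
 by (simp add: minus_eq minus_add a_ac)

lemma add_add_swap:
 "[|x \<in> $G; y \<in> $G; z \<in> $G; w \<in> $G|]
  ==> (x \<oplus> y) \<oplus> (z \<oplus> w) = (x \<oplus> z) \<oplus> (y \<oplus> w)" by (simp add: a_ac)

lemma add_eq_zero: "x \<in> $G ==> y \<in> $G ==> x \<oplus> y = \<zero> ==> x = \<ominus> y"
 by (metis minus_equality)

end

section \<open>Scalars, subspaces, submodules and homomorphisms\<close>

context fd_algebra
begin

abbreviation (input) "fdm \<equiv> fd_right_module A"
abbreviation (input) "mhom \<equiv> module_hom A"
abbreviation (input) "submod \<equiv> rsubmodule A"
abbreviation (input) "projective \<equiv> projective_module A"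
abbreviation (input) "injective \<equiv> injective_module A"
abbreviation (input) "proj_res \<equiv> projective_resolution A"
abbreviation (input) "regular \<equiv> regular_module A"

lemma ring_A: "ring A" ..

lemmas A_monoid = abelian_group.axioms(1)[OF ring.is_abelian_group[OF ring_A]]

lemmas A_l_neg = abelian_group.l_neg[OF ring.is_abelian_group[OF ring_A]]
 and A_a_ac = abelian_monoid.a_ac[OF A_monoid]
 and A_assoc = monoid.m_assoc[OF ring.is_monoid[OF ring_A]]
 and A_l_distr = ring.ring_simprules(13)[OF ring_A]
 and A_r_distr = ring.ring_simprules(23)[OF ring_A]

lemma scalar_closed [simp, intro]: "x \<in> $A ==> c \<odot> x \<in> $A"
 using smult_closed by (simp add: ring_of_type_algebra_def)

lemma scalar_add: "x \<in> $A ==> (c + d) \<odot> x = c \<odot> x \<oplus> d \<odot> x"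
 using smult_l_distr[of c d x] by (simp add: ring_of_type_algebra_def)

lemma scalar_mult: "x \<in> $A ==> (c * d) \<odot> x = c \<odot> (d \<odot> x)"
 using smult_assoc1[of c d x] by (simp add: ring_of_type_algebra_def)

lemma scalar_one [simp]: "x \<in> $A ==> 1 \<odot> x = x" using smult_one[of x] by (simp add: ring_of_type_algebra_def)

lemma scalar_add_right: "x \<in> $A ==> y \<in> $A ==> c \<odot> (x \<oplus> y) = c \<odot> x \<oplus> c \<odot> y"
 using smult_r_distr[of c x y] by (simp add: ring_of_type_algebra_def)

lemma scalar_unit_left: "x \<in> $A ==> (c \<odot> \<one>) \<otimes> x = c \<odot> x" by (simp add: smult_mult_left)

lemma scalar_unit_right: "x \<in> $A ==> x \<otimes> (c \<odot> \<one>) = c \<odot> x" by (simp add: smult_mult_right)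

lemma scalar_zero [simp]: "x \<in> $A ==> 0 \<odot> x = \<zero>" using scalar_add[of x 0 0] by (simp add: add.l_cancel_one)

definition sc :: "('a, 'm) rmodule \<Rightarrow> 'k \<Rightarrow> 'm \<Rightarrow> 'm" where
 "sc M c x = x *[M] (c \<odot> \<one>)"

definition subspace :: "('a, 'm) rmodule \<Rightarrow> 'm set \<Rightarrow> bool" where
 "subspace M U \<longleftrightarrow> U \<subseteq> $M \<and> \<zero>[M] \<in> U \<and> (\<forall>x\<in>U. \<forall>y\<in>U. x +[M] y \<in> U) \<and> (\<forall>c. \<forall>x\<in>U. sc M c x \<in> U)"

lemma subspaceI:
 "[|U \<subseteq> $M; \<zero>[M] \<in> U; \<And>x y. x \<in> U ==> y \<in> U ==> x +[M] y \<in> U; \<And>c x. x \<in> U ==> sc M c x \<in> U|]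
  ==> subspace M U" by (auto simp: subspace_def)

lemma subspaceD:
 assumes "subspace M U"
 shows "U \<subseteq> $M" "\<zero>[M] \<in> U" "x \<in> U ==> y \<in> U ==> x +[M] y \<in> U" "x \<in> U ==> sc M c x \<in> U"
  "x \<in> U ==> x \<in> $M" using assms by (auto simp: subspace_def)

lemma rsubmoduleI:
 "[|U \<subseteq> $M; \<zero>[M] \<in> U; \<And>x y. x \<in> U ==> y \<in> U ==> x +[M] y \<in> U;
  \<And>x a. x \<in> U ==> a \<in> $A ==> x *[M] a \<in> U|] ==> submod U M"
 by (auto simp: rsubmodule_def)

lemma rsubmoduleD:
 assumes "submod U M"
 shows "U \<subseteq> $M" "\<zero>[M] \<in> U" "x \<in> U ==> y \<in> U ==> x +[M] y \<in> U"
  "x \<in> U ==> a \<in> $A ==> x *[M] a \<in> U" "x \<in> U ==> x \<in> $M"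
 using assms by (auto simp: rsubmodule_def)

lemma submodule_subspace: "submod U M ==> subspace M U" by (auto simp: rsubmodule_def subspace_def sc_def)

lemma module_homI:
 "[|\<And>x. x \<in> $M ==> f x \<in> $N;
  \<And>x y. x \<in> $M ==> y \<in> $M ==> f (x +[M] y) = f x +[N] f y;
  \<And>x a. x \<in> $M ==> a \<in> $A ==> f (x *[M] a) = f x *[N] a|] ==> mhom M N f"
 by (auto simp: module_hom_def)

lemma module_homD:
 assumes "mhom M N f"
 shows "x \<in> $M ==> f x \<in> $N"
  "x \<in> $M ==> y \<in> $M ==> f (x +[M] y) = f x +[N] f y"
  "x \<in> $M ==> a \<in> $A ==> f (x *[M] a) = f x *[N] a"
  "x \<in> $M ==> f (sc M c x) = sc N c (f x)" using assms by (auto simp: module_hom_def sc_def)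

lemma module_hom_id: "mhom M M (\<lambda>x. x)" by (auto simp: module_hom_def)

lemma module_hom_comp:
 "mhom M N f ==> mhom N L g ==> mhom M L (\<lambda>x. g (f x))" unfolding module_hom_def by (auto simp: Pi_iff)

text \<open>Linear generation is expressed by the subspaces that contain S, not by coefficients, so
  that it passes along a linear map by taking preimages of subspaces.\<close>

definition generates :: "('a, 'm) rmodule \<Rightarrow> 'm set \<Rightarrow> bool" where
 "generates M S \<longleftrightarrow> finite S \<and> S \<subseteq> $M \<and> (\<forall>U. subspace M U \<and> S \<subseteq> U \<longrightarrow> U = $M)"

end

locale amod = fd_algebra A + fd_right_module A M for A :: "('k::field, 'a) module" (structure) and M :: "('a, 'm) rmodule"
begin

lemma act_closed [simp, intro]: "x \<in> $M ==> a \<in> $A ==> x *[M] a \<in> $M" by (rule ract_closed)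

lemma act_zero [simp]: "x \<in> $M ==> x *[M] \<zero> = \<zero>[M]"
 using ract_add_right[of x \<zero> \<zero>] by (simp add: M.add.l_cancel_one)

lemma zero_act [simp]: "a \<in> $A ==> \<zero>[M] *[M] a = \<zero>[M]"
 using ract_add_left[of "\<zero>[M]" "\<zero>[M]" a] by (simp add: M.add.l_cancel_one)

lemma neg_act: "x \<in> $M ==> a \<in> $A ==> (-[M] x) *[M] a = -[M] (x *[M] a)"
 using ract_add_left[of "-[M] x" x a] by (simp add: M.l_neg M.add_eq_zero)

lemma minus_act:
 "x \<in> $M ==> y \<in> $M ==> a \<in> $A ==> (x -[M] y) *[M] a = x *[M] a -[M] y *[M] a"
 by (simp add: M.minus_eq ract_add_left neg_act)

lemma sc_closed [simp, intro]: "x \<in> $M ==> sc M c x \<in> $M" by (simp add: sc_def)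

lemma sc_add: "x \<in> $M ==> y \<in> $M ==> sc M c (x +[M] y) = sc M c x +[M] sc M c y"
 by (simp add: sc_def ract_add_left)

lemma sc_plus: "x \<in> $M ==> sc M (c + d) x = sc M c x +[M] sc M d x" by (simp add: sc_def ract_add_right scalar_add)

lemma sc_mult: "x \<in> $M ==> sc M (c * d) x = sc M c (sc M d x)"
 by (simp add: sc_def mult.commute[of c] scalar_mult ract_mult[symmetric] scalar_unit_left)

lemma sc_sc: "x \<in> $M ==> sc M c (sc M d x) = sc M (c * d) x" by (simp add: sc_mult)

lemma sc_one [simp]: "x \<in> $M ==> sc M 1 x = x" by (simp add: sc_def ract_one)

lemma sc_zero [simp]: "x \<in> $M ==> sc M 0 x = \<zero>[M]" by (simp add: sc_def)

lemma sc_zero_right [simp]: "sc M c \<zero>[M] = \<zero>[M]" by (simp add: sc_def)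

lemma sc_neg_one: "x \<in> $M ==> sc M (-1) x = -[M] x" using sc_plus[of x "-1" 1] by (simp add: M.add_eq_zero)

lemma sc_minus: "x \<in> $M ==> y \<in> $M ==> sc M c (x -[M] y) = sc M c x -[M] sc M c y"
 by (simp add: sc_def minus_act)

lemma sc_act: "x \<in> $M ==> a \<in> $A ==> sc M c x *[M] a = sc M c (x *[M] a)"
 by (simp add: sc_def ract_mult[symmetric] scalar_unit_left scalar_unit_right)

lemma act_scalar: "x \<in> $M ==> a \<in> $A ==> x *[M] (c \<odot> a) = sc M c (x *[M] a)"
 by (simp add: sc_def ract_mult[symmetric] scalar_unit_right)

lemma sc_eq_zero: "x \<in> $M ==> sc M c x = \<zero>[M] ==> c \<noteq> 0 ==> x = \<zero>[M]"
 using sc_sc[of x "inverse c" c] by simp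

lemma subspace_carrier: "subspace M ($M)" by (rule subspaceI) auto

lemma subspace_zero: "subspace M {\<zero>[M]}" by (rule subspaceI) auto

lemma subspace_minus:
 assumes "subspace M U" "x \<in> U" "y \<in> U" shows "x -[M] y \<in> U"
proof -
 note s = subspaceD[OF assms(1)]
 have "-[M] y = sc M (-1) y" using s(1) assms by (subst sc_neg_one) auto
 then show ?thesis using s assms by (simp add: M.minus_eq)
qed

lemma subspace_neg:
 assumes "subspace M U" "y \<in> U" shows "-[M] y \<in> U" by (metis assms sc_neg_one subspaceD(4) subspaceD(5))

lemma submodule_minus: "submod U M ==> x \<in> U ==> y \<in> U ==> x -[M] y \<in> U"
 by (rule subspace_minus[OF submodule_subspace])

lemma submodule_carrier: "submod ($M) M" by (rule rsubmoduleI) auto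

lemma submodule_zero: "submod {\<zero>[M]} M" by (rule rsubmoduleI) auto

lemma subspace_line: "s \<in> $M ==> subspace M {sc M c s |c. True}"
proof (rule subspaceI, goal_cases)
 case 2 then show ?case by (auto intro!: exI[of _ 0])
next
 case (3 x y) then show ?case by (auto simp: sc_plus[symmetric])
next
 case (4 c x) then show ?case by (auto simp: sc_sc)
qed auto

section \<open>Sums, ranks and complements of subspaces\<close>

definition ssum :: "'m set \<Rightarrow> 'm set \<Rightarrow> 'm set" where
 "ssum U V = {u +[M] v |u v. u \<in> U \<and> v \<in> V}"

lemma ssumI: "u \<in> U ==> v \<in> V ==> u +[M] v \<in> ssum U V" by (auto simp: ssum_def)

lemma subspace_ssum:
 assumes U: "subspace M U" and V: "subspace M V" shows "subspace M (ssum U V)"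
proof (rule subspaceI, goal_cases)
 case 1 show ?case using subspaceD[OF U] subspaceD[OF V] by (auto simp: ssum_def)
next
 case 2 show ?case using ssumI[OF subspaceD(2)[OF U] subspaceD(2)[OF V]] by simp
next
 case (3 x y)
 then obtain u v u' v' where *: "u \<in> U" "v \<in> V" "u' \<in> U" "v' \<in> V" "x = u +[M] v" "y = u' +[M] v'" by (auto simp: ssum_def)
 then have "x +[M] y = (u +[M] u') +[M] (v +[M] v')" using subspaceD(5)[OF U] subspaceD(5)[OF V] by (simp add: M.add_add_swap)
 then show ?case using ssumI[OF subspaceD(3)[OF U *(1,3)] subspaceD(3)[OF V *(2,4)]] by simp
next
 case (4 c x)
 then obtain u v where *: "u \<in> U" "v \<in> V" "x = u +[M] v" by (auto simp: ssum_def)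
 then have "sc M c x = sc M c u +[M] sc M c v" using subspaceD(5)[OF U] subspaceD(5)[OF V] by (simp add: sc_add)
 then show ?case using ssumI[OF subspaceD(4)[OF U *(1)] subspaceD(4)[OF V *(2)]] by simp
qed

lemma ssum_upper:
 assumes U: "subspace M U" and V: "subspace M V" shows "U \<subseteq> ssum U V" "V \<subseteq> ssum U V"
proof -
 show "U \<subseteq> ssum U V"
 proof
  fix x assume "x \<in> U"
  then show "x \<in> ssum U V" using ssumI[OF _ subspaceD(2)[OF V], of x U] subspaceD(5)[OF U] by simp
 qed
 show "V \<subseteq> ssum U V"
 proof
  fix x assume "x \<in> V"
  then show "x \<in> ssum U V" using ssumI[OF subspaceD(2)[OF U], of x V] subspaceD(5)[OF V] by simp
 qed
qed

lemma finsum_in_subspace: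
 assumes U: "subspace M U" and f: "\<And>s. s \<in> S ==> f s \<in> U"
 shows "finsum M f S \<in> U"
proof (cases "finite S")
 case True
 then show ?thesis using f
 proof (induction S)
  case (insert x F)
  then show ?case using subspaceD[OF U] by (subst M.finsum_insert) (auto simp: Pi_iff)
 qed (use subspaceD[OF U] in auto)
qed (use subspaceD[OF U] in auto)

lemma generates_ex: "\<exists>S. generates M S"
proof -
 obtain S where S: "finite S" "S \<subseteq> $M"
  "\<And>x. x \<in> $M ==> \<exists>c. x = finsum M (\<lambda>s. s *[M] (c s \<odot> \<one>)) S"
  using fd_right_module.finite_dim[OF fd_right_module_axioms] by auto
 have "generates M S" unfolding generates_def
 proof (intro conjI allI impI)
  fix U assume U: "subspace M U \<and> S \<subseteq> U"
  have "x \<in> U" if x: "x \<in> $M" for x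
  proof -
   obtain c where "x = finsum M (\<lambda>s. s *[M] (c s \<odot> \<one>)) S" using S(3)[OF x] by blast
   then show ?thesis using U subspaceD(4)[of M U] by (auto intro!: finsum_in_subspace simp: sc_def)
  qed
  then show "U = $M" using U by (auto simp: subspace_def)
 qed (use S in auto)
 then show ?thesis by blast
qed

text \<open>Dimensions enter only through the existence of a strictly monotone function on subspaces.\<close>

lemma rank_ex_aux:
 assumes "finite S" "S \<subseteq> $M"
 shows "\<exists>W. subspace M W \<and> S \<subseteq> W \<and> (\<forall>U. subspace M U \<and> S \<subseteq> U \<longrightarrow> W \<subseteq> U) \<and>
   (\<exists>r. \<forall>U V. subspace M U \<and> subspace M V \<and> U \<subset> V \<and> V \<subseteq> W \<longrightarrow> r U < (r V::nat))"
 using assms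
proof (induction S)
 case empty
 have "subspace M {\<zero>[M]}" by (rule subspace_zero)
 moreover have "\<not> (U \<subset> V \<and> V \<subseteq> {\<zero>[M]})" if "subspace M U" for U V using that by (auto simp: subspace_def)
 ultimately show ?case using subspaceD(2) by (intro exI[of _ "{\<zero>[M]}"]) blast
next
 case (insert s S)
 then obtain W r where W: "subspace M W" "S \<subseteq> W" "\<And>U. subspace M U ==> S \<subseteq> U ==> W \<subseteq> U"
  and r: "\<And>U V. subspace M U ==> subspace M V ==> U \<subset> V ==> V \<subseteq> W ==> r U < (r V::nat)"
 proof -
  have "S \<subseteq> $M" using insert.prems by simp
  from insert.IH[OF this] show thesis using that by (elim exE conjE) blast
 qed
 have s: "s \<in> $M" using insert by auto
 define L where "L = {sc M c s |c. True}"
 have L: "subspace M L" unfolding L_def by (rule subspace_line[OF s])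
 define W' where "W' = ssum W L"
 have W': "subspace M W'" unfolding W'_def by (rule subspace_ssum[OF W(1) L])
 have sL: "s \<in> L" unfolding L_def using s sc_one by (metis (mono_tags, lifting) mem_Collect_eq)
 have up: "W \<subseteq> W'" "L \<subseteq> W'" unfolding W'_def using ssum_upper[OF W(1) L] by auto
 have least: "W' \<subseteq> U" if U: "subspace M U" "insert s S \<subseteq> U" for U
  using W(3)[of U] U subspaceD[OF U(1)] by (auto simp: W'_def ssum_def L_def)
 \<comment> \<open>The line spanned by s adds at most one dimension to W, so a subspace of the sum
   is measured by its trace on W and by whether it leaves W.\<close>
 define r' where "r' V = 2 * r (V \<inter> W) + (if V \<subseteq> W then 0 else 1)" for V
 have "r' U < r' V" if U: "subspace M U" and V: "subspace M V" and UV: "U \<subset> V" and VW: "V \<subseteq> W'" for U V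
 proof -
  note Ud = subspaceD[OF U] and Vd = subspaceD[OF V] and Wd = subspaceD[OF W(1)]
  have i: "subspace M (U \<inter> W)" "subspace M (V \<inter> W)" using Ud Vd Wd by (auto intro!: subspaceI)
  show ?thesis
  proof (cases "U \<inter> W = V \<inter> W")
   case False
   then have "r (U \<inter> W) < r (V \<inter> W)" using i UV by (intro r) auto
   then show ?thesis by (auto simp: r'_def)
  next
   case True
   then have nV: "\<not> V \<subseteq> W" using UV by auto
   have "U \<subseteq> W"
   proof (rule ccontr)
    assume "\<not> U \<subseteq> W"
    then obtain u where u: "u \<in> U" "u \<notin> W" by auto
    then obtain w d where wd: "w \<in> W" "u = w +[M] sc M d s"
    proof -
     have "u \<in> W'" using u(1) UV VW by auto
     then show thesis using that by (auto simp: W'_def ssum_def L_def)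
    qed
    have d: "d \<noteq> 0" using u wd s Wd by auto
    have "v \<in> U" if v: "v \<in> V" for v
    proof -
     obtain w' c where wc: "w' \<in> W" "v = w' +[M] sc M c s"
     proof -
      have "v \<in> W'" using v VW by auto
      then show thesis using that by (auto simp: W'_def ssum_def L_def)
     qed
     \<comment> \<open>The multiple of u by k has the same component along s as v, so the difference
       lies in \<open>V \<inter> W\<close>, which equals \<open>U \<inter> W\<close>.\<close>
     define k where "k = c / d"
     have ku: "sc M k u = sc M k w +[M] sc M c s" using wd s Wd d by (simp add: sc_add sc_sc k_def)
     have "v -[M] sc M k u = w' -[M] sc M k w" using wc wd s Wd unfolding ku
      by (simp add: M.minus_eq M.minus_add M.a_ac M.r_neg M.r_neg1 M.r_neg2)
     moreover have "w' -[M] sc M k w \<in> W" using wc wd Wd W(1) by (intro subspace_minus) auto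
     moreover have "sc M k u \<in> U" using u Ud by auto
     moreover have "v -[M] sc M k u \<in> V" using v UV Vd u Ud(4) V by (intro subspace_minus) auto
     ultimately have "v -[M] sc M k u \<in> U" using True by auto
     then have "(v -[M] sc M k u) +[M] sc M k u \<in> U" using \<open>sc M k u \<in> U\<close> Ud(3) by blast
     then show ?thesis using v Vd(1) u Ud(1) by (subst (asm) M.minus_add_cancel) auto
    qed
    then show False using UV by auto
   qed
   then show ?thesis using True nV by (auto simp: r'_def)
  qed
 qed
 then have "\<exists>r. \<forall>U V. subspace M U \<and> subspace M V \<and> U \<subset> V \<and> V \<subseteq> W' \<longrightarrow> r U < (r V::nat)"
  by (intro exI[of _ r']) blast
 moreover have "insert s S \<subseteq> W'" using up sL W(2) by auto
 ultimately show ?case using W' least by (intro exI[of _ W'] conjI allI impI) auto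
qed

lemma rank_ex: "\<exists>r. \<forall>U V. subspace M U \<and> subspace M V \<and> U \<subset> V \<longrightarrow> r U < (r V::nat)"
proof -
 obtain S where S: "generates M S" using generates_ex by blast
 obtain W where W: "subspace M W" "S \<subseteq> W"
  "\<exists>r. \<forall>U V. subspace M U \<and> subspace M V \<and> U \<subset> V \<and> V \<subseteq> W \<longrightarrow> r U < (r V::nat)"
  using rank_ex_aux[of S] S unfolding generates_def by blast
 have "W = $M" using W(1,2) S unfolding generates_def by blast
 then obtain r where "\<forall>U V. subspace M U \<and> subspace M V \<and> U \<subset> V \<and> V \<subseteq> $M \<longrightarrow> r U < (r V::nat)"
  using W(3) by blast
 then show ?thesis by (intro exI[of _ r]) (metis subspaceD(1))
qed

text \<open>Ranks are bounded by that of the whole module, so a subspace of greatest rank exists,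
  and strict monotonicity makes it maximal for inclusion. Arguments by greatest dimension are run
  through this.\<close>

lemma maximal_subspace:
 assumes "P U0" "\<And>U. P U ==> subspace M U"
 obtains U where "P U" "\<And>V. P V ==> U \<subseteq> V ==> V = U"
proof -
 obtain r where r: "\<And>U V. subspace M U ==> subspace M V ==> U \<subset> V ==> r U < (r V::nat)"
  using rank_ex by blast
 have "r U \<le> r ($M)" if "P U" for U using r[OF assms(2)[OF that] subspace_carrier] subspaceD(1)[OF assms(2)[OF that]]
  by (cases "U = $M") (auto intro: less_imp_le)
 then have "\<forall>U. P U \<longrightarrow> r U < Suc (r ($M))" by (simp add: less_Suc_eq_le)
 from ex_has_greatest_nat[OF assms(1) this]
 obtain U where U: "P U" "\<And>V. P V ==> r V \<le> r U" by auto
 have "V = U" if "P V" "U \<subseteq> V" for V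
  using r[OF assms(2)[OF U(1)] assms(2)[OF that(1)]] U(2)[OF that(1)] that(2) by (metis leD psubsetI)
 then show ?thesis using that U(1) by blast
qed

lemma minimal_subspace:
 assumes "P U0" "\<And>U. P U ==> subspace M U"
 obtains U where "P U" "\<And>V. P V ==> V \<subseteq> U ==> V = U"
proof -
 obtain r where r: "\<And>U V. subspace M U ==> subspace M V ==> U \<subset> V ==> r U < (r V::nat)"
  using rank_ex by blast
 obtain U where U: "P U" "\<And>V. P V ==> r U \<le> r V" using ex_has_least_nat[of P U0 r] assms(1) by blast
 have "V = U" if "P V" "V \<subseteq> U" for V
  using r[OF assms(2)[OF that(1)] assms(2)[OF U(1)]] U(2)[OF that(1)] that(2) by (metis leD psubsetI)
 then show ?thesis using that U(1) by blast
qed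

text \<open>A maximal subspace that meets L trivially is a complement: a vector outside the sum
  could be added to it without creating an intersection with L.\<close>

lemma complement_ex:
 assumes L: "subspace M L"
 obtains W where "subspace M W" "L \<inter> W = {\<zero>[M]}" "ssum L W = $M"
proof -
 have z: "subspace M {\<zero>[M]} \<and> L \<inter> {\<zero>[M]} = {\<zero>[M]}" using subspace_zero subspaceD(2)[OF L] by auto
 obtain W where W: "subspace M W" "L \<inter> W = {\<zero>[M]}"
  and max: "\<And>V. subspace M V ==> L \<inter> V = {\<zero>[M]} ==> W \<subseteq> V ==> V = W"
 proof (rule maximal_subspace[of "\<lambda>W. subspace M W \<and> L \<inter> W = {\<zero>[M]}", OF z])
  fix U assume a: "subspace M U \<and> L \<inter> U = {\<zero>[M]}"
   "\<And>V. subspace M V \<and> L \<inter> V = {\<zero>[M]} ==> U \<subseteq> V ==> V = U"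
  then show thesis by (intro that[of U]) simp_all
 qed simp
 note Ld = subspaceD[OF L] and Wd = subspaceD[OF W(1)]
 have "y \<in> ssum L W" if y: "y \<in> $M" for y
 proof (rule ccontr)
  assume n: "y \<notin> ssum L W"
  define Y where "Y = {sc M c y |c. True}"
  have Y: "subspace M Y" unfolding Y_def by (rule subspace_line[OF y])
  have yY: "y \<in> Y" unfolding Y_def using y sc_one by (metis (mono_tags, lifting) mem_Collect_eq)
  have "x = \<zero>[M]" if x: "x \<in> L" "x \<in> ssum W Y" for x
  proof -
   obtain w c where wc: "w \<in> W" "x = w +[M] sc M c y" using x by (auto simp: ssum_def Y_def)
   \<comment> \<open>With a nonzero c the equation could be solved for y, which would put y into
     \<open>ssum L W\<close>.\<close>
   have "c = 0"
   proof (rule ccontr)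
    assume c: "c \<noteq> 0"
    have "sc M (inverse c) x = sc M (inverse c) w +[M] y" using wc Wd y c by (simp add: sc_add sc_sc)
    then have "y = sc M (inverse c) x -[M] sc M (inverse c) w" using wc(1) Wd y by (simp add: M.add_diff_cancel_left)
    then have "y = sc M (inverse c) x +[M] sc M (-1) (sc M (inverse c) w)" using wc(1) Wd by (simp add: sc_neg_one M.minus_eq)
    moreover have "sc M (inverse c) x \<in> L" using x Ld(4) by blast
    moreover have "sc M (-1) (sc M (inverse c) w) \<in> W" using wc Wd(4) by blast
    ultimately show False using n ssumI[of "sc M (inverse c) x" L] by metis
   qed
   then have "x = w" using wc Wd y by simp
   then show ?thesis using W(2) x wc by auto
  qed
  then have "L \<inter> ssum W Y \<subseteq> {\<zero>[M]}" by blast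
  moreover have "\<zero>[M] \<in> L \<inter> ssum W Y" using Ld(2) subspaceD(2)[OF subspace_ssum[OF W(1) Y]] by blast
  ultimately have "L \<inter> ssum W Y = {\<zero>[M]}" by blast
  then have "ssum W Y = W" using max subspace_ssum[OF W(1) Y] ssum_upper[OF W(1) Y] by blast
  then have "y \<in> W" using yY ssum_upper[OF W(1) Y] by auto
  then show False using n ssum_upper[OF L W(1)] by auto
 qed
 then have "ssum L W = $M" using subspaceD(1)[OF subspace_ssum[OF L W(1)]] by auto
 then show ?thesis using that W by blast
qed

definition linear_to :: "'m set \<Rightarrow> ('m \<Rightarrow> 'm) \<Rightarrow> bool" where
 "linear_to L f \<longleftrightarrow> (\<forall>x\<in>$M. f x \<in> L) \<and>
   (\<forall>x\<in>$M. \<forall>y\<in>$M. f (x +[M] y) = f x +[M] f y) \<and>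
   (\<forall>c. \<forall>x\<in>$M. f (sc M c x) = sc M c (f x))"

lemma projection_ex:
 assumes L: "subspace M L"
 obtains f where "linear_to L f" "\<And>x. x \<in> L ==> f x = x"
proof -
 obtain W where W: "subspace M W" "L \<inter> W = {\<zero>[M]}" "ssum L W = $M" using complement_ex[OF L] by blast
 note Ld = subspaceD[OF L] and Wd = subspaceD[OF W(1)]
 have ex: "\<exists>l. l \<in> L \<and> y -[M] l \<in> W" if "y \<in> $M" for y
 proof -
  have "y \<in> ssum L W" using W(3) that by simp
  then obtain l w where "l \<in> L" "w \<in> W" "y = l +[M] w" by (auto simp: ssum_def)
  then show ?thesis using Ld Wd by (intro exI[of _ l]) (simp add: M.add_diff_cancel_left)
 qed
 have uniq: "l = l'" if "y \<in> $M" "l \<in> L" "l' \<in> L" "y -[M] l \<in> W" "y -[M] l' \<in> W" for y l l'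
 proof -
  have "l' -[M] l = (y -[M] l) -[M] (y -[M] l')" using that Ld(5) by (simp add: M.diff_diff)
  then have "l' -[M] l \<in> W" using that subspace_minus[OF W(1)] by simp
  moreover have "l' -[M] l \<in> L" using that subspace_minus[OF L] by simp
  ultimately have "l' -[M] l = \<zero>[M]" using W(2) by blast
  then show ?thesis using that(2,3) Ld(5) by (simp add: M.diff_eq_iff)
 qed
 define f where "f y = (THE l. l \<in> L \<and> y -[M] l \<in> W)" for y
 have fI: "f y = l" if "y \<in> $M" "l \<in> L" "y -[M] l \<in> W" for y l unfolding f_def using that uniq by blast
 have f: "f y \<in> L" "y -[M] f y \<in> W" if y: "y \<in> $M" for y
 proof -
  obtain l where "l \<in> L" "y -[M] l \<in> W" using ex[OF y] by blast
  then show "f y \<in> L" "y -[M] f y \<in> W" using fI[OF y] by auto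
 qed
 have "linear_to L f" unfolding linear_to_def
 proof (intro conjI ballI allI)
  fix x y assume xy: "x \<in> $M" "y \<in> $M"
  have "(x +[M] y) -[M] (f x +[M] f y) = (x -[M] f x) +[M] (y -[M] f y)" using xy f Ld by (simp add: M.minus_eq M.minus_add M.a_ac)
  then show "f (x +[M] y) = f x +[M] f y" using xy f Ld Wd by (intro fI) auto
 next
  fix c x assume x: "x \<in> $M"
  have "sc M c x -[M] sc M c (f x) = sc M c (x -[M] f x)" using x f Ld by (simp add: sc_minus)
  then show "f (sc M c x) = sc M c (f x)" using x f Ld Wd by (intro fI) auto
 qed (use f in auto)
 moreover have "f x = x" if "x \<in> L" for x using that Ld Wd by (intro fI) auto
 ultimately show ?thesis using that by blast
qed

definition functional :: "('m \<Rightarrow> 'k) \<Rightarrow> bool" where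
 "functional \<mu> \<longleftrightarrow> (\<forall>x\<in>$M. \<forall>y\<in>$M. \<mu> (x +[M] y) = \<mu> x + \<mu> y) \<and>
   (\<forall>c. \<forall>x\<in>$M. \<mu> (sc M c x) = c * \<mu> x)"

text \<open>The linear projection onto the line of z, read off as a coefficient. Such functionals
  are the raw material of the Frobenius forms that split off projective summands.\<close>

lemma functional_ex:
 assumes z: "z \<in> $M" "z \<noteq> \<zero>[M]"
 obtains \<mu> where "functional \<mu>" "\<mu> z = 1"
proof -
 define L where "L = {sc M c z |c. True}"
 have L: "subspace M L" unfolding L_def by (rule subspace_line[OF z(1)])
 obtain f where f: "linear_to L f" "\<And>x. x \<in> L ==> f x = x" using projection_ex[OF L] by blast
 have inj: "c = d" if "sc M c z = sc M d z" for c d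
 proof -
  have "sc M (c + (- d)) z = \<zero>[M]" using that z sc_plus[of z c "-d"] sc_plus[of z d "-d"] by simp
  then show ?thesis using sc_eq_zero[OF z(1)] z(2) by force
 qed
 define \<mu> where "\<mu> x = (THE c. f x = sc M c z)" for x
 have \<mu>I: "\<mu> x = c" if "f x = sc M c z" for x c unfolding \<mu>_def using that inj by auto
 have \<mu>: "f x = sc M (\<mu> x) z" if "x \<in> $M" for x using f(1) that \<mu>I unfolding linear_to_def L_def by fastforce
 have "functional \<mu>" unfolding functional_def
 proof (intro conjI ballI allI)
  fix x y assume "x \<in> $M" "y \<in> $M"
  then show "\<mu> (x +[M] y) = \<mu> x + \<mu> y" using f(1) \<mu> z unfolding linear_to_def by (intro \<mu>I) (simp add: sc_plus)
 next
  fix c x assume "x \<in> $M"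
  then show "\<mu> (sc M c x) = c * \<mu> x" using f(1) \<mu> z unfolding linear_to_def by (intro \<mu>I) (simp add: sc_mult)
 qed
 moreover have "z \<in> L" unfolding L_def using z sc_one by (metis (mono_tags, lifting) mem_Collect_eq)
 then have "\<mu> z = 1" using f(2) z by (intro \<mu>I) simp
 ultimately show ?thesis using that by blast
qed

end

section \<open>Submodules, quotients and direct sums\<close>

context fd_algebra
begin

section \<open>Module axioms and homomorphic images\<close>

lemma amodI: "fdm M ==> amod A M" by (intro amod.intro fd_algebra_axioms)

lemma modules_amod: "M \<in> modules A ==> amod A M" by (simp add: modules_def amodI)

text \<open>The linear combinations of a generating set form a subspace that contains the set, hence
  are everything. This trades the coefficients in the definition of a module for a statement about
  subspaces.\<close>

lemma fd_moduleI:
 fixes M :: "('a, 'm) rmodule"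
 assumes grp: "abelian_group M"
  and closed: "\<And>x a. x \<in> $M ==> a \<in> $A ==> x *[M] a \<in> $M"
  and add_left: "\<And>x y a. x \<in> $M ==> y \<in> $M ==> a \<in> $A
   ==> (x +[M] y) *[M] a = x *[M] a +[M] y *[M] a"
  and add_right: "\<And>x a b. x \<in> $M ==> a \<in> $A ==> b \<in> $A
   ==> x *[M] (a \<oplus> b) = x *[M] a +[M] x *[M] b"
  and mult: "\<And>x a b. x \<in> $M ==> a \<in> $A ==> b \<in> $A
   ==> x *[M] (a \<otimes> b) = (x *[M] a) *[M] b"
  and one: "\<And>x. x \<in> $M ==> x *[M] \<one> = x"
  and gen: "\<exists>S. generates M S"
 shows "fdm M"
proof -
 interpret M: abelian_group M by (rule grp)
 obtain S where S: "finite S" "S \<subseteq> $M" "\<And>U. subspace M U ==> S \<subseteq> U ==> U = $M"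
  using gen unfolding generates_def by blast
 have sc_cl: "x \<in> $M ==> sc M c x \<in> $M" for x c by (simp add: sc_def closed)
 have z: "x *[M] \<zero> = \<zero>[M]" if "x \<in> $M" for x
  using add_right[OF that, of \<zero> \<zero>] closed[OF that, of \<zero>] by (simp add: M.add.l_cancel_one)
 have z': "\<zero>[M] *[M] a = \<zero>[M]" if "a \<in> $A" for a
  using add_left[of "\<zero>[M]" "\<zero>[M]" a] closed[of "\<zero>[M]" a] that by (simp add: M.add.l_cancel_one)
 define comb where "comb c = finsum M (\<lambda>s. sc M (c s) s) S" for c :: "'m \<Rightarrow> 'k"
 have comb_cl: "comb c \<in> $M" for c unfolding comb_def using S sc_cl by (intro M.finsum_closed) auto
 have comb_add: "comb c +[M] comb d = comb (\<lambda>s. c s + d s)" for c d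
 proof -
  have "comb c +[M] comb d = finsum M (\<lambda>s. sc M (c s) s +[M] sc M (d s) s) S"
   unfolding comb_def using S sc_cl by (intro M.finsum_addf[symmetric]) auto
  also have "\<dots> = comb (\<lambda>s. c s + d s)"
   unfolding comb_def using S sc_cl by (intro M.finsum_cong') (auto simp: sc_def scalar_add add_right)
  finally show ?thesis .
 qed
 have sum_act: "finsum M f F *[M] a = finsum M (\<lambda>s. f s *[M] a) F"
  if "finite F" "f \<in> F \<rightarrow> $M" "a \<in> $A" for f F a using that
 proof (induction F)
  case (insert x F)
  have "finsum M f F \<in> $M" using insert by (intro M.finsum_closed) auto
  moreover have "f x \<in> $M" "f \<in> F \<rightarrow> $M" "(\<lambda>s. f s *[M] a) \<in> F \<rightarrow> $M" "f x *[M] a \<in> $M"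
   using insert.prems closed by auto
  ultimately show ?case using insert by (simp add: add_left)
 qed (simp add: z')
 have comb_sc: "sc M a (comb c) = comb (\<lambda>s. a * c s)" for a c
 proof -
  have "sc M a (comb c) = finsum M (\<lambda>s. sc M (c s) s *[M] (a \<odot> \<one>)) S"
   unfolding comb_def sc_def[of _ a] using S sc_cl by (intro sum_act) auto
  also have "\<dots> = comb (\<lambda>s. a * c s)" unfolding comb_def using S sc_cl
   by (intro M.finsum_cong') (auto simp: sc_def mult[symmetric] scalar_unit_left scalar_mult[symmetric] mult.commute closed)
  finally show ?thesis .
 qed
 have comb_zero: "comb (\<lambda>_. 0) = \<zero>[M]"
 proof -
  have "comb (\<lambda>_. 0) = finsum M (\<lambda>s. \<zero>[M]) S"
   unfolding comb_def using S by (intro M.finsum_cong') (auto simp: sc_def z)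
  then show ?thesis by simp
 qed
 have comb_single: "comb (\<lambda>s. if s = t then 1 else 0) = t" if t: "t \<in> S" for t
 proof -
  have "comb (\<lambda>s. if s = t then 1 else 0) = finsum M (\<lambda>s. if t = s then s else \<zero>[M]) S"
   unfolding comb_def using S by (intro M.finsum_cong') (auto simp: sc_def z one)
  also have "\<dots> = t" using S t by (intro M.add.finprod_singleton[of t S "\<lambda>s. s"]) auto
  finally show ?thesis .
 qed
 have "subspace M (range comb)"
 proof (rule subspaceI)
  show "\<zero>[M] \<in> range comb" using comb_zero by (metis rangeI)
 qed (use comb_cl comb_add comb_sc in auto)
 moreover have "S \<subseteq> range comb" using comb_single by (metis rangeI subsetI)
 ultimately have all: "range comb = $M" using S(3) by blast
 show ?thesis
 proof (intro fd_right_module.intro fd_right_module_axioms.intro)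
  have "\<exists>c. x = finsum M (\<lambda>s. s *[M] (c s \<odot> \<one>)) S" if "x \<in> $M" for x
   using that all unfolding comb_def sc_def by auto
  then show "\<exists>S. finite S \<and> S \<subseteq> $M \<and>
     (\<forall>x\<in>$M. \<exists>c. x = finsum M (\<lambda>s. s *[M] (c s \<odot> \<one>)) S)" using S(1,2) by blast
 qed (use grp closed add_left add_right mult one ring_A in auto)
qed

text \<open>A structure that receives a surjective homomorphism inherits every module axiom.
  Quotients, transported copies, direct powers and duals are recognised as modules in this
  way.\<close>

lemma image_module:
 assumes M: "fdm M" and f: "mhom M Q f" "f ` $M = $Q"
  and z: "\<zero>[Q] = f \<zero>[M]"
 shows "fdm Q"
proof -
 interpret M: amod A M by (rule amodI[OF M])
 note h = module_homD[OF f(1)]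
 have ex: "\<exists>x\<in>$M. y = f x" if "y \<in> $Q" for y using f(2) that by auto
 show ?thesis
 proof (rule fd_moduleI)
  show "abelian_group Q"
  proof (rule abelian_groupI)
   fix x y z assume "x \<in> $Q" "y \<in> $Q" "z \<in> $Q"
   then obtain x' y' z' where "x' \<in> $M" "y' \<in> $M" "z' \<in> $M"
    "x = f x'" "y = f y'" "z = f z'" using ex by metis
   then show "(x +[Q] y) +[Q] z = x +[Q] (y +[Q] z)" by (simp add: h(2)[symmetric] M.M.a_assoc)
  next
   fix x y assume "x \<in> $Q" "y \<in> $Q"
   then obtain x' y' where "x' \<in> $M" "y' \<in> $M" "x = f x'" "y = f y'" using ex by metis
   then show "x +[Q] y \<in> $Q" "x +[Q] y = y +[Q] x" using h(1)[of "x' +[M] y'"] by (simp_all add: h(2)[symmetric] M.M.a_comm)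
  next
   fix x assume "x \<in> $Q"
   then obtain x' where x': "x' \<in> $M" "x = f x'" using ex by metis
   then show "\<zero>[Q] +[Q] x = x" by (simp add: z h(2)[symmetric])
   show "\<exists>y\<in>$Q. y +[Q] x = \<zero>[Q]"
    using x' h(1) by (intro bexI[of _ "f (-[M] x')"]) (simp_all add: z h(2)[symmetric] M.M.l_neg)
  qed (use h(1) z in auto)
 next
  fix x a assume "x \<in> $Q" and a: "a \<in> $A"
  then obtain x' where x': "x' \<in> $M" "x = f x'" using ex by metis
  show "x *[Q] a \<in> $Q" using x' a h(1)[of "x' *[M] a"] by (simp add: h(3)[symmetric])
  fix b assume b: "b \<in> $A"
  show "x *[Q] (a \<oplus> b) = x *[Q] a +[Q] x *[Q] b" using x' a b by (simp add: h(3)[symmetric] h(2)[symmetric] M.ract_add_right)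
  show "x *[Q] (a \<otimes> b) = (x *[Q] a) *[Q] b" using x' a b by (simp add: h(3)[symmetric] M.ract_mult)
 next
  fix x y a assume xy: "x \<in> $Q" "y \<in> $Q" and a: "a \<in> $A"
  from xy obtain x' y' where x': "x' \<in> $M" "y' \<in> $M" "x = f x'" "y = f y'" using ex by metis
  then show "(x +[Q] y) *[Q] a = x *[Q] a +[Q] y *[Q] a" using a by (simp add: h(3)[symmetric] h(2)[symmetric] M.ract_add_left)
 next
  fix x assume "x \<in> $Q"
  then obtain x' where "x' \<in> $M" "x = f x'" using ex by metis
  then show "x *[Q] \<one> = x" by (simp add: h(3)[symmetric] M.ract_one)
 next
  obtain S where S: "finite S" "S \<subseteq> $M" "\<And>U. subspace M U ==> S \<subseteq> U ==> U = $M"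
   using M.generates_ex unfolding generates_def by blast
  have "generates Q (f ` S)" unfolding generates_def
  proof (intro conjI allI impI)
   fix U assume U: "subspace Q U \<and> f ` S \<subseteq> U"
   then have U': "subspace Q U" by simp
   have "subspace M {x \<in> $M. f x \<in> U}" using subspaceD(2,3,4)[OF U'] z by (intro subspaceI) (auto simp: h)
   then have "{x \<in> $M. f x \<in> U} = $M" by (rule S(3)) (use U S in auto)
   then have "f ` $M \<subseteq> U" by blast
   then show "U = $Q" using subspaceD(1)[OF U'] f(2) by blast
  qed (use S h in auto)
  then show "\<exists>S. generates Q S" by blast
 qed
qed

text \<open>The inverse is carried along explicitly, so that isomorphisms can be reversed and
  composed without recourse to bijections.\<close>

definition mod_iso ::
 "('a, 'm) rmodule \<Rightarrow> ('a, 'n) rmodule \<Rightarrow> ('m \<Rightarrow> 'n) \<Rightarrow> ('n \<Rightarrow> 'm) \<Rightarrow> bool" where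
 "mod_iso M N f g \<longleftrightarrow> mhom M N f \<and> mhom N M g \<and>
   (\<forall>x\<in>$M. g (f x) = x) \<and> (\<forall>y\<in>$N. f (g y) = y)"

lemma mod_isoD:
 assumes "mod_iso M N f g"
 shows "mhom M N f" "mhom N M g"
  "x \<in> $M ==> g (f x) = x" "y \<in> $N ==> f (g y) = y"
  "f ` $M = $N" "inj_on f ($M)"
proof -
 show *: "mhom M N f" "mhom N M g"
  "x \<in> $M ==> g (f x) = x" "y \<in> $N ==> f (g y) = y" for x y using assms by (auto simp: mod_iso_def)
 show "f ` $M = $N" using module_homD(1)[OF *(1)] module_homD(1)[OF *(2)] *(4) by (auto simp: image_iff) (metis)
 show "inj_on f ($M)" using *(3) by (rule inj_on_inverseI)
qed

lemma mod_iso_sym: "mod_iso M N f g ==> mod_iso N M g f" by (auto simp: mod_iso_def)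

lemma mod_iso_trans:
 assumes 1: "mod_iso M N f g" and 2: "mod_iso N L h k"
 shows "mod_iso M L (\<lambda>x. h (f x)) (\<lambda>x. g (k x))" unfolding mod_iso_def
proof (intro conjI ballI)
 show "mhom M L (\<lambda>x. h (f x))" using 1 2 by (auto simp: mod_iso_def intro: module_hom_comp)
 show "mhom L M (\<lambda>x. g (k x))" using 1 2 by (auto simp: mod_iso_def intro: module_hom_comp)
 show "g (k (h (f x))) = x" if "x \<in> $M" for x using that mod_isoD[OF 1] mod_isoD(3)[OF 2] module_homD(1)[OF mod_isoD(1)[OF 1]] by simp
 show "h (f (g (k x))) = x" if "x \<in> $L" for x using that mod_isoD(4)[OF 1] mod_isoD[OF 2] module_homD(1)[OF mod_isoD(2)[OF 2]] by simp
qed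

lemma mod_iso_refl: "mod_iso M M (\<lambda>x. x) (\<lambda>x. x)" by (auto simp: mod_iso_def module_hom_id)

lemma bij_hom_mod_iso:
 assumes M: "fdm M" and f: "mhom M N f" "bij_betw f ($M) ($N)"
 shows "mod_iso M N f (inv_into ($M) f)"
proof -
 interpret M: amod A M by (rule amodI[OF M])
 note h = module_homD[OF f(1)]
 define g where "g = inv_into ($M) f"
 have g: "g (f x) = x" if "x \<in> $M" for x using that f(2) by (simp add: g_def bij_betw_def)
 have ex: "\<exists>x\<in>$M. y = f x" if "y \<in> $N" for y using f(2) that by (auto simp: bij_betw_def)
 have "mhom N M g"
 proof (rule module_homI)
  fix x assume "x \<in> $N"
  then obtain x' where x': "x' \<in> $M" "x = f x'" using ex by metis
  then show "g x \<in> $M" using g by simp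
  show "g (x +[N] y) = g x +[M] g y" if y: "y \<in> $N" for y
  proof -
   obtain y' where "y' \<in> $M" "y = f y'" using ex[OF y] by blast
   then show ?thesis using x' g by (simp add: h(2)[symmetric])
  qed
  show "g (x *[N] a) = g x *[M] a" if "a \<in> $A" for a using x' g that by (simp add: h(3)[symmetric])
 qed
 moreover have "f (g y) = y" if "y \<in> $N" for y using ex[OF that] g by auto
 ultimately show ?thesis using f(1) g unfolding mod_iso_def g_def by blast
qed

lemma module_iso_iff:
 assumes "fdm M"
 shows "module_iso A M N \<longleftrightarrow> (\<exists>f g. mod_iso M N f g)"
proof
 assume "module_iso A M N"
 then show "\<exists>f g. mod_iso M N f g" unfolding module_iso_def using bij_hom_mod_iso[OF assms] by blast
next
 assume "\<exists>f g. mod_iso M N f g"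
 then obtain f g where i: "mod_iso M N f g" by blast
 have "bij_betw f ($M) ($N)" using mod_isoD(5,6)[OF i] by (simp add: bij_betw_def)
 then show "module_iso A M N" using mod_isoD(1)[OF i] unfolding module_iso_def by blast
qed

lemma module_isoI: "mod_iso M N f g ==> module_iso A M N" using mod_isoD(1,5,6) unfolding module_iso_def bij_betw_def by metis

text \<open>Coordinates with respect to a finite generating set, spread over the natural numbers,
  move a module of any type into the type over which the definitions quantify.\<close>

lemma universe_copy:
 fixes M :: "('a, 'm) rmodule"
 assumes M: "fdm M"
 obtains M' f g where "M' \<in> modules A" "mod_iso M M' f g"
proof -
 interpret M: amod A M by (rule amodI[OF M])
 obtain S where S: "finite S" "S \<subseteq> $M"
  "\<And>x. x \<in> $M ==> \<exists>c. x = finsum M (\<lambda>s. s *[M] (c s \<odot> \<one>)) S"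
  using fd_right_module.finite_dim[OF M] by auto
 define c where "c x = (SOME c. x = finsum M (\<lambda>s. s *[M] (c s \<odot> \<one>)) S)" for x
 have c: "x = finsum M (\<lambda>s. s *[M] (c x s \<odot> \<one>)) S" if "x \<in> $M" for x
  unfolding c_def using someI_ex[OF S(3)[OF that]] .
 obtain h :: "'m \<Rightarrow> nat" where h: "inj_on h S" using finite_imp_inj_to_nat_seg[OF S(1)] by auto
 \<comment> \<open>The coefficients are chosen separately for each x, so f need not be linear.
   Injectivity is enough, because the structure of the copy is defined by transport along f.\<close>
 define f where "f x = (\<lambda>i. if i \<in> h ` S then c x (inv_into S h i) else 0)" for x
 have inj: "inj_on f ($M)"
 proof (rule inj_onI)
  fix x y assume xy: "x \<in> $M" "y \<in> $M" and e: "f x = f y"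
  have cc: "c x s = c y s" if "s \<in> S" for s using fun_cong[OF e, of "h s"] that h by (simp add: f_def inv_into_f_f[OF h])
  have "finsum M (\<lambda>s. s *[M] (c x s \<odot> \<one>)) S = finsum M (\<lambda>s. s *[M] (c y s \<odot> \<one>)) S"
   using S(2) cc by (intro M.M.finsum_cong') auto
  then show "x = y" using c xy by metis
 qed
 define g where "g = inv_into ($M) f"
 have g: "g (f x) = x" if "x \<in> $M" for x using that inj by (simp add: g_def)
 define M' :: "('k, 'a) umodule" where
  "M' = \<lparr>carrier = f ` $M, monoid.mult = undefined, one = undefined, ring.zero = f \<zero>[M],
    add = (\<lambda>x y. f (g x +[M] g y)), ract = (\<lambda>x a. f (g x *[M] a))\<rparr>"
 have hom: "mhom M M' f" by (rule module_homI) (auto simp: M'_def g)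
 have "fdm M'" by (rule image_module[OF M hom]) (auto simp: M'_def)
 moreover have "bij_betw f ($M) ($M')" using inj by (simp add: bij_betw_def M'_def)
 ultimately show ?thesis using that bij_hom_mod_iso[OF M hom] by (auto simp: modules_def)
qed

section \<open>Kernels, images, submodules and quotients\<close>

lemma hom_zero:
 assumes "fdm M" "fdm N" "mhom M N f"
 shows "f \<zero>[M] = \<zero>[N]"
proof -
 interpret M: amod A M by (rule amodI[OF assms(1)])
 interpret N: amod A N by (rule amodI[OF assms(2)])
 have "f \<zero>[M] +[N] f \<zero>[M] = f \<zero>[M]" using module_homD(2)[OF assms(3), of "\<zero>[M]" "\<zero>[M]"] by simp
 then show ?thesis using module_homD(1)[OF assms(3), of "\<zero>[M]"] by (simp add: N.M.add.l_cancel_one)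
qed

lemma hom_neg:
 assumes "fdm M" "fdm N" "mhom M N f" "x \<in> $M"
 shows "f (-[M] x) = -[N] f x"
proof -
 interpret M: amod A M by (rule amodI[OF assms(1)])
 interpret N: amod A N by (rule amodI[OF assms(2)])
 have "f (-[M] x) +[N] f x = \<zero>[N]"
  using module_homD(2)[OF assms(3), of "-[M] x" x] assms(4) hom_zero[OF assms(1-3)] by (simp add: M.M.l_neg)
 then show ?thesis using module_homD(1)[OF assms(3)] assms(4) by (intro N.M.add_eq_zero) auto
qed

lemma hom_minus:
 assumes "fdm M" "fdm N" "mhom M N f" "x \<in> $M" "y \<in> $M"
 shows "f (x -[M] y) = f x -[N] f y"
proof -
 interpret M: amod A M by (rule amodI[OF assms(1)])
 interpret N: amod A N by (rule amodI[OF assms(2)])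
 show ?thesis using assms(4,5) by (simp add: M.M.minus_eq N.M.minus_eq module_homD(2)[OF assms(3)] hom_neg[OF assms(1-3)])
qed

lemma hom_inj:
 assumes "fdm M" "fdm N" "mhom M N f"
  and k: "\<And>x. x \<in> $M ==> f x = \<zero>[N] ==> x = \<zero>[M]"
 shows "inj_on f ($M)"
proof (rule inj_onI)
 interpret M: amod A M by (rule amodI[OF assms(1)])
 interpret N: amod A N by (rule amodI[OF assms(2)])
 fix x y assume xy: "x \<in> $M" "y \<in> $M" "f x = f y"
 then have "f (x -[M] y) = \<zero>[N]" using module_homD(1)[OF assms(3)] by (simp add: hom_minus[OF assms(1-3)])
 then have "x -[M] y = \<zero>[M]" using k xy by simp
 then show "x = y" using xy by (simp add: M.M.diff_eq_iff)
qed

lemma hom_eq_kernel: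
 assumes "fdm M" "fdm N" "mhom M N f" "x \<in> $M" "y \<in> $M"
 shows "f x = f y \<longleftrightarrow> f (x -[M] y) = \<zero>[N]"
proof -
 interpret N: amod A N by (rule amodI[OF assms(2)])
 show ?thesis using module_homD(1)[OF assms(3)] assms(4,5) by (simp add: hom_minus[OF assms(1-3)] N.M.diff_eq_iff)
qed

lemma kernel_submodule:
 assumes "fdm M" "fdm N" "mhom M N f"
 shows "submod {x \<in> $M. f x = \<zero>[N]} M"
proof -
 interpret M: amod A M by (rule amodI[OF assms(1)])
 interpret N: amod A N by (rule amodI[OF assms(2)])
 show ?thesis by (rule rsubmoduleI) (auto simp: module_homD[OF assms(3)] hom_zero[OF assms])
qed

lemma image_submodule:
 assumes "fdm M" "fdm N" "mhom M N f" "submod U M"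
 shows "submod (f ` U) N"
proof (rule rsubmoduleI)
 note h = module_homD[OF assms(3)] and u = rsubmoduleD[OF assms(4)]
 show "f ` U \<subseteq> $N" using h u by auto
 show "\<zero>[N] \<in> f ` U" using u(2) hom_zero[OF assms(1-3)] by (metis image_eqI)
 show "x +[N] y \<in> f ` U" if xy: "x \<in> f ` U" "y \<in> f ` U" for x y
 proof -
  from xy obtain a b where "a \<in> U" "b \<in> U" "x = f a" "y = f b" by auto
  then show ?thesis using u h(2)[of a b] by (metis image_eqI)
 qed
 show "x *[N] a \<in> f ` U" if x: "x \<in> f ` U" "a \<in> $A" for x a
 proof -
  from x obtain b where "b \<in> U" "x = f b" by auto
  then show ?thesis using u h(3)[of b a] x by (metis image_eqI)
 qed
qed

lemma preimage_submodule:
 assumes "fdm M" "fdm N" "mhom M N f" "submod U N"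
 shows "submod {x \<in> $M. f x \<in> U} M"
proof (rule rsubmoduleI)
 interpret M: amod A M by (rule amodI[OF assms(1)])
 note h = module_homD[OF assms(3)] and u = rsubmoduleD[OF assms(4)]
 show "\<zero>[M] \<in> {x \<in> $M. f x \<in> U}" using u(2) hom_zero[OF assms(1-3)] by simp
qed (use rsubmoduleD(3,4)[OF assms(4)] module_homD(2,3)[OF assms(3)] amod.act_closed[OF amodI[OF assms(1)]]
   abelian_group.axioms(1)[OF fd_right_module.axioms(2)[OF assms(1)]] in
   \<open>auto simp: abelian_monoid.a_closed\<close>)

text \<open>Only finite generation needs an idea: a linear projection onto the submodule maps
  generators of M to generators of U.\<close>

lemma submodule_module:
 assumes M: "fdm M" and U: "submod U M"
 shows "fdm (M |. U)"
proof -
 interpret M: amod A M by (rule amodI[OF M])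
 note u = rsubmoduleD[OF U]
 have neg: "-[M] x \<in> U" if "x \<in> U" for x using M.subspace_neg[OF submodule_subspace[OF U] that] .
 show ?thesis
 proof (rule fd_moduleI)
  show "abelian_group (M |. U)"
  proof (rule abelian_groupI, goal_cases)
   case (6 x)
   then show ?case using neg u(5) by (auto intro!: bexI[of _ "-[M] x"] simp: M.M.l_neg)
  qed (auto simp: u M.M.a_ac)
  obtain S where S: "finite S" "S \<subseteq> $M" "\<And>U. subspace M U ==> S \<subseteq> U ==> U = $M"
   using M.generates_ex unfolding generates_def by blast
  obtain p where p: "M.linear_to U p" "\<And>x. x \<in> U ==> p x = x"
   using M.projection_ex[OF submodule_subspace[OF U]] by blast
  note p' = p(1)[unfolded M.linear_to_def]
  have "generates (M |. U) (p ` S)" unfolding generates_def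
  proof (intro conjI allI impI)
   fix V assume V: "subspace (M |. U) V \<and> p ` S \<subseteq> V"
   then have V': "V \<subseteq> U" "\<zero>[M] \<in> V" "\<And>x y. x \<in> V ==> y \<in> V ==> x +[M] y \<in> V" "\<And>c x. x \<in> V ==> sc M c x \<in> V"
    by (auto simp: subspace_def sc_def)
   have "subspace M {x \<in> $M. p x \<in> V}" using V' p' p(2)[OF u(2)] by (intro subspaceI) auto
   then have "{x \<in> $M. p x \<in> V} = $M" by (rule S(3)) (use V S in auto)
   then have "U \<subseteq> V" using p(2) u(5) by (metis (mono_tags, lifting) mem_Collect_eq subsetI)
   then show "V = $(M |. U)" using V' by auto
  qed (use S p' in auto)
  then show "\<exists>S. generates (M |. U) S" by blast
 qed (auto simp: u M.ract_add_left M.ract_add_right M.ract_mult M.ract_one)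
qed

lemma submodule_inclusion: "submod U M ==> mhom (M |. U) M (\<lambda>x. x)" by (rule module_homI) (auto dest: rsubmoduleD)

lemma submodule_modules: "M \<in> modules A ==> submod U M ==> (M |. U) \<in> modules A"
 by (simp add: modules_def submodule_module)

lemma submodule_trans: "submod U M ==> submod V (M |. U) ==> submod V M" by (auto simp: rsubmodule_def)

lemma submodule_restrict: "submod V M ==> V \<subseteq> U ==> submod V (M |. U)" by (auto simp: rsubmodule_def)

lemma coset_eq_iff:
 assumes M: "fdm M" and U: "submod U M" and x: "x \<in> $M" and y: "y \<in> $M"
 shows "U +>\<^bsub>M\<^esub> x = U +>\<^bsub>M\<^esub> y \<longleftrightarrow> x -[M] y \<in> U"
proof -
 interpret M: amod A M by (rule amodI[OF M])
 note u = rsubmoduleD[OF U]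
 have sub: "U +>\<^bsub>M\<^esub> x \<subseteq> U +>\<^bsub>M\<^esub> y" if xy: "x -[M] y \<in> U" "x \<in> $M" "y \<in> $M" for x y
 proof
  fix z assume "z \<in> U +>\<^bsub>M\<^esub> x"
  then obtain w where w: "w \<in> U" "z = w +[M] x" by (auto simp: a_r_coset_def')
  then have "z = (w +[M] (x -[M] y)) +[M] y" using xy u(5) by (simp add: M.M.a_assoc M.M.minus_add_cancel)
  then show "z \<in> U +>\<^bsub>M\<^esub> y" using u(3)[OF w(1) xy(1)] by (auto simp: a_r_coset_def')
 qed
 show ?thesis
 proof
  assume "U +>\<^bsub>M\<^esub> x = U +>\<^bsub>M\<^esub> y"
  moreover have "x \<in> U +>\<^bsub>M\<^esub> x" using u(2) x by (auto simp: a_r_coset_def' intro!: bexI[of _ "\<zero>[M]"])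
  ultimately obtain w where "w \<in> U" "x = w +[M] y" by (auto simp: a_r_coset_def')
  then show "x -[M] y \<in> U" using u(5) y by (simp add: M.M.add_diff_cancel)
 next
  assume a: "x -[M] y \<in> U"
  have "y -[M] x = -[M] (x -[M] y)" using x y by (simp add: M.M.minus_eq M.M.minus_add M.M.a_comm)
  then have "y -[M] x \<in> U" using M.subspace_neg[OF submodule_subspace[OF U] a] by simp
  then show "U +>\<^bsub>M\<^esub> x = U +>\<^bsub>M\<^esub> y" using sub[OF a x y] sub[OF _ y x] by blast
 qed
qed

lemma quotient_carrier: "$(quotient_module M U) = (\<lambda>x. U +>\<^bsub>M\<^esub> x) ` $M"
 by (auto simp: quotient_module_def A_RCOSETS_def')

lemma quotient_zero: "\<zero>[quotient_module M U] = U" by (simp add: quotient_module_def)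

lemma quotient_hom:
 assumes M: "fdm M" and U: "submod U M"
 shows "mhom M (quotient_module M U) (\<lambda>x. U +>\<^bsub>M\<^esub> x)"
proof -
 interpret M: amod A M by (rule amodI[OF M])
 note u = rsubmoduleD[OF U]
 have "abelian_subgroup U M"
 proof (rule abelian_subgroupI3)
  show "additive_subgroup U M"
  proof (rule additive_subgroupI, rule M.M.add.subgroupI)
   show "U \<subseteq> $M" "U \<noteq> {}" using u(1,2) by auto
  qed (use u(3) M.subspace_neg[OF submodule_subspace[OF U]] in simp_all)
 qed (rule M.M.abelian_group_axioms)
 then interpret U: abelian_subgroup U M .
 show ?thesis
 proof (rule module_homI)
  fix x y assume "x \<in> $M" "y \<in> $M"
  then show "U +>\<^bsub>M\<^esub> (x +[M] y) = (U +>\<^bsub>M\<^esub> x) +[quotient_module M U] (U +>\<^bsub>M\<^esub> y)"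
   by (simp add: quotient_module_def U.a_rcos_sum)
 next
  fix x a assume xa: "x \<in> $M" "a \<in> $A"
  \<comment> \<open>The action on the quotient is defined as a union over representatives; all of
    them contribute the same coset.\<close>
  have *: "U +>\<^bsub>M\<^esub> (z *[M] a) = U +>\<^bsub>M\<^esub> (x *[M] a)" if z: "z \<in> U +>\<^bsub>M\<^esub> x" for z
  proof -
   obtain w where w: "w \<in> U" "z = w +[M] x" using z by (auto simp: a_r_coset_def')
   then have "z *[M] a -[M] x *[M] a = w *[M] a" using xa u(5) by (simp add: M.ract_add_left M.M.add_diff_cancel)
   then show ?thesis using w xa u(4,5) by (subst coset_eq_iff[OF M U]) auto
  qed
  have "x \<in> U +>\<^bsub>M\<^esub> x" using u(2) xa by (auto simp: a_r_coset_def' intro!: bexI[of _ "\<zero>[M]"])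
  then have "(\<Union>z\<in>U +>\<^bsub>M\<^esub> x. U +>\<^bsub>M\<^esub> (z *[M] a)) = U +>\<^bsub>M\<^esub> (x *[M] a)"
   by (rule UN_constant_eq) (use * in blast)
  then show "U +>\<^bsub>M\<^esub> (x *[M] a) = (U +>\<^bsub>M\<^esub> x) *[quotient_module M U] a" by (simp add: quotient_module_def)
 qed (auto simp: quotient_carrier)
qed

lemma coset_zero_iff:
 assumes M: "fdm M" and U: "submod U M" and x: "x \<in> $M"
 shows "U +>\<^bsub>M\<^esub> x = U \<longleftrightarrow> x \<in> U"
proof -
 interpret M: amod A M by (rule amodI[OF M])
 have "U +>\<^bsub>M\<^esub> \<zero>[M] = U" using rsubmoduleD(1)[OF U] by (rule M.M.a_coset_add_zero)
 then show ?thesis using coset_eq_iff[OF M U x M.M.zero_closed] x by simp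
qed

lemma quotient_fd:
 assumes M: "fdm M" and U: "submod U M"
 shows "fdm (quotient_module M U)"
proof -
 interpret M: amod A M by (rule amodI[OF M])
 have "U +>\<^bsub>M\<^esub> \<zero>[M] = U" using rsubmoduleD(1)[OF U] by (rule M.M.a_coset_add_zero)
 then show ?thesis by (intro image_module[OF M quotient_hom[OF M U]]) (auto simp: quotient_carrier quotient_zero)
qed

lemma factor_hom:
 fixes Q :: "('a, 'q) rmodule"
 assumes M: "fdm M" and Q: "fdm Q" and N: "fdm N"
  and p: "mhom M Q p" "p ` $M = $Q" and f: "mhom M N f"
  and k: "\<And>x. x \<in> $M ==> p x = \<zero>[Q] ==> f x = \<zero>[N]"
 obtains g where "mhom Q N g" "\<And>x. x \<in> $M ==> g (p x) = f x"
proof -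
 interpret M: amod A M by (rule amodI[OF M])
 define g where "g y = f (SOME x. x \<in> $M \<and> p x = y)" for y
 have g: "g (p x) = f x" if x: "x \<in> $M" for x
 proof -
  define x' where "x' = (SOME x'. x' \<in> $M \<and> p x' = p x)"
  have x': "x' \<in> $M \<and> p x' = p x" unfolding x'_def by (rule someI[of _ x]) (use x in simp)
  then have "p (x' -[M] x) = \<zero>[Q]" using hom_eq_kernel[OF M Q p(1), of x' x] x by simp
  then have "f (x' -[M] x) = \<zero>[N]" using k x x' by simp
  then have "f x' = f x" using hom_eq_kernel[OF M N f, of x' x] x x' by simp
  then show ?thesis unfolding g_def x'_def .
 qed
 have ex: "\<exists>x\<in>$M. y = p x" if "y \<in> $Q" for y using p(2) that by auto
 have "mhom Q N g"
 proof (rule module_homI)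
  fix x assume "x \<in> $Q"
  then obtain x' where x': "x' \<in> $M" "x = p x'" using ex by metis
  then show "g x \<in> $N" using g module_homD(1)[OF f] by simp
  show "g (x +[Q] y) = g x +[N] g y" if y: "y \<in> $Q" for y
  proof -
   obtain y' where "y' \<in> $M" "y = p y'" using ex[OF y] by blast
   then show ?thesis using x' g by (simp add: module_homD(2)[OF p(1),symmetric] module_homD(2)[OF f])
  qed
  show "g (x *[Q] a) = g x *[N] a" if "a \<in> $A" for a
   using x' g that by (simp add: module_homD(3)[OF p(1),symmetric] module_homD(3)[OF f])
 qed
 then show ?thesis using that g by blast
qed

lemma first_iso:
 assumes M: "fdm M" and Q: "fdm Q" and N: "fdm N"
  and p: "mhom M Q p" "p ` $M = $Q"
  and f: "mhom M N f" "f ` $M = $N"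
  and k: "\<And>x. x \<in> $M ==> p x = \<zero>[Q] \<longleftrightarrow> f x = \<zero>[N]"
 obtains g h where "mod_iso Q N g h" "\<And>x. x \<in> $M ==> g (p x) = f x"
proof -
 obtain g where g: "mhom Q N g" "\<And>x. x \<in> $M ==> g (p x) = f x" using factor_hom[OF M Q N p f(1)] k by metis
 obtain h where h: "mhom N Q h" "\<And>x. x \<in> $M ==> h (f x) = p x" using factor_hom[OF M N Q f p(1)] k by metis
 have "mod_iso Q N g h" unfolding mod_iso_def
 proof (intro conjI ballI)
  fix x assume "x \<in> $Q"
  then obtain x' where "x' \<in> $M" "x = p x'" using p(2) by auto
  then show "h (g x) = x" using g h by simp
 next
  fix x assume "x \<in> $N"
  then obtain x' where "x' \<in> $M" "x = f x'" using f(2) by auto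
  then show "g (h x) = x" using g h by simp
 qed (use g h in auto)
 then show ?thesis using that g by blast
qed

section \<open>Direct sums and split epimorphisms\<close>

lemma direct_sum_simps [simp]:
 "$(direct_sum M N) = $M \<times> $N"
 "\<zero>[direct_sum M N] = (\<zero>[M], \<zero>[N])"
 "(x, y) +[direct_sum M N] (x', y') = (x +[M] x', y +[N] y')"
 "(x, y) *[direct_sum M N] a = (x *[M] a, y *[N] a)" by (simp_all add: direct_sum_def)

lemma direct_sum_fd:
 assumes M: "fdm M" and N: "fdm N"
 shows "fdm (direct_sum M N)"
proof -
 interpret M: amod A M by (rule amodI[OF M])
 interpret N: amod A N by (rule amodI[OF N])
 show ?thesis
 proof (rule fd_moduleI)
  show "abelian_group (direct_sum M N)"
  proof (rule abelian_groupI, goal_cases)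
   case (6 x)
   then show ?case by (cases x) (auto intro!: bexI[of _ "(-[M] fst x, -[N] snd x)"] simp: M.M.l_neg N.M.l_neg)
  qed (auto simp: M.M.a_ac N.M.a_ac)
  obtain S where S: "finite S" "S \<subseteq> $M" "\<And>U. subspace M U ==> S \<subseteq> U ==> U = $M"
   using M.generates_ex unfolding generates_def by blast
  obtain T where T: "finite T" "T \<subseteq> $N" "\<And>U. subspace N U ==> T \<subseteq> U ==> U = $N"
   using N.generates_ex unfolding generates_def by blast
  have "generates (direct_sum M N) (S \<times> {\<zero>[N]} \<union> {\<zero>[M]} \<times> T)" unfolding generates_def
  proof (intro conjI allI impI)
   fix V assume V: "subspace (direct_sum M N) V \<and> S \<times> {\<zero>[N]} \<union> {\<zero>[M]} \<times> T \<subseteq> V"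
   then have v: "subspace (direct_sum M N) V" by simp
   note vd = subspaceD(2-4)[OF v]
   have a: "(x, y) \<in> V ==> (x', y') \<in> V ==> (x +[M] x', y +[N] y') \<in> V" for x y x' y'
    using vd(2)[of "(x,y)" "(x',y')"] by simp
   have b: "(x, y) \<in> V ==> (sc M c x, sc N c y) \<in> V" for c x y using vd(3)[of "(x,y)" c] by (simp add: sc_def)
   have "subspace M {x \<in> $M. (x, \<zero>[N]) \<in> V}"
    using a[of _ "\<zero>[N]" _ "\<zero>[N]"] b[of _ "\<zero>[N]"] vd(1) by (intro subspaceI) auto
   then have 1: "{x \<in> $M. (x, \<zero>[N]) \<in> V} = $M" by (rule S(3)) (use S V in auto)
   have "subspace N {x \<in> $N. (\<zero>[M], x) \<in> V}"
    using a[of "\<zero>[M]" _ "\<zero>[M]"] b[of "\<zero>[M]"] vd(1) by (intro subspaceI) auto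
   then have 2: "{x \<in> $N. (\<zero>[M], x) \<in> V} = $N" by (rule T(3)) (use T V in auto)
   have "(x, y) \<in> V" if "x \<in> $M" "y \<in> $N" for x y using a[of x "\<zero>[N]" "\<zero>[M]" y] that 1 2 by auto
   then show "V = $(direct_sum M N)" using subspaceD(1)[OF v] by auto
  qed (use S T in auto)
  then show "\<exists>S. generates (direct_sum M N) S" by blast
 qed (auto simp: M.ract_add_left N.ract_add_left M.ract_add_right N.ract_add_right
   M.ract_mult N.ract_mult M.ract_one N.ract_one)
qed

lemma hom_fst: "mhom (direct_sum M N) M fst" by (rule module_homI) auto

lemma hom_snd: "mhom (direct_sum M N) N snd" by (rule module_homI) auto

lemma hom_inl:
 assumes "fdm N" shows "mhom M (direct_sum M N) (\<lambda>x. (x, \<zero>[N]))"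
proof -
 interpret N: amod A N by (rule amodI[OF assms])
 show ?thesis by (rule module_homI) auto
qed

lemma hom_inr:
 assumes "fdm M" shows "mhom N (direct_sum M N) (\<lambda>x. (\<zero>[M], x))"
proof -
 interpret M: amod A M by (rule amodI[OF assms])
 show ?thesis by (rule module_homI) auto
qed

lemma hom_pair:
 "mhom L M f ==> mhom L N g ==> mhom L (direct_sum M N) (\<lambda>x. (f x, g x))"
 by (rule module_homI) (auto dest: module_homD)

lemma hom_add:
 assumes N: "fdm N" and "mhom M N f" "mhom M N g"
 shows "mhom M N (\<lambda>x. f x +[N] g x)"
proof -
 interpret N: amod A N by (rule amodI[OF N])
 show ?thesis using assms(2,3)
  by (intro module_homI) (auto simp: module_homD[OF assms(2)] module_homD[OF assms(3)] N.M.add_add_swap N.ract_add_left)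
qed

lemma hom_diff:
 assumes N: "fdm N" and "mhom M N f" "mhom M N g"
 shows "mhom M N (\<lambda>x. f x -[N] g x)"
proof -
 interpret N: amod A N by (rule amodI[OF N])
 show ?thesis using assms(2,3)
  by (intro module_homI) (auto simp: module_homD[OF assms(2)] module_homD[OF assms(3)] N.M.add_diff_add N.minus_act)
qed

lemma hom_restrict: "mhom M N f ==> (\<And>x. x \<in> $M ==> f x \<in> V) ==> mhom M (N |. V) f"
 by (auto simp: module_hom_def)

lemma hom_restrict_dom: "mhom M N f ==> U \<subseteq> $M ==> mhom (M |. U) N f"
 unfolding module_hom_def by (auto; blast)

lemma mod_iso_direct_sum:
 assumes "mod_iso M M' f g" "mod_iso N N' h k"
 shows "mod_iso (direct_sum M N) (direct_sum M' N') (\<lambda>(x, y). (f x, h y)) (\<lambda>(x, y). (g x, k y))"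
proof -
 have "mhom (direct_sum M N) (direct_sum M' N') (\<lambda>(x, y). (f x, h y))"
  using module_homD[OF mod_isoD(1)[OF assms(1)]] module_homD[OF mod_isoD(1)[OF assms(2)]] by (intro module_homI) auto
 moreover have "mhom (direct_sum M' N') (direct_sum M N) (\<lambda>(x, y). (g x, k y))"
  using module_homD[OF mod_isoD(2)[OF assms(1)]] module_homD[OF mod_isoD(2)[OF assms(2)]] by (intro module_homI) auto
 ultimately show ?thesis using mod_isoD(3,4)[OF assms(1)] mod_isoD(3,4)[OF assms(2)] by (auto simp: mod_iso_def)
qed

lemma mod_iso_direct_sum_comm:
 "mod_iso (direct_sum M N) (direct_sum N M) (\<lambda>(x, y). (y, x)) (\<lambda>(x, y). (y, x))"
 unfolding mod_iso_def by (intro conjI module_homI) auto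

lemma split_iso:
 assumes M: "fdm M" and P: "fdm P"
  and p: "mhom M P p" and s: "mhom P M s" and ps: "\<And>x. x \<in> $P ==> p (s x) = x"
 shows "\<exists>f g. mod_iso M (direct_sum P (M\<lparr>carrier := {x \<in> $M. p x = \<zero>[P]}\<rparr>)) f g"
proof -
 interpret M: amod A M by (rule amodI[OF M])
 interpret P: amod A P by (rule amodI[OF P])
 define K where "K = {x \<in> $M. p x = \<zero>[P]}"
 have K: "submod K M" unfolding K_def by (rule kernel_submodule[OF M P p])
 have sp: "mhom M M (\<lambda>x. s (p x))" by (rule module_hom_comp[OF p s])
 have d: "mhom M M (\<lambda>x. x -[M] s (p x))" by (rule hom_diff[OF M module_hom_id sp])
 have dK: "x -[M] s (p x) \<in> K" if "x \<in> $M" for x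
  using that module_homD(1)[OF p] module_homD(1)[OF s] by (simp add: K_def hom_minus[OF M P p] ps)
 have f: "mhom M (direct_sum P (M |. K)) (\<lambda>x. (p x, x -[M] s (p x)))" by (rule hom_pair[OF p hom_restrict[OF d dK]])
 have fst: "mhom (direct_sum P (M |. K)) M (\<lambda>x. s (fst x))" by (rule module_hom_comp[OF hom_fst s])
 have snd: "mhom (direct_sum P (M |. K)) M snd" using module_hom_comp[OF hom_snd[of P] submodule_inclusion[OF K]] by simp
 have g: "mhom (direct_sum P (M |. K)) M (\<lambda>x. s (fst x) +[M] snd x)" by (rule hom_add[OF M fst snd])
 have "mod_iso M (direct_sum P (M |. K)) (\<lambda>x. (p x, x -[M] s (p x))) (\<lambda>x. s (fst x) +[M] snd x)" unfolding mod_iso_def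
 proof (intro conjI ballI f g)
  fix x assume "x \<in> $M"
  then show "s (fst (p x, x -[M] s (p x))) +[M] snd (p x, x -[M] s (p x)) = x"
   using module_homD(1)[OF p] module_homD(1)[OF s] by (simp add: M.M.add_minus_cancel)
 next
  fix y assume "y \<in> $(direct_sum P (M |. K))"
  then obtain u v where y: "y = (u, v)" "u \<in> $P" "v \<in> $M" "p v = \<zero>[P]" by (auto simp: K_def)
  have "p (s u +[M] v) = u" using y module_homD(1)[OF s] by (simp add: module_homD(2)[OF p] ps)
  then show "(p (s (fst y) +[M] snd y), (s (fst y) +[M] snd y) -[M] s (p (s (fst y) +[M] snd y))) = y"
   using y module_homD(1)[OF s] by (simp add: M.M.add_diff_cancel_left)
 qed
 then show ?thesis unfolding K_def by blast
qed

text \<open>Among the images of the powers of f there is a minimal one, so two consecutive images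
  agree; injectivity of the power then cancels it. This is what makes modules that are retracts of
  each other isomorphic.\<close>

lemma injective_endo_surj:
 assumes M: "fdm M" and f: "mhom M M f" "inj_on f ($M)"
 shows "f ` $M = $M"
proof -
 interpret M: amod A M by (rule amodI[OF M])
 obtain U where U: "\<exists>k. U = (f ^^ k) ` $M" and m: "\<And>V. \<exists>k. V = (f ^^ k) ` $M ==> V \<subseteq> U ==> V = U"
 proof (rule M.minimal_subspace[of "\<lambda>U. \<exists>k. U = (f ^^ k) ` $M"])
  show "\<exists>k. $M = (f ^^ k) ` $M" by (rule exI[of _ 0]) simp
  fix U assume "\<exists>k. U = (f ^^ k) ` $M"
  then obtain k where k: "U = (f ^^ k) ` $M" by blast
  have "submod ((f ^^ k) ` $M) M"
  proof (induction k)
   case (Suc k)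
   have "(f ^^ Suc k) ` $M = f ` ((f ^^ k) ` $M)" by auto
   then show ?case using image_submodule[OF M M f(1) Suc] by simp
  qed (simp add: M.submodule_carrier)
  then show "subspace M U" using k submodule_subspace by simp
 qed blast
 obtain k where k: "U = (f ^^ k) ` $M" using U by blast
 have fk: "(f ^^ k) x \<in> $M" if "x \<in> $M" for x k using that by (induction k) (auto simp: module_homD(1)[OF f(1)])
 have inj: "inj_on (f ^^ k) ($M)" for k
 proof (induction k)
  case (Suc k) then show ?case using f(2) fk by (auto simp: inj_on_def)
 qed simp
 have "(f ^^ Suc k) ` $M = U"
 proof (rule m)
  show "(f ^^ Suc k) ` $M \<subseteq> U"
  proof
   fix y assume "y \<in> (f ^^ Suc k) ` $M"
   then obtain x where "x \<in> $M" "y = (f ^^ k) (f x)" by (auto simp: funpow_swap1)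
   then show "y \<in> U" using module_homD(1)[OF f(1)] unfolding k by blast
  qed
 qed blast
 show ?thesis
 proof (intro equalityI subsetI)
  fix y assume y: "y \<in> $M"
  then have "(f ^^ k) y \<in> (f ^^ Suc k) ` $M" using \<open>_ = U\<close> k by auto
  then obtain x where x: "x \<in> $M" "(f ^^ k) y = (f ^^ k) (f x)" by (auto simp: funpow_swap1)
  then have "y = f x" using inj[of k] y module_homD(1)[OF f(1)] by (auto simp: inj_on_def)
  then show "y \<in> f ` $M" using x by blast
 qed (auto simp: module_homD(1)[OF f(1)])
qed

end

section \<open>Projective and injective modules\<close>

context fd_algebra
begin

lemma sc_direct_sum: "sc (direct_sum M N) c (x, y) = (sc M c x, sc N c y)" by (simp add: sc_def)

lemma module_hom_zero:
 assumes "fdm N" shows "mhom M N (\<lambda>x. \<zero>[N])"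
proof -
 interpret N: amod A N by (rule amodI[OF assms])
 show ?thesis by (rule module_homI) auto
qed

lemma modulesD: "M \<in> modules A ==> fdm M" by (simp add: modules_def)

text \<open>Projectivity is tested on modules of the universe type only; replacing L and Y by copies
  extends the lifting property to modules of every type.\<close>

lemma proj_lift:
 assumes P: "projective P" and L: "fdm L" and Y: "fdm Y"
  and g: "mhom L Y g" "g ` $L = $Y" and f: "mhom P Y f"
 obtains h where "mhom P L h" "\<And>x. x \<in> $P ==> g (h x) = f x"
proof -
 obtain L' l l' where L': "L' \<in> modules A" "mod_iso L L' l l'" using universe_copy[OF L] by blast
 obtain Y' y y' where Y': "Y' \<in> modules A" "mod_iso Y Y' y y'" using universe_copy[OF Y] by blast
 note l = mod_isoD[OF L'(2)] and y = mod_isoD[OF Y'(2)]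
 have 1: "mhom L' Y' (\<lambda>x. y (g (l' x)))" by (rule module_hom_comp[OF module_hom_comp[OF l(2) g(1)] y(1)])
 have l'_surj: "l' ` $L' = $L" using mod_isoD(5)[OF mod_iso_sym[OF L'(2)]] .
 have 2: "(\<lambda>x. y (g (l' x))) ` $L' = $Y'" using l'_surj g(2) y(5) by (metis image_image)
 have 3: "mhom P Y' (\<lambda>x. y (f x))" by (rule module_hom_comp[OF f y(1)])
 obtain h where h: "mhom P L' h" "\<And>x. x \<in> $P ==> y (g (l' (h x))) = y (f x)"
  using P 1 2 3 L'(1) Y'(1) unfolding projective_module_def by meson
 have "g (l' (h x)) = f x" if "x \<in> $P" for x using h(2)[OF that] y(3) module_homD(1)[OF f that]
   module_homD(1)[OF g(1) module_homD(1)[OF l(2) module_homD(1)[OF h(1) that]]] by metis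
 then show ?thesis using that[OF module_hom_comp[OF h(1) l(2)]] by blast
qed

lemma inj_extend:
 assumes I: "injective I" and L: "fdm L" and Y: "fdm Y"
  and g: "mhom L Y g" "inj_on g ($L)" and f: "mhom L I f"
 obtains h where "mhom Y I h" "\<And>x. x \<in> $L ==> h (g x) = f x"
proof -
 obtain L' l l' where L': "L' \<in> modules A" "mod_iso L L' l l'" using universe_copy[OF L] by blast
 obtain Y' y y' where Y': "Y' \<in> modules A" "mod_iso Y Y' y y'" using universe_copy[OF Y] by blast
 note l = mod_isoD[OF L'(2)] and y = mod_isoD[OF Y'(2)]
 have 1: "mhom L' Y' (\<lambda>x. y (g (l' x)))" by (rule module_hom_comp[OF module_hom_comp[OF l(2) g(1)] y(1)])
 have 2: "inj_on (\<lambda>x. y (g (l' x))) ($L')"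
 proof (rule inj_onI)
  fix a b assume ab: "a \<in> $L'" "b \<in> $L'" "y (g (l' a)) = y (g (l' b))"
  then have "l' a \<in> $L" "l' b \<in> $L" using module_homD(1)[OF l(2)] by auto
  then have "l' a = l' b" using ab(3) g y(6) module_homD(1)[OF g(1)] by (meson inj_onD)
  then show "a = b" using ab l(4) by metis
 qed
 have 3: "mhom L' I (\<lambda>x. f (l' x))" by (rule module_hom_comp[OF l(2) f])
 obtain h where h: "mhom Y' I h" "\<And>x. x \<in> $L' ==> h (y (g (l' x))) = f (l' x)"
  using I 1 2 3 L'(1) Y'(1) unfolding injective_module_def by meson
 have "h (y (g x)) = f x" if "x \<in> $L" for x using h(2)[OF module_homD(1)[OF l(1) that]] l(3)[OF that] by simp
 then show ?thesis using that[OF module_hom_comp[OF y(1) h(1)]] by blast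
qed

lemma projective_retract:
 assumes P: "projective P" and Q: "fdm Q"
  and p: "mhom P Q p" and s: "mhom Q P s" and ps: "\<And>x. x \<in> $Q ==> p (s x) = x"
 shows "projective Q" unfolding projective_module_def
proof (intro conjI ballI allI impI Q)
 fix L Y g f assume LY: "L \<in> modules A" "Y \<in> modules A"
  and *: "mhom L Y g \<and> g ` $L = $Y \<and> mhom Q Y f"
 obtain h where h: "mhom P L h" "\<And>x. x \<in> $P ==> g (h x) = f (p x)"
  using proj_lift[OF P modulesD[OF LY(1)] modulesD[OF LY(2)], of g "\<lambda>x. f (p x)"] * module_hom_comp[OF p] by blast
 have "g (h (s x)) = f x" if "x \<in> $Q" for x using h(2)[OF module_homD(1)[OF s that]] ps[OF that] by simp
 then show "\<exists>h. mhom Q L h \<and> (\<forall>x\<in>$Q. g (h x) = f x)" using module_hom_comp[OF s h(1)] by blast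
qed

lemma injective_retract:
 assumes P: "injective P" and Q: "fdm Q"
  and p: "mhom P Q p" and s: "mhom Q P s" and ps: "\<And>x. x \<in> $Q ==> p (s x) = x"
 shows "injective Q" unfolding injective_module_def
proof (intro conjI ballI allI impI Q)
 fix L Y g f assume LY: "L \<in> modules A" "Y \<in> modules A"
  and *: "mhom L Y g \<and> inj_on g ($L) \<and> mhom L Q f"
 have sf: "mhom L P (\<lambda>x. s (f x))" using * module_hom_comp[OF _ s] by blast
 obtain h where h: "mhom Y P h" "\<And>x. x \<in> $L ==> h (g x) = s (f x)"
  using inj_extend[OF P modulesD[OF LY(1)] modulesD[OF LY(2)] _ _ sf, of g] * by blast
 have "p (h (g x)) = f x" if "x \<in> $L" for x using h(2)[OF that] ps module_homD(1)[of L Q f, OF _ that] * by simp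
 then show "\<exists>h. mhom Y Q h \<and> (\<forall>x\<in>$L. h (g x) = f x)" using module_hom_comp[OF h(1) p] by blast
qed

lemma projective_iso:
 assumes "projective P" "fdm Q" "mod_iso P Q f g"
 shows "projective Q" using projective_retract[OF assms(1,2) mod_isoD(1)[OF assms(3)] mod_isoD(2)[OF assms(3)]]
  mod_isoD(4)[OF assms(3)] by blast

lemma injective_iso:
 assumes "injective P" "fdm Q" "mod_iso P Q f g"
 shows "injective Q" using injective_retract[OF assms(1,2) mod_isoD(1)[OF assms(3)] mod_isoD(2)[OF assms(3)]]
  mod_isoD(4)[OF assms(3)] by blast

lemma projectiveD: "projective P ==> fdm P" by (simp add: projective_module_def)

lemma injectiveD: "injective P ==> fdm P" by (simp add: injective_module_def)

lemma projective_direct_sum: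
 assumes P: "projective P" and Q: "projective Q"
 shows "projective (direct_sum P Q)" unfolding projective_module_def
proof (intro conjI ballI allI impI direct_sum_fd projectiveD[OF P] projectiveD[OF Q])
 fix L Y g f assume LY: "L \<in> modules A" "Y \<in> modules A"
  and *: "mhom L Y g \<and> g ` $L = $Y \<and> mhom (direct_sum P Q) Y f"
 interpret L: amod A L by (rule modules_amod[OF LY(1)])
 interpret P: amod A P by (rule amodI[OF projectiveD[OF P]])
 interpret Q: amod A Q by (rule amodI[OF projectiveD[OF Q]])
 have f: "mhom (direct_sum P Q) Y f" using * by blast
 obtain h where h: "mhom P L h" "\<And>x. x \<in> $P ==> g (h x) = f (x, \<zero>[Q])"
  using proj_lift[OF P modulesD[OF LY(1)] modulesD[OF LY(2)] _ _
   module_hom_comp[OF hom_inl[OF projectiveD[OF Q]] f], of g] * by blast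
 obtain k where k: "mhom Q L k" "\<And>x. x \<in> $Q ==> g (k x) = f (\<zero>[P], x)"
  using proj_lift[OF Q modulesD[OF LY(1)] modulesD[OF LY(2)] _ _
   module_hom_comp[OF hom_inr[OF projectiveD[OF P]] f], of g] * by blast
 have "g (h (fst z) +[L] k (snd z)) = f z" if z: "z \<in> $(direct_sum P Q)" for z
 proof -
  obtain x y where z: "z = (x, y)" "x \<in> $P" "y \<in> $Q" using z by auto
  have "f z = f (x, \<zero>[Q]) +[Y] f (\<zero>[P], y)" using module_homD(2)[OF f, of "(x, \<zero>[Q])" "(\<zero>[P], y)"] z by simp
  then show ?thesis using z h k module_homD(1)[OF h(1)] module_homD(1)[OF k(1)] * module_homD(2)[of L Y g] by simp
 qed
 moreover have "mhom (direct_sum P Q) L (\<lambda>z. h (fst z) +[L] k (snd z))"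
  by (rule hom_add[OF modulesD[OF LY(1)] module_hom_comp[OF hom_fst h(1)] module_hom_comp[OF hom_snd k(1)]])
 ultimately show "\<exists>h. mhom (direct_sum P Q) L h \<and> (\<forall>x\<in>$(direct_sum P Q). g (h x) = f x)" by blast
qed

section \<open>The regular module and principal right ideals\<close>

lemma regular_simps [simp]:
 "$(regular) = $A" "\<zero>[regular] = \<zero>"
 "x +[regular] y = x \<oplus> y" "x *[regular] a = x \<otimes> a" by (simp_all add: regular_module_def)

lemma regular_fd: "fdm (regular)"
proof (rule fd_moduleI)
 show "abelian_group (regular)"
 proof (rule abelian_groupI, goal_cases)
  case (6 x) then show ?case by (auto intro!: bexI[of _ "\<ominus> x"] simp: A_l_neg)
 qed (auto simp: A_a_ac)
 obtain S where S: "finite S" "S \<subseteq> $A" "\<forall>x\<in>$A. \<exists>c. x = finsum A (\<lambda>s. c s \<odot> s) S"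
  using fd_algebra.finite_dim[OF fd_algebra_axioms] by blast
 have "generates (regular) S" unfolding generates_def
 proof (intro conjI allI impI)
  fix U assume "subspace (regular) U \<and> S \<subseteq> U"
  then have U: "U \<subseteq> $A" "\<zero> \<in> U" "\<And>x y. x \<in> U ==> y \<in> U ==> x \<oplus> y \<in> U"
    "\<And>c x. x \<in> U ==> c \<odot> x \<in> U" "S \<subseteq> U"
   by (auto simp: subspace_def sc_def scalar_unit_right subset_iff)
  have "finsum A (\<lambda>s. c s \<odot> s) F \<in> U" if "finite F" "F \<subseteq> S" for c F using that
  proof (induction F)
   case (insert x F)
   then show ?case using U S(2) by (subst abelian_monoid.finsum_insert[OF A_monoid]) (auto simp: Pi_iff subset_iff)
  qed (use U in auto)
  then have "x \<in> U" if "x \<in> $A" for x using S(1,3) that by (metis order_refl)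
  then show "U = $(regular)" using U(1) by auto
 qed (use S in auto)
 then show "\<exists>S. generates (regular) S" by blast
qed (auto simp: A_l_distr A_r_distr A_assoc)

lemma regular_projective: "projective (regular)" unfolding projective_module_def
proof (intro conjI ballI allI impI regular_fd)
 fix L Y g f assume LY: "L \<in> modules A" "Y \<in> modules A"
  and *: "mhom L Y g \<and> g ` $L = $Y \<and> mhom (regular) Y f"
 interpret L: amod A L by (rule modules_amod[OF LY(1)])
 have f: "mhom (regular) Y f" and g: "mhom L Y g" using * by auto
 have "f \<one> \<in> $Y" using module_homD(1)[OF f, of \<one>] by simp
 then obtain l where l: "l \<in> $L" "g l = f \<one>" using * by (metis imageE)
 have "mhom (regular) L (\<lambda>x. l *[L] x)" using l by (intro module_homI) (auto simp: L.ract_add_right L.ract_mult)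
 moreover have "g (l *[L] x) = f x" if "x \<in> $A" for x using module_homD(3)[OF f, of \<one> x] that l module_homD(3)[OF g] by simp
 ultimately show "\<exists>h. mhom (regular) L h \<and> (\<forall>x\<in>$(regular). g (h x) = f x)" by auto
qed

lemma idempotent_carrier: "$(idempotent_module A u) = {u \<otimes> a |a. a \<in> $A}" by (simp add: idempotent_module_def)

lemma idempotent_simps [simp]:
 "\<zero>[idempotent_module A u] = \<zero>" "x +[idempotent_module A u] y = x \<oplus> y"
 "x *[idempotent_module A u] a = x \<otimes> a" by (simp_all add: idempotent_module_def)

lemma right_ideal_submodule:
 assumes "u \<in> $A" shows "submod {u \<otimes> a |a. a \<in> $A} (regular)"
proof (rule rsubmoduleI)
 show "\<zero>[regular] \<in> {u \<otimes> a |a. a \<in> $A}" using assms by (auto intro!: exI[of _ \<zero>])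
 show "x +[regular] y \<in> {u \<otimes> a |a. a \<in> $A}"
  if "x \<in> {u \<otimes> a |a. a \<in> $A}" "y \<in> {u \<otimes> a |a. a \<in> $A}" for x y
  using that assms by (auto simp: A_r_distr[symmetric])
 show "x *[regular] a \<in> {u \<otimes> a |a. a \<in> $A}" if "x \<in> {u \<otimes> a |a. a \<in> $A}" "a \<in> $A" for x a
  using that assms by (auto simp: A_assoc)
qed (use assms in auto)

lemma idempotent_as_restriction:
 "idempotent_module A u = (regular)\<lparr>carrier := {u \<otimes> a |a. a \<in> $A}\<rparr>" by (simp add: idempotent_module_def)

lemma idempotent_fd: "u \<in> $A ==> fdm (idempotent_module A u)"
 unfolding idempotent_as_restriction by (rule submodule_module[OF regular_fd right_ideal_submodule])

lemma idempotent_mem: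
 assumes "u \<in> $A" "u \<otimes> u = u"
 shows "x \<in> $(idempotent_module A u) \<longleftrightarrow> x \<in> $A \<and> u \<otimes> x = x"
 using assms by (auto simp: idempotent_carrier A_assoc[symmetric]) metis

lemma idempotent_projective:
 assumes u: "u \<in> $A" "u \<otimes> u = u" shows "projective (idempotent_module A u)"
proof (rule projective_retract[OF regular_projective idempotent_fd[OF u(1)]])
 show "mhom (regular) (idempotent_module A u) (\<lambda>x. u \<otimes> x)"
  using u by (intro module_homI) (auto simp: idempotent_carrier A_r_distr A_assoc)
 show "mhom (idempotent_module A u) (regular) (\<lambda>x. x)" using u by (intro module_homI) (auto simp: idempotent_mem)
 show "u \<otimes> x = x" if "x \<in> $(idempotent_module A u)" for x using that u by (simp add: idempotent_mem)
qed

lemma zero_module_ex: obtains Z :: "('k, 'a) umodule" where "Z \<in> modules A" "zero_module Z"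
proof -
 obtain R f g where R: "(R :: ('k, 'a) umodule) \<in> modules A" "mod_iso (regular) R f g" using universe_copy[OF regular_fd] by blast
 interpret R: amod A R by (rule modules_amod[OF R(1)])
 have "R\<lparr>carrier := {\<zero>[R]}\<rparr> \<in> modules A" by (rule submodule_modules[OF R(1) R.submodule_zero])
 moreover have "zero_module (R\<lparr>carrier := {\<zero>[R]}\<rparr>)" by (simp add: zero_module_def)
 ultimately show ?thesis using that by blast
qed

lemma zero_projective:
 assumes Z: "fdm Z" "zero_module Z" shows "projective Z"
proof (rule projective_retract[OF regular_projective Z(1)])
 show "mhom (regular) Z (\<lambda>x. \<zero>[Z])" by (rule module_hom_zero[OF Z(1)])
 show "mhom Z (regular) (\<lambda>x. \<zero>[regular])" by (rule module_hom_zero[OF regular_fd])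
qed (use Z(2) in \<open>auto simp: zero_module_def\<close>)

text \<open>Generators are added one at a time, so that properties of the covering module are controlled
 by their stability under adding a copy of the regular module.\<close>

lemma enough_projectives:
 fixes M :: "('a, 'm) rmodule"
 assumes M: "fdm M"
  and zero: "\<And>Z. Z \<in> modules A ==> zero_module Z ==> \<Phi> Z"
  and step: "\<And>F G. F \<in> modules A ==> \<Phi> F ==> G \<in> modules A ==>
    module_iso A G (direct_sum F (regular)) ==> \<Phi> G"
 obtains F p where "F \<in> modules A" "projective F" "\<Phi> F"
  "mhom F M p" "p ` $F = $M"
proof -
 interpret M: amod A M by (rule amodI[OF M])
 obtain S where S: "finite S" "S \<subseteq> $M" "\<And>U. subspace M U ==> S \<subseteq> U ==> U = $M"
  using M.generates_ex unfolding generates_def by blast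
 have "\<exists>F p. F \<in> modules A \<and> projective F \<and> \<Phi> F \<and> mhom F M p \<and> T \<subseteq> p ` $F"
  if "finite T" "T \<subseteq> $M" for T using that
 proof (induction T)
  case empty
  obtain Z :: "('k, 'a) umodule" where Z: "Z \<in> modules A" "zero_module Z" by (rule zero_module_ex)
  then show ?case using zero_projective[OF modulesD[OF Z(1)] Z(2)] zero module_hom_zero[OF M] by blast
 next
  case (insert s T)
  then obtain F p where F: "F \<in> modules A" "projective F" "\<Phi> F" "mhom F M p" "T \<subseteq> p ` $F" by auto
  interpret F: amod A F by (rule modules_amod[OF F(1)])
  let ?D = "direct_sum F (regular)"
  have D: "fdm ?D" by (rule direct_sum_fd[OF modulesD[OF F(1)] regular_fd])
  obtain G f g where G: "G \<in> modules A" "mod_iso ?D G f g" using universe_copy[OF D] by blast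
  have s: "s \<in> $M" using insert by auto
  have hs: "mhom (regular) M (\<lambda>x. s *[M] x)" using s by (intro module_homI) (auto simp: M.ract_add_right M.ract_mult)
  define q where "q z = p (fst z) +[M] s *[M] (snd z)" for z
  have q: "mhom ?D M q" unfolding q_def by (rule hom_add[OF M module_hom_comp[OF hom_fst F(4)] module_hom_comp[OF hom_snd hs]])
  have "mhom G M (\<lambda>x. q (g x))" by (rule module_hom_comp[OF mod_isoD(2)[OF G(2)] q])
  moreover have "insert s T \<subseteq> (\<lambda>x. q (g x)) ` $G"
  proof
   fix t assume "t \<in> insert s T"
   then have "\<exists>z\<in>$?D. q z = t"
   proof
    assume "t = s"
    then have "q (\<zero>[F], \<one>) = t" using s hom_zero[OF modulesD[OF F(1)] M F(4)] by (simp add: q_def M.ract_one)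
    then show ?thesis by (intro bexI[of _ "(\<zero>[F], \<one>)"]) auto
   next
    assume "t \<in> T"
    then obtain x where x: "x \<in> $F" "t = p x" using F(5) by auto
    then have "q (x, \<zero>) = t" using s module_homD(1)[OF F(4)] by (simp add: q_def)
    then show ?thesis using x by (intro bexI[of _ "(x, \<zero>)"]) auto
   qed
   then obtain z where z: "z \<in> $?D" "q z = t" by blast
   then show "t \<in> (\<lambda>x. q (g x)) ` $G"
    using mod_isoD(3)[OF G(2) z(1)] module_homD(1)[OF mod_isoD(1)[OF G(2)] z(1)] by (intro image_eqI[of _ _ "f z"]) auto
  qed
  moreover have "projective G" by (rule projective_iso[OF projective_direct_sum[OF F(2) regular_projective] modulesD[OF G(1)] G(2)])
  moreover have "\<Phi> G" using step[OF F(1,3) G(1) module_isoI[OF mod_iso_sym[OF G(2)]]] .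
  ultimately show ?case using G(1) by blast
 qed
 from this[OF S(1,2)] obtain F p where F: "F \<in> modules A" "projective F" "\<Phi> F" "mhom F M p" "S \<subseteq> p ` $F" by auto
 interpret F: amod A F by (rule modules_amod[OF F(1)])
 have "subspace M (p ` $F)" by (rule submodule_subspace[OF image_submodule[OF modulesD[OF F(1)] M F(4) F.submodule_carrier]])
 then have "p ` $F = $M" using S(3) F(5) by blast
 then show ?thesis using that F by blast
qed

text \<open>By the annihilator condition \<open>x y \<mapsto> v y\<close> is a homomorphism on the
  right ideal \<open>x A\<close>. It extends to A, and w is the value of the extension at 1. This is
  how injectivity turns into exactness of right multiplications.\<close>

lemma injective_divisible:
 assumes I: "injective I" and v: "v \<in> $I" and x: "x \<in> $A"
  and ann: "\<And>y. y \<in> $A ==> x \<otimes> y = \<zero> ==> v *[I] y = \<zero>[I]"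
 obtains w where "w \<in> $I" "v = w *[I] x"
proof -
 note Ifd = injectiveD[OF I]
 interpret I: amod A I by (rule amodI[OF Ifd])
 let ?R = "regular"
 let ?L = "idempotent_module A x"
 have L: "fdm ?L" by (rule idempotent_fd[OF x])
 have p: "mhom ?R ?L (\<lambda>y. x \<otimes> y)" using x by (intro module_homI) (auto simp: idempotent_carrier A_r_distr A_assoc)
 have ps: "(\<lambda>y. x \<otimes> y) ` $?R = $?L" by (auto simp: idempotent_carrier)
 have f: "mhom ?R I (\<lambda>y. v *[I] y)" using v by (intro module_homI) (auto simp: I.ract_add_right I.ract_mult)
 obtain g where g: "mhom ?L I g" "\<And>y. y \<in> $?R ==> g (x \<otimes> y) = v *[I] y"
  using factor_hom[OF regular_fd L Ifd p ps f] ann by auto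
 have inc: "mhom ?L ?R (\<lambda>x. x)" unfolding idempotent_as_restriction by (rule submodule_inclusion[OF right_ideal_submodule[OF x]])
 obtain h where h: "mhom ?R I h" "\<And>y. y \<in> $?L ==> h y = g y"
  using inj_extend[OF I L regular_fd inc _ g(1)] by (metis inj_on_id2)
 have xL: "x \<in> $?L" using x by (auto simp: idempotent_carrier intro!: exI[of _ \<one>])
 have "v = g (x \<otimes> \<one>)" using g(2)[of \<one>] v by (simp add: I.ract_one)
 also have "\<dots> = h x" using h(2)[OF xL] x by simp
 also have "\<dots> = h \<one> *[I] x" using module_homD(3)[OF h(1), of \<one> x] x by simp
 finally show ?thesis using that module_homD(1)[OF h(1), of \<one>] by simp
qed

text \<open>Both modules are quotients of the regular module by the same annihilator.\<close>

lemma cyclic_iso: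
 assumes M: "fdm M" and N: "fdm N"
  and v: "v \<in> $M" "$M = {v *[M] a |a. a \<in> $A}"
  and w: "w \<in> $N" "$N = {w *[N] a |a. a \<in> $A}"
  and ann: "\<And>a. a \<in> $A ==> v *[M] a = \<zero>[M] \<longleftrightarrow> w *[N] a = \<zero>[N]"
 obtains f g where "mod_iso M N f g" "f v = w"
proof -
 interpret M: amod A M by (rule amodI[OF M])
 interpret N: amod A N by (rule amodI[OF N])
 let ?R = "regular"
 have p: "mhom ?R M (\<lambda>y. v *[M] y)" using v(1) by (intro module_homI) (auto simp: M.ract_add_right M.ract_mult)
 have q: "mhom ?R N (\<lambda>y. w *[N] y)" using w(1) by (intro module_homI) (auto simp: N.ract_add_right N.ract_mult)
 have ps: "(\<lambda>y. v *[M] y) ` $?R = $M" unfolding v(2) by auto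
 have qs: "(\<lambda>y. w *[N] y) ` $?R = $N" unfolding w(2) by auto
 obtain f g where fg: "mod_iso M N f g" "\<And>a. a \<in> $?R ==> f (v *[M] a) = w *[N] a"
  using first_iso[OF regular_fd M N p ps q qs] ann by auto
 have "f v = w" using fg(2)[of \<one>] v(1) w(1) by (simp add: M.ract_one N.ract_one)
 then show ?thesis using that fg(1) by blast
qed

text \<open>The space of linear maps from A to M, on which A acts through the argument. It is right
  adjoint to forgetting the action, which is the source of its injectivity.\<close>

definition coinduced :: "('a, 'm) rmodule \<Rightarrow> ('a, 'a \<Rightarrow> 'm) rmodule" where
 "coinduced M =
   \<lparr>carrier = {f \<in> extensional ($A). (\<forall>x\<in>$A. f x \<in> $M) \<and>
    (\<forall>x\<in>$A. \<forall>y\<in>$A. f (x \<oplus> y) = f x +[M] f y) \<and>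
    (\<forall>c. \<forall>x\<in>$A. f (c \<odot> x) = sc M c (f x))},
   monoid.mult = undefined, one = undefined, ring.zero = (\<lambda>x\<in>$A. \<zero>[M]),
   add = (\<lambda>f g. \<lambda>x\<in>$A. f x +[M] g x), ract = (\<lambda>f a. \<lambda>x\<in>$A. f (a \<otimes> x))\<rparr>"

text \<open>Among the spans of finite sets there is one of greatest rank. Adding a further vector
  cannot enlarge it, so it is the whole space.\<close>

lemma generates_from_rank:
 fixes N :: "('a, 'n) rmodule"
 assumes z: "\<zero>[N] \<in> $N" and cl: "subspace N ($N)"
  and r: "\<And>U V. subspace N U ==> subspace N V ==> U \<subset> V ==> r U < (r V::nat)"
 shows "\<exists>S. generates N S"
proof -
 define span where "span S = \<Inter>{U. subspace N U \<and> S \<subseteq> U}" for S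
 have sp: "subspace N (span S)" "S \<subseteq> span S" if "S \<subseteq> $N" for S
 proof -
  show "subspace N (span S)"
  proof (rule subspaceI)
   show "span S \<subseteq> $N" using cl that unfolding span_def by blast
   show "\<zero>[N] \<in> span S" unfolding span_def using subspaceD(2) by blast
   show "x +[N] y \<in> span S" if "x \<in> span S" "y \<in> span S" for x y using that unfolding span_def by (auto intro: subspaceD(3))
   show "sc N c x \<in> span S" if "x \<in> span S" for c x using that unfolding span_def by (auto intro: subspaceD(4))
  qed
 qed (auto simp: span_def)
 have le: "r U \<le> r ($N)" if "subspace N U" for U
  using r[OF that cl] subspaceD(1)[OF that] by (cases "U = $N") (auto intro: less_imp_le)
 have "\<exists>S. (finite S \<and> S \<subseteq> $N) \<and> (\<forall>T. finite T \<and> T \<subseteq> $N \<longrightarrow> r (span T) \<le> r (span S))"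
 proof (rule ex_has_greatest_nat[of "\<lambda>S. finite S \<and> S \<subseteq> $N" "{}" _ "Suc (r ($N))"])
  show "\<forall>T. finite T \<and> T \<subseteq> $N \<longrightarrow> r (span T) < Suc (r ($N))"
   using sp(1) le by (simp add: less_Suc_eq_le)
 qed simp
 then obtain S where S: "finite S" "S \<subseteq> $N"
  and max: "\<And>T. finite T ==> T \<subseteq> $N ==> r (span T) \<le> r (span S)" by blast
 have "generates N S" unfolding generates_def
 proof (intro conjI allI impI S)
  fix U assume U: "subspace N U \<and> S \<subseteq> U"
  have "x \<in> U" if x: "x \<in> $N" for x
  proof -
   have i: "insert x S \<subseteq> $N" using x S by auto
   have "span S \<subseteq> span (insert x S)" by (auto simp: span_def)
   moreover have "r (span (insert x S)) \<le> r (span S)" using max[OF _ i] S by simp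
   ultimately have "span S = span (insert x S)" using r[OF sp(1)[OF S(2)] sp(1)[OF i]] by (metis leD psubsetI)
   then have "x \<in> span S" using sp(2)[OF i] by auto
   then show ?thesis using U by (auto simp: span_def)
  qed
  then show "U = $N" using U by (auto dest: subspaceD)
 qed
 then show ?thesis by blast
qed

end

section \<open>Finite dimension and injectivity of coinduced modules\<close>

context amod
begin

text \<open>A linear map on A is determined by its values on finitely many generators, so evaluation
  embeds the coinduced module linearly into a finite sum of copies of M, along which a rank function
  is pulled back.\<close>

lemma coinduced_fd: "fdm (coinduced M)"
proof (rule fd_moduleI)
 let ?C = "coinduced M"
 have carr: "f \<in> $?C \<longleftrightarrow> f \<in> extensional ($A) \<and> (\<forall>x\<in>$A. f x \<in> $M) \<and>
    (\<forall>x\<in>$A. \<forall>y\<in>$A. f (x \<oplus> y) = f x +[M] f y) \<and>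
    (\<forall>c. \<forall>x\<in>$A. f (c \<odot> x) = sc M c (f x))" for f by (simp add: coinduced_def)
 have ops: "\<zero>[?C] = (\<lambda>x\<in>$A. \<zero>[M])" "f +[?C] g = (\<lambda>x\<in>$A. f x +[M] g x)"
  "f *[?C] a = (\<lambda>x\<in>$A. f (a \<otimes> x))" for f g a by (simp_all add: coinduced_def)
 have eqI: "f = g" if "f \<in> extensional ($A)" "g \<in> extensional ($A)"
  "\<And>x. x \<in> $A ==> f x = g x" for f g :: "'a \<Rightarrow> 'm" using that by (rule extensionalityI)
 have addC: "f +[?C] g \<in> $?C" if "f \<in> $?C" "g \<in> $?C" for f g using that by (auto simp: carr ops M.add_add_swap sc_add)
 have zC: "\<zero>[?C] \<in> $?C" by (auto simp: carr ops)
 have negC: "(\<lambda>x\<in>$A. -[M] f x) \<in> $?C" if "f \<in> $?C" for f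
  using that by (auto simp: carr M.minus_add M.a_comm sc_neg_one[symmetric] sc_sc sc_add)
 have actC: "f *[?C] a \<in> $?C" if "f \<in> $?C" "a \<in> $A" for f a using that by (auto simp: carr ops A_r_distr smult_mult_right)
 show grp: "abelian_group ?C"
 proof (rule abelian_groupI)
  fix f g h assume *: "f \<in> $?C" "g \<in> $?C" "h \<in> $?C"
  then show "(f +[?C] g) +[?C] h = f +[?C] (g +[?C] h)" by (intro eqI) (auto simp: ops carr M.a_assoc)
 next
  fix f g assume *: "f \<in> $?C" "g \<in> $?C"
  then show "f +[?C] g = g +[?C] f" by (intro eqI) (auto simp: ops carr M.a_comm)
 next
  fix f assume f: "f \<in> $?C"
  then show "\<zero>[?C] +[?C] f = f" by (intro eqI) (auto simp: ops carr)
  show "\<exists>g\<in>$?C. g +[?C] f = \<zero>[?C]"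
  proof (rule bexI[OF _ negC[OF f]])
   show "(\<lambda>x\<in>$A. -[M] f x) +[?C] f = \<zero>[?C]" using f by (intro eqI) (auto simp: ops carr M.l_neg)
  qed
 qed (use addC zC in auto)
 show "(f +[?C] g) *[?C] a = f *[?C] a +[?C] g *[?C] a" if "f \<in> $?C" "g \<in> $?C" "a \<in> $A" for f g a
  using that by (intro eqI) (auto simp: ops carr)
 show "f *[?C] (a \<oplus> b) = f *[?C] a +[?C] f *[?C] b" if "f \<in> $?C" "a \<in> $A" "b \<in> $A" for f a b
  using that by (intro eqI) (auto simp: ops carr A_l_distr)
 show "f *[?C] (a \<otimes> b) = (f *[?C] a) *[?C] b" if "f \<in> $?C" "a \<in> $A" "b \<in> $A" for f a b
  using that by (intro eqI) (auto simp: ops carr A_assoc)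
 show "f *[?C] \<one> = f" if "f \<in> $?C" for f using that by (intro eqI) (auto simp: ops carr)
 have scC: "sc ?C c f = (\<lambda>x\<in>$A. sc M c (f x))" if "f \<in> $?C" for c f
  using that by (intro eqI) (auto simp: sc_def[of ?C] ops carr scalar_unit_left)
 have subC: "subspace ?C ($?C)" by (rule subspaceI) (use addC zC actC in \<open>auto simp: sc_def\<close>)
 have fdM: "fdm M" by (rule fd_right_module_axioms)
 \<comment> \<open>Induction on S: each further s adds one copy of M to the target N, and equality
   in that copy is equality of the values at s.\<close>
 have ex: "\<exists>(N::('k, 'a) umodule) g. N \<in> modules A \<and> (\<forall>f\<in>$?C. g f \<in> $N) \<and>
   (\<forall>f\<in>$?C. \<forall>h\<in>$?C. g (f +[?C] h) = g f +[N] g h) \<and>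
   (\<forall>c. \<forall>f\<in>$?C. g (sc ?C c f) = sc N c (g f)) \<and> (\<forall>f\<in>$?C. \<forall>h\<in>$?C. g f = g h \<longrightarrow> (\<forall>s\<in>S. f s = h s))"
  if "finite S" "S \<subseteq> $A" for S using that
 proof (induction S)
  case empty
  obtain Z :: "('k, 'a) umodule" where Z: "Z \<in> modules A" "zero_module Z" by (rule zero_module_ex)
  interpret Z: amod A Z by (rule modules_amod[OF Z(1)])
  show ?case using Z by (intro exI[of _ Z] exI[of _ "\<lambda>_. \<zero>[Z]"]) auto
 next
  case (insert s S)
  then obtain N :: "('k, 'a) umodule" and g where N: "N \<in> modules A" and g: "\<forall>f\<in>$?C. g f \<in> $N"
   "\<forall>f\<in>$?C. \<forall>h\<in>$?C. g (f +[?C] h) = g f +[N] g h"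
   "\<forall>c. \<forall>f\<in>$?C. g (sc ?C c f) = sc N c (g f)"
   "\<forall>f\<in>$?C. \<forall>h\<in>$?C. g f = g h \<longrightarrow> (\<forall>s\<in>S. f s = h s)" by auto
  have s: "s \<in> $A" using insert by auto
  obtain N' u u' where N': "(N' :: ('k, 'a) umodule) \<in> modules A" "mod_iso (direct_sum N M) N' u u'"
   using universe_copy[OF direct_sum_fd[OF modulesD[OF N] fdM]] by blast
  note h = module_homD[OF mod_isoD(1)[OF N'(2)]]
  define g' where "g' f = u (g f, f s)" for f
  have c: "(g f, f s) \<in> $(direct_sum N M)" if "f \<in> $?C" for f using that g s by (auto simp: carr)
  show ?case
  proof (intro exI[of _ N'] exI[of _ g'] conjI ballI allI impI N')
   fix f assume f: "f \<in> $?C"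
   show "g' f \<in> $N'" unfolding g'_def by (rule h(1)[OF c[OF f]])
   show "g' (sc ?C a f) = sc N' a (g' f)" for a
    unfolding g'_def h(4)[OF c[OF f], symmetric] sc_direct_sum using f g(3) s by (simp add: scC)
   fix k assume k: "k \<in> $?C"
   show "g' (f +[?C] k) = g' f +[N'] g' k" unfolding g'_def h(2)[OF c[OF f] c[OF k], symmetric] using f k g(2) s by (simp add: ops)
   fix t assume e: "g' f = g' k" and t: "t \<in> insert s S"
   have "(g f, f s) = (g k, k s)" using e c[OF f] c[OF k] mod_isoD(6)[OF N'(2)] unfolding g'_def by (meson inj_onD)
   then show "f t = k t" using t g(4) f k by auto
  qed
 qed
 obtain S where S: "generates (regular) S" using amod.generates_ex[OF amodI[OF regular_fd]] by blast
 then have S': "finite S" "S \<subseteq> $A" by (auto simp: generates_def)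
 obtain N :: "('k, 'a) umodule" and g where Ng: "N \<in> modules A \<and> (\<forall>f\<in>$?C. g f \<in> $N) \<and>
   (\<forall>f\<in>$?C. \<forall>h\<in>$?C. g (f +[?C] h) = g f +[N] g h) \<and>
   (\<forall>c. \<forall>f\<in>$?C. g (sc ?C c f) = sc N c (g f)) \<and> (\<forall>f\<in>$?C. \<forall>h\<in>$?C. g f = g h \<longrightarrow> (\<forall>s\<in>S. f s = h s))"
  using ex[OF S'] by (elim exE)
 then have N: "N \<in> modules A" by (rule conjunct1)
 have g: "g f \<in> $N" "h \<in> $?C ==> g (f +[?C] h) = g f +[N] g h"
   "g (sc ?C c f) = sc N c (g f)"
   "h \<in> $?C ==> g f = g h ==> s \<in> S ==> f s = h s" if "f \<in> $?C" for f h c s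
  subgoal using conjunct1[OF conjunct2[OF Ng]] that by (rule bspec)
  subgoal using conjunct1[OF conjunct2[OF conjunct2[OF Ng]]] that by simp
  subgoal using conjunct1[OF conjunct2[OF conjunct2[OF conjunct2[OF Ng]]]] that by simp
  subgoal using conjunct2[OF conjunct2[OF conjunct2[OF conjunct2[OF Ng]]]] that by simp
  done
 interpret N: amod A N by (rule modules_amod[OF N])
 have inj: "inj_on g ($?C)"
 proof (rule inj_onI)
  fix f h assume fh: "f \<in> $?C" "h \<in> $?C" "g f = g h"
  have "subspace (regular) {x \<in> $A. f x = h x}"
  proof (rule subspaceI)
   have "f (0 \<odot> \<zero>) = h (0 \<odot> \<zero>)" using fh(1,2) unfolding carr by (metis abelian_monoid.zero_closed[OF A_monoid] sc_zero)
   then show "\<zero>[regular] \<in> {x \<in> $A. f x = h x}" by simp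
  qed (use fh in \<open>auto simp: carr sc_def[of "regular"] scalar_unit_right\<close>)
  then have "{x \<in> $A. f x = h x} = $A" using S g(4)[OF fh] S'(2) unfolding generates_def by auto
  then show "f = h" using fh by (intro eqI) (auto simp: carr)
 qed
 obtain r where r: "\<And>U V. subspace N U ==> subspace N V ==> U \<subset> V ==> r U < (r V::nat)"
  using N.rank_ex by blast
 have gz: "g \<zero>[?C] = \<zero>[N]"
 proof -
  have "sc ?C 0 \<zero>[?C] = \<zero>[?C]" using zC by (subst scC) (auto simp: ops)
  then show ?thesis using g(3)[OF zC, of 0] g(1)[OF zC] by simp
 qed
 have gsub: "subspace N (g ` U)" if U: "subspace ?C U" for U
 proof (rule subspaceI)
  note u = subspaceD[OF U]
  show "g ` U \<subseteq> $N" using u(1) g(1) by auto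
  show "\<zero>[N] \<in> g ` U" using gz u(2) by (metis image_eqI)
  show "x +[N] y \<in> g ` U" if "x \<in> g ` U" "y \<in> g ` U" for x y using that u(3,5) g(2) by (smt (verit) image_iff)
  show "sc N c x \<in> g ` U" if "x \<in> g ` U" for c x using that u(4,5) g(3) by (smt (verit) image_iff)
 qed
 show "\<exists>S. generates ?C S"
 proof (rule generates_from_rank[OF zC subC, of "\<lambda>U. r (g ` U)"])
  fix U V assume UV: "subspace ?C U" "subspace ?C V" "U \<subset> V"
  have "g ` U \<subset> g ` V" using UV(3) inj_on_image_eq_iff[OF inj subspaceD(1)[OF UV(1)] subspaceD(1)[OF UV(2)]] by blast
  then show "r (g ` U) < r (g ` V)" by (intro r gsub UV)
 qed
qed (use fd_right_module_axioms in \<open>auto simp: coinduced_def A_r_distr smult_mult_right\<close>)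

text \<open>A homomorphism into the coinduced module is determined by the linear map
  \<open>f1\<close> that evaluates it at 1. Linear maps extend along a linear retraction
  \<open>\<rho>\<close> of g, and \<open>h y a = f1 (\<rho> (y a))\<close> restores compatibility
  with A.\<close>

lemma coinduced_injective: "injective (coinduced M)" unfolding injective_module_def
proof (intro conjI ballI allI impI coinduced_fd)
 let ?C = "coinduced M"
 have carr: "f \<in> $?C \<longleftrightarrow> f \<in> extensional ($A) \<and> (\<forall>x\<in>$A. f x \<in> $M) \<and>
    (\<forall>x\<in>$A. \<forall>y\<in>$A. f (x \<oplus> y) = f x +[M] f y) \<and>
    (\<forall>c. \<forall>x\<in>$A. f (c \<odot> x) = sc M c (f x))" for f by (simp add: coinduced_def)
 have ops: "f +[?C] g = (\<lambda>x\<in>$A. f x +[M] g x)" "f *[?C] a = (\<lambda>x\<in>$A. f (a \<otimes> x))" for f g a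
  by (simp_all add: coinduced_def)
 fix L Y g f assume L: "L \<in> modules A" and Y: "Y \<in> modules A"
  and *: "mhom L Y g \<and> inj_on g ($L) \<and> mhom L ?C f"
 interpret L: amod A L by (rule modules_amod[OF L])
 interpret Y: amod A Y by (rule modules_amod[OF Y])
 have g: "mhom L Y g" "inj_on g ($L)" and f: "mhom L ?C f" using * by auto
 note gh = module_homD[OF g(1)] and fh = module_homD[OF f]
 let ?U = "g ` $L"
 have U: "subspace Y ?U" by (rule submodule_subspace[OF image_submodule[OF modulesD[OF L] modulesD[OF Y] g(1) L.submodule_carrier]])
 obtain p where p: "Y.linear_to ?U p" "\<And>x. x \<in> ?U ==> p x = x" using Y.projection_ex[OF U] by blast
 note p' = p(1)[unfolded Y.linear_to_def]
 define q where "q = inv_into ($L) g"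
 have q: "q (g l) = l" if "l \<in> $L" for l using that g(2) by (simp add: q_def)
 define \<rho> where "\<rho> y = q (p y)" for y
 have \<rho>g: "\<rho> (g l) = l" if "l \<in> $L" for l using that q p(2) by (simp add: \<rho>_def)
 have pL: "\<exists>l\<in>$L. p y = g l" if "y \<in> $Y" for y using p' that by blast
 have \<rho>c: "\<rho> y \<in> $L" if "y \<in> $Y" for y using pL[OF that] q by (auto simp: \<rho>_def)
 have \<rho>a: "\<rho> (y +[Y] z) = \<rho> y +[L] \<rho> z" if yz: "y \<in> $Y" "z \<in> $Y" for y z
 proof -
  obtain l where l: "l \<in> $L" "p y = g l" using pL[OF yz(1)] by blast
  obtain m where m: "m \<in> $L" "p z = g m" using pL[OF yz(2)] by blast
  note lm = l m
  have "p (y +[Y] z) = g (l +[L] m)" using p' yz lm gh(2) by simp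
  then show ?thesis using lm q by (simp add: \<rho>_def)
 qed
 have \<rho>s: "\<rho> (sc Y c y) = sc L c (\<rho> y)" if yz: "y \<in> $Y" for y c
 proof -
  obtain l where lm: "l \<in> $L" "p y = g l" using pL[OF yz] by blast
  have "p (sc Y c y) = g (sc L c l)" using p' yz lm gh(4) by simp
  then show ?thesis using lm q by (simp add: \<rho>_def)
 qed
 define f1 where "f1 l = f l \<one>" for l
 have fC: "f l \<in> $?C" if "l \<in> $L" for l using fh(1)[OF that] .
 have f1c: "f1 l \<in> $M" if "l \<in> $L" for l using fC[OF that] by (simp add: f1_def carr)
 have f1a: "f1 (l +[L] m) = f1 l +[M] f1 m" if "l \<in> $L" "m \<in> $L" for l m using that by (simp add: f1_def fh(2) ops)
 have f1r: "f1 (l *[L] a) = f l a" if "l \<in> $L" "a \<in> $A" for l a using that by (simp add: f1_def fh(3) ops)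
 have f1s: "f1 (sc L c l) = sc M c (f1 l)" if "l \<in> $L" for l c
  using f1r[OF that, of "c \<odot> \<one>"] fC[OF that] by (simp add: sc_def[of L] f1_def carr)
 define h where "h y = (\<lambda>a\<in>$A. f1 (\<rho> (y *[Y] a)))" for y
 have hC: "h y \<in> $?C" if "y \<in> $Y" for y using that unfolding carr h_def
  by (auto simp: Y.ract_add_right \<rho>a \<rho>c f1a f1c Y.act_scalar \<rho>s f1s)
 have "mhom Y ?C h"
 proof (rule module_homI)
  fix y assume y: "y \<in> $Y"
  show "h y \<in> $?C" by (rule hC[OF y])
  show "h (y +[Y] z) = h y +[?C] h z" if "z \<in> $Y" for z
   using y that by (auto simp: h_def ops Y.ract_add_left \<rho>a \<rho>c f1a intro!: restrict_ext)
  show "h (y *[Y] a) = h y *[?C] a" if "a \<in> $A" for a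
   using y that by (auto simp: h_def ops Y.ract_mult[symmetric] intro!: restrict_ext)
 qed
 moreover have "h (g l) = f l" if l: "l \<in> $L" for l
 proof (rule extensionalityI)
  show "h (g l) \<in> extensional ($A)" by (simp add: h_def)
  show "f l \<in> extensional ($A)" using fC[OF l] by (simp add: carr)
  fix a assume a: "a \<in> $A"
  have "\<rho> (g l *[Y] a) = l *[L] a" using \<rho>g[of "l *[L] a"] l a gh(3) by simp
  then show "h (g l) a = f l a" using a f1r[OF l a] by (simp add: h_def)
 qed
 ultimately show "\<exists>h. mhom Y ?C h \<and> (\<forall>x\<in>$L. h (g x) = f x)" by blast
qed

lemma coinduced_embedding:
 "mhom M (coinduced M) (\<lambda>v. \<lambda>a\<in>$A. v *[M] a)"
 "inj_on (\<lambda>v. \<lambda>a\<in>$A. v *[M] a) ($M)"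
proof -
 show "mhom M (coinduced M) (\<lambda>v. \<lambda>a\<in>$A. v *[M] a)"
 proof (rule module_homI)
  fix v assume v: "v \<in> $M"
  show "(\<lambda>a\<in>$A. v *[M] a) \<in> $(coinduced M)" using v by (auto simp: coinduced_def ract_add_right act_scalar)
  show "(\<lambda>a\<in>$A. (v +[M] w) *[M] a) =
    (\<lambda>a\<in>$A. v *[M] a) +[coinduced M] (\<lambda>a\<in>$A. w *[M] a)" if "w \<in> $M" for w
   using v that by (auto simp: coinduced_def ract_add_left intro!: restrict_ext)
  show "(\<lambda>b\<in>$A. (v *[M] a) *[M] b) = (\<lambda>b\<in>$A. v *[M] b) *[coinduced M] a" if "a \<in> $A" for a
   using v that by (auto simp: coinduced_def ract_mult intro!: restrict_ext)
 qed
 show "inj_on (\<lambda>v. \<lambda>a\<in>$A. v *[M] a) ($M)"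
 proof (rule inj_onI)
  fix v w assume vw: "v \<in> $M" "w \<in> $M"
   and e: "(\<lambda>a\<in>$A. v *[M] a) = (\<lambda>a\<in>$A. w *[M] a)"
  have "v *[M] \<one> = w *[M] \<one>" using fun_cong[OF e, of \<one>] by simp
  then show "v = w" using vw by (simp add: ract_one)
 qed
qed

end

section \<open>Injective hulls and resolutions\<close>

context fd_algebra
begin

section \<open>Short exact sequences, injective hulls and resolutions\<close>

definition ses ::
 "('a, 'l) rmodule \<Rightarrow> ('a, 'm) rmodule \<Rightarrow> ('a, 'n) rmodule \<Rightarrow> ('l \<Rightarrow> 'm) \<Rightarrow> ('m \<Rightarrow> 'n) \<Rightarrow> bool" where
 "ses L M N f g \<longleftrightarrow> fdm L \<and> fdm M \<and> fdm N \<and>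
   mhom L M f \<and> mhom M N g \<and> inj_on f ($L) \<and> g ` $M = $N \<and>
   f ` $L = {x \<in> $M. g x = \<zero>[N]}"

lemma sesD:
 assumes "ses L M N f g"
 shows "fdm L" "fdm M" "fdm N"
  "mhom L M f" "mhom M N g" "inj_on f ($L)" "g ` $M = $N"
  "f ` $L = {x \<in> $M. g x = \<zero>[N]}" using assms by (auto simp: ses_def)

lemma ses_kernel:
 assumes M: "fdm M" and N: "fdm N"
  and g: "mhom M N g" "g ` $M = $N"
 shows "ses (M\<lparr>carrier := {x \<in> $M. g x = \<zero>[N]}\<rparr>) M N (\<lambda>x. x) g"
 unfolding ses_def using submodule_module[OF M kernel_submodule[OF M N g(1)]] M N g
  submodule_inclusion[OF kernel_submodule[OF M N g(1)]] by auto

lemma cokernel_ex: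
 fixes M :: "('a, 'm) rmodule"
 assumes M: "fdm M" and U: "submod U M"
 obtains Q p where "Q \<in> modules A" "mhom M Q p" "p ` $M = $Q"
  "U = {x \<in> $M. p x = \<zero>[Q]}"
proof -
 obtain Q f g where Q: "(Q :: ('k, 'a) umodule) \<in> modules A" "mod_iso (quotient_module M U) Q f g"
  using universe_copy[OF quotient_fd[OF M U]] by blast
 have qf: "fdm (quotient_module M U)" by (rule quotient_fd[OF M U])
 let ?p = "\<lambda>x. f (U +>\<^bsub>M\<^esub> x)"
 have "mhom M Q ?p" by (rule module_hom_comp[OF quotient_hom[OF M U] mod_isoD(1)[OF Q(2)]])
 moreover have "?p ` $M = $Q" using mod_isoD(5)[OF Q(2)] by (simp add: quotient_carrier image_image)
 moreover have "?p x = \<zero>[Q] \<longleftrightarrow> x \<in> U" if x: "x \<in> $M" for x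
 proof -
  have c: "U +>\<^bsub>M\<^esub> x \<in> $(quotient_module M U)" using x by (simp add: quotient_carrier)
  have z: "f U = \<zero>[Q]" using hom_zero[OF qf modulesD[OF Q(1)] mod_isoD(1)[OF Q(2)]] by (simp add: quotient_zero)
  have zc: "U \<in> $(quotient_module M U)"
   using abelian_monoid.zero_closed[OF abelian_group.axioms(1)[OF fd_right_module.axioms(2)[OF qf]]] by (simp add: quotient_zero)
  have "?p x = \<zero>[Q] \<longleftrightarrow> U +>\<^bsub>M\<^esub> x = U" using z mod_isoD(6)[OF Q(2)] c zc by (metis inj_onD)
  then show ?thesis using coset_zero_iff[OF M U x] by simp
 qed
 then have "U = {x \<in> $M. ?p x = \<zero>[Q]}" using rsubmoduleD(1)[OF U] by blast
 ultimately show ?thesis using that Q(1) by blast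
qed

text \<open>A maximal essential extension inside an injective module splits off, by a complement that is
 maximal among those meeting it trivially.\<close>

lemma injective_hull_ex:
 fixes M :: "('a, 'm) rmodule"
 assumes M: "fdm M"
 obtains I j where "I \<in> modules A" "injective I" "mhom M I j" "inj_on j ($M)"
  "essential_submodule A (j ` $M) I"
proof -
 interpret M: amod A M by (rule amodI[OF M])
 obtain E c c' where E: "(E :: ('k, 'a) umodule) \<in> modules A" "mod_iso (coinduced M) E c c'"
  using universe_copy[OF M.coinduced_fd] by blast
 note Efd = modulesD[OF E(1)]
 interpret E: amod A E by (rule amodI[OF Efd])
 have Einj: "injective E" by (rule injective_iso[OF M.coinduced_injective Efd E(2)])
 define j where "j v = c (\<lambda>a\<in>$A. v *[M] a)" for v
 have j: "mhom M E j" unfolding j_def by (rule module_hom_comp[OF M.coinduced_embedding(1) mod_isoD(1)[OF E(2)]])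
 have j_inj: "inj_on j ($M)" using comp_inj_on[OF M.coinduced_embedding(2), of c] inj_on_subset[OF mod_isoD(6)[OF E(2)]]
   module_homD(1)[OF M.coinduced_embedding(1)] by (simp add: j_def[abs_def] o_def image_subset_iff)
 define J where "J = j ` $M"
 have J: "submod J E" unfolding J_def by (rule image_submodule[OF M Efd j M.submodule_carrier])
 define P where "P U \<longleftrightarrow> submod U E \<and> essential_submodule A J (E |. U)" for U
 have "P J" unfolding P_def essential_submodule_def using J submodule_restrict[OF J] by (auto simp: rsubmodule_def)
 then obtain U where U: "P U" and Umax: "\<And>V. P V ==> U \<subseteq> V ==> V = U"
  using E.maximal_subspace[of P] submodule_subspace unfolding P_def by metis
 have Us: "submod U E" and Ue: "essential_submodule A J (E |. U)" using U by (auto simp: P_def)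
 have JU: "J \<subseteq> U" using Ue by (auto simp: essential_submodule_def rsubmodule_def)
 have Jess: "V = {\<zero>[E]}" if "submod V E" "V \<subseteq> U" "J \<inter> V = {\<zero>[E]}" for V
  using Ue submodule_restrict[OF that(1,2)] that(3) unfolding essential_submodule_def by simp
 have "submod {\<zero>[E]} E \<and> U \<inter> {\<zero>[E]} = {\<zero>[E]}" using E.submodule_zero rsubmoduleD(2)[OF Us] by blast
 then obtain V where V: "submod V E" "U \<inter> V = {\<zero>[E]}"
  and Vmax: "\<And>W. submod W E ==> U \<inter> W = {\<zero>[E]} ==> V \<subseteq> W ==> W = V"
  using E.maximal_subspace[of "\<lambda>V. submod V E \<and> U \<inter> V = {\<zero>[E]}" "{\<zero>[E]}"] submodule_subspace by metis
 obtain Q p where Q: "Q \<in> modules A" and p: "mhom E Q p" "p ` $E = $Q"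
  and ker: "V = {x \<in> $E. p x = \<zero>[Q]}" using cokernel_ex[OF Efd V(1)] by blast
 note Qfd = modulesD[OF Q]
 interpret Q: amod A Q by (rule amodI[OF Qfd])
 let ?U = "(E |. U)"
 have Ufd: "fdm ?U" by (rule submodule_module[OF Efd Us])
 have inc: "mhom ?U E (\<lambda>x. x)" by (rule submodule_inclusion[OF Us])
 have pU: "mhom ?U Q p" by (rule hom_restrict_dom[OF p(1) rsubmoduleD(1)[OF Us]])
 have pz: "x = \<zero>[E]" if "x \<in> U" "p x = \<zero>[Q]" for x
 proof -
  have "x \<in> U \<inter> V" using that ker rsubmoduleD(5)[OF Us] by blast
  then show ?thesis using V(2) by simp
 qed
 have pinj: "inj_on p ($?U)" by (rule hom_inj[OF Ufd Qfd pU]) (use pz in auto)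
 obtain h where h: "mhom Q E h" and hp: "\<And>x. x \<in> U ==> h (p x) = x"
  using inj_extend[OF Einj Ufd Qfd pU pinj inc] by auto
 \<comment> \<open>Maximality of V among the submodules that meet U trivially makes the image of U
   essential in the quotient Q.\<close>
 have comp: "W = {\<zero>[Q]}" if W: "submod W Q" "\<And>u. u \<in> U ==> p u \<in> W ==> u = \<zero>[E]" for W
 proof -
  let ?W = "{x \<in> $E. p x \<in> W}"
  have W': "submod ?W E" by (rule preimage_submodule[OF Efd Qfd p(1) W(1)])
  have "V \<subseteq> ?W" unfolding ker using rsubmoduleD(2)[OF W(1)] by auto
  moreover have "U \<inter> ?W = {\<zero>[E]}" using W(2) rsubmoduleD(2)[OF Us] rsubmoduleD(2)[OF W'] by blast
  ultimately have "?W = V" using Vmax[OF W'] by blast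
  then have "w = \<zero>[Q]" if "w \<in> W" for w
   using that p(2) rsubmoduleD(1)[OF W(1)] unfolding ker by (smt (verit, best) imageE mem_Collect_eq subset_iff)
  then show ?thesis using rsubmoduleD(2)[OF W(1)] by blast
 qed
 have hker: "{x \<in> $Q. h x = \<zero>[E]} = {\<zero>[Q]}" by (rule comp[OF kernel_submodule[OF Qfd Efd h]]) (use hp in auto)
 have hinj: "inj_on h ($Q)" by (rule hom_inj[OF Qfd Efd h]) (use hker in blast)
 define R where "R = h ` $Q"
 have R: "submod R E" unfolding R_def by (rule image_submodule[OF Qfd Efd h Q.submodule_carrier])
 have UR: "U \<subseteq> R"
 proof
  fix u assume u: "u \<in> U"
  then have "p u \<in> $Q" using module_homD(1)[OF p(1)] rsubmoduleD(5)[OF Us] by blast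
  then show "u \<in> R" unfolding R_def using hp[OF u] by (metis image_eqI)
 qed
 \<comment> \<open>Since Q is essential over the image of U and h embeds Q into E, the image R is an
   essential extension of J that contains U. Maximality gives \<open>R = U\<close>, so
   \<open>x \<mapsto> h (p x)\<close> is a retraction of E onto U.\<close>
 have "P R" unfolding P_def essential_submodule_def
 proof (intro conjI allI impI R submodule_restrict[OF J])
  show "J \<subseteq> R" using JU UR by blast
  fix T assume T: "submod T (E |. R) \<and> J \<inter> T = {\<zero>[(E |. R)]}"
  then have T': "submod T E" "J \<inter> T = {\<zero>[E]}" "T \<subseteq> R" using submodule_trans[OF R] by (auto simp: rsubmodule_def)
  have UT: "U \<inter> T = {\<zero>[E]}"
  proof (rule Jess)
   show "submod (U \<inter> T) E" using Us T'(1) unfolding rsubmodule_def by blast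
   show "J \<inter> (U \<inter> T) = {\<zero>[E]}" using T'(2) JU by blast
  qed blast
  have hT: "{x \<in> $Q. h x \<in> T} = {\<zero>[Q]}"
  proof (rule comp[OF preimage_submodule[OF Qfd Efd h T'(1)]])
   fix u assume "u \<in> U" "p u \<in> {x \<in> $Q. h x \<in> T}"
   then have "u \<in> U \<inter> T" using hp by auto
   then show "u = \<zero>[E]" using UT by blast
  qed
  have "x = \<zero>[E]" if x: "x \<in> T" for x
  proof -
   obtain y where y: "y \<in> $Q" "x = h y" using x T'(3) unfolding R_def by blast
   then have "y = \<zero>[Q]" using hT x by blast
   then show ?thesis using y hom_zero[OF Qfd Efd h] by simp
  qed
  then have "T \<subseteq> {\<zero>[E]}" by blast
  then have "T = {\<zero>[E]}" using rsubmoduleD(2)[OF T'(1)] by blast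
  then show "T = {\<zero>[(E |. R)]}" by simp
 qed
 then have RU: "R = U" using Umax UR by blast
 have "injective ?U"
 proof (rule injective_retract[OF Einj Ufd _ inc])
  show "mhom E ?U (\<lambda>x. h (p x))"
  proof (rule hom_restrict[OF module_hom_comp[OF p(1) h]])
   fix x assume "x \<in> $E"
   then show "h (p x) \<in> U" using module_homD(1)[OF p(1)] RU unfolding R_def by blast
  qed
 qed (use hp in simp)
 moreover have "?U \<in> modules A" by (rule submodule_modules[OF E(1) Us])
 moreover have "mhom M ?U j" by (rule hom_restrict[OF j]) (use JU J_def in blast)
 ultimately show ?thesis using that[of ?U j] j_inj Ue J_def by blast
qed

text \<open>All choices of one step of a resolution in a single tuple, so that one choice function
  can be iterated.\<close>

definition hull_data ::
 "('k, 'a) umodule \<Rightarrow> (('k, 'a) umodule \<times> ((nat \<Rightarrow> 'k) \<Rightarrow> (nat \<Rightarrow> 'k)) \<times> ('k, 'a) umodule \<times> ((nat \<Rightarrow> 'k) \<Rightarrow> (nat \<Rightarrow> 'k))) \<Rightarrow> bool" where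
 "hull_data N = (\<lambda>(I, j, C, q). I \<in> modules A \<and> injective I \<and> C \<in> modules A \<and> ses N I C j q \<and>
   essential_submodule A (j ` $N) I)"

lemma hull_data_ex:
 assumes N: "N \<in> modules A" shows "\<exists>x. hull_data N x"
proof -
 obtain I j where I: "I \<in> modules A" "injective I" "mhom N I j" "inj_on j ($N)"
  "essential_submodule A (j ` $N) I" by (rule injective_hull_ex[OF modulesD[OF N]])
 interpret N: amod A N by (rule modules_amod[OF N])
 have s: "submod (j ` $N) I" by (rule image_submodule[OF modulesD[OF N] modulesD[OF I(1)] I(3) N.submodule_carrier])
 obtain C q where C: "C \<in> modules A" "mhom I C q" "q ` $I = $C"
  "j ` $N = {x \<in> $I. q x = \<zero>[C]}" using cokernel_ex[OF modulesD[OF I(1)] s] by blast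
 have "hull_data N (I, j, C, q)" using I C N by (auto simp: hull_data_def ses_def modulesD)
 then show ?thesis by blast
qed

text \<open>\<open>N k\<close> is the k-th cosyzygy and \<open>I k\<close> its injective hull; a
  differential is the projection to the next cosyzygy followed by its embedding. The isomorphism of
  M with its copy is absorbed into the first embedding.\<close>

lemma minimal_injective_resolution_ex:
 fixes M :: "('a, 'm) rmodule"
 assumes M: "fdm M"
 shows "\<exists>I j d. minimal_injective_resolution A M I j d"
proof -
 obtain M' f g where M': "(M' :: ('k, 'a) umodule) \<in> modules A" "mod_iso M M' f g" using universe_copy[OF M] by blast
 define H where "H N = (SOME x. hull_data N x)" for N
 define N where "N k = ((\<lambda>N. fst (snd (snd (H N)))) ^^ k) M'" for k
 have H: "hull_data T (H T)" if "T \<in> modules A" for T unfolding H_def by (rule someI_ex[OF hull_data_ex[OF that]])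
 define I where "I k = fst (H (N k))" for k
 define j where "j k = fst (snd (H (N k)))" for k
 define q where "q k = snd (snd (snd (H (N k))))" for k
 have N0: "N 0 = M'" and NS: "N (Suc k) = fst (snd (snd (H (N k))))" for k by (auto simp: N_def)
 have *: "N k \<in> modules A \<and> I k \<in> modules A \<and> injective (I k) \<and> ses (N k) (I k) (N (Suc k)) (j k) (q k) \<and>
   essential_submodule A (j k ` $(N k)) (I k) \<and> N (Suc k) \<in> modules A" for k
 proof (induction k)
  case 0
  show ?case using H[of "N 0"] M'(1) NS[of 0] by (auto simp: N0 hull_data_def I_def j_def q_def split: prod.splits)
 next
  case (Suc k)
  then have "N (Suc k) \<in> modules A" by simp
  then show ?case using H[of "N (Suc k)"] NS[of "Suc k"] by (auto simp: hull_data_def I_def j_def q_def split: prod.splits)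
 qed
 define d where "d k = (\<lambda>x. j (Suc k) (q k x))" for k
 have s: "ses (N k) (I k) (N (Suc k)) (j k) (q k)" for k using * by blast
 have dker: "{x \<in> $(I k). d k x = \<zero>[I (Suc k)]} = j k ` $(N k)" for k
 proof -
  have nz: "\<zero>[N (Suc k)] \<in> $(N (Suc k))"
   using abelian_monoid.zero_closed[OF abelian_group.axioms(1)[OF fd_right_module.axioms(2)[OF sesD(1)[OF s[of "Suc k"]]]]] .
  have "d k x = \<zero>[I (Suc k)] \<longleftrightarrow> q k x = \<zero>[N (Suc k)]" if "x \<in> $(I k)" for x
   using hom_zero[OF sesD(1,2,4)[OF s[of "Suc k"]]] sesD(6)[OF s[of "Suc k"]] nz
    module_homD(1)[OF sesD(5)[OF s[of k]] that] unfolding d_def by (metis inj_onD)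
  then show ?thesis unfolding sesD(8)[OF s] by blast
 qed
 have dim: "d k ` $(I k) = j (Suc k) ` $(N (Suc k))" for k unfolding d_def sesD(7)[OF s, symmetric] by (simp add: image_image)
 have j0: "mhom M (I 0) (\<lambda>x. j 0 (f x))"
  using module_hom_comp[OF mod_isoD(1)[OF M'(2)], of "I 0" "j 0"] sesD(4)[OF s[of 0]] by (simp add: N0)
 have j0i: "(\<lambda>x. j 0 (f x)) ` $M = j 0 ` $(N 0)" unfolding N0 mod_isoD(5)[OF M'(2), symmetric] by (simp add: image_image)
 have "minimal_injective_resolution A M I (\<lambda>x. j 0 (f x)) d"
  unfolding minimal_injective_resolution_def exact_right_resolution_def a_kernel_def'
 proof (intro conjI allI)
  show "inj_on (\<lambda>x. j 0 (f x)) ($M)"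
   using comp_inj_on[OF mod_isoD(6)[OF M'(2)], of "j 0"] mod_isoD(5)[OF M'(2)] sesD(6)[OF s[of 0]] by (simp add: N0 o_def)
  show "(\<lambda>x. j 0 (f x)) ` $M = {x \<in> $(I 0). d 0 x = \<zero>[I 1]}" using j0i dker[of 0] by simp
  show "essential_submodule A ((\<lambda>x. j 0 (f x)) ` $M) (I 0)" using * j0i by simp
  show "mhom (I k) (I (Suc k)) (d k)" for k unfolding d_def by (rule module_hom_comp[OF sesD(5)[OF s] sesD(4)[OF s]])
  show "d k ` $(I k) = {x \<in> $(I (Suc k)). d (Suc k) x = \<zero>[I (Suc (Suc k))]}" for k using dim dker by simp
  show "essential_submodule A (d k ` $(I k)) (I (Suc k))" for k using * dim by simp
 qed (use * j0 in auto)
 then show ?thesis by blast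
qed

text \<open>The tail of a minimal injective resolution is a minimal injective resolution of the
  cosyzygy, so inductions along it only have to understand the first term.\<close>

lemma minimal_resolution_step:
 assumes M: "fdm M" and res: "minimal_injective_resolution A M I j d"
 defines "C \<equiv> (I 1)\<lparr>carrier := d 0 ` $(I 0)\<rparr>"
 shows "C \<in> modules A" "ses M (I 0) C j (d 0)"
  "minimal_injective_resolution A C (\<lambda>i. I (Suc i)) (\<lambda>x. x) (\<lambda>i. d (Suc i))"
proof -
 note r = res[unfolded minimal_injective_resolution_def exact_right_resolution_def a_kernel_def']
 have I: "I i \<in> modules A" for i using r by blast
 interpret I0: amod A "I 0" by (rule modules_amod[OF I])
 have d: "mhom (I i) (I (Suc i)) (d i)" for i using r by blast
 have s: "submod (d 0 ` $(I 0)) (I 1)" using image_submodule[OF modulesD[OF I] modulesD[OF I] d[of 0] I0.submodule_carrier] by simp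
 show C: "C \<in> modules A" unfolding C_def by (rule submodule_modules[OF I s])
 have "mhom (I 0) C (d 0)" unfolding C_def by (rule hom_restrict) (use d[of 0] in auto)
 then show "ses M (I 0) C j (d 0)" using r M C by (auto simp: ses_def modulesD C_def)
 have "mhom C (I 1) (\<lambda>x. x)" unfolding C_def by (rule submodule_inclusion[OF s])
 then show "minimal_injective_resolution A C (\<lambda>i. I (Suc i)) (\<lambda>x. x) (\<lambda>i. d (Suc i))"
  unfolding minimal_injective_resolution_def exact_right_resolution_def a_kernel_def' using r by (auto simp: C_def)
qed

lemma projective_resolution_step:
 assumes M: "fdm M" and res: "proj_res M P p d"
 defines "N \<equiv> (P 0)\<lparr>carrier := {x \<in> $(P 0). p x = \<zero>[M]}\<rparr>"
 shows "N \<in> modules A" "ses N (P 0) M (\<lambda>x. x) p" "projective (P 0)"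
  "proj_res N (\<lambda>i. P (Suc i)) (d 0) (\<lambda>i. d (Suc i))"
proof -
 note r = res[unfolded projective_resolution_def exact_left_resolution_def a_kernel_def']
 have r1: "\<forall>i. P i \<in> modules A" using r by (elim conjE)
 have r2: "\<forall>i. mhom (P (Suc i)) (P i) (d i)" using r by (elim conjE)
 have r3: "d 0 ` $(P 1) = {x \<in> $(P 0). p x = \<zero>[M]}" using r by (elim conjE)
 have r4: "\<forall>i. d (Suc i) ` $(P (Suc (Suc i))) = {x \<in> $(P (Suc i)). d i x = \<zero>[P i]}" using r by (elim conjE)
 have r5: "\<forall>i. projective (P i)" using r by (elim conjE)
 have r6: "p ` $(P 0) = $M" using r by (elim conjE)
 have P: "P i \<in> modules A" for i by (rule r1[rule_format])
 have p: "mhom (P 0) M p" using r by (elim conjE)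
 have s: "submod {x \<in> $(P 0). p x = \<zero>[M]} (P 0)" by (rule kernel_submodule[OF modulesD[OF P] M p])
 show N: "N \<in> modules A" unfolding N_def by (rule submodule_modules[OF P s])
 show "ses N (P 0) M (\<lambda>x. x) p" unfolding N_def by (rule ses_kernel[OF modulesD[OF P] M p]) (rule r6)
 show "projective (P 0)" by (rule r5[rule_format])
 note r' = r1 r2 r3 r4 r5
 have hN: "mhom (P 1) N (d 0)" unfolding N_def
 proof (rule hom_restrict)
  show "mhom (P 1) (P 0) (d 0)" using r2[rule_format, of 0] by simp
  show "d 0 x \<in> {x \<in> $(P 0). p x = \<zero>[M]}" if "x \<in> $(P 1)" for x unfolding r3[symmetric] using that by (rule imageI)
 qed
 have N0: "$N = {x \<in> $(P 0). p x = \<zero>[M]}" "\<zero>[N] = \<zero>[P 0]" by (simp_all add: N_def)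
 show "proj_res N (\<lambda>i. P (Suc i)) (d 0) (\<lambda>i. d (Suc i))"
  unfolding projective_resolution_def exact_left_resolution_def a_kernel_def' N0
 proof (intro conjI allI)
  show "mhom (P (Suc 0)) N (d 0)" using hN by simp
  show "d 0 ` $(P (Suc 0)) = {x \<in> $(P 0). p x = \<zero>[M]}" using r'(3) by simp
  show "d (Suc 0) ` $(P (Suc 1)) = {x \<in> $(P (Suc 0)). d 0 x = \<zero>[P 0]}" using r'(4)[rule_format, of 0] by simp
 qed (rule r'(1,2,4,5)[rule_format])+
qed

lemma projective_resolution_splice:
 assumes s: "ses N F M f g" and F: "F \<in> modules A" "projective F"
  and res: "proj_res N P p d"
 shows "proj_res M (case_nat F P) g (case_nat (\<lambda>x. f (p x)) d)"
proof -
 note r = res[unfolded projective_resolution_def exact_left_resolution_def a_kernel_def']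
 have fz: "f x = \<zero>[F] \<longleftrightarrow> x = \<zero>[N]" if "x \<in> $N" for x
  using that sesD(6)[OF s] hom_zero[OF sesD(1,2,4)[OF s]]
   abelian_monoid.zero_closed[OF abelian_group.axioms(1)[OF fd_right_module.axioms(2)[OF sesD(1)[OF s]]]] by (metis inj_onD)
 have pc: "p x \<in> $N" if "x \<in> $(P 0)" for x using r that by blast
 have P: "P i \<in> modules A" "projective (P i)" "mhom (P (Suc i)) (P i) (d i)" for i using r by auto
 have p: "mhom (P 0) N p" "p ` $(P 0) = $N"
  "d 0 ` $(P 1) = {x \<in> $(P 0). p x = \<zero>[N]}"
  "d (Suc i) ` $(P (Suc (Suc i))) = {x \<in> $(P (Suc i)). d i x = \<zero>[P i]}" for i using r by auto
 show ?thesis unfolding projective_resolution_def exact_left_resolution_def a_kernel_def'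
 proof (intro conjI allI)
  fix i
  show "case_nat F P i \<in> modules A" "projective (case_nat F P i)" using F P by (auto split: nat.splits)
  show "mhom (case_nat F P (Suc i)) (case_nat F P i) (case_nat (\<lambda>x. f (p x)) d i)"
   using P(3) module_hom_comp[OF p(1) sesD(4)[OF s]] by (auto split: nat.splits)
  show "case_nat (\<lambda>x. f (p x)) d (Suc i) ` $(case_nat F P (Suc (Suc i))) =
   {x \<in> $(case_nat F P (Suc i)). case_nat (\<lambda>x. f (p x)) d i x = \<zero>[case_nat F P i]}"
  proof (cases i)
   case 0
   have "{x \<in> $(P 0). f (p x) = \<zero>[F]} = {x \<in> $(P 0). p x = \<zero>[N]}" using fz pc by blast
   then show ?thesis using 0 p(3) by simp
  qed (use p(4) in simp)
 next
  have "(\<lambda>x. f (p x)) ` $(P 0) = f ` $N" unfolding p(2)[symmetric] by (simp add: image_image)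
  then show "case_nat (\<lambda>x. f (p x)) d 0 ` $(case_nat F P 1) = {x \<in> $(case_nat F P 0). g x = \<zero>[M]}"
   using sesD(8)[OF s] by simp
 qed (use sesD[OF s] in auto)
qed

lemma exact_right_splice:
 assumes s: "ses M I0 C f g" and I0: "I0 \<in> modules A"
  and res: "exact_right_resolution A C I j d"
 shows "exact_right_resolution A M (case_nat I0 I) f (case_nat (\<lambda>x. j (g x)) d)"
proof -
 note r = res[unfolded exact_right_resolution_def a_kernel_def']
 have cz: "\<zero>[C] \<in> $C"
  using abelian_monoid.zero_closed[OF abelian_group.axioms(1)[OF fd_right_module.axioms(2)[OF sesD(3)[OF s]]]] .
 have j: "mhom C (I 0) j" "inj_on j ($C)" "j ` $C = {x \<in> $(I 0). d 0 x = \<zero>[I 1]}" and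
  I: "I i \<in> modules A" "mhom (I i) (I (Suc i)) (d i)"
   "d i ` $(I i) = {x \<in> $(I (Suc i)). d (Suc i) x = \<zero>[I (Suc (Suc i))]}" for i using r by auto
 have jz: "j x = \<zero>[I 0] \<longleftrightarrow> x = \<zero>[C]" if "x \<in> $C" for x
  using that j(2) hom_zero[OF sesD(3)[OF s] modulesD[OF I(1)] j(1)] cz by (metis inj_onD)
 show ?thesis unfolding exact_right_resolution_def a_kernel_def'
 proof (intro conjI allI)
  fix i
  show "case_nat I0 I i \<in> modules A" using I0 I by (auto split: nat.splits)
  show "mhom (case_nat I0 I i) (case_nat I0 I (Suc i)) (case_nat (\<lambda>x. j (g x)) d i)"
   using I(2) module_hom_comp[OF sesD(5)[OF s] j(1)] by (auto split: nat.splits)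
  show "case_nat (\<lambda>x. j (g x)) d i ` $(case_nat I0 I i) =
    {x \<in> $(case_nat I0 I (Suc i)). case_nat (\<lambda>x. j (g x)) d (Suc i) x = \<zero>[case_nat I0 I (Suc (Suc i))]}"
  proof (cases i)
   case 0
   have "(\<lambda>x. j (g x)) ` $I0 = j ` $C" unfolding sesD(7)[OF s, symmetric] by (simp add: image_image)
   then show ?thesis using 0 j(3) by simp
  qed (use I(3) in simp)
 next
  have "{x \<in> $I0. j (g x) = \<zero>[I 0]} = {x \<in> $I0. g x = \<zero>[C]}" using jz module_homD(1)[OF sesD(5)[OF s]] by blast
  then show "f ` $M = {x \<in> $(case_nat I0 I 0). case_nat (\<lambda>x. j (g x)) d 0 x = \<zero>[case_nat I0 I 1]}"
   using sesD(8)[OF s] by simp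
 qed (use sesD[OF s] in auto)
qed

lemma ses_iso_left:
 assumes s: "ses L M N f g" and L': "fdm L'" and i: "mod_iso L' L h k"
 shows "ses L' M N (\<lambda>x. f (h x)) g"
proof -
 have "(\<lambda>x. f (h x)) ` $L' = f ` $L" unfolding mod_isoD(5)[OF i, symmetric] by (simp add: image_image)
 moreover have "inj_on (\<lambda>x. f (h x)) ($L')"
  using comp_inj_on[OF mod_isoD(6)[OF i], of f] mod_isoD(5)[OF i] sesD(6)[OF s] by (simp add: o_def)
 ultimately show ?thesis using s L' module_hom_comp[OF mod_isoD(1)[OF i] sesD(4)[OF s]] by (simp add: ses_def)
qed

lemma ses_iso_middle:
 assumes s: "ses L M N f g" and M': "fdm M'" and i: "mod_iso M M' h k"
 shows "ses L M' N (\<lambda>x. h (f x)) (\<lambda>x. g (k x))"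
proof -
 note hk = mod_isoD[OF i] and ki = mod_isoD[OF mod_iso_sym[OF i]]
 have "(\<lambda>x. g (k x)) ` $M' = g ` $M" unfolding ki(5)[symmetric] by (simp add: image_image)
 moreover have "inj_on (\<lambda>x. h (f x)) ($L)"
  using comp_inj_on[OF sesD(6)[OF s], of h] inj_on_subset[OF hk(6)] module_homD(1)[OF sesD(4)[OF s]]
  by (auto simp: o_def image_subset_iff)
 moreover have "(\<lambda>x. h (f x)) ` $L = {x \<in> $M'. g (k x) = \<zero>[N]}"
 proof -
  have "(\<lambda>x. h (f x)) ` $L = h ` {x \<in> $M. g x = \<zero>[N]}" unfolding sesD(8)[OF s, symmetric] by (simp add: image_image)
  also have "\<dots> = {x \<in> $M'. g (k x) = \<zero>[N]}"
  proof (intro equalityI subsetI)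
   fix y assume "y \<in> h ` {x \<in> $M. g x = \<zero>[N]}"
   then show "y \<in> {x \<in> $M'. g (k x) = \<zero>[N]}" using hk(3) module_homD(1)[OF hk(1)] by auto
  next
   fix y assume "y \<in> {x \<in> $M'. g (k x) = \<zero>[N]}"
   then show "y \<in> h ` {x \<in> $M. g x = \<zero>[N]}" using hk(4) module_homD(1)[OF hk(2)] by (intro image_eqI[of _ _ "k y"]) auto
  qed
  finally show ?thesis .
 qed
 ultimately show ?thesis using s M' module_hom_comp[OF sesD(4)[OF s] hk(1)] module_hom_comp[OF hk(2) sesD(5)[OF s]] by (simp add: ses_def)
qed

lemma ses_iso_right:
 assumes s: "ses L M N f g" and N': "fdm N'" and i: "mod_iso N N' h k"
 shows "ses L M N' f (\<lambda>x. h (g x))"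
proof -
 have "(\<lambda>x. h (g x)) ` $M = $N'" unfolding mod_isoD(5)[OF i, symmetric] sesD(7)[OF s, symmetric] by (simp add: image_image)
 moreover have "h (g x) = \<zero>[N'] \<longleftrightarrow> g x = \<zero>[N]" if "x \<in> $M" for x
  using hom_zero[OF sesD(3)[OF s] N' mod_isoD(1)[OF i]] mod_isoD(3)[OF i] module_homD(1)[OF sesD(5)[OF s] that]
   abelian_monoid.zero_closed[OF abelian_group.axioms(1)[OF fd_right_module.axioms(2)[OF sesD(3)[OF s]]]] by metis
 then have "{x \<in> $M. g x = \<zero>[N]} = {x \<in> $M. h (g x) = \<zero>[N']}" by blast
 ultimately show ?thesis using s N' module_hom_comp[OF sesD(5)[OF s] mod_isoD(1)[OF i]] by (simp add: ses_def)
qed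

text \<open>The infimum of a nonempty set of extended naturals is attained and that of the empty set
  is infinite, so a finite bound always comes from an actual resolution.\<close>

lemma projdim_le_iff:
 "projdim A M \<le> enat k \<longleftrightarrow> (\<exists>P p d. proj_res M P p d \<and> (\<forall>i>k. zero_module (P i)))"
proof
 assume "\<exists>P p d. proj_res M P p d \<and> (\<forall>i>k. zero_module (P i))"
 then show "projdim A M \<le> enat k" unfolding projdim_def by (intro Inf_lower) blast
next
 let ?S = "{enat k | k. \<exists>P p d. proj_res M P p d \<and> (\<forall>i>k. zero_module (P i))}"
 assume le: "projdim A M \<le> enat k"
 have "?S \<noteq> {}"
 proof
  assume "?S = {}"
  then have "projdim A M = \<infinity>" unfolding projdim_def by (simp only: Inf_enat_def) simp
  then show False using le by simp
 qed
 then obtain x where x: "x \<in> ?S" by blast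
 have "Inf ?S = (LEAST x. x \<in> ?S)" using \<open>?S \<noteq> {}\<close> by (simp only: Inf_enat_def) simp
 then have "projdim A M \<in> ?S" unfolding projdim_def using LeastI[of "\<lambda>x. x \<in> ?S", OF x] by metis
 then obtain m P p d where m: "projdim A M = enat m" "proj_res M P p d" "\<forall>i>m. zero_module (P i)" by blast
 then have "\<forall>i>k. zero_module (P i)" using le by simp
 then show "\<exists>P p d. proj_res M P p d \<and> (\<forall>i>k. zero_module (P i))" using m(2) by blast
qed

lemma projective_resolution_projective:
 assumes M: "M \<in> modules A" "projective M"
 shows "\<exists>P p d. proj_res M P p d \<and> P 0 = M \<and> (\<forall>i>0. zero_module (P i))"
proof -
 obtain Z :: "('k, 'a) umodule" where Z: "Z \<in> modules A" "zero_module Z" by (rule zero_module_ex)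
 interpret Z: amod A Z by (rule modules_amod[OF Z(1)])
 interpret M: amod A M by (rule modules_amod[OF M(1)])
 have Zp: "projective Z" by (rule zero_projective[OF modulesD[OF Z(1)] Z(2)])
 have Zc: "$Z = {\<zero>[Z]}" using Z(2) by (simp add: zero_module_def)
 have "proj_res M (case_nat M (\<lambda>_. Z)) (\<lambda>x. x) (case_nat (\<lambda>_. \<zero>[M]) (\<lambda>_ _. \<zero>[Z]))"
  unfolding projective_resolution_def exact_left_resolution_def a_kernel_def'
  using M Z Zp Zc module_hom_zero[OF modulesD[OF M(1)]] module_hom_zero[OF modulesD[OF Z(1)]] module_hom_id by (auto split: nat.splits)
 then show ?thesis using Z(2)
  by (intro exI[of _ "case_nat M (\<lambda>_. Z)"] exI[of _ "\<lambda>x. x"] exI[of _ "case_nat (\<lambda>_. \<zero>[M]) (\<lambda>_ _. \<zero>[Z])"])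
   (auto split: nat.splits)
qed

end

section \<open>The algebra in coordinates\<close>

datatype idx = Ix_e nat | Ix_a nat | Ix_b nat | Ix_c nat

fun idx_ok :: "nat \<Rightarrow> idx \<Rightarrow> bool" where
 "idx_ok n (Ix_e i) \<longleftrightarrow> 1 \<le> i \<and> i \<le> n"
| "idx_ok n (Ix_a i) \<longleftrightarrow> 1 \<le> i \<and> i < n"
| "idx_ok n (Ix_b i) \<longleftrightarrow> 1 \<le> i \<and> i < n"
| "idx_ok n (Ix_c i) \<longleftrightarrow> 1 \<le> i \<and> i < n"

text \<open>The coordinates are those with respect to the basis of the \<open>e\<^sub>i\<close>, \<open>a\<^sub>i\<close>, \<open>b\<^sub>i\<close> and
 \<open>c\<^sub>i = a\<^sub>i b\<^sub>i\<close>; all basis elements with an index out of range are zero.\<close>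

locale coordinate_algebra = fd_algebra A for A :: "('k::field, 'a) module" (structure) +
 fixes n :: nat and co :: "idx \<Rightarrow> 'a \<Rightarrow> 'k"
 assumes n2: "n \<ge> 2"
  and co_add: "x \<in> $A ==> y \<in> $A ==> co t (x \<oplus> y) = co t x + co t y"
  and co_smult: "x \<in> $A ==> co t (c \<odot> x) = c * co t x"
  and co_one: "co (Ix_e i) \<one> = (if 1 \<le> i \<and> i \<le> n then 1 else 0)"
   "co (Ix_a i) \<one> = 0" "co (Ix_b i) \<one> = 0" "co (Ix_c i) \<one> = 0"
  and co_mult: "x \<in> $A ==> y \<in> $A ==> co (Ix_e i) (x \<otimes> y) = co (Ix_e i) x * co (Ix_e i) y"
   "x \<in> $A ==> y \<in> $A ==>
     co (Ix_a i) (x \<otimes> y) = co (Ix_e i) x * co (Ix_a i) y + co (Ix_a i) x * co (Ix_e (Suc i)) y"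
   "x \<in> $A ==> y \<in> $A ==>
     co (Ix_b i) (x \<otimes> y) = co (Ix_e (Suc i)) x * co (Ix_b i) y + co (Ix_b i) x * co (Ix_e i) y"
   "x \<in> $A ==> y \<in> $A ==>
     co (Ix_c i) (x \<otimes> y) = (if 1 \<le> i \<and> i < n then co (Ix_e i) x * co (Ix_c i) y + co (Ix_c i) x * co (Ix_e i) y
      + co (Ix_a i) x * co (Ix_b i) y + co (Ix_b (i-1)) x * co (Ix_a (i-1)) y else 0)"
  and co_out: "x \<in> $A ==> \<not> idx_ok n t ==> co t x = 0"
  and co_ext: "x \<in> $A ==> y \<in> $A ==> (\<And>t. co t x = co t y) ==> x = y"
  and co_ex: "\<exists>x\<in>$A. \<forall>t. co t x = (if idx_ok n t then f t else 0)"
begin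

lemma co_zero [simp]: "co t \<zero> = 0" using co_smult[of \<zero> t 0] by simp

definition mk :: "(idx \<Rightarrow> 'k) \<Rightarrow> 'a" where
 "mk f = (SOME x. x \<in> $A \<and> (\<forall>t. co t x = (if idx_ok n t then f t else 0)))"

lemma mk: "mk f \<in> $A" "co t (mk f) = (if idx_ok n t then f t else 0)"
proof -
 have "\<exists>x. x \<in> $A \<and> (\<forall>t. co t x = (if idx_ok n t then f t else 0))" using co_ex by blast
 from someI_ex[OF this] show "mk f \<in> $A" "co t (mk f) = (if idx_ok n t then f t else 0)" unfolding mk_def by blast+
qed

definition bas :: "idx \<Rightarrow> 'a" where "bas t = mk (\<lambda>s. if s = t then 1 else 0)"

abbreviation "ee i \<equiv> bas (Ix_e i)"

abbreviation "aa i \<equiv> bas (Ix_a i)"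

abbreviation "bb i \<equiv> bas (Ix_b i)"

abbreviation "cc i \<equiv> bas (Ix_c i)"

lemma bas_closed [simp]: "bas t \<in> $A" by (simp add: bas_def mk)

lemma co_bas [simp]: "co s (bas t) = (if s = t \<and> idx_ok n t then 1 else 0)" by (simp add: bas_def mk)

lemma alg_eqI:
 assumes "x \<in> $A" "y \<in> $A"
  "\<And>i. co (Ix_e i) x = co (Ix_e i) y" "\<And>i. co (Ix_a i) x = co (Ix_a i) y"
  "\<And>i. co (Ix_b i) x = co (Ix_b i) y" "\<And>i. co (Ix_c i) x = co (Ix_c i) y"
 shows "x = y"
proof (rule co_ext[OF assms(1,2)])
 show "co t x = co t y" for t using assms(3-) by (cases t) auto
qed

lemmas co_simps = co_add co_smult co_one co_mult

lemma co_0 [simp]: "x \<in> $A ==> co (Ix_e 0) x = 0" "x \<in> $A ==> co (Ix_a 0) x = 0"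
 "x \<in> $A ==> co (Ix_b 0) x = 0" "x \<in> $A ==> co (Ix_c 0) x = 0" by (auto intro: co_out)

lemma co_n [simp]: "x \<in> $A ==> n < i ==> co (Ix_e i) x = 0" "x \<in> $A ==> n \<le> i ==> co (Ix_a i) x = 0"
 "x \<in> $A ==> n \<le> i ==> co (Ix_b i) x = 0" "x \<in> $A ==> n \<le> i ==> co (Ix_c i) x = 0"
 by (auto intro: co_out)

lemma bas_out [simp]: "\<not> idx_ok n t ==> bas t = \<zero>" by (rule co_ext) auto

lemma mult_closed [simp, intro]: "x \<in> $A ==> y \<in> $A ==> x \<otimes> y \<in> $A"
 using ring.ring_simprules(5)[OF ring_A] .

lemma add_closed [simp, intro]: "x \<in> $A ==> y \<in> $A ==> x \<oplus> y \<in> $A"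
 using ring.ring_simprules(1)[OF ring_A] .

lemma one_A [simp]: "\<one> \<in> $A" using ring.ring_simprules(6)[OF ring_A] .

lemma zero_A [simp]: "\<zero> \<in> $A" using ring.ring_simprules(2)[OF ring_A] .

section \<open>Multiplication table and expansions in the basis\<close>

lemma mult_ee: "ee i \<otimes> ee j = (if i = j then ee i else \<zero>)" by (rule alg_eqI) (auto simp: co_simps)

lemma ee_idem [simp]: "ee i \<otimes> ee i = ee i" by (simp add: mult_ee)

lemma mult_ea: "ee i \<otimes> aa j = (if i = j then aa j else \<zero>)" by (rule alg_eqI) (auto simp: co_simps)

lemma mult_ae: "aa j \<otimes> ee i = (if i = Suc j then aa j else \<zero>)" by (rule alg_eqI) (auto simp: co_simps)

lemma mult_eb: "ee i \<otimes> bb j = (if i = Suc j then bb j else \<zero>)" by (rule alg_eqI) (auto simp: co_simps)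

lemma mult_be: "bb j \<otimes> ee i = (if i = j then bb j else \<zero>)" by (rule alg_eqI) (auto simp: co_simps)

lemma mult_ec: "ee i \<otimes> cc j = (if i = j then cc j else \<zero>)" by (rule alg_eqI) (auto simp: co_simps)

lemma mult_ce: "cc j \<otimes> ee i = (if i = j then cc j else \<zero>)" by (rule alg_eqI) (auto simp: co_simps)

lemma mult_ab: "aa i \<otimes> bb j = (if i = j then cc i else \<zero>)" by (rule alg_eqI) (auto simp: co_simps)

text \<open>At \<open>i = n - 1\<close> the value is \<open>cc n\<close>, which is out of range and
  hence zero: this is the relation at the vertex n. The condition \<open>1 \<le> i\<close> excludes
  \<open>bb 0 = \<zero>\<close>, where the formula would give the nonzero
  \<open>cc 1\<close>.\<close>

lemma mult_ba: "bb i \<otimes> aa j = (if i = j \<and> 1 \<le> i then cc (Suc i) else \<zero>)" by (rule alg_eqI) (auto simp: co_simps)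

lemma mult_rad: "aa i \<otimes> aa j = \<zero>" "bb i \<otimes> bb j = \<zero>" "aa i \<otimes> cc j = \<zero>" "bb i \<otimes> cc j = \<zero>"
 "cc i \<otimes> aa j = \<zero>" "cc i \<otimes> bb j = \<zero>" "cc i \<otimes> cc j = \<zero>" by (rule alg_eqI; auto simp: co_simps)+

lemmas mult_table = mult_ee mult_ea mult_ae mult_eb mult_be mult_ec mult_ce mult_ab mult_ba mult_rad

text \<open>\<open>e_i A\<close> is spanned by \<open>e_i\<close>, \<open>a_i\<close>,
  \<open>b_{i-1}\<close> and \<open>c_i\<close>. The truncated subtraction is harmless, since
  \<open>bb 0\<close> is zero.\<close>

lemma ee_mult_expand:
 assumes x: "x \<in> $A"
 shows "ee i \<otimes> x = (co (Ix_e i) x \<odot> ee i \<oplus> co (Ix_a i) x \<odot> aa i) \<oplus>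
  (co (Ix_b (i-1)) x \<odot> bb (i-1) \<oplus> co (Ix_c i) x \<odot> cc i)"
 using x by (intro alg_eqI) (auto simp: co_simps intro!: co_out)

lemma mult_ee_expand:
 assumes x: "x \<in> $A"
 shows "x \<otimes> ee i = (co (Ix_e i) x \<odot> ee i \<oplus> co (Ix_b i) x \<odot> bb i) \<oplus>
  (co (Ix_a (i-1)) x \<odot> aa (i-1) \<oplus> co (Ix_c i) x \<odot> cc i)"
 using x by (intro alg_eqI) (auto simp: co_simps intro!: co_out)

lemma mult_bb_expand:
 assumes x: "x \<in> $A" shows "x \<otimes> bb i = co (Ix_e (Suc i)) x \<odot> bb i \<oplus> co (Ix_a i) x \<odot> cc i"
 using x by (intro alg_eqI) (auto simp: co_simps)

lemma mult_aa_expand: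
 assumes x: "x \<in> $A" shows "x \<otimes> aa i = co (Ix_e i) x \<odot> aa i \<oplus> co (Ix_b i) x \<odot> cc (Suc i)"
 using x by (intro alg_eqI) (auto simp: co_simps)

lemma mult_cc_expand:
 assumes x: "x \<in> $A" shows "x \<otimes> cc i = co (Ix_e i) x \<odot> cc i" using x by (intro alg_eqI) (auto simp: co_simps)

text \<open>The sequence of right multiplications
 \<open>M e\<^sub>n \<rightarrow> \<dots> \<rightarrow> M e\<^sub>1 \<rightarrow> M e\<^sub>1 \<rightarrow> \<dots> \<rightarrow> M e\<^sub>n\<close>, with the maps \<open>b\<^sub>i\<close>, then \<open>c\<^sub>1\<close>, then the maps \<open>a\<^sub>i\<close>: its
 exactness at the place \<open>j\<close> is the predicate \<open>H j\<close> below.\<close>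

definition eps :: "nat \<Rightarrow> 'a" where
 "eps j = ee (if j < n then n - j else j + 1 - n)"

text \<open>\<open>yy j\<close> is the map that enters the place j. The value zero at 0 turns
  \<open>H 0\<close> into injectivity of the first map; for \<open>j \<ge> 2 * n\<close> the index
  of \<open>aa\<close> is out of range, so the sequence continues by zeros.\<close>

definition yy :: "nat \<Rightarrow> 'a" where
 "yy j = (if j = 0 then \<zero> else if j < n then bb (n - j) else if j = n then cc 1 else aa (j - n))"

lemma eps_closed [simp]: "eps j \<in> $A" by (simp add: eps_def)

lemma yy_closed [simp]: "yy j \<in> $A" by (simp add: yy_def)

lemma zero_mult_A [simp]: "x \<in> $A ==> \<zero> \<otimes> x = \<zero>" "x \<in> $A ==> x \<otimes> \<zero> = \<zero>"
 using ring.ring_simprules(24,25)[OF ring_A] by auto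

lemma yy_eps: "yy j \<otimes> eps j = yy j" using n2 by (auto simp: yy_def eps_def mult_table)

lemma eps_yy: "eps j \<otimes> yy (Suc j) = yy (Suc j)" using n2 by (auto simp: yy_def eps_def mult_table)

lemma yy_yy: "yy j \<otimes> yy (Suc j) = \<zero>" using n2 by (auto simp: yy_def mult_table)

lemma eps_idem: "eps j \<otimes> eps j = eps j" by (simp add: eps_def)

text \<open>The equation \<open>v *[M] eps j = v\<close> places v at the vertex of j. The preimage w
  may be any vector, since \<open>yy (Suc j)\<close> absorbs \<open>eps j\<close> from the left and
  so w can always be cut down to its vertex.\<close>

definition H :: "nat \<Rightarrow> ('a, 'm) rmodule \<Rightarrow> bool" where
 "H j M \<longleftrightarrow> (\<forall>v\<in>$M. v *[M] eps j = v \<and> v *[M] yy (Suc j) = \<zero>[M] \<longrightarrow> (\<exists>w\<in>$M. v = w *[M] yy j))"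

section \<open>Diagram chases in short exact sequences\<close>

lemma HI: "(\<And>v. v \<in> $M ==> v *[M] eps j = v ==> v *[M] yy (Suc j) = \<zero>[M] ==> \<exists>w\<in>$M. v = w *[M] yy j) ==> H j M"
 by (auto simp: H_def)

lemma HD:
 assumes "H j M" "v \<in> $M" "v *[M] eps j = v" "v *[M] yy (Suc j) = \<zero>[M]"
 obtains w where "w \<in> $M" "v = w *[M] yy j" using assms by (auto simp: H_def)

text \<open>With homologies written as H^j, this is the part H^j(P) \<rightarrow> H^j(M)
  \<rightarrow> H^{j+1}(N) of the long exact sequence.\<close>

lemma ses_chase_right:
 assumes s: "ses N P M f g" and P: "H j P" and N: "H (Suc j) N" shows "H j M"
proof (rule HI)
 note d = sesD[OF s]
 interpret N: amod A N by (rule amodI[OF d(1)])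
 interpret P: amod A P by (rule amodI[OF d(2)])
 interpret M: amod A M by (rule amodI[OF d(3)])
 note f = module_homD[OF d(4)] and g = module_homD[OF d(5)]
 fix v assume v: "v \<in> $M" "v *[M] eps j = v" "v *[M] yy (Suc j) = \<zero>[M]"
 have "v \<in> g ` $P" using v(1) d(7) by simp
 then obtain p0 where p0: "p0 \<in> $P" "g p0 = v" by auto
 \<comment> \<open>A preimage of v need not sit at the vertex of j; multiplication by the idempotent
   moves it there without changing its image.\<close>
 define p where "p = p0 *[P] eps j"
 have p: "p \<in> $P" "g p = v" "p *[P] eps j = p" using p0 v by (auto simp: p_def g P.ract_mult[symmetric] eps_idem)
 have "p *[P] yy (Suc j) \<in> {x \<in> $P. g x = \<zero>[M]}" using p v by (simp add: g)
 then obtain n0 where n0: "n0 \<in> $N" "f n0 = p *[P] yy (Suc j)" unfolding d(8)[symmetric] by auto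
 define m where "m = n0 *[N] eps (Suc j)"
 have m: "m \<in> $N" "f m = p *[P] yy (Suc j)" "m *[N] eps (Suc j) = m"
  using n0 p by (auto simp: m_def f P.ract_mult[symmetric] N.ract_mult[symmetric] eps_idem yy_eps)
 have "f (m *[N] yy (Suc (Suc j))) = f \<zero>[N]" using m p hom_zero[OF d(1,2,4)] by (simp add: f P.ract_mult[symmetric] yy_yy)
 then have "m *[N] yy (Suc (Suc j)) = \<zero>[N]" using d(6) m by (simp add: inj_on_eq_iff)
 then obtain k where k: "k \<in> $N" "m = k *[N] yy (Suc j)" using HD[OF N m(1,3)] by blast
 define k' where "k' = k *[N] eps j"
 have k': "k' \<in> $N" "m = k' *[N] yy (Suc j)" "k' *[N] eps j = k'" using k by (auto simp: k'_def N.ract_mult[symmetric] eps_yy eps_idem)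
 define q where "q = p -[P] f k'"
 have "q \<in> $P" "q *[P] eps j = q" using p k' f(1) f(3)[of k' "eps j"] by (auto simp: q_def P.minus_act)
 moreover have "q *[P] yy (Suc j) = \<zero>[P]" using p k' f(1) f(3)[of k' "yy (Suc j)"] m(2) by (simp add: q_def P.minus_act)
 ultimately obtain w where w: "w \<in> $P" "q = w *[P] yy j" using HD[OF P] by blast
 have "f k' \<in> {x \<in> $P. g x = \<zero>[M]}" unfolding d(8)[symmetric] using k' by blast
 then have "g q = v" using p k' f(1) v by (simp add: q_def hom_minus[OF d(2,3,5)])
 then have "v = g w *[M] yy j" using w g by simp
 then show "\<exists>w\<in>$M. v = w *[M] yy j" using w g by blast
qed

text \<open>The part H^j(M) \<rightarrow> H^{j+1}(N) \<rightarrow> H^{j+1}(P) of the long exact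
  sequence.\<close>

lemma ses_chase_left:
 assumes s: "ses N P M f g" and M: "H j M" and P: "H (Suc j) P" shows "H (Suc j) N"
proof (rule HI)
 note d = sesD[OF s]
 interpret N: amod A N by (rule amodI[OF d(1)])
 interpret P: amod A P by (rule amodI[OF d(2)])
 interpret M: amod A M by (rule amodI[OF d(3)])
 note f = module_homD[OF d(4)] and g = module_homD[OF d(5)]
 fix v assume v: "v \<in> $N" "v *[N] eps (Suc j) = v" "v *[N] yy (Suc (Suc j)) = \<zero>[N]"
 have "f v *[P] eps (Suc j) = f v" "f v *[P] yy (Suc (Suc j)) = \<zero>[P]"
  using v f(3)[of v "eps (Suc j)"] f(3)[of v "yy (Suc (Suc j))"] hom_zero[OF d(1,2,4)] by simp_all
 then obtain p0 where p0: "p0 \<in> $P" "f v = p0 *[P] yy (Suc j)" using HD[OF P] v f(1) by blast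
 define p where "p = p0 *[P] eps j"
 have p: "p \<in> $P" "f v = p *[P] yy (Suc j)" "p *[P] eps j = p" using p0 by (auto simp: p_def P.ract_mult[symmetric] eps_yy eps_idem)
 have "f v \<in> {x \<in> $P. g x = \<zero>[M]}" unfolding d(8)[symmetric] using v by blast
 then have "g p *[M] yy (Suc j) = \<zero>[M]" using p(1,2) g(3)[of p "yy (Suc j)"] by simp
 moreover have "g p *[M] eps j = g p" using p(1,3) g(3)[of p "eps j"] by simp
 ultimately obtain w where w: "w \<in> $M" "g p = w *[M] yy j" using HD[OF M] p(1) g(1) by blast
 obtain w' where w': "w' \<in> $P" "w = g w'" using w(1) d(7) by blast
 have "g (p -[P] w' *[P] yy j) = \<zero>[M]" using p w w' g by (simp add: hom_minus[OF d(2,3,5)])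
 then have "p -[P] w' *[P] yy j \<in> {x \<in> $P. g x = \<zero>[M]}" using p w' by simp
 then obtain u where u: "u \<in> $N" "f u = p -[P] w' *[P] yy j" unfolding d(8)[symmetric] by auto
 have "f (u *[N] yy (Suc j)) = f v" using u p w' by (simp add: f P.minus_act P.ract_mult[symmetric] yy_yy)
 then have "v = u *[N] yy (Suc j)" using d(6) u v by (simp add: inj_on_eq_iff)
 then show "\<exists>w\<in>$N. v = w *[N] yy (Suc j)" using u by blast
qed

text \<open>No map enters the place 0, so exactness there is injectivity of the first multiplication
  and passes to submodules.\<close>

lemma ses_chase_zero:
 assumes s: "ses N P M f g" and P: "H 0 P" shows "H 0 N"
proof (rule HI)
 note d = sesD[OF s]
 interpret N: amod A N by (rule amodI[OF d(1)])
 interpret P: amod A P by (rule amodI[OF d(2)])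
 note f = module_homD[OF d(4)]
 fix v assume v: "v \<in> $N" "v *[N] eps 0 = v" "v *[N] yy (Suc 0) = \<zero>[N]"
 have "f v *[P] eps 0 = f v" "f v *[P] yy (Suc 0) = \<zero>[P]"
  using v f(3)[of v "eps 0"] f(3)[of v "yy (Suc 0)"] hom_zero[OF d(1,2,4)] by simp_all
 then obtain p where p: "p \<in> $P" "f v = p *[P] yy 0" using HD[OF P] v f(1) by blast
 then have "f v = f \<zero>[N]" using hom_zero[OF d(1,2,4)] by (simp add: yy_def)
 then have "v = \<zero>[N]" using d(6) v by (simp add: inj_on_eq_iff)
 then show "\<exists>w\<in>$N. v = w *[N] yy 0" by (intro bexI[of _ "\<zero>[N]"]) auto
qed

lemma ses_chase_middle:
 assumes s: "ses N P M f g" and N: "H j N" and M: "H j M" shows "H j P"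
proof (rule HI)
 note d = sesD[OF s]
 interpret N: amod A N by (rule amodI[OF d(1)])
 interpret P: amod A P by (rule amodI[OF d(2)])
 interpret M: amod A M by (rule amodI[OF d(3)])
 note f = module_homD[OF d(4)] and g = module_homD[OF d(5)]
 fix p assume p: "p \<in> $P" "p *[P] eps j = p" "p *[P] yy (Suc j) = \<zero>[P]"
 have "g p *[M] eps j = g p" "g p *[M] yy (Suc j) = \<zero>[M]"
  using p g(3)[of p "eps j"] g(3)[of p "yy (Suc j)"] hom_zero[OF d(2,3,5)] by simp_all
 then obtain w where w: "w \<in> $M" "g p = w *[M] yy j" using HD[OF M] p(1) g(1) by blast
 obtain w' where w': "w' \<in> $P" "w = g w'" using w(1) d(7) by blast
 define q where "q = p -[P] w' *[P] yy j"
 have q: "q \<in> $P" "q *[P] eps j = q" "q *[P] yy (Suc j) = \<zero>[P]"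
  using p w' by (auto simp: q_def P.minus_act P.ract_mult[symmetric] yy_eps yy_yy)
 have "g q = \<zero>[M]" using p w w' g by (simp add: q_def hom_minus[OF d(2,3,5)])
 then have "q \<in> {x \<in> $P. g x = \<zero>[M]}" using q by simp
 then obtain u0 where u0: "u0 \<in> $N" "f u0 = q" unfolding d(8)[symmetric] by auto
 define u where "u = u0 *[N] eps j"
 have u: "u \<in> $N" "f u = q" "u *[N] eps j = u" using u0 q by (auto simp: u_def f N.ract_mult[symmetric] eps_idem)
 have "f (u *[N] yy (Suc j)) = f \<zero>[N]" using u q hom_zero[OF d(1,2,4)] by (simp add: f)
 then have "u *[N] yy (Suc j) = \<zero>[N]" using d(6) u by (simp add: inj_on_eq_iff)
 then obtain k where k: "k \<in> $N" "u = k *[N] yy j" using HD[OF N u(1,3)] by blast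
 have "q = f k *[P] yy j" using u k f by simp
 then have "p = f k *[P] yy j +[P] w' *[P] yy j" using p w' P.M.minus_add_cancel[of p "w' *[P] yy j"] by (simp add: q_def)
 then have "p = (f k +[P] w') *[P] yy j" using w' k f(1) by (simp add: P.ract_add_left)
 then show "\<exists>w\<in>$P. p = w *[P] yy j" using w' k f(1) by blast
qed

section \<open>Exactness of retracts, direct sums and projective modules\<close>

lemma H_retract:
 assumes M: "fdm M" and N: "fdm N"
  and p: "mhom M N p" and s: "mhom N M s" and ps: "\<And>x. x \<in> $N ==> p (s x) = x"
  and H: "H j M"
 shows "H j N"
proof (rule HI)
 note p' = module_homD[OF p] and s' = module_homD[OF s]
 fix v assume v: "v \<in> $N" "v *[N] eps j = v" "v *[N] yy (Suc j) = \<zero>[N]"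
 have "s v *[M] eps j = s v" "s v *[M] yy (Suc j) = \<zero>[M]"
  using v s'(3)[of v "eps j"] s'(3)[of v "yy (Suc j)"] hom_zero[OF N M s] by simp_all
 then obtain w where w: "w \<in> $M" "s v = w *[M] yy j" using HD[OF H] v s'(1) by blast
 then have "v = p w *[N] yy j" using ps[OF v(1)] p'(3)[of w "yy j"] by simp
 then show "\<exists>w\<in>$N. v = w *[N] yy j" using w p'(1) by blast
qed

lemma H_iso:
 assumes "fdm M" "fdm N" "mod_iso M N f g" "H j M" shows "H j N"
 using H_retract[OF assms(1,2) mod_isoD(1,2)[OF assms(3)] _ assms(4)] mod_isoD(4)[OF assms(3)] by blast

lemma H_direct_sum:
 assumes M: "fdm M" and N: "fdm N"
 shows "H j (direct_sum M N) \<longleftrightarrow> H j M \<and> H j N"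
proof
 interpret M: amod A M by (rule amodI[OF M])
 interpret N: amod A N by (rule amodI[OF N])
 assume D: "H j (direct_sum M N)"
 show "H j M \<and> H j N" using H_retract[OF direct_sum_fd[OF M N] M hom_fst hom_inl[OF N] _ D]
   H_retract[OF direct_sum_fd[OF M N] N hom_snd hom_inr[OF M] _ D] by simp
next
 assume H: "H j M \<and> H j N"
 show "H j (direct_sum M N)"
 proof (rule HI)
  fix v assume v: "v \<in> $(direct_sum M N)" "v *[direct_sum M N] eps j = v"
   "v *[direct_sum M N] yy (Suc j) = \<zero>[direct_sum M N]"
  obtain x y where xy: "v = (x, y)" by (cases v)
  obtain w where "w \<in> $M" "x = w *[M] yy j" using HD[of j M x] H v xy by auto
  moreover obtain z where "z \<in> $N" "y = z *[N] yy j" using HD[of j N y] H v xy by auto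
  ultimately show "\<exists>w\<in>$(direct_sum M N). v = w *[direct_sum M N] yy j" using xy by (intro bexI[of _ "(w, z)"]) auto
 qed
qed

lemma H_zero: assumes Z: "fdm Z" "zero_module Z" shows "H j Z"
proof -
 interpret Z: amod A Z by (rule amodI[OF Z(1)])
 show ?thesis using Z(2) by (intro HI) (auto simp: zero_module_def)
qed

text \<open>The coordinates of the product with \<open>yy (Suc j)\<close> show which coordinates of
  v vanish, and the remaining basis elements at the vertex of j are products with
  \<open>yy j\<close>. The range of j ends just before the vertex \<open>n - 1\<close> in the second
  half.\<close>

lemma H_regular:
 assumes j: "j < 2 * n - 2" shows "H j (regular)"
proof (rule HI)
 fix v assume v: "v \<in> $(regular)" "v *[regular] eps j = v"
  "v *[regular] yy (Suc j) = \<zero>[regular]"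
 then have vA: "v \<in> $A" and y0: "v \<otimes> yy (Suc j) = \<zero>" by auto
 obtain m where m: "m = (if j < n then n - j else j + 1 - n)" by blast
 have vm: "v \<otimes> ee m = v" using v m by (simp add: eps_def)
 have c0: "co t (v \<otimes> yy (Suc j)) = 0" for t using y0 by simp
 consider "j = 0" | "0 < j" "j < n" | "j = n" | "n < j" by linarith
 then show "\<exists>w\<in>$(regular). v = w *[regular] yy j"
 proof cases
  case 1
  have "co (Ix_e n) v = 0" "co (Ix_a (n-1)) v = 0"
   using c0[of "Ix_b (n-1)"] c0[of "Ix_c (n-1)"] n2 vA 1 by (auto simp: yy_def co_simps split: if_splits)
  then have "v = \<zero>" using vA n2 1 m by (subst vm[symmetric], subst mult_ee_expand) (auto intro!: alg_eqI simp: co_simps)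
  then show ?thesis using 1 by (intro bexI[of _ \<zero>]) (auto simp: yy_def)
 next
  case 2
  then have m': "1 \<le> m" "m < n" "j = n - m" using m by auto
  have e: "co (Ix_e m) v = 0"
  proof (cases "m = 1")
   case True
   then have "Suc j = n" using m' by simp
   then show ?thesis using c0[of "Ix_c 1"] True n2 vA by (simp add: yy_def co_simps)
  next
   case False
   then have "yy (Suc j) = bb (m - 1)" using m' by (auto simp: yy_def)
   then show ?thesis using c0[of "Ix_b (m-1)"] False m' vA by (auto simp: co_simps split: if_splits)
  qed
  have a: "co (Ix_a (m-1)) v = 0"
  proof (cases "m = 1")
   case False
   then have "yy (Suc j) = bb (m - 1)" using m' by (auto simp: yy_def)
   then show ?thesis using c0[of "Ix_c (m-1)"] False m' vA by (auto simp: co_simps split: if_splits)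
  qed (use vA in simp)
  \<comment> \<open>Only \<open>b_m\<close> and \<open>c_m\<close> can still occur in v, and they
    are \<open>e_{m+1} b_m\<close> and \<open>a_m b_m\<close>.\<close>
  have "v = (co (Ix_b m) v \<odot> ee (Suc m) \<oplus> co (Ix_c m) v \<odot> aa m) \<otimes> bb m"
   using vA m' e a by (subst vm[symmetric], subst mult_ee_expand) (auto intro!: alg_eqI simp: co_simps)
  then show ?thesis using m' vA by (auto simp: yy_def)
 next
  case 3
  \<comment> \<open>The bound on j reaches the place n only if n > 2, so that \<open>cc 2\<close> is
    in range and detects the coordinate of \<open>b_1\<close>.\<close>
  then have m1: "m = 1" "n > 2" using j m by auto
  have "yy (Suc j) = aa 1" using 3 by (simp add: yy_def)
  then have e: "co (Ix_e 1) v = 0" "co (Ix_b 1) v = 0" using c0[of "Ix_a 1"] c0[of "Ix_c 2"] m1 vA by (simp_all add: co_simps)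
  have "v = (co (Ix_c 1) v \<odot> ee 1) \<otimes> cc 1"
   using vA m1 e by (subst vm[symmetric], subst mult_ee_expand) (auto intro!: alg_eqI simp: co_simps)
  then show ?thesis using 3 n2 by (auto simp: yy_def)
 next
  case 4
  then have m': "2 \<le> m" "Suc m < n" "j = m - 1 + n" using m j by auto
  have "yy (Suc j) = aa m" using m' by (auto simp: yy_def)
  then have e: "co (Ix_e m) v = 0" "co (Ix_b m) v = 0" using c0[of "Ix_a m"] c0[of "Ix_c (Suc m)"] m' vA by (simp_all add: co_simps)
  have "v = (co (Ix_a (m-1)) v \<odot> ee (m-1) \<oplus> co (Ix_c m) v \<odot> bb (m-1)) \<otimes> aa (m-1)"
   using vA m' e by (subst vm[symmetric], subst mult_ee_expand) (auto intro!: alg_eqI simp: co_simps)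
  moreover have "yy j = aa (m-1)" using m' by (auto simp: yy_def)
  ultimately show ?thesis by (metis add_closed bas_closed regular_simps(1,4) scalar_closed)
 qed
qed

text \<open>The witness is \<open>b_{n-1}\<close>: the relation at the vertex n makes
  \<open>a_{n-1}\<close> kill it, while no left multiple of \<open>a_{n-2}\<close>, or of
  \<open>c_1\<close> if n = 2, has a coordinate at \<open>b_{n-1}\<close>. This is what stops the
  dominant dimension of A at 2n - 2.\<close>

lemma not_H_regular: "\<not> H (2 * n - 2) (regular)"
proof
 assume H: "H (2 * n - 2) (regular)"
 have e: "eps (2 * n - 2) = ee (n - 1)" using n2 by (auto simp: eps_def intro!: arg_cong[of _ _ ee])
 have y: "yy (Suc (2 * n - 2)) = aa (n - 1)" using n2 by (auto simp: yy_def intro!: arg_cong[of _ _ aa])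
 have "bb (n - 1) \<otimes> ee (n - 1) = bb (n - 1)" "bb (n - 1) \<otimes> aa (n - 1) = \<zero>" using n2 by (auto simp: mult_table)
 then obtain w where w: "w \<in> $A" "bb (n - 1) = w \<otimes> yy (2 * n - 2)" using HD[OF H, of "bb (n - 1)"] by (auto simp: e y)
 have "co (Ix_b (n-1)) (w \<otimes> yy (2 * n - 2)) = 0" using w(1) n2 by (auto simp: yy_def co_simps)
 moreover have "Suc 0 \<le> n - Suc 0" using n2 by linarith
 ultimately show False using w(2)[symmetric] n2 by simp
qed

text \<open>Exactness passes from A to the covers built by adding copies of A, and a projective
  module is a retract of such a cover.\<close>

lemma projective_H:
 assumes P: "projective P" and j: "j < 2 * n - 2" shows "H j P"
proof -
 note Pfd = projectiveD[OF P]
 obtain F p where F: "F \<in> modules A" "\<forall>j<2*n-2. H j F" "mhom F P p" "p ` $F = $P"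
 proof (rule enough_projectives[OF Pfd, of "\<lambda>F. \<forall>j<2*n-2. H j F"])
  show "\<forall>j<2*n-2. H j Z" if "Z \<in> modules A" "zero_module Z" for Z :: "('k, 'a) umodule"
   using H_zero[OF modulesD[OF that(1)] that(2)] by blast
  show "\<forall>j<2*n-2. H j G" if F: "F \<in> modules A" "\<forall>j<2*n-2. H j F" and G: "G \<in> modules A"
   and i: "module_iso A G (direct_sum F (regular))" for F G :: "('k, 'a) umodule"
  proof (intro allI impI)
   fix j assume j: "j < 2 * n - 2"
   obtain f g where fg: "mod_iso G (direct_sum F (regular)) f g" using i module_iso_iff[OF modulesD[OF G]] by blast
   have D: "fdm (direct_sum F (regular))" by (rule direct_sum_fd[OF modulesD[OF F(1)] regular_fd])
   have "H j (direct_sum F (regular))" using F(2) j H_regular[OF j] H_direct_sum[OF modulesD[OF F(1)] regular_fd] by blast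
   then show "H j G" by (rule H_iso[OF D modulesD[OF G] mod_iso_sym[OF fg]])
  qed
 qed blast
 obtain s where "mhom P F s" "\<And>x. x \<in> $P ==> p (s x) = x"
  using proj_lift[OF P modulesD[OF F(1)] Pfd F(3,4) module_hom_id] by blast
 then show ?thesis using H_retract[OF modulesD[OF F(1)] Pfd F(3)] F(2) j by blast
qed

end

section \<open>Homological dimensions\<close>

context coordinate_algebra
begin

lemma act_expand:
 assumes M: "fdm M" and v: "v \<in> $M" "v *[M] ee i = v" and x: "x \<in> $A"
 shows "v *[M] x = (sc M (co (Ix_e i) x) v +[M] sc M (co (Ix_a i) x) (v *[M] aa i)) +[M]
  (sc M (co (Ix_b (i-1)) x) (v *[M] bb (i-1)) +[M] sc M (co (Ix_c i) x) (v *[M] cc i))"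
proof -
 interpret M: amod A M by (rule amodI[OF M])
 have "v *[M] x = v *[M] (ee i \<otimes> x)" using v x by (simp add: M.ract_mult)
 then show ?thesis using v x by (simp add: ee_mult_expand M.ract_add_right M.act_scalar)
qed

text \<open>By divisibility v is a multiple of \<open>yy j\<close> as soon as every y with
  \<open>yy j \<otimes> y = \<zero>\<close> kills v. Expanding the action of y reduces this to the
  products of v with the arrows that leave its vertex and with c.\<close>

lemma injective_H:
 assumes I: "injective I" and H0: "H 0 I" shows "H j I"
proof (rule HI)
 note Ifd = injectiveD[OF I]
 interpret I: amod A I by (rule amodI[OF Ifd])
 fix v assume v: "v \<in> $I" "v *[I] eps j = v" "v *[I] yy (Suc j) = \<zero>[I]"
 define m where "m = (if j < n then n - j else j + 1 - n)"
 have vm: "v *[I] ee m = v" using v by (simp add: eps_def m_def)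
 note ex = act_expand[OF Ifd v(1) vm]
 consider "j = 0" | "0 < j" "j < n" | "j = n" | "n < j" "j < 2 * n" | "2 * n \<le> j" by linarith
 then show "\<exists>w\<in>$I. v = w *[I] yy j"
 proof cases
  case 1
  then show ?thesis using HD[OF H0] v by blast
 next
  case 2
  then have m: "1 \<le> m" "m < n" "yy j = bb m" by (auto simp: m_def yy_def)
  have b: "v *[I] bb (m-1) = \<zero>[I]" using v(3) 2 v(1) by (cases "Suc j < n") (auto simp: m_def yy_def Suc_diff_Suc)
  have c: "v *[I] cc m = \<zero>[I]"
  proof (cases "m = 1")
   case True
   then have "Suc j = n" using 2 by (simp add: m_def)
   then show ?thesis using v(3) True by (auto simp: yy_def)
  next
   case False
   then have "cc m = bb (m-1) \<otimes> aa (m-1)" using m by (simp add: mult_table)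
   then show ?thesis using b v by (simp add: I.ract_mult)
  qed
  \<comment> \<open>Only for m = n - 1 does \<open>b_m a_m\<close> vanish, which leaves the
    \<open>a_m\<close>-coordinate of y free. There \<open>v a_m\<close> sits at n and is killed by
    \<open>b_m\<close>, so \<open>H 0\<close> gives the missing equation.\<close>
  have a: "v *[I] aa (n-1) = \<zero>[I]" if "Suc m = n"
  proof -
   have mn: "n - 1 = m" using that by simp
   define u where "u = v *[I] aa m"
   have u: "u \<in> $I" "u *[I] eps 0 = u" "u *[I] yy (Suc 0) = \<zero>[I]"
    using v c m that mn n2 by (auto simp: u_def eps_def yy_def I.ract_mult[symmetric] mult_table)
   obtain w where "w \<in> $I" "u = w *[I] yy 0" using HD[OF H0 u] by blast
   then show ?thesis using mn by (simp add: u_def yy_def)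
  qed
  obtain w where "w \<in> $I" "v = w *[I] bb m"
  proof (rule injective_divisible[OF I v(1), of "bb m"])
   fix y assume y: "y \<in> $A" and z: "bb m \<otimes> y = \<zero>"
   have c0: "co t (bb m \<otimes> y) = 0" for t using z by simp
   have "co (Ix_e m) y = 0" using c0[of "Ix_b m"] m y by (simp add: co_simps)
   moreover have "sc I (co (Ix_a m) y) (v *[I] aa m) = \<zero>[I]"
   proof (cases "Suc m < n")
    case True
    then have "co (Ix_a m) y = 0" using c0[of "Ix_c (Suc m)"] m y by (simp add: co_simps)
    then show ?thesis using v by simp
   next
    case False
    then have "Suc m = n" using m by simp
    then show ?thesis using a by auto
   qed
   ultimately show "v *[I] y = \<zero>[I]" using ex[OF y] b c v by simp
  qed auto
  then show ?thesis using m by auto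
 next
  case 3
  then have m: "m = 1" "yy j = cc 1" using n2 by (auto simp: m_def yy_def)
  have a: "v *[I] aa 1 = \<zero>[I]" using v(3) 3 by (auto simp: yy_def)
  have "cc 1 = aa 1 \<otimes> bb 1" using n2 by (simp add: mult_table)
  then have c: "v *[I] cc 1 = \<zero>[I]" using a v by (simp add: I.ract_mult)
  obtain w where "w \<in> $I" "v = w *[I] cc 1"
  proof (rule injective_divisible[OF I v(1), of "cc 1"])
   fix y assume y: "y \<in> $A" and z: "cc 1 \<otimes> y = \<zero>"
   have c0: "co t (cc 1 \<otimes> y) = 0" for t using z by simp
   have "co (Ix_e 1) y = 0" using c0[of "Ix_c 1"] n2 y by (simp add: co_simps)
   then show "v *[I] y = \<zero>[I]" using ex[OF y] a c v m by simp
  qed auto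
  then show ?thesis using m by auto
 next
  case 4
  then have m: "2 \<le> m" "m \<le> n" "yy j = aa (m-1)" "yy (Suc j) = aa m"
   using n2 by (auto simp: m_def yy_def Suc_diff_le intro!: arg_cong[of _ _ aa])
  have a: "v *[I] aa m = \<zero>[I]" using v(3) m by simp
  have c: "v *[I] cc m = \<zero>[I]"
  proof -
   have "cc m = aa m \<otimes> bb m" by (simp add: mult_table)
   then show ?thesis using a v by (simp add: I.ract_mult)
  qed
  obtain w where "w \<in> $I" "v = w *[I] aa (m-1)"
  proof (rule injective_divisible[OF I v(1), of "aa (m-1)"])
   fix y assume y: "y \<in> $A" and z: "aa (m-1) \<otimes> y = \<zero>"
   have c0: "co t (aa (m-1) \<otimes> y) = 0" for t using z by simp
   have "co (Ix_e m) y = 0" "co (Ix_b (m-1)) y = 0"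
    using c0[of "Ix_a (m-1)"] c0[of "Ix_c (m-1)"] m y by (auto simp: co_simps split: if_splits)
   then show "v *[I] y = \<zero>[I]" using ex[OF y] a c v m by simp
  qed auto
  then show ?thesis using m by auto
 next
  case 5
  then have "bas (Ix_e m) = \<zero>" using n2 by (intro bas_out) (auto simp: m_def)
  then have "v = \<zero>[I]" using vm v by simp
  then show ?thesis by (intro bexI[of _ "\<zero>[I]"]) auto
 qed
qed

lemma cut:
 assumes M: "fdm M" and x: "x \<in> $A" "ee i \<otimes> x = x" and w: "w \<in> $M"
 shows "w *[M] x = (w *[M] ee i) *[M] x" "(w *[M] ee i) *[M] ee i = w *[M] ee i"
proof -
 interpret M: amod A M by (rule amodI[OF M])
 show "w *[M] x = (w *[M] ee i) *[M] x" "(w *[M] ee i) *[M] ee i = w *[M] ee i" using x w by (simp_all add: M.ract_mult[symmetric])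
qed

text \<open>Exactness at the vertices below \<open>n - 1\<close> and on the descending part forces the kernel of \<open>c\<^sub>i\<close>
 into the radical; the proof descends from \<open>i\<close> to \<open>i - 2\<close>.\<close>

lemma socle_to_radical:
 assumes M: "fdm M" and H: "\<And>j. j < 2 * n - 2 ==> H j M"
 shows "1 \<le> i ==> i < n ==> s \<in> $M ==> s *[M] ee i = s ==> s *[M] cc i = \<zero>[M]
  ==> \<exists>p\<in>$M. \<exists>q\<in>$M. s = p *[M] aa (i-1) +[M] q *[M] bb i"
proof (induction i arbitrary: s rule: less_induct)
 case (less i)
 interpret M: amod A M by (rule amodI[OF M])
 note s = less.prems(3-5)
 have desc: "\<exists>q\<in>$M. u = q *[M] bb m" if "2 \<le> m" "m < n" "u \<in> $M" "u *[M] ee m = u"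
  "u *[M] bb (m-1) = \<zero>[M]" for u m
 proof -
  have "yy (Suc (n - m)) = bb (m-1)" "yy (n - m) = bb m" "eps (n - m) = ee m"
   using that by (auto simp: yy_def eps_def intro!: arg_cong[of _ _ bb])
  moreover have "n - m < 2 * n - 2" using that by linarith
  ultimately show ?thesis using H[of "n - m"] that unfolding H_def by auto
 qed
 consider "i = 1" | "i = 2" | "i \<ge> 3" using less.prems(1) by linarith
 then show ?case
 proof cases
  case 1
  have "yy (Suc (n - 1)) = cc 1" "yy (n - 1) = bb 1" "eps (n - 1) = ee 1" using n2 by (auto simp: yy_def eps_def)
  moreover have "H (n - 1) M" by (rule H) (use n2 in linarith)
  ultimately obtain w where w: "w \<in> $M" "s = w *[M] bb 1" using HD[of "n-1" M s] s 1 by auto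
  then show ?thesis using 1 by (intro bexI[of _ "\<zero>[M]"] bexI[of _ w]) auto
 next
  case 2
  \<comment> \<open>The aim is to change s by a multiple of \<open>a_1\<close> so that
    \<open>b_1\<close> kills the difference and exactness in the descending half applies. Since
    \<open>b_1 a_1 = c_2\<close> kills s, t is killed by \<open>a_1\<close>.\<close>
  define t where "t = s *[M] bb 1"
  have cc2: "bb 1 \<otimes> aa 1 = cc 2" using mult_ba[of 1 1] by (simp add: numeral_2_eq_2)
  have t: "t \<in> $M" "t *[M] ee 1 = t" "t *[M] aa 1 = \<zero>[M]" using s 2 cc2 by (auto simp: t_def M.ract_mult[symmetric] mult_be)
  have "yy (Suc n) = aa 1" "yy n = cc 1" "eps n = ee 1" using n2 by (auto simp: yy_def eps_def)
  then obtain y where y: "y \<in> $M" "t = y *[M] cc 1"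
  proof -
   have "n < 2 * n - 2" using less.prems(2) 2 by linarith
   from HD[OF H[OF this], of t] show thesis
    using that t \<open>yy (Suc n) = aa 1\<close> \<open>yy n = cc 1\<close> \<open>eps n = ee 1\<close> by auto
  qed
  define u where "u = s -[M] y *[M] aa 1"
  have "u \<in> $M" "u *[M] ee 2 = u" "u *[M] bb (2-1) = \<zero>[M]"
   using s y 2 t_def less.prems(2) by (auto simp: u_def M.minus_act M.ract_mult[symmetric] mult_ae mult_ab)
  then obtain q where q: "q \<in> $M" "u = q *[M] bb 2" using desc[of 2] less.prems(2) 2 by auto
  then have "s = q *[M] bb 2 +[M] y *[M] aa 1" using s y M.M.minus_add_cancel[of s "y *[M] aa 1"] by (simp add: u_def)
  then have "s = y *[M] aa (2-1) +[M] q *[M] bb 2" using q y by (simp add: M.M.a_comm)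
  then show ?thesis using q y 2 by blast
 next
  case 3
  define t where "t = s *[M] bb (i-1)"
  have t: "t \<in> $M" "t *[M] ee (i-1) = t" "t *[M] aa (i-1) = \<zero>[M]"
   using s 3 less.prems(2) by (auto simp: t_def M.ract_mult[symmetric] mult_be mult_ba)
  have "yy (Suc (n + i - 2)) = aa (i-1)" "yy (n + i - 2) = aa (i-2)" "eps (n + i - 2) = ee (i-1)"
   using 3 by (auto simp: yy_def eps_def intro!: arg_cong[of _ _ aa] arg_cong[of _ _ ee])
  then obtain w0 where w0: "w0 \<in> $M" "t = w0 *[M] aa (i-2)"
  proof -
   have "n + i - 2 < 2 * n - 2" using less.prems(2) 3 by linarith
   from HD[OF H[OF this], of t] show thesis
    using that t \<open>yy (Suc (n + i - 2)) = _\<close> \<open>yy (n + i - 2) = _\<close> \<open>eps (n + i - 2) = _\<close> by auto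
  qed
  \<comment> \<open>Because \<open>b_{i-1} b_{i-2} = 0\<close>, the element \<open>c_{i-2}\<close>
    kills w, and the induction hypothesis describes w.\<close>
  define w where "w = w0 *[M] ee (i-2)"
  have w: "w \<in> $M" "w *[M] ee (i-2) = w" "t = w *[M] aa (i-2)" using w0 3 by (auto simp: w_def M.ract_mult[symmetric] mult_ea)
  have "w *[M] cc (i-2) = (w *[M] aa (i-2)) *[M] bb (i-2)" using w(1) by (simp add: M.ract_mult[symmetric] mult_ab)
  also have "\<dots> = s *[M] (bb (i-1) \<otimes> bb (i-2))" using s unfolding w(3)[symmetric] t_def by (simp add: M.ract_mult)
  finally have "w *[M] cc (i-2) = \<zero>[M]" using s by (simp add: mult_rad)
  then obtain p q where pq: "p \<in> $M" "q \<in> $M" "w = p *[M] aa (i-2-1) +[M] q *[M] bb (i-2)"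
  proof -
   have i2: "i - 2 < i" "1 \<le> i - 2" "i - 2 < n" using 3 less.prems(2) by linarith+
   show thesis using less.IH[OF i2 w(1,2) \<open>w *[M] cc (i-2) = \<zero>[M]\<close>] that by blast
  qed
  have "bb (i-2) \<otimes> aa (i-2) = cc (i-1)" using 3 by (auto simp: mult_ba intro!: arg_cong[of _ _ cc])
  \<comment> \<open>The summand from p dies in a product of two arrows a; for the other one
    \<open>b_{i-2} a_{i-2} = c_{i-1} = a_{i-1} b_{i-1}\<close>, so t comes from
    \<open>q a_{i-1}\<close>.\<close>
  then have tq: "t = (q *[M] aa (i-1)) *[M] bb (i-1)"
   unfolding w(3) pq(3) using pq(1,2) by (simp add: M.ract_add_left M.ract_mult[symmetric] mult_rad mult_ab)
  define u where "u = s -[M] q *[M] aa (i-1)"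
  have "u \<in> $M" "u *[M] ee i = u" "u *[M] bb (i-1) = \<zero>[M]"
   using s pq 3 tq t_def by (auto simp: u_def M.minus_act M.ract_mult[symmetric] mult_ae)
  then obtain r where r: "r \<in> $M" "u = r *[M] bb i" using desc[of i] less.prems(2) 3 by auto
  then have "s = r *[M] bb i +[M] q *[M] aa (i-1)" using s pq M.M.minus_add_cancel[of s "q *[M] aa (i-1)"] by (simp add: u_def)
  then have "s = q *[M] aa (i-1) +[M] r *[M] bb i" using r pq by (simp add: M.M.a_comm)
  then show ?thesis using r pq by blast
 qed
qed

section \<open>Splitting off indecomposable projective modules\<close>

abbreviation "eA i \<equiv> idempotent_module A (ee i)"

lemma eA_fd: "fdm (eA i)" by (rule idempotent_fd) simp

lemma eA_mem: "x \<in> $(eA i) \<longleftrightarrow> x \<in> $A \<and> ee i \<otimes> x = x" by (rule idempotent_mem) simp_all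

lemma eA_projective: "projective (eA i)" by (rule idempotent_projective) simp_all

text \<open>\<open>x \<mapsto> t x\<close> is a section of f, so \<open>e_i A\<close> splits off.
  That the kernel is a proper submodule is what lets the later inductions over submodules
  descend.\<close>

lemma peel_split:
 assumes M: "fdm M" and i: "1 \<le> i" "i \<le> n"
  and f: "mhom M (eA i) f" and t: "t \<in> $M" "t *[M] ee i = t" "f t = ee i"
 obtains K g h where "submod K M" "K \<noteq> $M" "mod_iso M (direct_sum (eA i) (M |. K)) g h"
proof -
 interpret M: amod A M by (rule amodI[OF M])
 have s: "mhom (eA i) M (\<lambda>x. t *[M] x)" using t by (intro module_homI) (auto simp: eA_mem M.ract_add_right M.ract_mult)
 have fs: "f (t *[M] x) = x" if "x \<in> $(eA i)" for x using that t module_homD(3)[OF f, of t x] by (simp add: eA_mem)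
 define K where "K = {x \<in> $M. f x = \<zero>[eA i]}"
 have "submod K M" unfolding K_def by (rule kernel_submodule[OF M eA_fd f])
 moreover have "t \<notin> K"
 proof
  assume "t \<in> K"
  then have "ee i = \<zero>" using t by (simp add: K_def)
  then have "co (Ix_e i) (ee i) = 0" by simp
  then show False using i by simp
 qed
 moreover obtain g h where "mod_iso M (direct_sum (eA i) (M |. K)) g h" using split_iso[OF M eA_fd f s fs] unfolding K_def by blast
 ultimately show ?thesis using that t by blast
qed

text \<open>For i < n the coefficient of \<open>c_i\<close> identifies \<open>e_i A\<close> with the
  dual of \<open>A e_i\<close>, so homomorphisms from M to \<open>e_i A\<close> are functionals on
  \<open>M e_i\<close>. The \<open>c_i\<close>-coordinate of \<open>f (v x)\<close> is \<mu> at
  \<open>v x e_i\<close>, and the other coordinates of \<open>f v\<close> are forced by taking x to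
  be an arrow or \<open>c_i\<close>.\<close>

lemma frobenius_hom:
 assumes M: "fdm M" and i: "1 \<le> i" "i < n" and \<mu>: "amod.functional A M \<mu>"
 defines "f \<equiv> \<lambda>v. mk (case_idx (\<lambda>j. if j = i then \<mu> (v *[M] cc i) else 0) (\<lambda>j. if j = i then \<mu> (v *[M] bb i) else 0)
   (\<lambda>j. if Suc j = i then \<mu> (v *[M] aa (i-1)) else 0) (\<lambda>j. if j = i then \<mu> (v *[M] ee i) else 0))"
 shows "mhom M (eA i) f"
proof -
 interpret M: amod A M by (rule amodI[OF M])
 have \<mu>a: "x \<in> $M ==> y \<in> $M ==> \<mu> (x +[M] y) = \<mu> x + \<mu> y"
  and \<mu>s: "x \<in> $M ==> \<mu> (sc M c x) = c * \<mu> x" for x y c using \<mu> unfolding M.functional_def by auto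
 have cof: "co (Ix_e j) (f v) = (if j = i then \<mu> (v *[M] cc i) else 0)"
  "co (Ix_a j) (f v) = (if j = i then \<mu> (v *[M] bb i) else 0)"
  "co (Ix_b j) (f v) = (if Suc j = i \<and> 1 \<le> j then \<mu> (v *[M] aa (i-1)) else 0)"
  "co (Ix_c j) (f v) = (if j = i then \<mu> (v *[M] ee i) else 0)" for j v using i by (auto simp: f_def mk)
 have fA: "f v \<in> $A" for v by (simp add: f_def mk)
 show ?thesis
 proof (rule module_homI)
  fix v assume v: "v \<in> $M"
  show "f v \<in> $(eA i)" unfolding eA_mem using fA i by (auto intro!: alg_eqI simp: co_simps cof)
  show "f (v +[M] w) = f v +[eA i] f w" if w: "w \<in> $M" for w
   using v w fA by (auto intro!: alg_eqI simp: co_simps cof M.ract_add_left \<mu>a)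
  show "f (v *[M] x) = f v *[eA i] x" if x: "x \<in> $A" for x
  proof -
   have 1: "(v *[M] x) *[M] cc i = sc M (co (Ix_e i) x) (v *[M] cc i)"
    using v x by (simp add: M.ract_mult[symmetric] mult_cc_expand M.act_scalar)
   have 2: "(v *[M] x) *[M] bb i = sc M (co (Ix_e (Suc i)) x) (v *[M] bb i) +[M] sc M (co (Ix_a i) x) (v *[M] cc i)"
    using v x by (simp add: M.ract_mult[symmetric] mult_bb_expand M.ract_add_right M.act_scalar)
   have 3: "(v *[M] x) *[M] aa (i-1) = sc M (co (Ix_e (i-1)) x) (v *[M] aa (i-1)) +[M] sc M (co (Ix_b (i-1)) x) (v *[M] cc i)"
    using v x i by (simp add: M.ract_mult[symmetric] mult_aa_expand M.ract_add_right M.act_scalar)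
   have 4: "(v *[M] x) *[M] ee i =
     (sc M (co (Ix_e i) x) (v *[M] ee i) +[M] sc M (co (Ix_b i) x) (v *[M] bb i)) +[M]
     (sc M (co (Ix_a (i-1)) x) (v *[M] aa (i-1)) +[M] sc M (co (Ix_c i) x) (v *[M] cc i))"
    using v x by (simp add: M.ract_mult[symmetric] mult_ee_expand M.ract_add_right M.act_scalar)
   show ?thesis
   proof (rule alg_eqI)
    show "co (Ix_a j) (f (v *[M] x)) = co (Ix_a j) (f v *[eA i] x)" for j
     using v x fA by (simp add: co_simps cof 2 \<mu>a \<mu>s algebra_simps)
    show "co (Ix_b j) (f (v *[M] x)) = co (Ix_b j) (f v *[eA i] x)" for j
    proof (cases "Suc j = i")
     case True
     then have ij: "i - 1 = j" by simp
     show ?thesis using v x fA i True 3[unfolded ij] by (cases j) (auto simp: co_simps cof[unfolded ij] \<mu>a \<mu>s algebra_simps)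
    qed (use v x fA in \<open>simp add: co_simps cof\<close>)
    show "co (Ix_c j) (f (v *[M] x)) = co (Ix_c j) (f v *[eA i] x)" for j
     using v x fA i 4 by (cases "i = 1") (auto simp: co_simps cof \<mu>a \<mu>s algebra_simps)
   qed (use v x fA in \<open>auto simp: co_simps cof 1 \<mu>s\<close>)
  qed
 qed
qed

text \<open>A functional with value 1 at \<open>t c_i\<close> gives a homomorphism that sends
  \<open>t e_i\<close> to \<open>e_i\<close> up to a multiple of \<open>c_i\<close>. Adding a
  multiple of \<open>t c_i\<close> to \<open>t e_i\<close> removes this error without changing the
  products used.\<close>

lemma peel:
 assumes M: "fdm M" and i: "1 \<le> i" "i < n"
  and t: "t \<in> $M" "t *[M] cc i \<noteq> \<zero>[M]"
 obtains K g h where "submod K M" "K \<noteq> $M" "mod_iso M (direct_sum (eA i) (M |. K)) g h"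
proof -
 interpret M: amod A M by (rule amodI[OF M])
 obtain \<mu> where \<mu>: "M.functional \<mu>" "\<mu> (t *[M] cc i) = 1" using M.functional_ex[of "t *[M] cc i"] t by auto
 have \<mu>a: "x \<in> $M ==> y \<in> $M ==> \<mu> (x +[M] y) = \<mu> x + \<mu> y"
  and \<mu>s: "x \<in> $M ==> \<mu> (sc M c x) = c * \<mu> x" for x y c using \<mu> unfolding M.functional_def by auto
 have \<mu>0: "\<mu> \<zero>[M] = 0" using \<mu>s[of "\<zero>[M]" 0] by simp
 define f where "f = (\<lambda>v. mk (case_idx (\<lambda>j. if j = i then \<mu> (v *[M] cc i) else 0) (\<lambda>j. if j = i then \<mu> (v *[M] bb i) else 0)
   (\<lambda>j. if Suc j = i then \<mu> (v *[M] aa (i-1)) else 0) (\<lambda>j. if j = i then \<mu> (v *[M] ee i) else 0)))"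
 have f: "mhom M (eA i) f" unfolding f_def by (rule frobenius_hom[OF M i \<mu>(1)])
 define t0 where "t0 = t *[M] ee i"
 have t0: "t0 \<in> $M" "t0 *[M] ee i = t0" "t0 *[M] cc i = t *[M] cc i" "t0 *[M] bb i = \<zero>[M]"
  "t0 *[M] aa (i-1) = \<zero>[M]" using t i by (auto simp: t0_def M.ract_mult[symmetric] mult_table)
 define k where "k = - \<mu> t0"
 define u where "u = t0 +[M] sc M k (t *[M] cc i)"
 have u: "u \<in> $M" "u *[M] ee i = u" "u *[M] cc i = t *[M] cc i" "u *[M] bb i = \<zero>[M]"
  "u *[M] aa (i-1) = \<zero>[M]" "\<mu> u = 0"
  using t t0 i by (auto simp: u_def M.ract_add_left M.sc_act M.ract_mult[symmetric] mult_table \<mu>a \<mu>s \<mu>(2) k_def)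
 have "f u = ee i" unfolding f_def u(2-5) \<mu>0 \<mu>(2) u(6) using i by (intro alg_eqI) (auto simp: mk)
 then show ?thesis using peel_split[OF M i(1) less_imp_le[OF i(2)] f u(1,2)] that by metis
qed

lemma component_induct:
 assumes M: "fdm M" and U: "subspace M U"
  and c: "\<And>i. 1 \<le> i ==> i \<le> n ==> v *[M] ee i \<in> U" and v: "v \<in> $M"
 shows "v \<in> U"
proof -
 interpret M: amod A M by (rule amodI[OF M])
 define f where "f k = mk (case_idx (\<lambda>j. if j \<le> k then 1 else 0) (\<lambda>_. 0) (\<lambda>_. 0) (\<lambda>_. 0))" for k :: nat
 have "v *[M] f k \<in> U" if "k \<le> n" for k using that
 proof (induction k)
  case 0
  have "f 0 = \<zero>" by (rule alg_eqI) (auto simp: f_def mk)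
  then show ?case using v subspaceD(2)[OF U] by simp
 next
  case (Suc k)
  have "f (Suc k) = f k \<oplus> ee (Suc k)" using Suc.prems by (intro alg_eqI) (auto simp: f_def mk co_simps)
  moreover have "f k \<in> $A" by (simp add: f_def mk)
  ultimately have "v *[M] f (Suc k) = v *[M] f k +[M] v *[M] ee (Suc k)" using v by (simp add: M.ract_add_right)
  then show ?case using Suc c subspaceD(3)[OF U] by simp
 qed
 moreover have "f n = \<one>" by (rule alg_eqI) (auto simp: f_def mk co_simps)
 ultimately show ?thesis using v by (metis M.ract_one order_refl)
qed

text \<open>Once all \<open>c_i\<close> act as zero, exactness leaves vectors only at the vertices n
  - 1 and n. A nonzero vector t at n exists, and \<open>H 0\<close> makes \<open>t b_{n-1}\<close>
  nonzero, so t generates a copy of \<open>e_n A\<close>.\<close>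

lemma last_peel:
 assumes M: "fdm M" and H: "\<And>j. j < 2 * n - 2 ==> H j M"
  and nz: "\<not> zero_module M" and c0: "\<And>i t. 1 \<le> i ==> i < n ==> t \<in> $M ==> t *[M] cc i = \<zero>[M]"
 obtains K g h where "submod K M" "K \<noteq> $M" "mod_iso M (direct_sum (eA n) (M |. K)) g h"
proof -
 interpret M: amod A M by (rule amodI[OF M])
 \<comment> \<open>The part through \<open>a_{i-1}\<close> vanishes: a second application of
   \<open>socle_to_radical\<close>, to its source vector, turns it into
   \<open>y b_{i-1} a_{i-1} = y c_i = 0\<close>.\<close>
 have rad: "\<exists>q\<in>$M. v = q *[M] bb i \<and> q *[M] ee (Suc i) = q"
  if i: "1 \<le> i" "i < n" and v: "v \<in> $M" "v *[M] ee i = v" for i v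
 proof -
  obtain p q where pq: "p \<in> $M" "q \<in> $M" "v = p *[M] aa (i-1) +[M] q *[M] bb i"
   using socle_to_radical[OF M H i v c0[OF i v(1)]] by blast
  have "p *[M] aa (i-1) = \<zero>[M]"
  proof (cases "i = 1")
   case False
   define p' where "p' = p *[M] ee (i-1)"
   have p': "p' \<in> $M" "p' *[M] ee (i-1) = p'" "p *[M] aa (i-1) = p' *[M] aa (i-1)"
    using pq False i by (auto simp: p'_def M.ract_mult[symmetric] mult_table)
   have i': "1 \<le> i - 1" "i - 1 < n" using i False by auto
   obtain x y where xy: "x \<in> $M" "y \<in> $M" "p' = x *[M] aa (i-1-1) +[M] y *[M] bb (i-1)"
    using socle_to_radical[OF M H i' p'(1,2) c0[OF i' p'(1)]] by blast
   have "p' *[M] aa (i-1) = y *[M] cc i"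
    unfolding xy(3) using xy(1,2) i i' by (simp add: M.ract_add_left M.ract_mult[symmetric] mult_table)
   then show ?thesis using p'(3) c0[OF i xy(2)] by simp
  qed (use pq in simp)
  then have "v = q *[M] bb i" using pq by simp
  then show ?thesis using pq i by (intro bexI[of _ "q *[M] ee (Suc i)"]) (auto simp: M.ract_mult[symmetric] mult_table)
 qed
 \<comment> \<open>Two steps of \<open>rad\<close> end in the product
   \<open>b_{i+1} b_i = 0\<close>.\<close>
 have low: "v = \<zero>[M]" if i: "1 \<le> i" "Suc i < n" and v: "v \<in> $M" "v *[M] ee i = v" for i v
 proof -
  obtain q where q: "q \<in> $M" "v = q *[M] bb i" "q *[M] ee (Suc i) = q" using rad[of i v] i v by auto
  obtain r where r: "r \<in> $M" "q = r *[M] bb (Suc i)" using rad[of "Suc i" q] i q by auto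
  show ?thesis unfolding q(2) r(2) using r(1) by (simp add: M.ract_mult[symmetric] mult_rad)
 qed
 have n1: "1 \<le> n - 1" "n - 1 < n" "Suc (n - 1) = n" using n2 by auto
 have "\<exists>t. t \<in> $M \<and> t *[M] ee n \<noteq> \<zero>[M]"
 proof (rule ccontr)
  assume a: "\<nexists>t. t \<in> $M \<and> t *[M] ee n \<noteq> \<zero>[M]"
  have "v = \<zero>[M]" if v: "v \<in> $M" for v
  proof -
   have "v *[M] ee i = \<zero>[M]" if i: "1 \<le> i" "i \<le> n" for i
   proof -
    have vi: "v *[M] ee i \<in> $M" "(v *[M] ee i) *[M] ee i = v *[M] ee i" using v by (simp_all add: M.ract_mult[symmetric])
    consider "i = n" | "Suc i = n" | "Suc i < n" using i by linarith
    then show ?thesis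
    proof cases
     case 2
     then obtain q where "q \<in> $M" "v *[M] ee i = q *[M] bb i" "q *[M] ee n = q" using rad[OF i(1) _ vi] by auto
     then show ?thesis using a by force
    qed (use a v low[OF i(1) _ vi] in auto)
   qed
   note vi = this
   have "v \<in> {\<zero>[M]}" by (rule component_induct[OF M M.subspace_zero]) (use v vi in auto)
   then show ?thesis by simp
  qed
  then show False using nz by (auto simp: zero_module_def)
 qed
 then obtain t0 where t0: "t0 \<in> $M" "t0 *[M] ee n \<noteq> \<zero>[M]" by blast
 define t where "t = t0 *[M] ee n"
 have t: "t \<in> $M" "t *[M] ee n = t" "t \<noteq> \<zero>[M]" using t0 by (auto simp: t_def M.ract_mult[symmetric])
 have "t *[M] bb (n-1) \<noteq> \<zero>[M]"
 proof
  assume "t *[M] bb (n-1) = \<zero>[M]"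
  then have "\<exists>w\<in>$M. t = w *[M] yy 0" using HD[OF H[of 0], of t] t n2 by (auto simp: eps_def yy_def)
  then show False using t by (auto simp: yy_def)
 qed
 then obtain \<mu> where \<mu>: "M.functional \<mu>" "\<mu> (t *[M] bb (n-1)) = 1" using M.functional_ex[of "t *[M] bb (n-1)"] t by auto
 have \<mu>a: "x \<in> $M ==> y \<in> $M ==> \<mu> (x +[M] y) = \<mu> x + \<mu> y"
  and \<mu>s: "x \<in> $M ==> \<mu> (sc M c x) = c * \<mu> x" for x y c using \<mu> unfolding M.functional_def by auto
 have \<mu>0: "\<mu> \<zero>[M] = 0" using \<mu>s[of "\<zero>[M]" 0] by simp
 \<comment> \<open>The analogue of the Frobenius form for \<open>e_n A\<close>, whose socle is
   spanned by \<open>b_{n-1}\<close>: the coordinate at \<open>b_{n-1}\<close> is \<mu> of the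
   component at n - 1.\<close>
 define f where "f = (\<lambda>v. mk (case_idx (\<lambda>j. if j = n then \<mu> (v *[M] bb (n-1)) else 0) (\<lambda>_. 0)
   (\<lambda>j. if Suc j = n then \<mu> (v *[M] ee (n-1)) else 0) (\<lambda>_. 0)))"
 have cof: "co (Ix_e j) (f v) = (if j = n then \<mu> (v *[M] bb (n-1)) else 0)"
  "co (Ix_a j) (f v) = 0"
  "co (Ix_b j) (f v) = (if Suc j = n then \<mu> (v *[M] ee (n-1)) else 0)"
  "co (Ix_c j) (f v) = 0" for j v using n2 by (auto simp: f_def mk)
 have fA: "f v \<in> $A" for v by (simp add: f_def mk)
 \<comment> \<open>Compatibility of f with the action involves \<open>v a_{n-2}\<close>, which
   starts at a vertex without vectors, or is zero if n = 2.\<close>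
 have az: "v *[M] aa (n-1-1) = \<zero>[M]" if v: "v \<in> $M" for v
 proof (cases "n = 2")
  case False
  then have "1 \<le> n - 2" "Suc (n - 2) < n" using n2 by auto
  from low[OF this, of "v *[M] ee (n-2)"] have z: "v *[M] ee (n-2) = \<zero>[M]" using v by (simp add: M.ract_mult[symmetric])
  have "v *[M] aa (n-2) = (v *[M] ee (n-2)) *[M] aa (n-2)" using v by (simp add: M.ract_mult[symmetric] mult_ea)
  then show ?thesis using z by (simp add: numeral_2_eq_2)
 next
  case True
  then have "aa (n-1-1) = \<zero>" by (intro bas_out) simp
  then show ?thesis using v by simp
 qed
 have f: "mhom M (eA n) f"
 proof (rule module_homI)
  fix v assume v: "v \<in> $M"
  show "f v \<in> $(eA n)" unfolding eA_mem using fA n2 by (auto intro!: alg_eqI simp: co_simps cof)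
  show "f (v +[M] w) = f v +[eA n] f w" if w: "w \<in> $M" for w
   using v w fA by (auto intro!: alg_eqI simp: co_simps cof M.ract_add_left \<mu>a)
  show "f (v *[M] x) = f v *[eA n] x" if x: "x \<in> $A" for x
  proof -
   have 1: "(v *[M] x) *[M] bb (n-1) = sc M (co (Ix_e n) x) (v *[M] bb (n-1))"
    using v x c0[OF n1(1,2) v] n1 by (simp add: M.ract_mult[symmetric] mult_bb_expand M.ract_add_right M.act_scalar)
   have 2: "(v *[M] x) *[M] ee (n-1) =
     sc M (co (Ix_e (n-1)) x) (v *[M] ee (n-1)) +[M] sc M (co (Ix_b (n-1)) x) (v *[M] bb (n-1))" using v x c0[OF n1(1,2) v] az[OF v]
    by (simp add: M.ract_mult[symmetric] mult_ee_expand M.ract_add_right M.act_scalar)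
   show ?thesis
   proof (rule alg_eqI)
    show "co (Ix_b j) (f (v *[M] x)) = co (Ix_b j) (f v *[eA n] x)" for j
    proof (cases "Suc j = n")
     case True
     then have "n - 1 = j" by simp
     then show ?thesis using v x fA True by (simp add: co_simps cof 2[unfolded \<open>n - 1 = j\<close>] \<mu>a \<mu>s algebra_simps)
    qed (use v x fA in \<open>simp add: co_simps cof\<close>)
    show "co (Ix_c j) (f (v *[M] x)) = co (Ix_c j) (f v *[eA n] x)" for j using v x fA by (simp add: co_simps cof)
   qed (use v x fA 1 in \<open>auto simp: co_simps cof \<mu>s\<close>)
  qed
 qed
 have "t *[M] ee (n-1) = \<zero>[M]"
 proof -
  have "t *[M] ee (n-1) = t0 *[M] (ee n \<otimes> ee (n-1))" unfolding t_def using t0 by (simp add: M.ract_mult)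
  then show ?thesis using n1 t0 by (simp add: mult_ee)
 qed
 then have "f t = ee n" using \<mu>(2) \<mu>0 fA n2 by (intro alg_eqI) (auto simp: cof)
 then show ?thesis using peel_split[OF M _ order_refl f t(1,2)] that n2 by (metis n1(1) One_nat_def Suc_le_eq n1(3) zero_less_Suc)
qed

text \<open>Minimal counterexample: a smallest submodule that is exact below 2n - 2 but not
  projective still splits off some \<open>e_i A\<close>. The complement is exact and smaller, hence
  projective, and so is the sum.\<close>

lemma projective_iff_H:
 assumes M: "fdm M"
 shows "projective M \<longleftrightarrow> (\<forall>j<2*n-2. H j M)"
proof
 assume "projective M" then show "\<forall>j<2*n-2. H j M" using projective_H by blast
next
 assume HM: "\<forall>j<2*n-2. H j M"
 interpret M: amod A M by (rule amodI[OF M])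
 show "projective M"
 proof (rule ccontr)
  assume np: "\<not> projective M"
  define P where "P U \<longleftrightarrow> submod U M \<and> (\<forall>j<2*n-2. H j (M |. U)) \<and> \<not> projective (M |. U)" for U
  have "P ($M)" using HM np M.submodule_carrier by (simp add: P_def)
  moreover have "subspace M U" if "P U" for U using that by (auto simp: P_def intro: submodule_subspace)
  ultimately obtain U where U: "P U" and m: "\<And>V. P V ==> V \<subseteq> U ==> V = U"
   by (rule M.minimal_subspace[of P]) blast+
  define N where "N = (M |. U)"
  have Us: "submod U M" using U by (simp add: P_def)
  have N: "fdm N" unfolding N_def by (rule submodule_module[OF M Us])
  have HN: "\<And>j. j < 2*n-2 ==> H j N" and nN: "\<not> projective N" using U by (auto simp: P_def N_def)
  have "\<not> zero_module N" using zero_projective[OF N] nN by blast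
  have "\<exists>i K g h. submod K N \<and> K \<noteq> $N \<and> mod_iso N (direct_sum (eA i) (N |. K)) g h"
  proof (cases "\<exists>i t. 1 \<le> i \<and> i < n \<and> t \<in> $N \<and> t *[N] cc i \<noteq> \<zero>[N]")
   case True
   then obtain i t where t: "1 \<le> i" "i < n" "t \<in> $N" "t *[N] cc i \<noteq> \<zero>[N]" by blast
   show ?thesis by (rule peel[OF N t]) blast
  next
   case False
   then have c0: "\<And>i t. 1 \<le> i ==> i < n ==> t \<in> $N ==> t *[N] cc i = \<zero>[N]" by blast
   show ?thesis by (rule last_peel[OF N HN \<open>\<not> zero_module N\<close> c0]) blast+
  qed
  then obtain i K g h where K: "submod K N" "K \<noteq> $N" "mod_iso N (direct_sum (eA i) (N |. K)) g h" by blast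
  have Ks: "submod K M" "K \<subseteq> U" "K \<noteq> U" "(N |. K) = (M |. K)"
   using K submodule_trans[OF Us] by (auto simp: N_def rsubmodule_def)
  have Kfd: "fdm (N |. K)" by (rule submodule_module[OF N K(1)])
  have "H j (N |. K)" if "j < 2*n-2" for j
   using H_iso[OF N direct_sum_fd[OF eA_fd Kfd] K(3) HN[OF that]] H_direct_sum[OF eA_fd Kfd] by blast
  then have pK: "projective (N |. K)" using m[of K] Ks by (auto simp: P_def)
  have "projective N" by (rule projective_iso[OF projective_direct_sum[OF eA_projective pK] N mod_iso_sym[OF K(3)]])
  then show False using nN by blast
 qed
qed

section \<open>Dominant dimension\<close>

lemma injective_projective_iff:
 assumes "injective I" shows "projective I \<longleftrightarrow> H 0 I"
proof -
 have "0 < 2 * n - 2" using n2 by simp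
 then show ?thesis using projective_iff_H[OF injectiveD[OF assms]] injective_H[OF assms] by blast
qed

text \<open>A nonzero vector that violates \<open>H 0\<close> spans a simple submodule at the vertex
  n, and an essential submodule contains every simple submodule.\<close>

lemma essential_H0:
 assumes M: "fdm M" and I: "fdm I" and j: "mhom M I j" "inj_on j ($M)"
  and ess: "essential_submodule A (j ` $M) I"
 shows "H 0 I \<longleftrightarrow> H 0 M"
proof
 interpret M: amod A M by (rule amodI[OF M])
 interpret I: amod A I by (rule amodI[OF I])
 assume HI': "H 0 I"
 show "H 0 M"
 proof (rule HI)
  fix v assume v: "v \<in> $M" "v *[M] eps 0 = v" "v *[M] yy (Suc 0) = \<zero>[M]"
  obtain w where "w \<in> $I" "j v = w *[I] yy 0" using HD[OF HI', of "j v"] v module_homD(1,3)[OF j(1)] hom_zero[OF M I j(1)]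
   by (metis eps_closed yy_closed)
  then have "j v = j \<zero>[M]" by (simp add: hom_zero[OF M I j(1)] yy_def)
  then have "v = \<zero>[M]" using v j(2) by (simp add: inj_on_eq_iff)
  then show "\<exists>w\<in>$M. v = w *[M] yy 0" by (intro bexI[of _ "\<zero>[M]"]) auto
 qed
next
 interpret M: amod A M by (rule amodI[OF M])
 interpret I: amod A I by (rule amodI[OF I])
 assume HM: "H 0 M"
 show "H 0 I"
 proof (rule HI)
  fix v assume v: "v \<in> $I" "v *[I] eps 0 = v" "v *[I] yy (Suc 0) = \<zero>[I]"
  have vn: "v *[I] ee n = v" "v *[I] bb (n-1) = \<zero>[I]" using v n2 by (auto simp: eps_def yy_def)
  define V where "V = {sc I c v |c. True}"
  \<comment> \<open>Of the basis elements that start at n only \<open>e_n\<close> and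
    \<open>b_{n-1}\<close> are in range, and the latter kills v; so the line of v is a
    submodule.\<close>
  have va: "v *[I] x = sc I (co (Ix_e n) x) v" if "x \<in> $A" for x using act_expand[OF I v(1) vn(1) that] vn that v(1) by simp
  have Vs: "subspace I V" unfolding V_def by (rule I.subspace_line[OF v(1)])
  have V: "submod V I"
  proof (rule rsubmoduleI)
   fix x a assume "x \<in> V" and a: "a \<in> $A"
   then obtain c where c: "x = sc I c v" by (auto simp: V_def)
   then have "x *[I] a = sc I (c * co (Ix_e n) a) v" using v a by (simp add: I.sc_act va I.sc_mult)
   then show "x *[I] a \<in> V" by (auto simp: V_def)
  qed (use subspaceD[OF Vs] in auto)
  have vV: "v \<in> V" unfolding V_def using v by (auto intro!: exI[of _ 1])
  have "v = \<zero>[I]"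
  proof (rule ccontr)
   assume nz: "v \<noteq> \<zero>[I]"
   then have "V \<noteq> {\<zero>[I]}" using vV by blast
   then have "j ` $M \<inter> V \<noteq> {\<zero>[I]}" using ess V unfolding essential_submodule_def by blast
   moreover have "\<zero>[I] \<in> j ` $M \<inter> V"
    using ess rsubmoduleD(2)[OF V] unfolding essential_submodule_def rsubmodule_def by blast
   ultimately obtain y where y: "y \<in> j ` $M" "y \<in> V" "y \<noteq> \<zero>[I]" by blast
   then obtain c where c: "y = sc I c v" by (auto simp: V_def)
   obtain x where "x \<in> $M" "y = j x" using y by blast
   then have cx: "sc I c v \<noteq> \<zero>[I]" "x \<in> $M" "j x = sc I c v" using c y by simp_all
   have jx: "j (x *[M] eps 0) = j x" "j (x *[M] yy (Suc 0)) = j \<zero>[M]"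
    using cx v by (simp_all add: module_homD(3)[OF j(1)] I.sc_act hom_zero[OF M I j(1)])
   then have "x *[M] eps 0 = x" "x *[M] yy (Suc 0) = \<zero>[M]" using j(2) cx(2) by (simp_all add: inj_on_eq_iff)
   then obtain w where "w \<in> $M" "x = w *[M] yy 0" using HD[OF HM cx(2)] by blast
   then have "x = \<zero>[M]" by (simp add: yy_def)
   then show False using cx hom_zero[OF M I j(1)] by simp
  qed
  then show "\<exists>w\<in>$I. v = w *[I] yy 0" by (intro bexI[of _ "\<zero>[I]"]) auto
 qed
qed

text \<open>\<open>H 0 M\<close> passes to the injective hull and makes it exact everywhere. The
  cosyzygy then carries the exactness of M moved by one place.\<close>

lemma minimal_resolution_H:
 assumes M: "fdm M" and res: "minimal_injective_resolution A M I j d"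
 defines "C \<equiv> (I 1)\<lparr>carrier := d 0 ` $(I 0)\<rparr>"
 shows "projective (I 0) \<longleftrightarrow> H 0 M" "H 0 M ==> H i C \<longleftrightarrow> H (Suc i) M"
proof -
 note st = minimal_resolution_step[OF M res, folded C_def]
 have I: "injective (I 0)" and e: "essential_submodule A (j ` $M) (I 0)" using res by (auto simp: minimal_injective_resolution_def)
 have HI0: "H 0 (I 0) \<longleftrightarrow> H 0 M" by (rule essential_H0[OF sesD(1,2,4,6)[OF st(2)] e])
 then show "projective (I 0) \<longleftrightarrow> H 0 M" using injective_projective_iff[OF I] by simp
 assume "H 0 M"
 then have "H i (I 0)" for i using injective_H[OF I] HI0 by blast
 then show "H i C \<longleftrightarrow> H (Suc i) M" using ses_chase_right[OF st(2)] ses_chase_left[OF st(2)] by blast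
qed

text \<open>The induction replaces M by its cosyzygy, which has the universe type. It is therefore
  run for that type, and a module of another type gets its first step separately.\<close>

lemma minimal_resolution_projectives_umodule:
 fixes M :: "('k, 'a) umodule"
 shows "fdm M ==> minimal_injective_resolution A M I j d ==>
  (\<forall>i<k. projective (I i)) \<longleftrightarrow> (\<forall>i<k. H i M)"
proof (induction k arbitrary: M I j d)
 case (Suc k)
 define C where "C = (I 1)\<lparr>carrier := d 0 ` $(I 0)\<rparr>"
 note st = minimal_resolution_step[OF Suc.prems, folded C_def]
 note h = minimal_resolution_H[OF Suc.prems, folded C_def]
 have "(\<forall>i<k. projective (I (Suc i))) \<longleftrightarrow> (\<forall>i<k. H i C)" by (rule Suc.IH[OF modulesD[OF st(1)] st(3)])
 then show ?case using h by (auto simp: All_less_Suc2)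
qed simp

lemma minimal_resolution_projectives:
 assumes "fdm M" "minimal_injective_resolution A M I j d"
 shows "(\<forall>i<k. projective (I i)) \<longleftrightarrow> (\<forall>i<k. H i M)"
proof (cases k)
 case (Suc k')
 define C where "C = (I 1)\<lparr>carrier := d 0 ` $(I 0)\<rparr>"
 note st = minimal_resolution_step[OF assms, folded C_def]
 note h = minimal_resolution_H[OF assms, folded C_def]
 have "(\<forall>i<k'. projective (I (Suc i))) \<longleftrightarrow> (\<forall>i<k'. H i C)"
  by (rule minimal_resolution_projectives_umodule[OF modulesD[OF st(1)] st(3)])
 then show ?thesis using h unfolding Suc by (auto simp: All_less_Suc2)
qed simp

lemma domdim_ge_iff:
 assumes M: "fdm M"
 shows "enat k \<le> domdim A M \<longleftrightarrow> (\<forall>i<k. H i M)"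
proof -
 define I where "I = (SOME I. \<exists>j d. minimal_injective_resolution A M I j d)"
 have "\<exists>j d. minimal_injective_resolution A M I j d" unfolding I_def by (rule someI_ex[OF minimal_injective_resolution_ex[OF M]])
 then obtain j d where res: "minimal_injective_resolution A M I j d" by blast
 let ?P = "\<lambda>i. projective (I i)"
 let ?S = "{enat k | k. \<forall>i\<le>k. ?P i}"
 have dd: "domdim A M = (if ?P 0 then Sup ?S + 1 else 0)" unfolding domdim_def I_def[symmetric] by (simp add: Let_def)
 have "enat k \<le> domdim A M \<longleftrightarrow> (\<forall>i<k. ?P i)"
 proof (cases k)
  case 0 then show ?thesis by (simp add: enat_0)
 next
  case (Suc m)
  show ?thesis
  proof
   assume le: "enat k \<le> domdim A M"
   then have P0: "?P 0" using dd Suc by (cases "?P 0") (auto simp: enat_0_iff)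
   show "\<forall>i<k. ?P i"
   proof (rule ccontr)
    assume "\<not> (\<forall>i<k. ?P i)"
    then obtain q where q: "q \<le> m" "\<not> ?P q" using Suc by (auto simp: less_Suc_eq_le)
    then have qp: "q > 0" using P0 by (cases q) auto
    \<comment> \<open>A nonprojective term at q keeps the supremum at most q - 1, and the 1 added in
      the definition raises the bound to q.\<close>
    have "x \<le> enat (q - 1)" if "x \<in> ?S" for x using that q(2) qp by (auto simp: not_le) (metis Suc_pred leI le_SucE less_Suc_eq_le)
    then have "Sup ?S \<le> enat (q - 1)" by (rule Sup_least)
    then have "domdim A M \<le> enat (q - 1) + 1" using dd P0 by (simp add: add_right_mono)
    also have "\<dots> = enat q" using qp by (simp add: one_enat_def)
    finally have "enat k \<le> enat q" using le by order
    then show False using q Suc by simp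
   qed
  next
   assume a: "\<forall>i<k. ?P i"
   then have P0: "?P 0" using Suc by simp
   have "enat m \<in> ?S" using a Suc by auto
   then have "enat m \<le> Sup ?S" by (rule Sup_upper)
   then have "enat m + 1 \<le> Sup ?S + 1" by (rule add_right_mono)
   then show "enat k \<le> domdim A M" using dd P0 Suc by (simp add: one_enat_def)
  qed
 qed
 then show ?thesis using minimal_resolution_projectives[OF M res] by simp
qed

text \<open>Passing to the kernel of a projective cover map moves exactness one place to the right,
  so after k steps the syzygy is exact at all places below 2n - 2, which means that it is
  projective.\<close>

lemma resolution_upper_umodule:
 fixes M :: "('k, 'a) umodule"
 shows "M \<in> modules A ==> (\<forall>j. j + k < 2 * n - 2 \<longrightarrow> H j M) ==>
  \<exists>P p d. proj_res M P p d \<and> (\<forall>i>k. zero_module (P i))"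
proof (induction k arbitrary: M)
 case 0
 then have "projective M" using projective_iff_H[OF modulesD[OF 0(1)]] by simp
 then show ?case using projective_resolution_projective[OF 0(1)] by blast
next
 case (Suc k)
 obtain F p where F: "F \<in> modules A" "projective F" "mhom F M p" "p ` $F = $M"
  by (rule enough_projectives[OF modulesD[OF Suc.prems(1)], of "\<lambda>_. True"]) blast+
 define N where "N = F\<lparr>carrier := {x \<in> $F. p x = \<zero>[M]}\<rparr>"
 have s: "ses N F M (\<lambda>x. x) p" unfolding N_def by (rule ses_kernel[OF modulesD[OF F(1)] modulesD[OF Suc.prems(1)] F(3,4)])
 have N: "N \<in> modules A" using sesD(1)[OF s] by (simp add: modules_def)
 have "H j N" if j: "j + k < 2 * n - 2" for j
 proof (cases j)
  case 0
  then show ?thesis using ses_chase_zero[OF s] projective_H[OF F(2), of 0] n2 by simp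
 next
  case (Suc i)
  then show ?thesis using ses_chase_left[OF s] Suc.prems(2) projective_H[OF F(2), of "Suc i"] j by auto
 qed
 then obtain P p' d where r: "proj_res N P p' d" "\<forall>i>k. zero_module (P i)" using Suc.IH[OF N] by blast
 have z: "\<forall>i>Suc k. zero_module (case_nat F P i)" using r(2) by (auto split: nat.splits)
 show ?case by (rule exI[of _ "case_nat F P"], rule exI[of _ p], rule exI[of _ "case_nat (\<lambda>x. p' x) d"],
   rule conjI[OF projective_resolution_splice[OF s F(1,2) r(1)] z])
qed

lemma projective_resolutionD:
 assumes "proj_res M P p d"
 shows "\<forall>i. P i \<in> modules A" "mhom (P 0) M p" "\<forall>i. mhom (P (Suc i)) (P i) (d i)"
  "p ` $(P 0) = $M" "d 0 ` $(P 1) = {x \<in> $(P 0). p x = \<zero>[M]}"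
  "\<forall>i. d (Suc i) ` $(P (Suc (Suc i))) = {x \<in> $(P (Suc i)). d i x = \<zero>[P i]}"
  "\<forall>i. projective (P i)"
proof -
 note r = assms[unfolded projective_resolution_def exact_left_resolution_def a_kernel_def']
 show "\<forall>i. P i \<in> modules A" using r by (elim conjE)
 show "mhom (P 0) M p" using r by (elim conjE)
 show "\<forall>i. mhom (P (Suc i)) (P i) (d i)" using r by (elim conjE)
 show "p ` $(P 0) = $M" using r by (elim conjE)
 show "d 0 ` $(P 1) = {x \<in> $(P 0). p x = \<zero>[M]}" using r by (elim conjE)
 show "\<forall>i. d (Suc i) ` $(P (Suc (Suc i))) = {x \<in> $(P (Suc i)). d i x = \<zero>[P i]}" using r by (elim conjE)
 show "\<forall>i. projective (P i)" using r by (elim conjE)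
qed

lemma iso_zero_iff:
 assumes M: "fdm M" and N: "fdm N" and i: "mod_iso M N f g" and x: "x \<in> $M"
 shows "f x = \<zero>[N] \<longleftrightarrow> x = \<zero>[M]"
proof -
 interpret M: amod A M by (rule amodI[OF M])
 show ?thesis using inj_on_eq_iff[OF mod_isoD(6)[OF i] x M.M.zero_closed] hom_zero[OF M N mod_isoD(1)[OF i]] by simp
qed

lemma projective_resolution_iso:
 assumes M: "fdm M" and N: "fdm N" and i: "mod_iso M N f g"
  and res: "proj_res M P p d"
 shows "proj_res N P (\<lambda>x. f (p x)) d"
proof -
 note r = projective_resolutionD[OF res]
 have "(\<lambda>x. f (p x)) ` $(P 0) = f ` (p ` $(P 0))" by (simp add: image_image)
 then have 1: "(\<lambda>x. f (p x)) ` $(P 0) = $N" unfolding r(4) mod_isoD(5)[OF i] .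
 have 2: "{x \<in> $(P 0). f (p x) = \<zero>[N]} = {x \<in> $(P 0). p x = \<zero>[M]}"
  using iso_zero_iff[OF M N i] module_homD(1)[OF r(2)] by (intro Collect_cong) auto
 show ?thesis unfolding projective_resolution_def exact_left_resolution_def a_kernel_def' 2
  by (intro conjI r 1 module_hom_comp[OF r(2) mod_isoD(1)[OF i]])
qed

lemma resolution_upper:
 assumes M: "fdm M" and H: "\<forall>j. j + k < 2 * n - 2 \<longrightarrow> H j M"
 shows "projdim A M \<le> enat k"
proof -
 obtain M' f g where M': "(M' :: ('k, 'a) umodule) \<in> modules A" "mod_iso M M' f g" using universe_copy[OF M] by blast
 have "\<forall>j. j + k < 2 * n - 2 \<longrightarrow> H j M'" using H H_iso[OF M modulesD[OF M'(1)] M'(2)] by blast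
 then obtain P p d where r: "proj_res M' P p d" "\<forall>i>k. zero_module (P i)" using resolution_upper_umodule[OF M'(1)] by metis
 have "proj_res M P (\<lambda>x. g (p x)) d" by (rule projective_resolution_iso[OF modulesD[OF M'(1)] M mod_iso_sym[OF M'(2)] r(1)])
 then show ?thesis unfolding projdim_le_iff using r(2) by (intro exI conjI)
qed

text \<open>Read backwards, each syzygy returns its exactness to the module before it, one place
  lower. The start is the zero syzygy beyond the last term, which is exact everywhere.\<close>

lemma resolution_lower:
 fixes M :: "('k, 'a) umodule"
 shows "M \<in> modules A ==> proj_res M P p d ==> (\<forall>i>k. zero_module (P i)) ==>
  j + k < 2 * n - 2 ==> H j M"
proof (induction k arbitrary: M P p d j)
 case 0
 define N where "N = (P 0)\<lparr>carrier := {x \<in> $(P 0). p x = \<zero>[M]}\<rparr>"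
 note st = projective_resolution_step[OF modulesD[OF 0(1)] 0(2), folded N_def]
 have "zero_module N"
 proof -
  have p1: "d 0 ` $(P 1) = $N" "mhom (P 1) N (d 0)" "P 1 \<in> modules A"
   using st(4) unfolding projective_resolution_def exact_left_resolution_def by auto
  have "$(P 1) = {\<zero>[P 1]}" using 0(3) by (auto simp: zero_module_def)
  then show ?thesis using p1 hom_zero[OF modulesD[OF p1(3)] modulesD[OF st(1)] p1(2)] by (auto simp: zero_module_def)
 qed
 then show ?case using ses_chase_right[OF st(2)] projective_H[OF st(3)] H_zero[OF modulesD[OF st(1)]] 0(4) by simp
next
 case (Suc k)
 define N where "N = (P 0)\<lparr>carrier := {x \<in> $(P 0). p x = \<zero>[M]}\<rparr>"
 note st = projective_resolution_step[OF modulesD[OF Suc.prems(1)] Suc.prems(2), folded N_def]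
 have "H (Suc j) N" by (rule Suc.IH[OF st(1,4)]) (use Suc.prems in auto)
 then show ?case using ses_chase_right[OF st(2)] projective_H[OF st(3), of j] Suc.prems(4) by simp
qed

lemma projdim_le_iff_H:
 assumes M: "M \<in> modules A"
 shows "projdim A M \<le> enat k \<longleftrightarrow> (\<forall>j. j + k < 2 * n - 2 \<longrightarrow> H j M)"
 using resolution_upper[OF modulesD[OF M]] resolution_lower[OF M] unfolding projdim_le_iff by blast

lemma Dom_eq_H: "Dom A k = {M \<in> modules A. \<forall>j<k. H j M}" using domdim_ge_iff[OF modulesD] by (auto simp: Dom_def)

lemma Proj_eq_H: "Proj A (n - 1) = {M \<in> modules A. \<forall>j<n-1. H j M}"
proof -
 \<comment> \<open>The range 2n - 2 is twice n - 1, so dominant dimension at least n - 1 and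
   projective dimension at most n - 1 are one and the same exactness condition.\<close>
 have "j + (n - 1) < 2 * n - 2 \<longleftrightarrow> j < n - 1" for j using n2 by auto
 then show ?thesis using projdim_le_iff_H by (auto simp: Proj_def)
qed

lemma domdim_regular: "domdim A (regular) = enat (2 * n - 2)"
proof -
 have 1: "enat (2 * n - 2) \<le> domdim A (regular)" using domdim_ge_iff[OF regular_fd] H_regular by blast
 have 2: "\<not> enat (Suc (2 * n - 2)) \<le> domdim A (regular)" using domdim_ge_iff[OF regular_fd] not_H_regular by blast
 from 2 have "domdim A (regular) \<le> enat (2 * n - 2)" by (cases "domdim A (regular)") auto
 then show ?thesis using 1 by order
qed

text \<open>The example is the simple module at n, obtained from A by dividing out the elements
  without \<open>e_n\<close>-coordinate. It forces the global dimension up to 2n - 2.\<close>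

lemma not_H0_ex: obtains M :: "('k, 'a) umodule" where "M \<in> modules A" "\<not> H 0 M"
proof -
 interpret R: amod A "regular" by (rule amodI[OF regular_fd])
 define U where "U = {x \<in> $A. co (Ix_e n) x = 0}"
 have U: "submod U (regular)" by (rule rsubmoduleI) (auto simp: U_def co_simps)
 obtain Q p where Q: "(Q :: ('k, 'a) umodule) \<in> modules A" "mhom (regular) Q p"
   "p ` $(regular) = $Q" "U = {x \<in> $(regular). p x = \<zero>[Q]}" using cokernel_ex[OF regular_fd U] by blast
 interpret Q: amod A Q by (rule modules_amod[OF Q(1)])
 define v where "v = p (ee n)"
 have mem: "p x = \<zero>[Q] \<longleftrightarrow> co (Ix_e n) x = 0" if "x \<in> $A" for x
 proof -
  have "x \<in> U \<longleftrightarrow> p x = \<zero>[Q]" using that unfolding Q(4) by simp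
  then show ?thesis using that by (simp add: U_def)
 qed
 have act: "v *[Q] x = p (ee n \<otimes> x)" if "x \<in> $A" for x using module_homD(3)[OF Q(2), of "ee n" x] that by (simp add: v_def)
 have e0: "eps 0 = ee n" "yy (Suc 0) = bb (n - 1)" using n2 by (simp_all add: eps_def yy_def)
 have v: "v \<in> $Q" using module_homD(1)[OF Q(2), of "ee n"] by (simp add: v_def)
 have v': "v *[Q] eps 0 = v" unfolding e0 act[OF bas_closed] by (simp add: v_def)
 have v'': "v *[Q] yy (Suc 0) = \<zero>[Q]" unfolding e0 act[OF bas_closed] mem[OF mult_closed[OF bas_closed bas_closed]]
  by (simp add: co_simps)
 have nz: "v \<noteq> \<zero>[Q]" unfolding v_def mem[OF bas_closed] using n2 by simp
 note v = v v' v'' nz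
 have "\<not> H 0 Q"
 proof
  assume "H 0 Q"
  from HD[OF this v(1-3)] obtain w where "w \<in> $Q" "v = w *[Q] yy 0" .
  then show False using v(4) by (simp add: yy_def)
 qed
 then show ?thesis using that Q(1) by blast
qed

lemma gldim_eq: "gldim A = enat (2 * n - 2)"
proof (rule antisym)
 show "gldim A \<le> enat (2 * n - 2)" unfolding gldim_def by (rule SUP_least) (simp add: projdim_le_iff_H)
 obtain M :: "('k, 'a) umodule" where M: "M \<in> modules A" "\<not> H 0 M" by (rule not_H0_ex)
 have lt: "0 + (2 * n - 3) < 2 * n - 2" using n2 by linarith
 have "\<not> projdim A M \<le> enat (2 * n - 3)"
 proof
  assume "projdim A M \<le> enat (2 * n - 3)"
  then have "H 0 M" using projdim_le_iff_H[OF M(1)] lt by blast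
  then show False using M(2) by blast
 qed
 then have "enat (2 * n - 2) \<le> projdim A M" using n2 by (cases "projdim A M") auto
 also have "\<dots> \<le> gldim A" unfolding gldim_def by (rule SUP_upper[OF M(1)])
 finally show "enat (2 * n - 2) \<le> gldim A" .
qed

lemma higher_Auslander: "higher_Auslander_algebra A" unfolding higher_Auslander_algebra_def
 using fd_algebra_axioms gldim_eq domdim_regular n2 by (intro conjI exI[of _ "2 * n - 2"]) auto

end

section \<open>Standard and costandard modules\<close>

text \<open>The reflection that exchanges the arrows a and b, by which the opposite algebra becomes
  an instance of the same coordinates.\<close>

fun swap_idx :: "idx \<Rightarrow> idx" where
 "swap_idx (Ix_e i) = Ix_e i" | "swap_idx (Ix_a i) = Ix_b i"
| "swap_idx (Ix_b i) = Ix_a i" | "swap_idx (Ix_c i) = Ix_c i"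

lemma swap_swap [simp]: "swap_idx (swap_idx t) = t" by (cases t) auto

lemma idx_ok_swap [simp]: "idx_ok n (swap_idx t) = idx_ok n t" by (cases t) auto

section \<open>Cyclic modules and the construction of filtrations\<close>

context fd_algebra
begin

text \<open>A cyclic module recorded by a generator and its annihilator, which determine it up to
  isomorphism. The standard, costandard and simple modules enter the filtrations only through this
  data.\<close>

definition cyc :: "('a, 'm) rmodule \<Rightarrow> 'm \<Rightarrow> ('a \<Rightarrow> bool) \<Rightarrow> bool" where
 "cyc M v P \<longleftrightarrow> fdm M \<and> v \<in> $M \<and> $M = {v *[M] a |a. a \<in> $A} \<and>
   (\<forall>a\<in>$A. v *[M] a = \<zero>[M] \<longleftrightarrow> P a)"

lemma cycD:
 assumes "cyc M v P"
 shows "fdm M" "v \<in> $M" "$M = {v *[M] a |a. a \<in> $A}"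
  "a \<in> $A ==> v *[M] a = \<zero>[M] \<longleftrightarrow> P a" using assms by (auto simp: cyc_def)

lemma cyc_elim:
 assumes "cyc M v P" "z \<in> $M" obtains a where "a \<in> $A" "z = v *[M] a" using assms unfolding cyc_def by blast

lemma cyc_mod_iso:
 assumes M: "cyc M v P" and N: "cyc N w P"
 obtains f g where "mod_iso M N f g" "f v = w"
 using cyclic_iso[OF cycD(1)[OF M] cycD(1)[OF N] cycD(2,3)[OF M] cycD(2,3)[OF N]] cycD(4)[OF M] cycD(4)[OF N] by blast

definition extension :: "('a, 'm) rmodule \<Rightarrow> 'm set \<Rightarrow> 'm \<Rightarrow> 'm set" where
 "extension M U v = {u +[M] v *[M] x |u x. u \<in> U \<and> x \<in> $A}"

lemma extension_props:
 assumes M: "fdm M" and U: "submod U M" and v: "v \<in> $M"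
 shows "submod (extension M U v) M" "U \<subseteq> extension M U v" "v \<in> extension M U v"
proof -
 interpret M: amod A M by (rule amodI[OF M])
 note u = rsubmoduleD[OF U]
 have I: "x +[M] v *[M] a \<in> extension M U v" if "x \<in> U" "a \<in> $A" for x a using that by (auto simp: extension_def)
 show sub: "U \<subseteq> extension M U v"
 proof
  fix x assume "x \<in> U"
  then show "x \<in> extension M U v" using I[of x \<zero>] u(5) v by simp
 qed
 show "v \<in> extension M U v" using I[OF u(2), of \<one>] v by (simp add: M.ract_one)
 show "submod (extension M U v) M"
 proof (rule rsubmoduleI)
  show "extension M U v \<subseteq> $M" using u(5) v by (auto simp: extension_def)
  show "\<zero>[M] \<in> extension M U v" using u(2) sub by blast
 next
  fix x y assume "x \<in> extension M U v" "y \<in> extension M U v"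
  then obtain x1 a y1 b where *: "x1 \<in> U" "a \<in> $A" "x = x1 +[M] v *[M] a" "y1 \<in> U" "b \<in> $A"
   "y = y1 +[M] v *[M] b" by (auto simp: extension_def)
  then have "x +[M] y = (x1 +[M] y1) +[M] v *[M] (a \<oplus> b)" using u(5) v by (simp add: M.ract_add_right M.M.add_add_swap)
  then show "x +[M] y \<in> extension M U v" using I[of "x1 +[M] y1" "a \<oplus> b"] * u(3) by simp
 next
  fix x a assume "x \<in> extension M U v" and a: "a \<in> $A"
  then obtain x1 b where *: "x1 \<in> U" "b \<in> $A" "x = x1 +[M] v *[M] b" by (auto simp: extension_def)
  then have "x *[M] a = x1 *[M] a +[M] v *[M] (b \<otimes> a)" using u(5) v a by (simp add: M.ract_add_left M.ract_mult)
  then show "x *[M] a \<in> extension M U v" using I[of "x1 *[M] a" "b \<otimes> a"] * a u(4) by simp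
 qed
qed

lemma extension_quotient:
 assumes M: "fdm M" and U: "submod U M" and v: "v \<in> $M"
  and ann: "\<And>x. x \<in> $A ==> v *[M] x \<in> U \<longleftrightarrow> P x"
 shows "cyc (quotient_module (M |. extension M U v) U) (U +>\<^bsub>(M |. extension M U v)\<^esub> v) P"
proof -
 interpret M: amod A M by (rule amodI[OF M])
 let ?E = "extension M U v" and ?M = "(M |. extension M U v)"
 note ep = extension_props[OF M U v]
 have E: "fdm ?M" by (rule submodule_module[OF M ep(1)])
 have U': "submod U ?M" by (rule submodule_restrict[OF U ep(2)])
 note q = quotient_hom[OF E U']
 have act: "(U +>\<^bsub>?M\<^esub> v) *[quotient_module ?M U] a = U +>\<^bsub>?M\<^esub> (v *[M] a)" if "a \<in> $A" for a
  using module_homD(3)[OF q, of v a] that ep(3) by simp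
 have va: "v *[M] a \<in> $?M" if "a \<in> $A" for a using rsubmoduleD(4)[OF ep(1) ep(3) that] by simp
 show ?thesis unfolding cyc_def
 proof (intro conjI ballI)
  show "fdm (quotient_module ?M U)" by (rule quotient_fd[OF E U'])
  show "U +>\<^bsub>?M\<^esub> v \<in> $(quotient_module ?M U)" unfolding quotient_carrier using ep(3) by simp
  show "$(quotient_module ?M U) = {(U +>\<^bsub>?M\<^esub> v) *[quotient_module ?M U] a |a. a \<in> $A}"
  proof (intro equalityI subsetI)
   fix z assume "z \<in> $(quotient_module ?M U)"
   then obtain y where y: "y \<in> ?E" "z = U +>\<^bsub>?M\<^esub> y" unfolding quotient_carrier by auto
   then obtain u a where ua: "u \<in> U" "a \<in> $A" "y = u +[M] v *[M] a" by (auto simp: extension_def)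
   have "a_minus ?M y (v *[M] a) = u"
   proof -
    interpret E: amod A ?M by (rule amodI[OF E])
    have "y = u +[?M] v *[M] a" using ua by simp
    then show ?thesis using E.M.add_diff_cancel[of u "v *[M] a"] va[OF ua(2)] ua(1) ep(2) by auto
   qed
   then have "z = U +>\<^bsub>?M\<^esub> (v *[M] a)" using coset_eq_iff[OF E U', of y "v *[M] a"] y va[OF ua(2)] ua(1) by simp
   then show "z \<in> {(U +>\<^bsub>?M\<^esub> v) *[quotient_module ?M U] a |a. a \<in> $A}" using act ua(2) by auto
  next
   fix z assume "z \<in> {(U +>\<^bsub>?M\<^esub> v) *[quotient_module ?M U] a |a. a \<in> $A}"
   then show "z \<in> $(quotient_module ?M U)" using act va unfolding quotient_carrier by auto
  qed
  show "(U +>\<^bsub>?M\<^esub> v) *[quotient_module ?M U] a = \<zero>[quotient_module ?M U] \<longleftrightarrow> P a" if "a \<in> $A" for a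
   unfolding act[OF that] quotient_zero using coset_zero_iff[OF E U' va[OF that]] ann[OF that] by simp
 qed
qed

text \<open>Q is an invariant carried along the filtration, in the applications exactness of M
  relative to U. Among the submodules with a filtration and with Q there is a maximal one, and a
  proper one could be extended by a further factor.\<close>

lemma filtered_memI:
 assumes M: "M \<in> modules A" and z: "Q {\<zero>[M]}"
  and step: "\<And>U. submod U M ==> Q U ==> U \<noteq> $M ==>
   \<exists>v i P w. v \<in> $M \<and> v \<notin> U \<and> Q (extension M U v) \<and> i \<in> {1..n} \<and>
    cyc (\<Theta> i) w P \<and> (\<forall>x\<in>$A. v *[M] x \<in> U \<longleftrightarrow> P x)"
 shows "M \<in> filtered_modules A n \<Theta>"
proof -
 interpret M: amod A M by (rule modules_amod[OF M])
 note Mfd = modulesD[OF M]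
 define F where "F C \<longleftrightarrow> (\<exists>r (U :: nat \<Rightarrow> (nat \<Rightarrow> 'k) set). U 0 = {\<zero>[M]} \<and> U r = C \<and> (\<forall>t\<le>r. submod (U t) M) \<and>
    (\<forall>t<r. U t \<subseteq> U (Suc t) \<and>
     (\<exists>i\<in>{1..n}. module_iso A (quotient_module (M |. U (Suc t)) (U t)) (\<Theta> i))))" for C
 have F0: "F {\<zero>[M]}" unfolding F_def by (intro exI[of _ 0] exI[of _ "\<lambda>_. {\<zero>[M]}"]) (simp add: M.submodule_zero)
 have Fs: "submod C M" if "F C" for C using that unfolding F_def by blast
 have P0: "F {\<zero>[M]} \<and> Q {\<zero>[M]}" using F0 z by simp
 have Ps: "subspace M U" if "F U \<and> Q U" for U using Fs that by (blast intro: submodule_subspace)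
 obtain C where C: "F C \<and> Q C" and max: "\<And>V. F V \<and> Q V ==> C \<subseteq> V ==> V = C"
  by (rule M.maximal_subspace[of "\<lambda>C. F C \<and> Q C", OF P0 Ps]) blast+
 have "C = $M"
 proof (rule ccontr)
  assume "C \<noteq> $M"
  then obtain v i P w where v: "v \<in> $M" "v \<notin> C" "Q (extension M C v)" "i \<in> {1..n}" "cyc (\<Theta> i) w P"
   "\<forall>x\<in>$A. v *[M] x \<in> C \<longleftrightarrow> P x" using step[of C] C Fs by blast
  have Cs: "submod C M" using C Fs by blast
  note ep = extension_props[OF Mfd Cs v(1)]
  have "cyc (quotient_module (M |. extension M C v) C) (C +>\<^bsub>(M |. extension M C v)\<^esub> v) P"
   by (rule extension_quotient[OF Mfd Cs v(1)]) (use v(6) in blast)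
  then have iso: "module_iso A (quotient_module (M |. extension M C v) C) (\<Theta> i)" using cyc_mod_iso[OF _ v(5)] module_isoI by metis
  obtain r U where U: "U 0 = {\<zero>[M]}" "U r = C" "\<forall>t\<le>r. submod (U t) M"
    "\<forall>t<r. U t \<subseteq> U (Suc t) \<and>
     (\<exists>i\<in>{1..n}. module_iso A (quotient_module (M |. U (Suc t)) (U t)) (\<Theta> i))" using C unfolding F_def by blast
  define U' where "U' t = (if t \<le> r then U t else extension M C v)" for t
  have "F (extension M C v)" unfolding F_def
  proof (intro exI[of _ "Suc r"] exI[of _ U'] conjI allI impI)
   fix t assume t: "t < Suc r"
   show "U' t \<subseteq> U' (Suc t)" using U t ep by (auto simp: U'_def less_Suc_eq)
   show "\<exists>i\<in>{1..n}. module_iso A (quotient_module (M |. U' (Suc t)) (U' t)) (\<Theta> i)"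
   proof (cases "t = r")
    case True then show ?thesis using iso v(4) U(2) by (auto simp: U'_def)
   next
    case False then show ?thesis using U(4) t by (auto simp: U'_def)
   qed
  qed (use U ep in \<open>auto simp: U'_def\<close>)
  then have "extension M C v = C" using max v(3) ep(2) by blast
  then show False using ep(3) v(2) by blast
 qed
 then show ?thesis using C M unfolding F_def filtered_modules_def by blast
qed

end

section \<open>The radical, standard and simple modules\<close>

context coordinate_algebra
begin

text \<open>The elements without \<open>e_i\<close>-coordinate form a maximal right ideal.
  Conversely the arrow ideal is nilpotent, so it lies in every maximal right ideal.\<close>

lemma jacobson_eq: "jacobson_radical A = {x \<in> $A. \<forall>i. co (Ix_e i) x = 0}"
proof -
 interpret R: amod A "regular" by (rule amodI[OF regular_fd])
 show ?thesis
 proof (intro equalityI subsetI)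
  fix x assume x: "x \<in> jacobson_radical A"
  then have xA: "x \<in> $A" by (simp add: jacobson_radical_def)
  have "co (Ix_e i) x = 0" for i
  proof (cases "1 \<le> i \<and> i \<le> n")
   case True
   let ?U = "{x \<in> $A. co (Ix_e i) x = 0}"
   have U: "submod ?U (regular)" by (rule rsubmoduleI) (auto simp: co_simps)
   have "maximal_right_ideal A ?U" unfolding maximal_right_ideal_def
   proof (intro conjI allI impI U)
    have "ee i \<notin> ?U" using True by simp
    then show "?U \<noteq> $A" using bas_closed[of "Ix_e i"] by blast
    fix V assume V: "submod V (regular) \<and> ?U \<subseteq> V"
    note v = rsubmoduleD[OF conjunct1[OF V]]
    show "V = ?U \<or> V = $A"
    proof (rule disjCI)
     assume "V \<noteq> $A"
     show "V = ?U"
     proof (rule ccontr)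
      assume "V \<noteq> ?U"
      then obtain z where z: "z \<in> V" "co (Ix_e i) z \<noteq> 0" using V v(5) by auto
      have zA: "z \<in> $A" using v(5)[OF z(1)] by simp
      have "y \<in> V" if y: "y \<in> $A" for y
      proof -
       define k where "k = co (Ix_e i) y / co (Ix_e i) z"
       have "k \<odot> z \<in> V" using v(4)[OF z(1), of "k \<odot> \<one>"] zA by (simp add: scalar_unit_right)
       moreover have "y \<oplus> (- k) \<odot> z \<in> ?U" using y zA z(2) by (simp add: co_simps k_def)
       then have "y \<oplus> (- k) \<odot> z \<in> V" using V by blast
       ultimately have "(y \<oplus> (- k) \<odot> z) \<oplus> k \<odot> z \<in> V" using v(3) by simp
       moreover have "(y \<oplus> (- k) \<odot> z) \<oplus> k \<odot> z = y" using y zA by (intro alg_eqI) (auto simp: co_simps)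
       ultimately show ?thesis by simp
      qed
      then show False using \<open>V \<noteq> $A\<close> v(1) by auto
     qed
    qed
   qed
   then have "x \<in> ?U" using x unfolding jacobson_radical_def by blast
   then show ?thesis by simp
  qed (use xA in \<open>auto intro: co_out\<close>)
  then show "x \<in> {x \<in> $A. \<forall>i. co (Ix_e i) x = 0}" using xA by simp
 next
  fix x assume "x \<in> {x \<in> $A. \<forall>i. co (Ix_e i) x = 0}"
  then have x: "x \<in> $A" "\<And>i. co (Ix_e i) x = 0" by auto
  have "x \<in> U" if U: "maximal_right_ideal A U" for U
  proof (rule ccontr)
   assume nx: "x \<notin> U"
   have Us: "submod U (regular)" and Une: "U \<noteq> $A"
    and Umax: "\<And>V. submod V (regular) ==> U \<subseteq> V ==> V = U \<or> V = $A"
    using U unfolding maximal_right_ideal_def by blast+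
   note ep = extension_props[OF regular_fd Us, of x]
   note u = rsubmoduleD[OF Us]
   have "extension (regular) U x = $A" using Umax[of "extension (regular) U x"] ep x nx by auto
   then have "\<one> \<in> extension (regular) U x" by simp
   then obtain w y where wy: "w \<in> U" "y \<in> $A" "\<one> = w \<oplus> x \<otimes> y" by (auto simp: extension_def)
   define r where "r = x \<otimes> y"
   have wA: "w \<in> $A" using u(5)[OF wy(1)] by simp
   have r: "r \<in> $A" "\<And>i. co (Ix_e i) r = 0" using x wy by (auto simp: r_def co_simps)
   have c: "co t w = co t \<one> - co t r" for t using wy(3) wA r(1) co_add[OF wA r(1), of t] by (simp add: r_def)
   \<comment> \<open>Here w is \<open>1 - r\<close> with \<open>r^3 = 0\<close>, so the geometric
     series inverts it and U would contain the unit.\<close>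
   have "w \<otimes> ((\<one> \<oplus> r) \<oplus> r \<otimes> r) = \<one>"
    using wA r by (intro alg_eqI) (auto simp: co_simps c algebra_simps intro: co_out)
   moreover have "w \<otimes> ((\<one> \<oplus> r) \<oplus> r \<otimes> r) \<in> U" using u(4)[OF wy(1), of "(\<one> \<oplus> r) \<oplus> r \<otimes> r"] r by simp
   ultimately have "\<one> \<in> U" by simp
   then have "y \<in> U" if "y \<in> $A" for y using u(4)[of \<one> y] that by simp
   then show False using Une u(1) by auto
  qed
  then show "x \<in> jacobson_radical A" using x(1) unfolding jacobson_radical_def by blast
 qed
qed

text \<open>The annihilator of the generator of \<open>\<Delta>(i) = e_i A / a_i A\<close>, which is
  spanned by the images of \<open>e_i\<close> and \<open>b_{i-1}\<close>. Since
  \<open>b_0 = 0\<close>, \<open>\<Delta>(1)\<close> is one-dimensional.\<close>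

definition Dann :: "nat \<Rightarrow> 'a \<Rightarrow> bool" where
 "Dann i x \<longleftrightarrow> co (Ix_e i) x = 0 \<and> co (Ix_b (i-1)) x = 0"

text \<open>For i > 1 the module \<open>\<nabla>(i)\<close> is uniserial with top at i - 1 and socle
  at i, hence cyclic with a generator at the vertex i - 1; \<open>\<nabla>(1)\<close> is
  simple.\<close>

definition Nann :: "nat \<Rightarrow> 'a \<Rightarrow> bool" where
 "Nann i x \<longleftrightarrow> (if i = 1 then co (Ix_e 1) x = 0 else co (Ix_e (i-1)) x = 0 \<and> co (Ix_a (i-1)) x = 0)"

lemma co_finsum:
 assumes "finite S" "\<And>s. s \<in> S ==> f s \<in> $A"
 shows "finsum A f S \<in> $A \<and> co t (finsum A f S) = (\<Sum>s\<in>S. co t (f s))" using assms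
proof (induction S)
 case empty
 then show ?case using abelian_monoid.finsum_empty[OF A_monoid, of f] by simp
next
 case (insert x F)
 then have "finsum A f (insert x F) = f x \<oplus> finsum A f F" by (intro abelian_monoid.finsum_insert[OF A_monoid]) auto
 then show ?case using insert by (simp add: co_simps)
qed

lemma quotient_cyc:
 assumes i: "1 \<le> i" "i \<le> n" and N: "submod N (regular)" "N \<subseteq> $(eA i)"
  and ann: "\<And>x. x \<in> $A ==> ee i \<otimes> x \<in> N \<longleftrightarrow> P x"
 shows "cyc (quotient_module (eA i) N) (N +>\<^bsub>eA i\<^esub> ee i) P"
proof -
 have e: "ee i \<in> $(eA i)" by (simp add: eA_mem)
 have N': "submod N (eA i)" using submodule_restrict[OF N(1)] N(2) unfolding idempotent_as_restriction by (simp add: idempotent_carrier)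
 note q = quotient_hom[OF eA_fd N']
 have act: "(N +>\<^bsub>eA i\<^esub> ee i) *[quotient_module (eA i) N] x = N +>\<^bsub>eA i\<^esub> (ee i \<otimes> x)" if "x \<in> $A" for x
  using module_homD(3)[OF q e that] by simp
 have mem: "ee i \<otimes> x \<in> $(eA i)" if "x \<in> $A" for x using that by (auto simp: idempotent_carrier)
 show ?thesis unfolding cyc_def
 proof (intro conjI ballI)
  show "fdm (quotient_module (eA i) N)" by (rule quotient_fd[OF eA_fd N'])
  show "N +>\<^bsub>eA i\<^esub> ee i \<in> $(quotient_module (eA i) N)" unfolding quotient_carrier using e by simp
  show "$(quotient_module (eA i) N) = {(N +>\<^bsub>eA i\<^esub> ee i) *[quotient_module (eA i) N] a |a. a \<in> $A}"
  proof (intro equalityI subsetI)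
   fix z assume "z \<in> $(quotient_module (eA i) N)"
   then obtain y where y: "y \<in> $(eA i)" "z = N +>\<^bsub>eA i\<^esub> y" unfolding quotient_carrier by auto
   then have "z = (N +>\<^bsub>eA i\<^esub> ee i) *[quotient_module (eA i) N] y" using act[of y] by (simp add: eA_mem)
   then show "z \<in> {(N +>\<^bsub>eA i\<^esub> ee i) *[quotient_module (eA i) N] a |a. a \<in> $A}" using y by (auto simp: eA_mem)
  next
   fix z assume "z \<in> {(N +>\<^bsub>eA i\<^esub> ee i) *[quotient_module (eA i) N] a |a. a \<in> $A}"
   then show "z \<in> $(quotient_module (eA i) N)" using act mem unfolding quotient_carrier by auto
  qed
  show "(N +>\<^bsub>eA i\<^esub> ee i) *[quotient_module (eA i) N] a = \<zero>[quotient_module (eA i) N] \<longleftrightarrow> P a" if "a \<in> $A" for a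
   unfolding act[OF that] quotient_zero using coset_zero_iff[OF eA_fd N' mem[OF that]] ann[OF that] by simp
 qed
qed

text \<open>The right ideal is spanned by \<open>a_i = a_i e_{i+1}\<close> and
  \<open>c_i = a_i b_i\<close>; the description by coordinates makes membership decidable by
  computation.\<close>

lemma right_ideal_aa: "{aa i \<otimes> a |a. a \<in> $A} = {x \<in> $A. ee i \<otimes> x = x \<and> co (Ix_e i) x = 0 \<and> co (Ix_b (i-1)) x = 0}"
proof (intro equalityI subsetI)
 fix x assume "x \<in> {aa i \<otimes> a |a. a \<in> $A}"
 then obtain y where y: "y \<in> $A" "x = aa i \<otimes> y" by blast
 have "ee i \<otimes> (aa i \<otimes> y) = aa i \<otimes> y" using y(1) by (simp add: A_assoc[symmetric] mult_ea)
 then show "x \<in> {x \<in> $A. ee i \<otimes> x = x \<and> co (Ix_e i) x = 0 \<and> co (Ix_b (i-1)) x = 0}"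
  using y by (simp add: co_simps)
next
 fix x assume "x \<in> {x \<in> $A. ee i \<otimes> x = x \<and> co (Ix_e i) x = 0 \<and> co (Ix_b (i-1)) x = 0}"
 then have x: "x \<in> $A" "ee i \<otimes> x = x" "co (Ix_e i) x = 0" "co (Ix_b (i-1)) x = 0" by auto
 define y where "y = co (Ix_a i) x \<odot> ee (Suc i) \<oplus> co (Ix_c i) x \<odot> bb i"
 have y: "y \<in> $A" by (simp add: y_def)
 have "ee i \<otimes> x = aa i \<otimes> y"
 proof (rule alg_eqI)
  show "co (Ix_b j) (ee i \<otimes> x) = co (Ix_b j) (aa i \<otimes> y)" for j
   using x(1) x(4) y by (cases "i = Suc j") (simp_all add: co_simps)
 qed (use x(1,3) y in \<open>auto simp: co_simps y_def\<close>)
 then have "x = aa i \<otimes> y" unfolding x(2) .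
 then show "x \<in> {aa i \<otimes> a |a. a \<in> $A}" using y by blast
qed

text \<open>Among the radical basis elements \<open>a_i\<close>, \<open>b_{i-1}\<close>,
  \<open>c_i\<close> of \<open>e_i A\<close> only \<open>a_i\<close> ends at a vertex above i, so
  the submodule divided out is \<open>a_i A\<close>.\<close>

lemma standard_cyc:
 assumes e: "\<And>j. 1 \<le> j ==> j \<le> n ==> e j = ee j" and i: "1 \<le> i" "i \<le> n"
 shows "\<exists>v. cyc (standard_module A n e i) v (Dann i)"
proof -
 define s where "s = finsum A e {i<..n}"
 have eA: "\<And>j. j \<in> {i<..n} ==> e j = ee j" using e by auto
 have s: "s \<in> $A" "co t s = (\<Sum>j\<in>{i<..n}. co t (ee j))" for t
 proof -
  have "s \<in> $A \<and> co t s = (\<Sum>j\<in>{i<..n}. co t (e j))" for t unfolding s_def by (rule co_finsum) (auto simp: eA)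
  then show "s \<in> $A" "co t s = (\<Sum>j\<in>{i<..n}. co t (ee j))" by (auto simp: eA)
 qed
 have cs: "co (Ix_e j) s = (if i < j \<and> j \<le> n then 1 else 0)" "co (Ix_a j) s = 0" "co (Ix_b j) s = 0" "co (Ix_c j) s = 0" for j
 proof -
  have "co (Ix_e j) s = (\<Sum>k\<in>{i<..n}. if k = j then 1 else 0)" unfolding s(2) using i by (intro sum.cong) auto
  then show "co (Ix_e j) s = (if i < j \<and> j \<le> n then 1 else 0)" by simp
 qed (simp_all add: s(2))
 define G where "G = {e i \<otimes> x \<otimes> finsum A e {i<..n} | x. x \<in> jacobson_radical A}"
 define N where "N = {aa i \<otimes> a |a. a \<in> $A}"
 have Ns: "submod N (regular)" unfolding N_def by (rule right_ideal_submodule) simp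
 have prod: "ee i \<otimes> x \<otimes> s = co (Ix_a i) x \<odot> aa i" if "x \<in> $A" "\<And>j. co (Ix_e j) x = 0" for x
  using that s(1) i by (intro alg_eqI) (auto simp: co_simps cs)
 have GN: "generated_submodule A (regular) G = N"
 proof (intro equalityI subsetI)
  fix z assume z: "z \<in> generated_submodule A (regular) G"
  have "G \<subseteq> N"
  proof
   fix g assume "g \<in> G"
   then obtain x where x: "x \<in> jacobson_radical A" "g = ee i \<otimes> x \<otimes> s" using e i by (auto simp: G_def s_def)
   then have "g = aa i \<otimes> (co (Ix_a i) x \<odot> \<one>)" using prod unfolding jacobson_eq by (simp add: scalar_unit_right)
   then show "g \<in> N" unfolding N_def by blast
  qed
  then show "z \<in> N" using z Ns unfolding generated_submodule_def by blast
 next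
  fix z assume "z \<in> N"
  then obtain y where y: "y \<in> $A" "z = aa i \<otimes> y" by (auto simp: N_def)
  have "aa i \<in> G"
  proof -
   have "aa i \<in> jacobson_radical A" by (simp add: jacobson_eq)
   moreover have "ee i \<otimes> aa i \<otimes> s = aa i" using i by (cases "i < n") (simp_all add: prod s(1))
   ultimately show ?thesis using e i unfolding G_def s_def[symmetric] by force
  qed
  then show "z \<in> generated_submodule A (regular) G" unfolding generated_submodule_def y(2) using y(1) by (auto dest: rsubmoduleD(4))
 qed
 have st: "standard_module A n e i = quotient_module (eA i) N" unfolding standard_module_def G_def[symmetric] GN using e i by simp
 have "cyc (quotient_module (eA i) N) (N +>\<^bsub>eA i\<^esub> ee i) (Dann i)"
 proof (rule quotient_cyc[OF i Ns])
  show "N \<subseteq> $(eA i)" unfolding N_def right_ideal_aa eA_mem by (auto simp: eA_mem)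
  show "ee i \<otimes> x \<in> N \<longleftrightarrow> Dann i x" if x: "x \<in> $A" for x
   unfolding N_def right_ideal_aa Dann_def using x i by (auto simp: co_simps A_assoc[symmetric])
 qed
 then show ?thesis unfolding st by blast
qed

text \<open>No arrow \<open>b_0\<close> leaves the vertex 1, so the radical of \<open>e_1 A\<close>
  is \<open>a_1 A\<close> and the simple module at 1 is \<open>\<Delta>(1)\<close>.\<close>

lemma simple_cyc:
 assumes e: "e 1 = ee 1" shows "\<exists>v. cyc (simple_module A e 1) v (Dann 1)"
proof -
 define N where "N = {ee 1 \<otimes> x | x. x \<in> jacobson_radical A}"
 have N': "N = {aa 1 \<otimes> a |a. a \<in> $A}" unfolding right_ideal_aa N_def jacobson_eq
 proof (intro equalityI subsetI)
  fix z assume "z \<in> {ee 1 \<otimes> x |x. x \<in> {x \<in> $A. \<forall>i. co (Ix_e i) x = 0}}"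
  then show "z \<in> {x \<in> $A. ee 1 \<otimes> x = x \<and> co (Ix_e 1) x = 0 \<and> co (Ix_b (1 - 1)) x = 0}"
   by (auto simp: co_simps A_assoc[symmetric])
 next
  fix z assume "z \<in> {x \<in> $A. ee 1 \<otimes> x = x \<and> co (Ix_e 1) x = 0 \<and> co (Ix_b (1 - 1)) x = 0}"
  then have z: "z \<in> $A" "ee 1 \<otimes> z = z" "co (Ix_e 1) z = 0" by auto
  have "co (Ix_e i) z = 0" for i using co_mult(1)[of "ee 1" z i] z by (cases "i = 1") auto
  then show "z \<in> {ee 1 \<otimes> x |x. x \<in> {x \<in> $A. \<forall>i. co (Ix_e i) x = 0}}"
   using z by (intro CollectI exI[of _ z]) simp
 qed
 have "cyc (quotient_module (eA 1) N) (N +>\<^bsub>eA 1\<^esub> ee 1) (Dann 1)"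
 proof (rule quotient_cyc)
  show "submod N (regular)" unfolding N' by (rule right_ideal_submodule) simp
  show "N \<subseteq> $(eA 1)" unfolding N' right_ideal_aa by (auto simp: eA_mem)
  show "ee 1 \<otimes> x \<in> N \<longleftrightarrow> Dann 1 x" if x: "x \<in> $A" for x
   unfolding N' right_ideal_aa Dann_def using x n2 by (auto simp: co_simps A_assoc[symmetric])
 qed (use n2 in auto)
 then show ?thesis unfolding simple_module_def e N_def by blast
qed

section \<open>The opposite algebra and costandard modules\<close>

lemma opposite_simps [simp]:
 "$(opposite A) = $A" "\<zero>[opposite A] = \<zero>" "\<one>\<^bsub>opposite A\<^esub> = \<one>"
 "x +[opposite A] y = x \<oplus> y" "x \<otimes>[opposite A] y = y \<otimes> x" "c \<odot>[opposite A] x = c \<odot> x"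
 by (simp_all add: opposite_def)

lemma opposite_finsum: "finsum (opposite A) f S = finsum A f S" by (simp add: opposite_def finsum_def finprod_def)

lemma opposite_ring: "ring (opposite A)"
proof (rule ringI)
 show "abelian_group (opposite A)"
 proof (rule abelian_groupI, goal_cases)
  case (6 x)
  have "\<ominus> x \<in> $A" "\<ominus> x \<oplus> x = \<zero>"
   using 6 abelian_group.a_inv_closed[OF ring.is_abelian_group[OF ring_A]] A_l_neg by auto
  then show ?case by auto
 qed (auto simp: A_a_ac)
 show "monoid (opposite A)" by (rule monoidI) (auto simp: A_assoc)
qed (auto simp: A_l_distr A_r_distr)

lemma opposite_fd_algebra: "fd_algebra (opposite A)"
proof (intro fd_algebra.intro fd_algebra_axioms.intro opposite_ring)
 show "Module.module ring_of_type_algebra (opposite A)"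
  using ring.is_abelian_group[OF opposite_ring] comm_ring_1_class.cring_from_type_algebra by (intro moduleI)
   (auto simp: ring_of_type_algebra_def scalar_add scalar_mult scalar_add_right abelian_group_def)
 show "(c \<odot>[opposite A] x) \<otimes>[opposite A] y = c \<odot>[opposite A] (x \<otimes>[opposite A] y)"
  "x \<otimes>[opposite A] (c \<odot>[opposite A] y) = c \<odot>[opposite A] (x \<otimes>[opposite A] y)"
  if "x \<in> $(opposite A)" "y \<in> $(opposite A)" for x y c using that by (simp_all add: smult_mult_left smult_mult_right)
 show "\<exists>S. finite S \<and> S \<subseteq> $(opposite A) \<and>
     (\<forall>x\<in>$(opposite A). \<exists>c. x = finsum (opposite A) (\<lambda>s. c s \<odot>[opposite A] s) S)"
  using fd_algebra.finite_dim[OF fd_algebra_axioms] by (simp add: opposite_finsum)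
qed

text \<open>Exchanging \<open>a_i\<close> and \<open>b_i\<close> while fixing \<open>e_i\<close> and
  \<open>c_i\<close> reverses all products. Everything proved from coordinates therefore also holds
  for left modules.\<close>

lemma opposite_coordinate: "coordinate_algebra (opposite A) n (\<lambda>t. co (swap_idx t))"
proof (intro coordinate_algebra.intro coordinate_algebra_axioms.intro opposite_fd_algebra n2)
 show "\<exists>x\<in>$(opposite A). \<forall>t. co (swap_idx t) x = (if idx_ok n t then f t else 0)" for f
 proof -
  obtain x where x: "x \<in> $A" "\<And>t. co t x = (if idx_ok n t then f (swap_idx t) else 0)"
   using co_ex[of "\<lambda>t. f (swap_idx t)"] by blast
  then show ?thesis by (intro bexI[of _ x]) simp_all
 qed
 show "x = y" if "x \<in> $(opposite A)" "y \<in> $(opposite A)" "\<And>t. co (swap_idx t) x = co (swap_idx t) y" for x y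
  using co_ext[of x y] that swap_swap by (metis opposite_simps(1))
qed (auto simp: co_simps co_out)

text \<open>The left standard module L is a standard module of the opposite algebra, with simple
  socle. A functional that does not vanish on the socle generates the dual, and its annihilator is
  computed from products in A.\<close>

lemma costandard_cyc:
 assumes e: "\<And>j. 1 \<le> j ==> j \<le> n ==> e j = ee j" and i: "1 \<le> i" "i \<le> n"
 shows "\<exists>w. cyc (costandard_module A n e i) w (Nann i)"
proof -
 interpret Op: coordinate_algebra "opposite A" n "\<lambda>t. co (swap_idx t)" by (rule opposite_coordinate)
 have ee: "Op.ee j = ee j" for j
 proof (rule alg_eqI)
  show "Op.ee j \<in> $A" using Op.bas_closed by simp
  fix i
  show "co (Ix_e i) (Op.ee j) = co (Ix_e i) (ee j)" using Op.co_bas[of "Ix_e i" "Ix_e j"] by simp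
  show "co (Ix_a i) (Op.ee j) = co (Ix_a i) (ee j)" using Op.co_bas[of "Ix_b i" "Ix_e j"] by simp
  show "co (Ix_b i) (Op.ee j) = co (Ix_b i) (ee j)" using Op.co_bas[of "Ix_a i" "Ix_e j"] by simp
  show "co (Ix_c i) (Op.ee j) = co (Ix_c i) (ee j)" using Op.co_bas[of "Ix_c i" "Ix_e j"] by simp
 qed simp
 define L where "L = left_standard_module A n e i"
 have jr: "jacobson_radical (opposite A) = jacobson_radical A" unfolding Op.jacobson_eq jacobson_eq by simp
 have eiA: "e i \<in> $A" using e i by simp
 have sA: "finsum A e {i<..n} \<in> $A" using co_finsum[of "{i<..n}" e] e by auto
 have "e i \<otimes>[opposite A] x \<otimes>[opposite A] finsum A e {i<..n} = finsum A e {i<..n} \<otimes> x \<otimes> e i"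
  if "x \<in> jacobson_radical A" for x using that sA eiA by (simp add: jacobson_eq A_assoc)
 then have G: "{e i \<otimes>[opposite A] x \<otimes>[opposite A] finsum A e {i<..n} | x. x \<in> jacobson_radical A} =
   {finsum A e {i<..n} \<otimes> x \<otimes> e i | x. x \<in> jacobson_radical A}" unfolding Setcompr_eq_image by (intro image_cong) auto
 have "L = standard_module (opposite A) n e i" unfolding L_def left_standard_module_def standard_module_def jr opposite_finsum G ..
 moreover have "\<exists>v. Op.cyc (standard_module (opposite A) n e i) v (Op.Dann i)" by (rule Op.standard_cyc) (use e i ee in auto)
 ultimately obtain v where v: "Op.cyc L v (Op.Dann i)" by auto
 interpret L: amod "opposite A" L by (rule Op.amodI[OF Op.cycD(1)[OF v]])
 note vL = Op.cycD(2)[OF v] and Lc = Op.cycD(3)[OF v]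
 have ann: "v *[L] a = \<zero>[L] \<longleftrightarrow> co (Ix_e i) a = 0 \<and> co (Ix_a (i-1)) a = 0" if "a \<in> $A" for a
  using Op.cycD(4)[OF v, of a] that by (simp add: Op.Dann_def)
 \<comment> \<open>For i > 1 the coordinate on the socle of L, spanned by \<open>v a_{i-1}\<close>;
   for i = 1 the only coordinate there is.\<close>
 define \<phi> where "\<phi> a = (if i = 1 then co (Ix_e 1) a else co (Ix_a (i-1)) a)" for a
 have \<phi>_add: "\<phi> (a \<oplus> b) = \<phi> a + \<phi> b" and \<phi>_sc: "\<phi> (c \<odot> a) = c * \<phi> a" if "a \<in> $A" "b \<in> $A" for a b c
  using that by (simp_all add: \<phi>_def co_simps)
 have same: "\<phi> a = \<phi> b" if "a \<in> $A" "b \<in> $A" "v *[L] a = v *[L] b" for a b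
 proof -
  have "v *[L] (a \<oplus> (-1) \<odot> b) = v *[L] a +[L] Op.sc L (-1) (v *[L] b)"
   using L.ract_add_right[of v a "(-1) \<odot> b"] L.act_scalar[of v b "-1"] vL that by simp
  also have "\<dots> = \<zero>[L]" using that vL by (simp add: L.sc_neg_one L.M.r_neg)
  finally have "co (Ix_e i) (a \<oplus> (-1) \<odot> b) = 0 \<and> co (Ix_a (i-1)) (a \<oplus> (-1) \<odot> b) = 0"
   using ann[of "a \<oplus> (-1) \<odot> b"] that by simp
  then show ?thesis using that by (auto simp: \<phi>_def co_simps)
 qed
 define w where "w = (\<lambda>l\<in>$L. \<phi> (SOME a. a \<in> $A \<and> l = v *[L] a))"
 have wv: "w (v *[L] a) = \<phi> a" if a: "a \<in> $A" for a
 proof -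
  have c: "v *[L] a \<in> $L" using vL a by simp
  have "\<exists>b. b \<in> $A \<and> v *[L] a = v *[L] b" using a by blast
  then have "(SOME b. b \<in> $A \<and> v *[L] a = v *[L] b) \<in> $A \<and>
    v *[L] a = v *[L] (SOME b. b \<in> $A \<and> v *[L] a = v *[L] b)" by (rule someI_ex)
  then have "\<phi> a = \<phi> (SOME b. b \<in> $A \<and> v *[L] a = v *[L] b)" by (elim conjE) (rule same[OF a])
  then show ?thesis using c by (simp add: w_def)
 qed
 have Lex: "\<exists>a\<in>$A. l = v *[L] a" if "l \<in> $L" for l using Lc that by auto
 let ?D = "dual_module A L"
 have Dc: "f \<in> $?D \<longleftrightarrow> f \<in> extensional ($L) \<and>
    (\<forall>x\<in>$L. \<forall>y\<in>$L. f (x +[L] y) = f x + f y) \<and>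
    (\<forall>x\<in>$L. \<forall>c. f (Op.sc L c x) = c * f x)" for f by (simp add: dual_module_def Op.sc_def)
 have ops: "\<zero>[?D] = (\<lambda>x\<in>$L. 0)" "f +[?D] g = (\<lambda>x\<in>$L. f x + g x)"
  "f *[?D] a = (\<lambda>x\<in>$L. f (x *[L] a))" for f g a by (simp_all add: dual_module_def)
 have wD: "w \<in> $?D" unfolding Dc
 proof (intro conjI ballI allI)
  show "w \<in> extensional ($L)" by (simp add: w_def)
  fix x assume "x \<in> $L"
  then obtain a where a: "a \<in> $A" "x = v *[L] a" using Lex by blast
  show "w (x +[L] y) = w x + w y" if "y \<in> $L" for y
  proof -
   obtain b where b: "b \<in> $A" "y = v *[L] b" using Lex \<open>y \<in> $L\<close> by blast
   have "x +[L] y = v *[L] (a \<oplus> b)" using L.ract_add_right[of v a b] a b vL by simp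
   then show ?thesis using a b wv \<phi>_add by simp
  qed
  show "w (Op.sc L c x) = c * w x" for c
  proof -
   have "Op.sc L c x = v *[L] (c \<odot> a)" using L.act_scalar[of v a c] a vL by simp
   then show ?thesis using a wv \<phi>_sc by simp
  qed
 qed
 have wx: "(w *[?D] x) (v *[L] a) = \<phi> (x \<otimes> a)" if "x \<in> $A" "a \<in> $A" for x a
  using that vL L.ract_mult[of v a x] wv[of "x \<otimes> a"] by (simp add: ops)
 have ext: "f = g" if "f \<in> extensional ($L)" "g \<in> extensional ($L)"
  "\<And>a. a \<in> $A ==> f (v *[L] a) = g (v *[L] a)" for f g :: "'a set \<Rightarrow> 'k"
 proof (rule extensionalityI[OF that(1,2)])
  fix l assume "l \<in> $L"
  then show "f l = g l" using Lex that(3) by blast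
 qed
 have wxD: "w *[?D] x \<in> $?D" if x: "x \<in> $A" for x unfolding Dc
 proof (intro conjI ballI allI)
  show "w *[?D] x \<in> extensional ($L)" by (simp add: ops)
  fix y assume y: "y \<in> $L"
  show "(w *[?D] x) (y +[L] z) = (w *[?D] x) y + (w *[?D] x) z" if "z \<in> $L" for z
   using y that x wD unfolding Dc by (simp add: ops L.ract_add_left)
  show "(w *[?D] x) (Op.sc L c y) = c * (w *[?D] x) y" for c using y x wD unfolding Dc by (simp add: ops L.sc_act)
 qed
 have hom: "mhom (regular) ?D (\<lambda>x. w *[?D] x)"
 proof (rule module_homI)
  fix x assume x: "x \<in> $(regular)"
  show "w *[?D] x \<in> $?D" using wxD x by simp
  show "w *[?D] (x +[regular] y) = w *[?D] x +[?D] w *[?D] y" if "y \<in> $(regular)" for y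
  proof (rule ext)
   fix a assume a: "a \<in> $A"
   have "(w *[?D] x +[?D] w *[?D] y) (v *[L] a) = (w *[?D] x) (v *[L] a) + (w *[?D] y) (v *[L] a)" using vL a by (simp add: ops(2))
   then show "(w *[?D] (x +[regular] y)) (v *[L] a) = (w *[?D] x +[?D] w *[?D] y) (v *[L] a)"
    using x that a by (simp add: wx A_l_distr \<phi>_add)
  qed (auto simp: ops)
  show "w *[?D] (x *[regular] y) = w *[?D] x *[?D] y" if y: "y \<in> $A" for y
  proof (rule ext)
   fix a assume a: "a \<in> $A"
   have "(v *[L] a) *[L] y = v *[L] (y \<otimes> a)" using L.ract_mult[of v a y] a y vL by simp
   then have "(w *[?D] x *[?D] y) (v *[L] a) = (w *[?D] x) (v *[L] (y \<otimes> a))" using vL a by (simp add: ops(3)[of _ y])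
   then show "(w *[?D] (x *[regular] y)) (v *[L] a) = (w *[?D] x *[?D] y) (v *[L] a)" using x y a by (simp add: wx A_assoc)
  qed (auto simp: ops)
 qed
 have onto: "(\<lambda>x. w *[?D] x) ` $(regular) = $?D"
 proof (intro equalityI subsetI)
  fix f assume f: "f \<in> $?D"
  define p where "p = f (v *[L] ee i)"
  define q where "q = f (v *[L] aa (i-1))"
  have fa: "f (v *[L] a) = co (Ix_e i) a * p + co (Ix_a (i-1)) a * q" if a: "a \<in> $A" for a
  proof -
   let ?b = "co (Ix_e i) a \<odot> ee i \<oplus> co (Ix_a (i-1)) a \<odot> aa (i-1)"
   have z: "v *[L] (a \<oplus> (-1) \<odot> ?b) = \<zero>[L]"
    using ann[of "a \<oplus> (-1) \<odot> ?b"] a i by (cases "i = 1") (auto simp: co_simps)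
   have "v *[L] a +[L] Op.sc L (-1) (v *[L] ?b) = \<zero>[L]"
    using z L.ract_add_right[of v a "(-1) \<odot> ?b"] L.act_scalar[of v ?b "-1"] vL a by simp
   then have "v *[L] a -[L] v *[L] ?b = \<zero>[L]" using vL a by (simp add: L.sc_neg_one L.M.minus_eq)
   then have "v *[L] a = v *[L] ?b" using vL a by (simp add: L.M.diff_eq_iff)
   also have "\<dots> = Op.sc L (co (Ix_e i) a) (v *[L] ee i) +[L] Op.sc L (co (Ix_a (i-1)) a) (v *[L] aa (i-1))"
    using L.ract_add_right[of v "co (Ix_e i) a \<odot> ee i" "co (Ix_a (i-1)) a \<odot> aa (i-1)"]
     L.act_scalar[of v "ee i"] L.act_scalar[of v "aa (i-1)"] vL a by simp
   finally show ?thesis using f vL unfolding Dc by (simp add: p_def q_def)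
  qed
  \<comment> \<open>For i > 1, acting on w by \<open>e_{i-1}\<close> gives the functional that reads
    the \<open>a_{i-1}\<close>-coordinate, and by \<open>a_{i-1}\<close> the one that reads the
    \<open>e_i\<close>-coordinate; q and p are the coefficients of f at these two.\<close>
  define x where "x = (if i = 1 then p \<odot> ee 1 else q \<odot> ee (i-1) \<oplus> p \<odot> aa (i-1))"
  have xA: "x \<in> $A" by (simp add: x_def)
  have "f = w *[?D] x"
  proof (rule ext)
   fix a assume a: "a \<in> $A"
   show "f (v *[L] a) = (w *[?D] x) (v *[L] a)"
    unfolding fa[OF a] wx[OF xA a] unfolding \<phi>_def x_def using a i n2 by (auto simp: co_simps)
  qed (use f in \<open>auto simp: Dc ops\<close>)
  then show "f \<in> (\<lambda>x. w *[?D] x) ` $(regular)" using xA by auto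
 qed (use wxD in auto)
 have zero: "\<zero>[?D] = w *[?D] \<zero>[regular]"
  by (rule ext) (use vL wx \<phi>_sc[of \<zero> \<zero> 0] in \<open>auto simp: ops(1) ops(3)[of w] \<phi>_def\<close>)
 have fdD: "fdm ?D" by (rule image_module[OF regular_fd hom onto zero])
 have annw: "w *[?D] x = \<zero>[?D] \<longleftrightarrow> Nann i x" if x: "x \<in> $A" for x
 proof
  assume z: "w *[?D] x = \<zero>[?D]"
  have 0: "\<phi> (x \<otimes> a) = 0" if a: "a \<in> $A" for a using wx[OF x a] vL a unfolding z by (simp add: ops(1))
  show "Nann i x" using 0[of "ee i"] 0[of "aa (i-1)"] x i n2 by (auto simp: Nann_def \<phi>_def co_simps split: if_splits)
 next
  assume N: "Nann i x"
  show "w *[?D] x = \<zero>[?D]"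
  proof (rule ext)
   fix a assume a: "a \<in> $A"
   show "(w *[?D] x) (v *[L] a) = \<zero>[?D] (v *[L] a)"
    unfolding wx[OF x a] using N x a vL i by (auto simp: ops(1) Nann_def \<phi>_def co_simps split: if_splits)
  qed (auto simp: ops)
 qed
 have "cyc ?D w (Nann i)" unfolding cyc_def
 proof (intro conjI ballI fdD wD annw)
  show "$?D = {w *[?D] a |a. a \<in> $A}" using onto by auto
 qed
 then show ?thesis unfolding costandard_module_def L_def by blast
qed

section \<open>Exactness and filtrations\<close>

lemma cyc_unit:
 assumes c: "cyc M v P" and k: "P (\<one> \<oplus> (-1) \<odot> ee k)"
 shows "v *[M] ee k = v"
proof -
 interpret M: amod A M by (rule amodI[OF cycD(1)[OF c]])
 have v: "v \<in> $M" by (rule cycD(2)[OF c])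
 have "v *[M] (\<one> \<oplus> (-1) \<odot> ee k) = \<zero>[M]" using cycD(4)[OF c, of "\<one> \<oplus> (-1) \<odot> ee k"] k by simp
 then have "v -[M] v *[M] ee k = \<zero>[M]" using v by (simp add: M.ract_add_right M.act_scalar M.sc_neg_one M.ract_one M.M.minus_eq)
 then show ?thesis using v by (simp add: M.M.diff_eq_iff)
qed

text \<open>\<open>\<Delta>(i)\<close> is spanned by v at i and \<open>v b_{i-1}\<close> at i - 1,
  which are matched by a map of the first half. The bound on j stops before the vertex 1, where
  \<open>\<Delta>(1)\<close> is not exact.\<close>

lemma standard_H:
 assumes c: "cyc M v (Dann i)" and i: "1 \<le> i" "i \<le> n" and j: "j < n - 1" shows "H j M"
proof (rule HI)
 interpret M: amod A M by (rule amodI[OF cycD(1)[OF c]])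
 note v = cycD(2)[OF c] and ann = cycD(4)[OF c]
 fix z assume z: "z \<in> $M" "z *[M] eps j = z" "z *[M] yy (Suc j) = \<zero>[M]"
 define m where "m = n - j"
 have m: "2 \<le> m" "m \<le> n" "eps j = ee m" "yy (Suc j) = bb (m-1)" "yy j = bb m" using j by (auto simp: m_def eps_def yy_def)
 have vi: "v *[M] ee i = v" by (rule cyc_unit[OF c]) (use i in \<open>auto simp: Dann_def co_simps\<close>)
 have va: "v *[M] aa i = \<zero>[M]" "v *[M] cc i = \<zero>[M]" by (simp_all add: ann Dann_def)
 obtain x where x: "x \<in> $A" "z = v *[M] x" using cyc_elim[OF c z(1)] by blast
 have z': "z = sc M (co (Ix_e i) x) v +[M] sc M (co (Ix_b (i-1)) x) (v *[M] bb (i-1))"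
  unfolding x(2) act_expand[OF cycD(1)[OF c] v vi x(1)] using v va by simp
 have ze: "z = sc M (co (Ix_e i) x) (v *[M] ee m) +[M] sc M (co (Ix_b (i-1)) x) (v *[M] (bb (i-1) \<otimes> ee m))"
  using z(2) v unfolding m(3) z' by (simp add: M.ract_add_left M.sc_act M.ract_mult)
 have vm: "v *[M] ee m = (if m = i then v else \<zero>[M])"
 proof -
  have "v *[M] ee m = v *[M] (ee i \<otimes> ee m)" using v vi by (simp add: M.ract_mult)
  then show ?thesis using v vi by (simp add: mult_ee)
 qed
 show "\<exists>w\<in>$M. z = w *[M] yy j"
 proof (cases "m = i")
  case True
  then have zi: "z = sc M (co (Ix_e i) x) v" using ze vm v m by (simp add: mult_be)
  have "1 \<le> i - 1 \<and> i - 1 < n" using True m by linarith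
  then have "\<not> Dann i (bb (i-1))" by (simp add: Dann_def)
  then have nz: "v *[M] bb (i-1) \<noteq> \<zero>[M]" using ann[of "bb (i-1)"] by simp
  have "sc M (co (Ix_e i) x) (v *[M] bb (i-1)) = \<zero>[M]" using z(3) True v unfolding m(4) zi by (simp add: M.sc_act)
  then have "co (Ix_e i) x = 0" using M.sc_eq_zero[of "v *[M] bb (i-1)" "co (Ix_e i) x"] nz v by auto
  then show ?thesis using zi v by (intro bexI[of _ "\<zero>[M]"]) auto
 next
  case False
  show ?thesis
  proof (cases "m = i - 1")
   case True
   then have "z = sc M (co (Ix_b (i-1)) x) (v *[M] bb m)" using ze vm v False by (simp add: mult_be)
   then show ?thesis using v unfolding m(5) by (intro bexI[of _ "sc M (co (Ix_b (i-1)) x) v"]) (simp_all add: M.sc_act)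
  next
   case F2: False
   then have "z = \<zero>[M]" using ze vm v False by (simp add: mult_be)
   then show ?thesis by (intro bexI[of _ "\<zero>[M]"]) auto
  qed
 qed
qed

text \<open>For i > 1, v at i - 1 and \<open>v a_{i-1}\<close> at i are matched by a map of the
  second half. \<open>\<nabla>(1)\<close> lives at the vertex 1 alone, and the places beyond n
  belong to higher vertices.\<close>

lemma costandard_H:
 assumes c: "cyc M v (Nann i)" and i: "1 \<le> i" "i \<le> n" and j: "n < j" "j < 2 * n" shows "H j M"
proof (rule HI)
 interpret M: amod A M by (rule amodI[OF cycD(1)[OF c]])
 note v = cycD(2)[OF c] and ann = cycD(4)[OF c]
 fix z assume z: "z \<in> $M" "z *[M] eps j = z" "z *[M] yy (Suc j) = \<zero>[M]"
 define m where "m = j + 1 - n"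
 have m: "2 \<le> m" "m \<le> n" "eps j = ee m" "yy (Suc j) = aa m" "yy j = aa (m-1)"
  using j by (auto simp: m_def eps_def yy_def intro!: arg_cong[of _ _ aa])
 define k where "k = (if i = 1 then 1 else i - 1)"
 have k: "1 \<le> k" "k \<le> n" using i by (auto simp: k_def)
 have vk: "v *[M] ee k = v" by (rule cyc_unit[OF c]) (use i k in \<open>auto simp: Nann_def co_simps k_def\<close>)
 have va: "v *[M] bb (k-1) = \<zero>[M]" "v *[M] cc k = \<zero>[M]" "i = 1 ==> v *[M] aa k = \<zero>[M]"
  by (simp_all add: ann Nann_def)
 obtain x where x: "x \<in> $A" "z = v *[M] x" using cyc_elim[OF c z(1)] by blast
 have z': "z = sc M (co (Ix_e k) x) v +[M] sc M (co (Ix_a k) x) (v *[M] aa k)"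
  unfolding x(2) act_expand[OF cycD(1)[OF c] v vk x(1)] using v va by simp
 have ze: "z = sc M (co (Ix_e k) x) (v *[M] ee m) +[M] sc M (co (Ix_a k) x) (v *[M] (aa k \<otimes> ee m))"
  using z(2) v unfolding m(3) z' by (simp add: M.ract_add_left M.sc_act M.ract_mult)
 have vm: "v *[M] ee m = (if m = k then v else \<zero>[M])"
 proof -
  have "v *[M] ee m = v *[M] (ee k \<otimes> ee m)" using v vk by (simp add: M.ract_mult)
  then show ?thesis using v vk by (simp add: mult_ee)
 qed
 show "\<exists>w\<in>$M. z = w *[M] yy j"
 proof (cases "m = k")
  case True
  then have zi: "z = sc M (co (Ix_e k) x) v" using ze vm v m by (simp add: mult_ae)
  have "i \<noteq> 1" using True m by (auto simp: k_def)
  moreover from this have "k = i - 1" "1 \<le> i - 1 \<and> i - 1 < n" using True m i by (auto simp: k_def)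
  ultimately have "\<not> Nann i (aa k)" by (simp add: Nann_def)
  then have nz: "v *[M] aa k \<noteq> \<zero>[M]" using ann[of "aa k"] by simp
  have "sc M (co (Ix_e k) x) (v *[M] aa k) = \<zero>[M]" using z(3) True v unfolding m(4) zi by (simp add: M.sc_act)
  then have "co (Ix_e k) x = 0" using M.sc_eq_zero[of "v *[M] aa k" "co (Ix_e k) x"] nz v by auto
  then show ?thesis using zi v by (intro bexI[of _ "\<zero>[M]"]) auto
 next
  case False
  show ?thesis
  proof (cases "m = Suc k")
   case True
   then have "z = sc M (co (Ix_a k) x) (v *[M] aa k)" using ze vm v False by (simp add: mult_ae)
   then show ?thesis using v True unfolding m(5) by (intro bexI[of _ "sc M (co (Ix_a k) x) v"]) (simp_all add: M.sc_act)
  next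
   case F2: False
   then have "z = \<zero>[M]" using ze vm v False by (simp add: mult_ae)
   then show ?thesis by (intro bexI[of _ "\<zero>[M]"]) auto
  qed
 qed
qed

text \<open>Exactness at a fixed place is closed under extensions, so it climbs along the
  filtration.\<close>

lemma filtered_H:
 assumes M: "M \<in> filtered_modules A n \<Theta>" and \<Theta>: "\<And>i. i \<in> {1..n} ==> fdm (\<Theta> i) \<and> H j (\<Theta> i)"
 shows "H j M"
proof -
 have Mm: "M \<in> modules A" using M by (simp add: filtered_modules_def)
 note Mfd = modulesD[OF Mm]
 interpret M: amod A M by (rule modules_amod[OF Mm])
 obtain r and U :: "nat \<Rightarrow> (nat \<Rightarrow> 'k) set" where U: "U 0 = {\<zero>[M]}" "U r = $M" "\<forall>t\<le>r. submod (U t) M"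
  "\<forall>t<r. U t \<subseteq> U (Suc t) \<and> (\<exists>i\<in>{1..n}. module_iso A (quotient_module (M |. U (Suc t)) (U t)) (\<Theta> i))"
  using M unfolding filtered_modules_def by blast
 have "H j (M |. U t)" if "t \<le> r" for t using that
 proof (induction t)
  case 0
  have "fdm (M |. U 0)" using submodule_module[OF Mfd] U(3) by simp
  then show ?case by (rule H_zero) (simp add: U(1) zero_module_def)
 next
  case (Suc t)
  let ?N = "(M |. U (Suc t))"
  have s: "submod (U t) M" "submod (U (Suc t)) M" "U t \<subseteq> U (Suc t)" using U Suc.prems by auto
  have N: "fdm ?N" by (rule submodule_module[OF Mfd s(2)])
  have s': "submod (U t) ?N" by (rule submodule_restrict[OF s(1,3)])
  let ?Q = "quotient_module ?N (U t)"
  have Q: "fdm ?Q" by (rule quotient_fd[OF N s'])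
  have "t < r" using Suc.prems by simp
  then obtain i where i: "i \<in> {1..n}" "module_iso A ?Q (\<Theta> i)" using U(4)[rule_format, of t] by blast
  obtain f g where fg: "mod_iso ?Q (\<Theta> i) f g" using i(2) module_iso_iff[OF Q] by blast
  have "H j ?Q" by (rule H_iso[OF _ Q mod_iso_sym[OF fg]]) (use \<Theta>[OF i(1)] in auto)
  moreover have "ses (M |. U t) ?N ?Q (\<lambda>x. x) (\<lambda>x. U t +>\<^bsub>?N\<^esub> x)" unfolding ses_def
  proof (intro conjI N Q quotient_hom[OF N s'])
   show "fdm (M |. U t)" by (rule submodule_module[OF Mfd s(1)])
   show "mhom (M |. U t) ?N (\<lambda>x. x)" using s(3) by (intro module_homI) auto
   show "(\<lambda>x. x) ` $(M |. U t) = {x \<in> $?N. U t +>\<^bsub>?N\<^esub> x = \<zero>[?Q]}"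
    unfolding quotient_zero using coset_zero_iff[OF N s'] s(3) by auto
  qed (auto simp: quotient_carrier)
  ultimately show ?case using ses_chase_middle Suc by simp
 qed
 from this[of r] show ?thesis using U(2) by simp
qed

text \<open>The filtration is built from below, with exactness of the first half modulo U as
  invariant Q. A vector v at the highest vertex m where M/U is nonzero generates
  \<open>\<Delta>(m)\<close> modulo U: its products with \<open>a_m\<close> and \<open>c_m\<close>
  fall into U, and Q keeps \<open>v b_{m-1}\<close> outside.\<close>

lemma filtered_standard:
 assumes \<Theta>: "\<And>i. 1 \<le> i ==> i \<le> n ==> \<exists>v. cyc (\<Theta> i) v (Dann i)"
 shows "filtered_modules A n \<Theta> = {M \<in> modules A. \<forall>j<n-1. H j M}"
proof (intro equalityI subsetI)
 fix M assume M: "M \<in> filtered_modules A n \<Theta>"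
 have "fdm (\<Theta> i) \<and> H j (\<Theta> i)" if i: "i \<in> {1..n}" and j: "j < n - 1" for i j
 proof -
  obtain v where v: "cyc (\<Theta> i) v (Dann i)" using \<Theta> i by auto
  show ?thesis using cycD(1)[OF v] standard_H[OF v _ _ j] i by simp
 qed
 then show "M \<in> {M \<in> modules A. \<forall>j<n-1. H j M}" using filtered_H[OF M] M by (auto simp: filtered_modules_def)
next
 fix M :: "('k, 'a) umodule" assume "M \<in> {M \<in> modules A. \<forall>j<n-1. H j M}"
 then have M: "M \<in> modules A" and HM: "\<And>j. j < n - 1 ==> H j M" by auto
 interpret M: amod A M by (rule modules_amod[OF M])
 note Mfd = modulesD[OF M]
 define Q where "Q U \<longleftrightarrow> (\<forall>m z. 2 \<le> m \<and> m \<le> n \<and> z \<in> $M \<and> z *[M] ee m = z \<and> z *[M] bb (m-1) \<in> U \<longrightarrow>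
   (\<exists>w\<in>$M. \<exists>u\<in>U. z = w *[M] bb m +[M] u))" for U
 show "M \<in> filtered_modules A n \<Theta>"
 proof (rule filtered_memI[OF M, of Q])
  show "Q {\<zero>[M]}" unfolding Q_def
  proof (intro allI impI)
   fix m z assume *: "2 \<le> m \<and> m \<le> n \<and> z \<in> $M \<and> z *[M] ee m = z \<and> z *[M] bb (m-1) \<in> {\<zero>[M]}"
   define j where "j = n - m"
   have j: "j < n - 1" "eps j = ee m" "yy (Suc j) = bb (m-1)" "yy j = bb m"
    using * by (auto simp: j_def eps_def yy_def intro!: arg_cong[of _ _ bb])
   obtain w where "w \<in> $M" "z = w *[M] bb m" using HD[OF HM[OF j(1)], of z] * j by auto
   then show "\<exists>w\<in>$M. \<exists>u\<in>{\<zero>[M]}. z = w *[M] bb m +[M] u" by - (rule bexI[of _ w], auto)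
  qed
 next
  fix U assume U: "submod U M" and QU: "Q U" and ne: "U \<noteq> $M"
  note u = rsubmoduleD[OF U]
  have QD: "\<exists>w\<in>$M. \<exists>u\<in>U. z = w *[M] bb m +[M] u"
   if "2 \<le> m" "m \<le> n" "z \<in> $M" "z *[M] ee m = z" "z *[M] bb (m-1) \<in> U" for m z using QU that unfolding Q_def by blast
  define B where "B = {m. 1 \<le> m \<and> m \<le> n \<and> (\<exists>z\<in>$M. z *[M] ee m = z \<and> z \<notin> U)}"
  have "B \<noteq> {}"
  proof
   assume e: "B = {}"
   have "v \<in> U" if v: "v \<in> $M" for v
   proof (rule component_induct[OF Mfd submodule_subspace[OF U] _ v])
    fix i assume i: "1 \<le> i" "i \<le> n"
    have "(v *[M] ee i) *[M] ee i = v *[M] ee i" using v by (simp add: M.ract_mult[symmetric])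
    then show "v *[M] ee i \<in> U" using e i v unfolding B_def by auto
   qed
   then show False using ne u(1) by blast
  qed
  \<comment> \<open>The highest vertex at which M/U is nonzero, so that whatever leaves v upwards
    lies in U.\<close>
  define m where "m = Max B"
  have finB: "finite B" by (rule finite_subset[of _ "{..n}"]) (auto simp: B_def)
  have mB: "m \<in> B" unfolding m_def by (rule Max_in[OF finB \<open>B \<noteq> {}\<close>])
  have m: "1 \<le> m" "m \<le> n" using mB by (auto simp: B_def)
  obtain v where v: "v \<in> $M" "v *[M] ee m = v" "v \<notin> U" using mB by (auto simp: B_def)
  have up: "z \<in> U" if "m < k" "z \<in> $M" "z *[M] ee k = z" for z k
  proof (cases "k \<le> n")
   case True
   then have "k \<notin> B" using that(1) Max_ge[OF finB, of k] by (auto simp: m_def)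
   then show ?thesis using that m True unfolding B_def by auto
  next
   case False
   then have "z = \<zero>[M]" using that by simp
   then show ?thesis using u(2) by simp
  qed
  have va: "v *[M] aa m \<in> U" by (rule up[of "Suc m"]) (use v in \<open>auto simp: M.ract_mult[symmetric] mult_ae\<close>)
  have vc: "v *[M] cc m \<in> U"
  proof -
   have "v *[M] cc m = (v *[M] aa m) *[M] bb m" using v by (simp add: M.ract_mult[symmetric] mult_ab)
   then show ?thesis using u(4)[OF va] by simp
  qed
  have sU: "sc M c x \<in> U" if "x \<in> U" for c x using subspaceD(4)[OF submodule_subspace[OF U] that] .
  have mU: "x -[M] y \<in> U" if "x \<in> U" "y \<in> U" for x y by (rule M.submodule_minus[OF U that])
  have scU: "c = 0" if "sc M c x \<in> U" "x \<in> $M" "x \<notin> U" for c x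
  proof (rule ccontr)
   assume "c \<noteq> 0"
   then have "sc M (inverse c) (sc M c x) = x" using that by (simp add: M.sc_sc)
   then show False using sU[OF that(1), of "inverse c"] that(3) by simp
  qed
  have wbU: "w *[M] bb m \<in> U" if w: "w \<in> $M" for w
  proof -
   have "w *[M] ee (Suc m) \<in> U" by (rule up[of "Suc m"]) (use w in \<open>auto simp: M.ract_mult[symmetric]\<close>)
   then have "(w *[M] ee (Suc m)) *[M] bb m \<in> U" using u(4) by simp
   then show ?thesis using w by (simp add: M.ract_mult[symmetric] mult_eb)
  qed
  \<comment> \<open>Otherwise Q would write v as \<open>w b_m\<close> plus an element of U; but
    \<open>w b_m\<close> passes through the vertex m + 1 and hence lies in U too.\<close>
  have vb: "v *[M] bb (m-1) \<notin> U" if m2: "2 \<le> m"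
  proof
   assume "v *[M] bb (m-1) \<in> U"
   then obtain w y where "w \<in> $M" "y \<in> U" "v = w *[M] bb m +[M] y" using QD[OF m2 m(2) v(1,2)] by blast
   then show False using v(3) wbU u(3) by auto
  qed
  have vx: "\<exists>y\<in>U. v *[M] x = (sc M (co (Ix_e m) x) v +[M] sc M (co (Ix_b (m-1)) x) (v *[M] bb (m-1))) +[M] y"
   if x: "x \<in> $A" for x
  proof
   let ?y = "sc M (co (Ix_a m) x) (v *[M] aa m) +[M] sc M (co (Ix_c m) x) (v *[M] cc m)"
   show "?y \<in> U" using va vc sU u(3) by simp
   show "v *[M] x = (sc M (co (Ix_e m) x) v +[M] sc M (co (Ix_b (m-1)) x) (v *[M] bb (m-1))) +[M] ?y"
    unfolding act_expand[OF Mfd v(1,2) x] using v(1) by (intro M.M.add_add_swap) auto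
  qed
  have vxe: "\<exists>y\<in>U. (v *[M] x) *[M] ee k = (if k = m then sc M (co (Ix_e m) x) v
     else if Suc k = m then sc M (co (Ix_b (m-1)) x) (v *[M] bb (m-1)) else \<zero>[M]) +[M] y" if x: "x \<in> $A" for x k
  proof -
   obtain y where y: "y \<in> U" "v *[M] x = (sc M (co (Ix_e m) x) v +[M] sc M (co (Ix_b (m-1)) x) (v *[M] bb (m-1))) +[M] y"
    using vx[OF x] by blast
   have vk: "v *[M] ee k = (if k = m then v else \<zero>[M])"
   proof -
    have "v *[M] ee k = v *[M] (ee m \<otimes> ee k)" using v by (simp add: M.ract_mult)
    then show ?thesis using v by (simp add: mult_ee)
   qed
   have vbk: "(v *[M] bb (m-1)) *[M] ee k = (if Suc k = m then v *[M] bb (m-1) else \<zero>[M])"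
    using v m by (auto simp: M.ract_mult[symmetric] mult_be)
   have "(v *[M] x) *[M] ee k = (sc M (co (Ix_e m) x) (v *[M] ee k) +[M]
      sc M (co (Ix_b (m-1)) x) ((v *[M] bb (m-1)) *[M] ee k)) +[M] y *[M] ee k"
    unfolding y(2) using v y(1) u(5) by (simp add: M.ract_add_left M.sc_act)
   then show ?thesis unfolding vk vbk using v u(4)[OF y(1), of "ee k"] by (intro bexI[of _ "y *[M] ee k"]) auto
  qed
  have ann: "v *[M] x \<in> U \<longleftrightarrow> Dann m x" if x: "x \<in> $A" for x
  proof
   assume D: "Dann m x"
   obtain y where "y \<in> U" "v *[M] x = (sc M (co (Ix_e m) x) v +[M] sc M (co (Ix_b (m-1)) x) (v *[M] bb (m-1))) +[M] y"
    using vx[OF x] by blast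
   then show "v *[M] x \<in> U" using D v u(5) by (simp add: Dann_def)
  next
   assume a: "v *[M] x \<in> U"
   obtain y where y: "y \<in> U" "(v *[M] x) *[M] ee m = sc M (co (Ix_e m) x) v +[M] y" using vxe[OF x, of m] by auto
   have "((v *[M] x) *[M] ee m) -[M] y \<in> U" using mU[OF u(4)[OF a] y(1)] by simp
   then have "sc M (co (Ix_e m) x) v \<in> U" unfolding y(2) using y(1) u(5) v by (simp add: M.M.add_diff_cancel)
   then have e: "co (Ix_e m) x = 0" using scU v by blast
   have "co (Ix_b (m-1)) x = 0"
   proof (cases "m = 1")
    case False
    then have m2: "2 \<le> m" using m by simp
    obtain y where y: "y \<in> U" "v *[M] x = (sc M (co (Ix_e m) x) v +[M] sc M (co (Ix_b (m-1)) x) (v *[M] bb (m-1))) +[M] y"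
     using vx[OF x] by blast
    then have "v *[M] x = sc M (co (Ix_b (m-1)) x) (v *[M] bb (m-1)) +[M] y" using e v by simp
    then have "sc M (co (Ix_b (m-1)) x) (v *[M] bb (m-1)) = v *[M] x -[M] y" using y(1) u(5) v by (simp add: M.M.add_diff_cancel)
    then have "sc M (co (Ix_b (m-1)) x) (v *[M] bb (m-1)) \<in> U" using mU[OF a y(1)] by simp
    then show ?thesis using scU vb[OF m2] v by simp
   qed (use x in simp)
   then show "Dann m x" using e by (simp add: Dann_def)
  qed
  note ep = extension_props[OF Mfd U v(1)]
  \<comment> \<open>Only for k = m can the new generator contribute to \<open>z b_{k-1}\<close>; in
    that case a multiple of v is subtracted from z before the invariant for U is used.\<close>
  have QE: "Q (extension M U v)" unfolding Q_def
  proof (intro allI impI)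
   fix k z assume "2 \<le> k \<and> k \<le> n \<and> z \<in> $M \<and> z *[M] ee k = z \<and> z *[M] bb (k-1) \<in> extension M U v"
   then have k: "2 \<le> k" "k \<le> n" and z: "z \<in> $M" "z *[M] ee k = z" "z *[M] bb (k-1) \<in> extension M U v" by auto
   consider "m < k" | "k = m" | "k < m" by linarith
   then show "\<exists>w\<in>$M. \<exists>u\<in>extension M U v. z = w *[M] bb k +[M] u"
   proof cases
    case 1
    then have "z \<in> extension M U v" using up z ep(2) by blast
    then show ?thesis using z by (intro bexI[of _ "\<zero>[M]"] bexI[of _ z]) auto
   next
    case 2
    obtain y x where y: "y \<in> U" "x \<in> $A" "z *[M] bb (k-1) = y +[M] v *[M] x" using z(3) by (auto simp: extension_def)
    obtain y' where y': "y' \<in> U" "(v *[M] x) *[M] ee (k-1) = sc M (co (Ix_b (m-1)) x) (v *[M] bb (m-1)) +[M] y'"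
     using vxe[OF y(2), of "k-1"] 2 k by auto
    define c where "c = co (Ix_b (m-1)) x"
    have "z *[M] bb (k-1) = (z *[M] bb (k-1)) *[M] ee (k-1)" using z by (simp add: M.ract_mult[symmetric] mult_be)
    also have "\<dots> = y *[M] ee (k-1) +[M] (sc M c (v *[M] bb (m-1)) +[M] y')"
     unfolding y(3) using y u(5) v y'(2) by (simp add: M.ract_add_left c_def)
    also have "\<dots> = (y *[M] ee (k-1) +[M] y') +[M] sc M c (v *[M] bb (m-1))" using y y' u(5) v by (simp add: M.M.a_ac)
    finally have zb: "z *[M] bb (k-1) = (y *[M] ee (k-1) +[M] y') +[M] sc M c (v *[M] bb (m-1))" .
    define z' where "z' = z -[M] sc M c v"
    have z': "z' \<in> $M" "z' *[M] ee k = z'" using z v 2 by (auto simp: z'_def M.minus_act M.sc_act)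
    have "z' *[M] bb (k-1) = z *[M] bb (k-1) -[M] sc M c (v *[M] bb (m-1))" using z v 2 by (simp add: z'_def M.minus_act M.sc_act)
    also have "\<dots> = y *[M] ee (k-1) +[M] y'" unfolding zb using y y' u(5) v by (simp add: M.M.add_diff_cancel)
    finally have "z' *[M] bb (k-1) \<in> U" using u(3) u(4)[OF y(1)] y'(1) by simp
    then obtain w t where wt: "w \<in> $M" "t \<in> U" "z' = w *[M] bb k +[M] t" using QD[OF k z'] by blast
    have "z = z' +[M] sc M c v" using z v by (simp add: z'_def M.M.minus_add_cancel)
    then have "z = w *[M] bb k +[M] (t +[M] sc M c v)" using wt u(5) v by (simp add: M.M.a_assoc)
    moreover have "t +[M] sc M c v \<in> extension M U v"
     using rsubmoduleD(3)[OF ep(1)] ep(2,3) wt(2) subspaceD(4)[OF submodule_subspace[OF ep(1)]] by blast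
    ultimately show ?thesis using wt(1) by blast
   next
    case 3
    obtain y x where y: "y \<in> U" "x \<in> $A" "z *[M] bb (k-1) = y +[M] v *[M] x" using z(3) by (auto simp: extension_def)
    obtain y' where y': "y' \<in> U" "(v *[M] x) *[M] ee (k-1) = \<zero>[M] +[M] y'" using vxe[OF y(2), of "k-1"] 3 k by auto
    have "z *[M] bb (k-1) = (z *[M] bb (k-1)) *[M] ee (k-1)" using z by (simp add: M.ract_mult[symmetric] mult_be)
    also have "\<dots> = y *[M] ee (k-1) +[M] y'" unfolding y(3) using y u(5) v y' by (simp add: M.ract_add_left)
    finally have "z *[M] bb (k-1) \<in> U" using u(3) u(4)[OF y(1)] y'(1) by simp
    then show ?thesis using QD[OF k z(1,2)] ep(2) by blast
   qed
  qed
  obtain t where "cyc (\<Theta> m) t (Dann m)" using \<Theta>[OF m] by blast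
  then show "\<exists>v i P w. v \<in> $M \<and> v \<notin> U \<and> Q (extension M U v) \<and> i \<in> {1..n} \<and>
    cyc (\<Theta> i) w P \<and> (\<forall>x\<in>$A. v *[M] x \<in> U \<longleftrightarrow> P x)"
   using v QE m ann by (intro exI[of _ v] exI[of _ m] exI[of _ "Dann m"] exI[of _ t]) auto
 qed
qed

text \<open>The mirror image, with the second half and the lowest vertex m at which M/U is nonzero.
  A vector there generates \<open>\<nabla>(m + 1)\<close> modulo U, unless m = 1 and
  \<open>a_1\<close> sends it into U, in which case the factor is
  \<open>\<nabla>(1)\<close>.\<close>

lemma filtered_costandard:
 assumes \<Theta>: "\<And>i. 1 \<le> i ==> i \<le> n ==> \<exists>v. cyc (\<Theta> i) v (Nann i)"
 shows "filtered_modules A n \<Theta> = {M \<in> modules A. \<forall>j. n < j \<and> j < 2 * n \<longrightarrow> H j M}"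
proof (intro equalityI subsetI)
 fix M assume M: "M \<in> filtered_modules A n \<Theta>"
 have "fdm (\<Theta> i) \<and> H j (\<Theta> i)" if i: "i \<in> {1..n}" and j: "n < j" "j < 2 * n" for i j
 proof -
  obtain v where v: "cyc (\<Theta> i) v (Nann i)" using \<Theta> i by auto
  show ?thesis using cycD(1)[OF v] costandard_H[OF v _ _ j] i by simp
 qed
 then show "M \<in> {M \<in> modules A. \<forall>j. n < j \<and> j < 2 * n \<longrightarrow> H j M}"
  using filtered_H[OF M] M by (auto simp: filtered_modules_def)
next
 fix M :: "('k, 'a) umodule" assume "M \<in> {M \<in> modules A. \<forall>j. n < j \<and> j < 2 * n \<longrightarrow> H j M}"
 then have M: "M \<in> modules A" and HM: "\<And>j. n < j ==> j < 2 * n ==> H j M" by auto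
 interpret M: amod A M by (rule modules_amod[OF M])
 note Mfd = modulesD[OF M]
 define Q where "Q U \<longleftrightarrow> (\<forall>m z. 2 \<le> m \<and> m \<le> n \<and> z \<in> $M \<and> z *[M] ee m = z \<and> z *[M] aa m \<in> U \<longrightarrow>
   (\<exists>w\<in>$M. \<exists>u\<in>U. z = w *[M] aa (m-1) +[M] u))" for U
 show "M \<in> filtered_modules A n \<Theta>"
 proof (rule filtered_memI[OF M, of Q])
  show "Q {\<zero>[M]}" unfolding Q_def
  proof (intro allI impI)
   fix m z assume *: "2 \<le> m \<and> m \<le> n \<and> z \<in> $M \<and> z *[M] ee m = z \<and> z *[M] aa m \<in> {\<zero>[M]}"
   define j where "j = n + m - 1"
   have j: "n < j" "j < 2 * n" "eps j = ee m" "yy (Suc j) = aa m" "yy j = aa (m-1)"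
    using * by (auto simp: j_def eps_def yy_def intro!: arg_cong[of _ _ aa])
   obtain w where "w \<in> $M" "z = w *[M] aa (m-1)" using HD[OF HM[OF j(1,2)], of z] * j by auto
   then show "\<exists>w\<in>$M. \<exists>u\<in>{\<zero>[M]}. z = w *[M] aa (m-1) +[M] u" by - (rule bexI[of _ w], auto)
  qed
 next
  fix U assume U: "submod U M" and QU: "Q U" and ne: "U \<noteq> $M"
  note u = rsubmoduleD[OF U]
  have QD: "\<exists>w\<in>$M. \<exists>u\<in>U. z = w *[M] aa (m-1) +[M] u"
   if "2 \<le> m" "m \<le> n" "z \<in> $M" "z *[M] ee m = z" "z *[M] aa m \<in> U" for m z using QU that unfolding Q_def by blast
  define B where "B = {m. 1 \<le> m \<and> m \<le> n \<and> (\<exists>z\<in>$M. z *[M] ee m = z \<and> z \<notin> U)}"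
  have "B \<noteq> {}"
  proof
   assume e: "B = {}"
   have "v \<in> U" if v: "v \<in> $M" for v
   proof (rule component_induct[OF Mfd submodule_subspace[OF U] _ v])
    fix i assume i: "1 \<le> i" "i \<le> n"
    have "(v *[M] ee i) *[M] ee i = v *[M] ee i" using v by (simp add: M.ract_mult[symmetric])
    then show "v *[M] ee i \<in> U" using e i v unfolding B_def by auto
   qed
   then show False using ne u(1) by blast
  qed
  define m where "m = Min B"
  have finB: "finite B" by (rule finite_subset[of _ "{..n}"]) (auto simp: B_def)
  have mB: "m \<in> B" unfolding m_def by (rule Min_in[OF finB \<open>B \<noteq> {}\<close>])
  have m: "1 \<le> m" "m \<le> n" using mB by (auto simp: B_def)
  have low: "z \<in> U" if "k < m" "z \<in> $M" "z *[M] ee k = z" for z k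
  proof (cases "1 \<le> k")
   case True
   then have "k \<notin> B" using that(1) Min_le[OF finB, of k] by (auto simp: m_def)
   then show ?thesis using that m True unfolding B_def by auto
  next
   case False
   then have "z = \<zero>[M]" using that by simp
   then show ?thesis using u(2) by simp
  qed
  have sU: "sc M c x \<in> U" if "x \<in> U" for c x using subspaceD(4)[OF submodule_subspace[OF U] that] .
  have mU: "x -[M] y \<in> U" if "x \<in> U" "y \<in> U" for x y by (rule M.submodule_minus[OF U that])
  have scU: "c = 0" if "sc M c x \<in> U" "x \<in> $M" "x \<notin> U" for c x
  proof (rule ccontr)
   assume "c \<noteq> 0"
   then have "sc M (inverse c) (sc M c x) = x" using that by (simp add: M.sc_sc)
   then show False using sU[OF that(1), of "inverse c"] that(3) by simp
  qed
  have waU: "w *[M] aa (m-1) \<in> U" if w: "w \<in> $M" for w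
  proof -
   have "w *[M] ee (m-1) \<in> U" by (rule low[of "m-1"]) (use w m in \<open>auto simp: M.ract_mult[symmetric]\<close>)
   then have "(w *[M] ee (m-1)) *[M] aa (m-1) \<in> U" using u(4) by simp
   then show ?thesis using w by (simp add: M.ract_mult[symmetric] mult_ea)
  qed
  text \<open>Either the new factor is the simple module at the vertex 1, or \<open>v\<close> generates a uniserial
   module with factors \<open>m\<close> and \<open>m + 1\<close>.\<close>
  define S where "S \<longleftrightarrow> m = 1 \<and> (\<exists>z\<in>$M. z *[M] ee 1 = z \<and> z \<notin> U \<and> z *[M] aa 1 \<in> U)"
  obtain v where v: "v \<in> $M" "v *[M] ee m = v" "v \<notin> U" and vS: "S ==> v *[M] aa m \<in> U"
  proof (cases S)
   case True then show ?thesis using that unfolding S_def by blast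
  next
   case False then show ?thesis using that mB unfolding B_def by blast
  qed
  have va: "m < n \<and> v *[M] aa m \<notin> U" if nS: "\<not> S"
  proof (cases "m = 1")
   case True then show ?thesis using nS v n2 unfolding S_def by auto
  next
   case False
   then have m2: "2 \<le> m" using m by simp
   have "v *[M] aa m \<notin> U"
   proof
    assume "v *[M] aa m \<in> U"
    then obtain w y where "w \<in> $M" "y \<in> U" "v = w *[M] aa (m-1) +[M] y" using QD[OF m2 m(2) v(1,2)] by blast
    then show False using v(3) waU u(3) by auto
   qed
   moreover have "m \<noteq> n"
   proof
    assume "m = n"
    then have "v *[M] aa m = \<zero>[M]" using v by simp
    then show False using calculation u(2) by simp
   qed
   ultimately show ?thesis using m by simp
  qed
  have vb: "v *[M] bb (m-1) \<in> U" by (rule low[of "m-1"]) (use v m in \<open>auto simp: M.ract_mult[symmetric] mult_be\<close>)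
  have vc: "v *[M] cc m \<in> U"
  proof (cases "m = 1")
   case False
   then have "m = n \<or> cc m = bb (m-1) \<otimes> aa (m-1)" using m by (auto simp: mult_ba)
   then have "v *[M] cc m = \<zero>[M] \<or> v *[M] cc m = (v *[M] bb (m-1)) *[M] aa (m-1)" using v by (auto simp: M.ract_mult)
   then show ?thesis using u(2) u(4)[OF vb, of "aa (m-1)"] by auto
  next
   case True
   show ?thesis
   proof (cases S)
    case S: True
    have "v *[M] cc m = (v *[M] aa m) *[M] bb m" using v by (simp add: M.ract_mult[symmetric] mult_ab)
    then show ?thesis using u(4)[OF vS[OF S]] by simp
   next
    case nS: False
    \<comment> \<open>The vector \<open>v c_1\<close> sits at the vertex 1 and is killed by
      \<open>a_1\<close>; outside U it would witness S.\<close>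
    have "(v *[M] cc 1) *[M] ee 1 = v *[M] cc 1" "(v *[M] cc 1) *[M] aa 1 \<in> U"
     using v u(2) by (auto simp: M.ract_mult[symmetric] mult_ce mult_rad)
    then show ?thesis using nS True v(1) unfolding S_def by auto
   qed
  qed
  have vx: "\<exists>y\<in>U. v *[M] x = (sc M (co (Ix_e m) x) v +[M] sc M (co (Ix_a m) x) (v *[M] aa m)) +[M] y" if x: "x \<in> $A" for x
  proof
   let ?y = "sc M (co (Ix_b (m-1)) x) (v *[M] bb (m-1)) +[M] sc M (co (Ix_c m) x) (v *[M] cc m)"
   show "?y \<in> U" using vb vc sU u(3) by simp
   show "v *[M] x = (sc M (co (Ix_e m) x) v +[M] sc M (co (Ix_a m) x) (v *[M] aa m)) +[M] ?y" by (rule act_expand[OF Mfd v(1,2) x])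
  qed
  have vxe: "\<exists>y\<in>U. (v *[M] x) *[M] ee k = (if k = m then sc M (co (Ix_e m) x) v
     else if k = Suc m then sc M (co (Ix_a m) x) (v *[M] aa m) else \<zero>[M]) +[M] y" if x: "x \<in> $A" for x k
  proof -
   obtain y where y: "y \<in> U" "v *[M] x = (sc M (co (Ix_e m) x) v +[M] sc M (co (Ix_a m) x) (v *[M] aa m)) +[M] y"
    using vx[OF x] by blast
   have vk: "v *[M] ee k = (if k = m then v else \<zero>[M])"
   proof -
    have "v *[M] ee k = v *[M] (ee m \<otimes> ee k)" using v by (simp add: M.ract_mult)
    then show ?thesis using v by (simp add: mult_ee)
   qed
   have vbk: "(v *[M] aa m) *[M] ee k = (if k = Suc m then v *[M] aa m else \<zero>[M])"
    using v m by (auto simp: M.ract_mult[symmetric] mult_ae)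
   have "(v *[M] x) *[M] ee k = (sc M (co (Ix_e m) x) (v *[M] ee k) +[M]
      sc M (co (Ix_a m) x) ((v *[M] aa m) *[M] ee k)) +[M] y *[M] ee k"
    unfolding y(2) using v y(1) u(5) by (simp add: M.ract_add_left M.sc_act)
   then show ?thesis unfolding vk vbk using v u(4)[OF y(1), of "ee k"] by (intro bexI[of _ "y *[M] ee k"]) auto
  qed
  \<comment> \<open>The generator of \<open>\<nabla>(i)\<close> sits at the vertex i - 1, whence the
    shift; the simple module \<open>\<nabla>(1)\<close> is the exception.\<close>
  define i where "i = (if S then 1 else Suc m)"
  have i: "1 \<le> i" "i \<le> n" using va n2 by (auto simp: i_def)
  have ann: "v *[M] x \<in> U \<longleftrightarrow> Nann i x" if x: "x \<in> $A" for x
  proof -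
   obtain y where y: "y \<in> U" "v *[M] x = (sc M (co (Ix_e m) x) v +[M] sc M (co (Ix_a m) x) (v *[M] aa m)) +[M] y"
    using vx[OF x] by blast
   show ?thesis
   proof
    assume D: "Nann i x"
    show "v *[M] x \<in> U"
    proof (cases S)
     case True
     then have "m = 1" "co (Ix_e m) x = 0" using D by (auto simp: S_def Nann_def i_def)
     then show ?thesis unfolding y(2) using y(1) vS[OF True] sU u(3) u(5) v by simp
    next
     case False
     then have "co (Ix_e m) x = 0" "co (Ix_a m) x = 0" using D m by (auto simp: Nann_def i_def)
     then show ?thesis unfolding y(2) using y(1) u(5) v by simp
    qed
   next
    assume a: "v *[M] x \<in> U"
    obtain y' where y': "y' \<in> U" "(v *[M] x) *[M] ee m = sc M (co (Ix_e m) x) v +[M] y'" using vxe[OF x, of m] by auto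
    have "((v *[M] x) *[M] ee m) -[M] y' \<in> U" using mU[OF u(4)[OF a] y'(1)] by simp
    then have "sc M (co (Ix_e m) x) v \<in> U" unfolding y'(2) using y'(1) u(5) v by (simp add: M.M.add_diff_cancel)
    then have e: "co (Ix_e m) x = 0" using scU v by blast
    show "Nann i x"
    proof (cases S)
     case True
     then show ?thesis using e by (auto simp: S_def Nann_def i_def)
    next
     case False
     have "v *[M] x = sc M (co (Ix_a m) x) (v *[M] aa m) +[M] y" using y(2) e v by simp
     then have "sc M (co (Ix_a m) x) (v *[M] aa m) = v *[M] x -[M] y" using y(1) u(5) v by (simp add: M.M.add_diff_cancel)
     then have "sc M (co (Ix_a m) x) (v *[M] aa m) \<in> U" using mU[OF a y(1)] by simp
     then have "co (Ix_a m) x = 0" using scU va[OF False] v by simp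
     then show ?thesis using e False m by (auto simp: Nann_def i_def)
    qed
   qed
  qed
  note ep = extension_props[OF Mfd U v(1)]
  have QE: "Q (extension M U v)" unfolding Q_def
  proof (intro allI impI)
   fix k z assume "2 \<le> k \<and> k \<le> n \<and> z \<in> $M \<and> z *[M] ee k = z \<and> z *[M] aa k \<in> extension M U v"
   then have k: "2 \<le> k" "k \<le> n" and z: "z \<in> $M" "z *[M] ee k = z" "z *[M] aa k \<in> extension M U v" by auto
   obtain y x where y: "y \<in> U" "x \<in> $A" "z *[M] aa k = y +[M] v *[M] x" using z(3) by (auto simp: extension_def)
   have ze: "z *[M] aa k = y *[M] ee (Suc k) +[M] (v *[M] x) *[M] ee (Suc k)"
   proof -
    have "z *[M] aa k = (z *[M] aa k) *[M] ee (Suc k)" using z by (simp add: M.ract_mult[symmetric] mult_ae)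
    also have "\<dots> = y *[M] ee (Suc k) +[M] (v *[M] x) *[M] ee (Suc k)"
     unfolding y(3) using y(1,2) u(5) v by (simp add: M.ract_add_left)
    finally show ?thesis .
   qed
   consider "k < m" | "k = m" | "m < k" by linarith
   then show "\<exists>w\<in>$M. \<exists>u\<in>extension M U v. z = w *[M] aa (k-1) +[M] u"
   proof cases
    case 1
    then have "z \<in> extension M U v" using low z ep(2) by blast
    then show ?thesis using z by (intro bexI[of _ "\<zero>[M]"] bexI[of _ z]) auto
   next
    case 2
    obtain y' where y': "y' \<in> U" "(v *[M] x) *[M] ee (Suc k) = sc M (co (Ix_a m) x) (v *[M] aa m) +[M] y'"
     using vxe[OF y(2), of "Suc k"] 2 by auto
    define c where "c = co (Ix_a m) x"
    have zb: "z *[M] aa k = (y *[M] ee (Suc k) +[M] y') +[M] sc M c (v *[M] aa m)"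
     unfolding ze y'(2) c_def using y y' u(5) v by (simp add: M.M.a_ac)
    define z' where "z' = z -[M] sc M c v"
    have z': "z' \<in> $M" "z' *[M] ee k = z'" using z v 2 by (auto simp: z'_def M.minus_act M.sc_act)
    have "z' *[M] aa k = z *[M] aa k -[M] sc M c (v *[M] aa m)" using z v 2 by (simp add: z'_def M.minus_act M.sc_act)
    also have "\<dots> = y *[M] ee (Suc k) +[M] y'" unfolding zb using y y' u(5) v by (simp add: M.M.add_diff_cancel)
    finally have "z' *[M] aa k \<in> U" using u(3) u(4)[OF y(1)] y'(1) by simp
    then obtain w t where wt: "w \<in> $M" "t \<in> U" "z' = w *[M] aa (k-1) +[M] t" using QD[OF k z'] by blast
    have "z = z' +[M] sc M c v" using z v by (simp add: z'_def M.M.minus_add_cancel)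
    then have "z = w *[M] aa (k-1) +[M] (t +[M] sc M c v)" using wt u(5) v by (simp add: M.M.a_assoc)
    moreover have "t +[M] sc M c v \<in> extension M U v"
     using rsubmoduleD(3)[OF ep(1)] ep(2,3) wt(2) subspaceD(4)[OF submodule_subspace[OF ep(1)]] by blast
    ultimately show ?thesis using wt(1) by blast
   next
    case 3
    obtain y' where y': "y' \<in> U" "(v *[M] x) *[M] ee (Suc k) = \<zero>[M] +[M] y'" using vxe[OF y(2), of "Suc k"] 3 by auto
    have "z *[M] aa k \<in> U" unfolding ze y'(2) using u(3) u(4)[OF y(1)] u(5) y'(1) by simp
    then show ?thesis using QD[OF k z(1,2)] ep(2) by blast
   qed
  qed
  obtain t where "cyc (\<Theta> i) t (Nann i)" using \<Theta>[OF i] by blast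
  then show "\<exists>v i P w. v \<in> $M \<and> v \<notin> U \<and> Q (extension M U v) \<and> i \<in> {1..n} \<and>
    cyc (\<Theta> i) w P \<and> (\<forall>x\<in>$A. v *[M] x \<in> U \<longleftrightarrow> P x)"
   using v QE i ann by (intro exI[of _ v] exI[of _ i] exI[of _ "Nann i"] exI[of _ t]) auto
 qed
qed

end

section \<open>Retracts and additive closures\<close>

context fd_algebra
begin

text \<open>Being a direct summand, without naming a complement. In this form the relation is
  transitive and connects modules of different types.\<close>

definition retract :: "('a, 'm) rmodule \<Rightarrow> ('a, 'n) rmodule \<Rightarrow> bool" where
 "retract L M \<longleftrightarrow> (\<exists>p s. mhom M L p \<and> mhom L M s \<and> (\<forall>x\<in>$L. p (s x) = x))"

lemma retractE:
 assumes "retract L M"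
 obtains p s where "mhom M L p" "mhom L M s" "\<And>x. x \<in> $L ==> p (s x) = x" using assms by (auto simp: retract_def)

lemma retractI:
 "mhom M L p ==> mhom L M s ==> (\<And>x. x \<in> $L ==> p (s x) = x) ==> retract L M"
 by (auto simp: retract_def)

lemma retract_iso: "mod_iso L M f g ==> retract L M" "mod_iso M L h k ==> retract L M"
 by (rule retractI[of M L g f] retractI[of M L h k]; auto simp: mod_iso_def)+

lemma retract_refl: "retract M M" by (rule retract_iso[OF mod_iso_refl])

lemma retract_trans:
 assumes "retract L M" "retract M N" shows "retract L N"
proof -
 obtain p s where p: "mhom M L p" "mhom L M s" "\<And>x. x \<in> $L ==> p (s x) = x" using assms(1) by (rule retractE) blast
 obtain q t where q: "mhom N M q" "mhom M N t" "\<And>x. x \<in> $M ==> q (t x) = x" using assms(2) by (rule retractE) blast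
 show ?thesis by (rule retractI[OF module_hom_comp[OF q(1) p(1)] module_hom_comp[OF p(2) q(2)]])
   (simp add: p(3) q(3) module_homD(1)[OF p(2)])
qed

lemma retract_sum:
 assumes "retract L M" "retract L' M'" shows "retract (direct_sum L L') (direct_sum M M')"
proof -
 obtain p s where p: "mhom M L p" "mhom L M s" "\<And>x. x \<in> $L ==> p (s x) = x" using assms(1) by (rule retractE) blast
 obtain q t where q: "mhom M' L' q" "mhom L' M' t" "\<And>x. x \<in> $L' ==> q (t x) = x"
  using assms(2) by (rule retractE) blast
 show ?thesis by (rule retractI[of _ _ "\<lambda>(x, y). (p x, q y)" "\<lambda>(x, y). (s x, t y)"])
   (auto intro!: module_homI simp: p(3) q(3) module_homD[OF p(1)] module_homD[OF p(2)]
    module_homD[OF q(1)] module_homD[OF q(2)])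
qed

lemma retract_fst: "fdm N ==> retract M (direct_sum M N)" by (rule retractI[OF hom_fst hom_inl]) auto

lemma retract_snd: "fdm M ==> retract N (direct_sum M N)" by (rule retractI[OF hom_snd hom_inr]) auto

lemma retract_split:
 assumes L: "fdm L" and M: "fdm M" and r: "retract L M"
 obtains Y f g where "Y \<in> modules A" "mod_iso M (direct_sum L Y) f g"
proof -
 obtain p s where p: "mhom M L p" "mhom L M s" "\<And>x. x \<in> $L ==> p (s x) = x" using r by (rule retractE) blast
 define K where "K = {x \<in> $M. p x = \<zero>[L]}"
 obtain f g where fg: "mod_iso M (direct_sum L (M |. K)) f g" using split_iso[OF M L p] unfolding K_def by blast
 have "fdm (M |. K)" unfolding K_def by (rule submodule_module[OF M kernel_submodule[OF M L p(1)]])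
 then obtain Y h k where Y: "Y \<in> modules A" "mod_iso (M |. K) Y h k" by (rule universe_copy)
 show ?thesis by (rule that[OF Y(1) mod_iso_trans[OF fg mod_iso_direct_sum[OF mod_iso_refl Y(2)]]])
qed

lemma direct_summand_iff:
 assumes L: "fdm L" and M: "fdm M"
 shows "direct_summand A L M \<longleftrightarrow> retract L M"
proof
 assume "direct_summand A L M"
 then obtain Y f g where "Y \<in> modules A" "mod_iso M (direct_sum L Y) f g"
  using module_iso_iff[OF M] unfolding direct_summand_def by blast
 then show "retract L M" using retract_trans[OF retract_fst[OF modulesD] retract_iso(2)] by blast
next
 assume "retract L M"
 then obtain Y f g where "Y \<in> modules A" "mod_iso M (direct_sum L Y) f g" by (rule retract_split[OF L M])
 then show "direct_summand A L M" unfolding direct_summand_def using module_isoI by blast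
qed

lemma direct_power_Suc:
 "mod_iso (direct_sum M (direct_power k M)) (direct_power (Suc k) M)
   (\<lambda>(x, y). \<lambda>i\<in>{..<Suc k}. if i = k then x else y i) (\<lambda>z. (z k, restrict z {..<k}))"
proof -
 show ?thesis unfolding mod_iso_def
 proof (intro conjI module_homI ballI; clarsimp simp: direct_power_def)
 qed (auto simp: direct_power_def PiE_iff less_Suc_eq fun_eq_iff extensional_def)
qed

lemma direct_power_0: "zero_module (direct_power 0 M)" by (auto simp: zero_module_def direct_power_def)

lemma direct_power_fd: assumes M: "fdm M" shows "fdm (direct_power k M)"
proof (induction k)
 case 0
 obtain Z :: "('k, 'a) umodule" where Z: "Z \<in> modules A" "zero_module Z" by (rule zero_module_ex)
 show ?case by (rule image_module[OF modulesD[OF Z(1)], of _ "\<lambda>_. \<lambda>_. undefined"])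
   (use Z(2) in \<open>auto simp: direct_power_def zero_module_def intro!: module_homI\<close>)
next
 case (Suc k)
 note i = mod_isoD[OF direct_power_Suc[of M k]]
 show ?case by (rule image_module[OF direct_sum_fd[OF M Suc] i(1,5)]) (auto simp: direct_power_def)
qed

section \<open>Additive closures, finite coresolutions and indecomposability\<close>

lemma add_closure_iff:
 assumes L: "L \<in> modules A" and T: "fdm T"
 shows "L \<in> add_closure A T \<longleftrightarrow> (\<exists>k. retract L (direct_power k T))"
 using L direct_summand_iff[OF modulesD[OF L] direct_power_fd[OF T]] by (simp add: add_closure_def)

lemma retract_power_one: "fdm T ==> retract T (direct_power (Suc 0) T)"
 using retract_trans[OF retract_fst[OF direct_power_fd] retract_iso(1)[OF direct_power_Suc]] .

lemma retract_power_zero: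
 assumes "fdm T" "zero_module Z" "fdm Z" shows "retract Z (direct_power 0 T)"
 by (rule retractI[OF module_hom_zero[OF assms(3)] module_hom_zero[OF direct_power_fd[OF assms(1)]]])
  (use assms(2) in \<open>simp add: zero_module_def\<close>)

lemma retract_power_sum:
 "retract P T ==> retract K (direct_power k T) ==> retract (direct_sum P K) (direct_power (Suc k) T)"
 using retract_trans[OF retract_sum retract_iso(1)[OF direct_power_Suc]] .

text \<open>The coresolution condition on a tilting module, stated for an arbitrary module in place
  of A, so that it can be obtained by splicing short exact sequences.\<close>

definition coresolved :: "('a, 'm) rmodule \<Rightarrow> ('a, 'n) rmodule \<Rightarrow> bool" where
 "coresolved T M \<longleftrightarrow> (\<exists>I j d. exact_right_resolution A M I j d \<and> (\<forall>i. I i \<in> add_closure A T) \<and>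
   (\<exists>r. \<forall>i>r. zero_module (I i)))"

lemma coresolved_splice:
 assumes s: "ses M P C f g" and T: "fdm T" and P: "retract P (direct_power k T)"
  and C: "coresolved T C"
 shows "coresolved T M"
proof -
 obtain P' h h' where P': "(P' :: ('k, 'a) umodule) \<in> modules A" "mod_iso P P' h h'" using universe_copy[OF sesD(2)[OF s]] by blast
 have P'T: "P' \<in> add_closure A T" using add_closure_iff[OF P'(1) T] retract_trans[OF retract_iso(2)[OF P'(2)] P] by blast
 obtain I j d r where I: "exact_right_resolution A C I j d" "\<forall>i. I i \<in> add_closure A T" "\<forall>i>r. zero_module (I i)"
  using C unfolding coresolved_def by blast
 note e = exact_right_splice[OF ses_iso_middle[OF s modulesD[OF P'(1)] P'(2)] P'(1) I(1)]
 have "\<forall>i. case_nat P' I i \<in> add_closure A T" using I(2) P'T by (auto split: nat.split)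
 moreover have "\<forall>i>Suc r. zero_module (case_nat P' I i)" using I(3) by (auto split: nat.split)
 ultimately show ?thesis unfolding coresolved_def using e by blast
qed

lemma coresolved_self:
 assumes M: "fdm M" and T: "fdm T" and P: "retract M (direct_power k T)"
 shows "coresolved T M"
proof -
 obtain Z :: "('k, 'a) umodule" where Z: "Z \<in> modules A" "zero_module Z" by (rule zero_module_ex)
 interpret M: amod A M by (rule amodI[OF M])
 interpret Z: amod A Z by (rule modules_amod[OF Z(1)])
 have Zc: "$Z = {\<zero>[Z]}" using Z(2) by (simp add: zero_module_def)
 have "exact_right_resolution A Z (\<lambda>_. Z) (\<lambda>x. x) (\<lambda>_ x. x)"
  unfolding exact_right_resolution_def a_kernel_def' using Z(1) by (auto simp: module_hom_id Zc)
 then have "coresolved T Z" unfolding coresolved_def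
  using Z add_closure_iff[OF Z(1) T] retract_power_zero[OF T Z(2) modulesD[OF Z(1)]] by blast
 moreover have "ses M M Z (\<lambda>x. x) (\<lambda>_. \<zero>[Z])"
  unfolding ses_def using M modulesD[OF Z(1)] module_hom_zero[OF modulesD[OF Z(1)]] by (auto simp: module_hom_id Zc)
 ultimately show ?thesis using coresolved_splice[OF _ T P] by blast
qed

text \<open>If both vectors are multiples of z and one of them is nonzero, then a component of z
  vanishes and so does the other vector. This rules out repeated summands wherever a space of
  dimension at most one is found.\<close>

lemma pair_line:
 assumes L: "fdm L" and Y: "fdm Y" and x: "x \<in> $L" "y \<in> $Y"
  and z: "z \<in> $(direct_sum L Y)" "(x, \<zero>[Y]) = sc (direct_sum L Y) c z" "(\<zero>[L], y) = sc (direct_sum L Y) d z"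
 shows "x = \<zero>[L] \<or> y = \<zero>[Y]"
proof -
 interpret L: amod A L by (rule amodI[OF L])
 interpret Y: amod A Y by (rule amodI[OF Y])
 obtain u v where uv: "z = (u, v)" "u \<in> $L" "v \<in> $Y" using z(1) by auto
 have *: "x = sc L c u" "sc Y c v = \<zero>[Y]" "y = sc Y d v" using z(2,3) by (simp_all add: uv sc_direct_sum)
 show ?thesis
 proof (cases "c = 0")
  case False
  then show ?thesis using Y.sc_eq_zero[OF uv(3) *(2)] *(3) by simp
 qed (use * uv in simp)
qed

text \<open>Every nonzero submodule contains z, so two nonzero summands would meet.\<close>

lemma indecomposableI:
 assumes M: "fdm M" and z: "z \<in> $M" "z \<noteq> \<zero>[M]"
  and ess: "\<And>x. x \<in> $M ==> x \<noteq> \<zero>[M] ==> \<exists>a\<in>$A. x *[M] a = z"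
 shows "indecomposable A M" unfolding indecomposable_def
proof (intro conjI ballI impI)
 interpret M: amod A M by (rule amodI[OF M])
 show "\<not> zero_module M" using z by (auto simp: zero_module_def)
 fix L Y :: "('k, 'a) umodule" assume LY: "L \<in> modules A" "Y \<in> modules A" and i: "module_iso A M (direct_sum L Y)"
 note D = direct_sum_fd[OF modulesD[OF LY(1)] modulesD[OF LY(2)]]
 interpret L: amod A L by (rule modules_amod[OF LY(1)])
 interpret Y: amod A Y by (rule modules_amod[OF LY(2)])
 obtain f g where fg: "mod_iso M (direct_sum L Y) f g" using i module_iso_iff[OF M] by blast
 note ig = mod_iso_sym[OF fg]
 have hit: "\<exists>a\<in>$A. u *[direct_sum L Y] a = f z" if u: "u \<in> $(direct_sum L Y)" "u \<noteq> \<zero>[direct_sum L Y]" for u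
 proof -
  have gu: "g u \<in> $M" "g u \<noteq> \<zero>[M]" "f (g u) = u"
   using module_homD(1)[OF mod_isoD(2)[OF fg] u(1)] mod_isoD(4)[OF fg u(1)] u(2) hom_zero[OF M D mod_isoD(1)[OF fg]] by auto
  obtain a where a: "a \<in> $A" "g u *[M] a = z" using ess[OF gu(1,2)] by blast
  have "f (g u *[M] a) = f (g u) *[direct_sum L Y] a" by (rule module_homD(3)[OF mod_isoD(1)[OF fg] gu(1) a(1)])
  then show ?thesis using a gu(3) by auto
 qed
 show "zero_module L \<or> zero_module Y"
 proof (rule ccontr)
  assume "\<not> (zero_module L \<or> zero_module Y)"
  then obtain l y where ly: "l \<in> $L" "l \<noteq> \<zero>[L]" "y \<in> $Y" "y \<noteq> \<zero>[Y]" by (auto simp: zero_module_def)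
  obtain a where a: "a \<in> $A" "(l, \<zero>[Y]) *[direct_sum L Y] a = f z" using hit[of "(l, \<zero>[Y])"] ly by auto
  obtain b where b: "b \<in> $A" "(\<zero>[L], y) *[direct_sum L Y] b = f z" using hit[of "(\<zero>[L], y)"] ly by auto
  have "f z = \<zero>[direct_sum L Y]" using a b by (metis Y.zero_act direct_sum_simps(2,4) prod.inject L.zero_act)
  moreover have "f \<zero>[M] = \<zero>[direct_sum L Y]" by (rule hom_zero[OF M D mod_isoD(1)[OF fg]])
  ultimately show False using inj_onD[OF mod_isoD(6)[OF fg], of z "\<zero>[M]"] z by auto
 qed
qed

lemma submodule_induct:
 assumes M: "fdm M"
  and step: "\<And>U. submod U M ==> (\<And>K. submod K M ==> K \<subset> U ==> \<Phi> K) ==> \<Phi> U"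
 shows "\<Phi> ($M)"
proof (rule ccontr)
 assume n: "\<not> \<Phi> ($M)"
 interpret M: amod A M by (rule amodI[OF M])
 define P where "P U \<longleftrightarrow> submod U M \<and> \<not> \<Phi> U" for U
 have "P ($M)" "\<And>U. P U ==> subspace M U" using n M.submodule_carrier submodule_subspace by (auto simp: P_def)
 then obtain U where U: "P U" and m: "\<And>V. P V ==> V \<subseteq> U ==> V = U" by (rule M.minimal_subspace[of P]) blast+
 then show False using step[of U] by (auto simp: P_def)
qed

end

section \<open>Tilting modules\<close>

context coordinate_algebra
begin

text \<open>Descent from the vertex n to 2: if m + 1 carries no vectors, then z at m is killed by
  \<open>a_m\<close> and the second half gives \<open>z = w a_{m-1}\<close>. Now
  \<open>z b_{m-1} = w c_{m-1} = 0\<close>, so the first half writes z as a multiple of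
  \<open>b_m\<close>, which comes from m + 1 and vanishes.\<close>

lemma both_exact_semisimple:
 assumes M: "fdm M" and H: "\<And>j. j < n - 1 ==> H j M" "\<And>j. n < j ==> j < 2 * n ==> H j M"
  and c: "\<And>i t. 1 \<le> i ==> i < n ==> t \<in> $M ==> t *[M] cc i = \<zero>[M]" and v: "v \<in> $M"
 shows "v *[M] ee 1 = v" "v *[M] aa 1 = \<zero>[M]"
proof -
 interpret M: amod A M by (rule amodI[OF M])
 have c': "t *[M] cc i = \<zero>[M]" if "t \<in> $M" for t i using c[of i t] that by (cases "1 \<le> i \<and> i < n") auto
 have z: "z = \<zero>[M]" if "2 \<le> m" "m \<le> n" "z \<in> $M" "z *[M] ee m = z" for m z using that
 proof (induction "n - m" arbitrary: m z rule: less_induct)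
  case less
  have up: "w = \<zero>[M]" if w: "w \<in> $M" "w *[M] ee (Suc m) = w" for w
  proof (cases "m = n")
   case True then show ?thesis using w by simp
  next
   case False then show ?thesis using less.hyps[of "Suc m" w] less.prems w by auto
  qed
  have upx: "w *[M] x = \<zero>[M]" if "w \<in> $M" "x \<in> $A" "ee (Suc m) \<otimes> x = x" for w x
   using up[of "w *[M] ee (Suc m)"] cut[OF M that(2,3,1)] that by simp
  have za: "z *[M] aa m = \<zero>[M]" by (rule up) (use less.prems in \<open>auto simp: M.ract_mult[symmetric] mult_ae\<close>)
  define j where "j = n + m - 1"
  have j: "n < j" "j < 2 * n" "eps j = ee m" "yy (Suc j) = aa m" "yy j = aa (m-1)"
   using less.prems by (auto simp: j_def eps_def yy_def intro!: arg_cong[of _ _ ee] arg_cong[of _ _ aa])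
  obtain w where w: "w \<in> $M" "z = w *[M] aa (m-1)" using HD[OF H(2)[OF j(1,2)] less.prems(3)] less.prems(4) za j(3-) by auto
  have zb: "z *[M] bb (m-1) = \<zero>[M]" using w c' by (simp add: M.ract_mult[symmetric] mult_ab)
  define l where "l = n - m"
  have l: "l < n - 1" "eps l = ee m" "yy (Suc l) = bb (m-1)"
   using less.prems(1,2) by (simp_all add: l_def eps_def yy_def Suc_diff_le[symmetric] numeral_2_eq_2)
  have l4: "yy l = bb m" using bas_out[of "Ix_b m"] less.prems(1,2) by (cases "m = n") (simp_all add: l_def yy_def)
  obtain u where "u \<in> $M" "z = u *[M] bb m" using HD[OF H(1)[OF l(1)] less.prems(3)] less.prems(4) zb l(2-) l4 by auto
  then show ?case using upx[of u "bb m"] by (simp add: mult_eb)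
 qed
 have "v \<in> {x \<in> $M. x *[M] ee 1 = x}"
 proof (rule component_induct[OF M _ _ v])
  show "subspace M {x \<in> $M. x *[M] ee 1 = x}" by (rule subspaceI) (auto simp: M.ract_add_left M.sc_act)
  fix i assume i: "1 \<le> i" "i \<le> n"
  show "v *[M] ee i \<in> {x \<in> $M. x *[M] ee 1 = x}"
  proof (cases "i = 1")
   case False
   then have "v *[M] ee i = \<zero>[M]" using z[of i "v *[M] ee i"] i v by (simp add: M.ract_mult[symmetric])
   then show ?thesis by simp
  qed (use v in \<open>simp add: M.ract_mult[symmetric]\<close>)
 qed
 then show v1: "v *[M] ee 1 = v" by simp
 show "v *[M] aa 1 = \<zero>[M]" by (rule z[of 2]) (use v n2 in \<open>auto simp: M.ract_mult[symmetric] mult_ae\<close>)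
qed

lemma Dann_1: "x \<in> $A ==> Dann 1 x \<longleftrightarrow> co (Ix_e 1) x = 0" by (simp add: Dann_def)

lemma simple_act:
 assumes S: "cyc S s (Dann 1)" and x: "x \<in> $A"
 shows "s *[S] x = sc S (co (Ix_e 1) x) s"
proof -
 interpret S: amod A S by (rule amodI[OF cycD(1)[OF S]])
 note s = cycD(2)[OF S]
 let ?c = "co (Ix_e 1) x"
 have "s *[S] (x \<oplus> (- ?c) \<odot> \<one>) = \<zero>[S]" using cycD(4)[OF S, of "x \<oplus> (- ?c) \<odot> \<one>"] x n2 by (simp add: Dann_def co_simps)
 moreover have "(x \<oplus> (- ?c) \<odot> \<one>) \<oplus> ?c \<odot> \<one> = x" using x by (intro alg_eqI) (auto simp: co_simps)
 moreover have "s *[S] ((x \<oplus> (- ?c) \<odot> \<one>) \<oplus> ?c \<odot> \<one>) = s *[S] (x \<oplus> (- ?c) \<odot> \<one>) +[S] s *[S] (?c \<odot> \<one>)"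
  using s x by (intro S.ract_add_right) auto
 ultimately show ?thesis using s by (simp add: sc_def)
qed

lemma simple_elim:
 assumes S: "cyc S s (Dann 1)" and z: "z \<in> $S" obtains c where "z = sc S c s" using cyc_elim[OF S z] simple_act[OF S] by metis

lemma simple_ne: assumes S: "cyc S s (Dann 1)" shows "s \<noteq> \<zero>[S]"
proof -
 interpret S: amod A S by (rule amodI[OF cycD(1)[OF S]])
 show ?thesis using cycD(4)[OF S, of \<one>] n2 S.ract_one[OF cycD(2)[OF S]] by (auto simp: Dann_def co_one)
qed

lemma simple_zero:
 assumes S: "cyc S s (Dann 1)" and x: "x \<in> $A" "co (Ix_e 1) x = 0" and z: "z \<in> $S"
 shows "z *[S] x = \<zero>[S]"
proof -
 interpret S: amod A S by (rule amodI[OF cycD(1)[OF S]])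
 obtain c where c: "z = sc S c s" by (rule simple_elim[OF S z])
 show ?thesis unfolding c using cycD(2)[OF S] simple_act[OF S x(1)] x by (simp add: S.sc_act)
qed

text \<open>A acts on M through the \<open>e_1\<close>-coordinate alone, so any nonzero vector spans
  a copy of S and a linear functional projects onto it.\<close>

lemma semisimple_split:
 assumes M: "fdm M" and S: "cyc S s (Dann 1)"
  and e: "\<And>v. v \<in> $M ==> v *[M] ee 1 = v" and a: "\<And>v. v \<in> $M ==> v *[M] aa 1 = \<zero>[M]"
  and nz: "\<not> zero_module M"
 shows "retract S M"
proof -
 interpret M: amod A M by (rule amodI[OF M])
 interpret S: amod A S by (rule amodI[OF cycD(1)[OF S]])
 note s = cycD(2)[OF S]
 obtain v where v: "v \<in> $M" "v \<noteq> \<zero>[M]" using nz M.M.zero_closed by (auto simp: zero_module_def)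
 obtain \<mu> where \<mu>: "M.functional \<mu>" "\<mu> v = 1" using M.functional_ex[OF v] by blast
 have cz: "z *[M] cc 1 = \<zero>[M]" if z: "z \<in> $M" for z
 proof -
  have "(z *[M] aa 1) *[M] bb 1 = \<zero>[M]" using a[OF z] by simp
  then show ?thesis using z by (simp add: M.ract_mult[symmetric] mult_ab)
 qed
 have act: "z *[M] x = sc M (co (Ix_e 1) x) z" if "z \<in> $M" "x \<in> $A" for z x
  using act_expand[OF M that(1) e that(2)] a[OF that(1)] cz[OF that(1)] that n2 by simp
 have "\<exists>f. mhom S M f \<and> f s = v"
 proof -
  define N where "N = M\<lparr>carrier := {sc M c v |c. True}\<rparr>"
  have N: "submod {sc M c v |c. True} M" using subspaceD[OF M.subspace_line[OF v(1)]] v by (intro rsubmoduleI) (auto simp: act M.sc_sc)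
  have "cyc N v (Dann 1)" unfolding cyc_def
  proof (intro conjI ballI)
   show "fdm N" unfolding N_def by (rule submodule_module[OF M N])
   show "v \<in> $N" using v by (auto simp: N_def intro!: exI[of _ 1])
   show "$N = {v *[N] x |x. x \<in> $A}" using act[OF v(1)] by (auto simp: N_def) (metis sc_def one_A scalar_closed)
   show "v *[N] x = \<zero>[N] \<longleftrightarrow> Dann 1 x" if "x \<in> $A" for x
    using act[OF v(1) that] M.sc_eq_zero[OF v(1)] v Dann_1[OF that] by (auto simp: N_def)
  qed
  then obtain f g where fg: "mod_iso S N f g" "f s = v" by (rule cyc_mod_iso[OF S])
  have "mhom N M (\<lambda>x. x)" unfolding N_def by (rule submodule_inclusion[OF N])
  then have "mhom S M f" by (rule module_hom_comp[OF mod_isoD(1)[OF fg(1)]])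
  then show ?thesis using fg(2) by blast
 qed
 then obtain f where f: "mhom S M f" "f s = v" by blast
 show ?thesis
 proof (rule retractI)
  show "mhom M S (\<lambda>z. sc S (\<mu> z) s)" using \<mu> s unfolding M.functional_def
   by (intro module_homI) (auto simp: act S.sc_plus S.sc_act S.sc_sc simple_act[OF S] mult.commute)
  show "mhom S M f" by (rule f(1))
  fix z assume "z \<in> $S"
  then obtain c where c: "z = sc S c s" by (rule simple_elim[OF S])
  show "sc S (\<mu> (f z)) s = z" unfolding c module_homD(4)[OF f(1) s] f(2) using \<mu> v unfolding M.functional_def by auto
 qed
qed

lemma simple_indecomposable:
 assumes S: "cyc S s (Dann 1)" shows "indecomposable A S"
proof (rule indecomposableI[OF cycD(1,2)[OF S] simple_ne[OF S]])
 interpret S: amod A S by (rule amodI[OF cycD(1)[OF S]])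
 fix x assume x: "x \<in> $S" "x \<noteq> \<zero>[S]"
 obtain c where c: "x = sc S c s" by (rule simple_elim[OF S x(1)])
 then have "c \<noteq> 0" using x(2) cycD(2)[OF S] by auto
 then have "x *[S] (inverse c \<odot> \<one>) = s" using cycD(2)[OF S] S.sc_sc by (simp add: c sc_def[symmetric])
 then show "\<exists>a\<in>$A. x *[S] a = s" by (intro bexI[of _ "inverse c \<odot> \<one>"]) auto
qed

text \<open>\<open>c_i\<close> spans the socle: according to which coordinate of x is nonzero,
  \<open>c_i\<close>, \<open>b_i\<close>, \<open>a_{i-1}\<close> or \<open>e_i\<close> carries x to
  a nonzero multiple of \<open>c_i\<close>.\<close>

lemma eA_indecomposable:
 assumes i: "1 \<le> i" "i < n" shows "indecomposable A (eA i)"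
proof (rule indecomposableI[OF eA_fd])
 have i0: "i \<le> n" using i by simp
 show "cc i \<in> $(eA i)" by (simp add: eA_mem mult_ec)
 have "co (Ix_c i) (cc i) = 1" using i by simp
 then show "cc i \<noteq> \<zero>[eA i]" by (metis co_zero idempotent_simps(1) zero_neq_one)
 fix x assume "x \<in> $(eA i)" and nz: "x \<noteq> \<zero>[eA i]"
 then have x: "x \<in> $A" "ee i \<otimes> x = x" by (auto simp: eA_mem)
 note ex = ee_mult_expand[OF x(1), of i, unfolded x(2)]
 have hit: "\<exists>a\<in>$A. x *[eA i] a = cc i" if "y \<in> $A" "x \<otimes> y = d \<odot> cc i" "d \<noteq> 0" for y d
  using that x by (intro bexI[of _ "inverse d \<odot> y"]) (auto simp: smult_mult_right scalar_mult[symmetric])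
 have c: "co t x = co t (ee i \<otimes> x)" for t using x by simp
 consider "co (Ix_e i) x \<noteq> 0" | "co (Ix_e i) x = 0" "co (Ix_a i) x \<noteq> 0"
  | "co (Ix_e i) x = 0" "co (Ix_b (i-1)) x \<noteq> 0"
  | "co (Ix_e i) x = 0" "co (Ix_a i) x = 0" "co (Ix_b (i-1)) x = 0" "co (Ix_c i) x \<noteq> 0" using nz ex by fastforce
 then show "\<exists>a\<in>$A. x *[eA i] a = cc i"
 proof cases
  case 1
  show ?thesis by (rule hit[OF _ _ 1, of "cc i"]) (use x in \<open>simp_all add: mult_cc_expand\<close>)
 next
  case 2
  have "co (Ix_e (Suc i)) x = 0" using c[of "Ix_e (Suc i)"] x(1) by (simp add: co_simps)
  then show ?thesis using x 2 by (intro hit[OF _ _ 2(2), of "bb i"]) (simp_all add: mult_bb_expand)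
 next
  case 3
  then have "1 \<le> i - 1" using x by (cases "i - 1") auto
  moreover have "co (Ix_e (i-1)) x = 0" using c[of "Ix_e (i-1)"] x(1) calculation by (auto simp: co_simps split: if_splits)
  ultimately show ?thesis using 3 x i by (intro hit[OF _ _ 3(2), of "aa (i-1)"]) (simp_all add: mult_aa_expand)
 next
  case 4
  then have "x = co (Ix_c i) x \<odot> cc i" using ex x by simp
  moreover have "(d \<odot> cc i) \<otimes> ee i = d \<odot> cc i" for d by (simp add: mult_ce smult_mult_left)
  ultimately have "x \<otimes> ee i = co (Ix_c i) x \<odot> cc i" by metis
  then show ?thesis by (rule hit[OF bas_closed _ 4(4)])
 qed
qed

text \<open>The idempotent \<open>e_1 + ... + e_k\<close>, given by its coordinates. The module
  \<open>E (n - 1)\<close> will turn out to be the minimal faithful projective-injective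
  one.\<close>

definition esum :: "nat \<Rightarrow> 'a" where
 "esum k = mk (case_idx (\<lambda>j. if j \<le> k then 1 else 0) (\<lambda>_. 0) (\<lambda>_. 0) (\<lambda>_. 0))"

lemma esum: "esum k \<in> $A" "co (Ix_e i) (esum k) = (if 1 \<le> i \<and> i \<le> n \<and> i \<le> k then 1 else 0)"
 "co (Ix_a i) (esum k) = 0" "co (Ix_b i) (esum k) = 0" "co (Ix_c i) (esum k) = 0" by (auto simp: esum_def mk)

lemma esum_idem: "esum k \<otimes> esum k = esum k" using esum(1) by (intro alg_eqI) (auto simp: co_simps esum(2-))

abbreviation "E k \<equiv> idempotent_module A (esum k)"

lemma E_mem: "x \<in> $(E k) \<longleftrightarrow> x \<in> $A \<and> esum k \<otimes> x = x" by (rule idempotent_mem[OF esum(1) esum_idem])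

lemma E_fd: "fdm (E k)" by (rule idempotent_fd[OF esum(1)])

lemma E_Suc: "retract (E (Suc k)) (direct_sum (eA (Suc k)) (E k))"
proof (rule retractI)
 have s: "esum (Suc k) \<otimes> ee (Suc k) = ee (Suc k)" "esum (Suc k) \<otimes> esum k = esum k"
  using esum(1) by (intro alg_eqI; auto simp: co_simps esum(2-))+
 have "esum (Suc k) = ee (Suc k) \<oplus> esum k" using esum(1) by (intro alg_eqI) (auto simp: co_simps esum(2-))
 then have d: "esum (Suc k) \<otimes> x = ee (Suc k) \<otimes> x \<oplus> esum k \<otimes> x" if "x \<in> $A" for x
  using that esum(1) by (simp add: A_l_distr)
 show "mhom (direct_sum (eA (Suc k)) (E k)) (E (Suc k)) (\<lambda>(x, y). x \<oplus> y)"
 proof (rule module_homI; clarsimp simp: eA_mem E_mem)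
  fix x y assume x: "x \<in> $A" "ee (Suc k) \<otimes> x = x" and y: "y \<in> $A" "esum k \<otimes> y = y"
  have "esum (Suc k) \<otimes> x = x" using s(1) x esum(1) by (metis A_assoc bas_closed)
  moreover have "esum (Suc k) \<otimes> y = y" using s(2) y esum(1) by (metis A_assoc)
  ultimately show "esum (Suc k) \<otimes> (x \<oplus> y) = x \<oplus> y" using x y esum(1) by (simp add: A_r_distr)
 qed (auto simp: A_a_ac A_l_distr)
 show "mhom (E (Suc k)) (direct_sum (eA (Suc k)) (E k)) (\<lambda>x. (ee (Suc k) \<otimes> x, esum k \<otimes> x))"
  using esum(1) by (intro module_homI) (auto simp: eA_mem E_mem A_r_distr A_assoc[symmetric] esum_idem)
 show "(\<lambda>(x, y). x \<oplus> y) (ee (Suc k) \<otimes> x, esum k \<otimes> x) = x" if "x \<in> $(E (Suc k))" for x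
  using that d by (auto simp: E_mem)
qed

text \<open>The summands \<open>e_1 A\<close>, ..., \<open>e_k A\<close> are split off one at a time
  from what the previous ones leave over.\<close>

lemma E_retract:
 assumes M: "fdm M" and t: "\<And>i. 1 \<le> i ==> i < n ==> \<exists>t\<in>$M. t *[M] cc i \<noteq> \<zero>[M]"
 shows "k < n ==> retract (E k) M"
proof (induction k)
 case 0
 interpret M: amod A M by (rule amodI[OF M])
 have "esum 0 = \<zero>" using esum(1) by (intro alg_eqI) (auto simp: esum(2-))
 then have "x = \<zero>" if "x \<in> $(E 0)" for x using that[unfolded E_mem] by auto
 then show ?case by (intro retractI[OF module_hom_zero[OF E_fd] module_hom_zero[OF M]]) simp
next
 case (Suc k)
 then have r: "retract (E k) M" by simp
 obtain Y f g where Y: "Y \<in> modules A" "mod_iso M (direct_sum (E k) Y) f g" by (rule retract_split[OF E_fd M r])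
 note Yfd = modulesD[OF Y(1)] and f = module_homD[OF mod_isoD(1)[OF Y(2)]]
 obtain t where t: "t \<in> $M" "t *[M] cc (Suc k) \<noteq> \<zero>[M]" using assms(2)[of "Suc k"] Suc.prems by auto
 obtain x y where xy: "f t = (x, y)" "x \<in> $(E k)" "y \<in> $Y" using f(1)[OF t(1)] by auto
 have "esum k \<otimes> x = x" "x \<in> $A" using xy(2) by (auto simp: E_mem)
 \<comment> \<open>Elements of \<open>E k\<close> have no \<open>e_{k+1}\<close>-coordinate, so
   \<open>c_{k+1}\<close> kills them and the nonzero product has to come from the complement
   Y.\<close>
 then have "co (Ix_e (Suc k)) x = 0" using esum(1)[of k] by (metis co_mult(1) esum(2) mult_zero_left not_less_eq_eq order_refl)
 then have xc: "x \<otimes> cc (Suc k) = \<zero>" using \<open>x \<in> $A\<close> by (simp add: mult_cc_expand)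
 have "f (t *[M] cc (Suc k)) = (\<zero>, y *[Y] cc (Suc k))" using f(3)[OF t(1), of "cc (Suc k)"] xy xc by simp
 moreover have "f (t *[M] cc (Suc k)) \<noteq> (\<zero>, \<zero>[Y])"
  using iso_zero_iff[OF M direct_sum_fd[OF E_fd Yfd] Y(2), of "t *[M] cc (Suc k)"] t
   fd_right_module.ract_closed[OF M t(1)] by simp
 ultimately have y: "y *[Y] cc (Suc k) \<noteq> \<zero>[Y]" by auto
 obtain K g h where K: "submod K Y" "mod_iso Y (direct_sum (eA (Suc k)) (Y |. K)) g h" by (rule peel[OF Yfd _ Suc.prems xy(3) y]) simp_all
 have "retract (direct_sum (eA (Suc k)) (E k)) (direct_sum Y (E k))"
  using retract_sum[OF retract_trans[OF retract_fst[OF submodule_module[OF Yfd K(1)]] retract_iso(2)[OF K(2)]] retract_refl] .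
 then show ?case using retract_trans[OF E_Suc] retract_trans[OF _ retract_iso(1)[OF mod_iso_direct_sum_comm]]
   retract_trans[OF _ retract_iso(2)[OF Y(2)]] by blast
qed

definition both_exact :: "('a, 'm) rmodule \<Rightarrow> bool" where
 "both_exact M \<longleftrightarrow> (\<forall>j. j < n - 1 \<or> n < j \<and> j < 2 * n \<longrightarrow> H j M)"

lemma both_exact_retract:
 assumes "fdm M" "fdm L" "retract L M" "both_exact M" shows "both_exact L"
proof -
 obtain p s where p: "mhom M L p" "mhom L M s" "\<And>x. x \<in> $L ==> p (s x) = x" using assms(3) by (rule retractE) blast
 show ?thesis using H_retract[OF assms(1,2) p] assms(4) unfolding both_exact_def by blast
qed

lemma both_exact_sum:
 "fdm M ==> fdm N ==> both_exact (direct_sum M N) \<longleftrightarrow> both_exact M \<and> both_exact N"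
 unfolding both_exact_def using H_direct_sum by blast

lemma both_exact_injective: "injective J ==> projective J ==> both_exact J"
proof -
 have "0 < 2 * n - 2" using n2 by simp
 then show "injective J ==> projective J ==> both_exact J"
  unfolding both_exact_def using injective_H projective_H by blast
qed

lemma H_power:
 assumes T: "fdm T" "H j T" shows "H j (direct_power k T)"
proof (induction k)
 case 0
 show ?case by (rule H_zero[OF direct_power_fd[OF T(1)] direct_power_0])
next
 case (Suc k)
 note fd = direct_power_fd[OF T(1)]
 show ?case by (rule H_iso[OF direct_sum_fd[OF T(1) fd] fd direct_power_Suc]) (simp add: H_direct_sum[OF T(1) fd] T Suc)
qed

text \<open>At i = 1 the annihilators of the standard and the costandard generator coincide, so this
  simple module belongs to both families.\<close>

lemma simple_both_exact:
 assumes S: "cyc S s (Dann 1)" shows "both_exact S"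
proof -
 have c: "cyc S s (Nann 1)" using S by (auto simp: cyc_def Dann_def Nann_def)
 show ?thesis unfolding both_exact_def using standard_H[OF S] costandard_H[OF c] n2 by auto
qed

lemma eA_E: "1 \<le> i ==> i \<le> k ==> retract (eA i) (E k)"
proof (rule retractI)
 assume i: "1 \<le> i" "i \<le> k"
 then have s: "esum k \<otimes> ee i = ee i" "ee i \<otimes> esum k = ee i" using esum(1) by (intro alg_eqI; auto simp: co_simps esum(2-))+
 show "mhom (E k) (eA i) (\<lambda>x. ee i \<otimes> x)" by (rule module_homI) (auto simp: eA_mem E_mem A_r_distr A_assoc[symmetric])
 have "esum k \<otimes> x = x" if "x \<in> $(eA i)" for x using that s esum(1) by (metis A_assoc bas_closed eA_mem)
 then show "mhom (eA i) (E k) (\<lambda>x. x)" by (intro module_homI) (auto simp: eA_mem E_mem)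
qed (simp add: eA_mem)

section \<open>Resolving the simple module at the vertex 1\<close>

abbreviation "aA i \<equiv> idempotent_module A (aa i)"

lemma aA_fd: "fdm (aA i)" by (rule idempotent_fd) simp

lemma aA_mem: "x \<in> $(aA i) \<longleftrightarrow> x \<in> $A \<and> ee i \<otimes> x = x \<and> co (Ix_e i) x = 0 \<and> co (Ix_b (i-1)) x = 0"
 unfolding idempotent_carrier right_ideal_aa by simp

text \<open>Glued together, these sequences resolve \<open>a_k A\<close> by
  \<open>e_{k+1} A\<close>, ..., \<open>e_n A\<close>. Read from the left they coresolve
  \<open>a_{n-1} A\<close> by \<open>e_{n-1} A\<close>, ..., \<open>e_1 A\<close>, which ends in the
  simple module \<open>e_1 A / a_1 A\<close>.\<close>

lemma aA_ses:
 assumes k: "1 \<le> k" "k < n" shows "ses (aA (Suc k)) (eA (Suc k)) (aA k) (\<lambda>x. x) (\<lambda>x. aa k \<otimes> x)"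
 unfolding ses_def
proof (intro conjI)
 show "mhom (aA (Suc k)) (eA (Suc k)) (\<lambda>x. x)" by (rule module_homI) (auto simp: aA_mem eA_mem)
 show "mhom (eA (Suc k)) (aA k) (\<lambda>x. aa k \<otimes> x)"
  by (rule module_homI) (auto simp: idempotent_carrier[of "aa k"] eA_mem A_r_distr A_assoc[symmetric])
 have "aa k \<otimes> x = aa k \<otimes> (ee (Suc k) \<otimes> x)" if "x \<in> $A" for x
  using that by (simp add: A_assoc[symmetric] mult_ae)
 then show "(\<lambda>x. aa k \<otimes> x) ` $(eA (Suc k)) = $(aA k)" by (auto simp: idempotent_carrier)
 have "aa k \<otimes> x = \<zero> \<longleftrightarrow> co (Ix_e (Suc k)) x = 0 \<and> co (Ix_b k) x = 0" if x: "x \<in> $A" for x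
 proof
  assume z: "aa k \<otimes> x = \<zero>"
  have "co (Ix_a k) (aa k \<otimes> x) = 0" "co (Ix_c k) (aa k \<otimes> x) = 0" unfolding z by simp_all
  then show "co (Ix_e (Suc k)) x = 0 \<and> co (Ix_b k) x = 0" using x k by (simp add: co_simps)
 next
  assume "co (Ix_e (Suc k)) x = 0 \<and> co (Ix_b k) x = 0"
  then show "aa k \<otimes> x = \<zero>" using x k by (intro alg_eqI) (auto simp: co_simps)
 qed
 then show "(\<lambda>x. x) ` $(aA (Suc k)) = {x \<in> $(eA (Suc k)). aa k \<otimes> x = \<zero>[aA k]}" by (auto simp: aA_mem eA_mem)
qed (auto simp: aA_fd eA_fd)

text \<open>Homomorphisms from such a module to the simple module at the vertex 1 vanish.\<close>

definition no_top :: "('a, 'm) rmodule \<Rightarrow> bool" where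
 "no_top P \<longleftrightarrow> (\<forall>x\<in>$P. x *[P] ee 1 = x \<longrightarrow> (\<exists>w\<in>$P. x = w *[P] bb 1))"

lemma no_topE:
 assumes "no_top P" "x \<in> $P" "x *[P] ee 1 = x" obtains w where "w \<in> $P" "x = w *[P] bb 1" using assms unfolding no_top_def by blast

lemma no_top_iso:
 assumes M: "no_top M" and i: "mod_iso M N f g" shows "no_top N" unfolding no_top_def
proof (intro ballI impI)
 note f = module_homD[OF mod_isoD(1)[OF i]] and g = module_homD[OF mod_isoD(2)[OF i]]
 fix x assume x: "x \<in> $N" "x *[N] ee 1 = x"
 then have "g x *[M] ee 1 = g x" using g(3)[OF x(1), of "ee 1"] by simp
 then obtain w where w: "w \<in> $M" "g x = w *[M] bb 1" using M g(1)[OF x(1)] unfolding no_top_def by blast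
 have "x = f w *[N] bb 1" using f(3)[OF w(1), of "bb 1"] w(2) mod_isoD(4)[OF i x(1)] by simp
 then show "\<exists>w\<in>$N. x = w *[N] bb 1" using f(1)[OF w(1)] by blast
qed

lemma no_top_zero: "fdm Z ==> zero_module Z ==> no_top Z"
proof -
 assume Z: "fdm Z" "zero_module Z"
 interpret Z: amod A Z by (rule amodI[OF Z(1)])
 show ?thesis using Z(2) by (auto simp: no_top_def zero_module_def)
qed

lemma no_top_eA: assumes k: "1 \<le> k" shows "no_top (eA (Suc k))" unfolding no_top_def
proof (intro ballI impI)
 fix x assume "x \<in> $(eA (Suc k))" "x *[eA (Suc k)] ee 1 = x"
 then have x: "x \<in> $A" "ee (Suc k) \<otimes> x = x" "x \<otimes> ee 1 = x" by (auto simp: eA_mem)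
 have c: "co t x = co t (ee (Suc k) \<otimes> x)" for t using x by simp
 have "co (Ix_e 1) x = 0" "co (Ix_c 1) x = 0" using c[of "Ix_e 1"] c[of "Ix_c 1"] x(1) k by (simp_all add: co_simps split: if_splits)
 then have "x = co (Ix_b 1) x \<odot> bb 1" using mult_ee_expand[OF x(1), of 1] x by simp
 moreover have "(d \<odot> ee 2) \<otimes> bb 1 = d \<odot> bb 1" for d by (simp add: smult_mult_left mult_eb)
 ultimately have w: "x = (co (Ix_b 1) x \<odot> ee 2) \<otimes> bb 1" by metis
 then have "ee (Suc k) \<otimes> x = (ee (Suc k) \<otimes> (co (Ix_b 1) x \<odot> ee 2)) \<otimes> bb 1" by (metis A_assoc bas_closed scalar_closed)
 then show "\<exists>w\<in>$(eA (Suc k)). x = w *[eA (Suc k)] bb 1"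
  using x by (intro bexI[of _ "ee (Suc k) \<otimes> (co (Ix_b 1) x \<odot> ee 2)"]) (auto simp: eA_mem A_assoc[symmetric])
qed

text \<open>Besides zero modules only copies of \<open>e_j A\<close> with j > k \<ge> 1 occur, and
  in these every vector at the vertex 1 is a multiple of \<open>b_1\<close>. The recursion ends with
  \<open>a_n A = 0\<close>.\<close>

lemma resolution_aA:
 "1 \<le> k ==> k \<le> n ==> \<exists>P p d. proj_res (aA k) P p d \<and> (\<forall>i. no_top (P i))"
proof (induction "n - k" arbitrary: k)
 case 0
 then have "aa k = \<zero>" using bas_out[of "Ix_a k"] by simp
 then have z: "zero_module (aA k)" by (auto simp: zero_module_def idempotent_carrier intro!: exI[of _ \<zero>])
 obtain Z f g where Z: "(Z :: ('k, 'a) umodule) \<in> modules A" "mod_iso (aA k) Z f g" using universe_copy[OF aA_fd] by blast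
 have zZ: "zero_module Z" using mod_isoD(5)[OF Z(2)] hom_zero[OF aA_fd modulesD[OF Z(1)] mod_isoD(1)[OF Z(2)]] z
  by (auto simp: zero_module_def)
 obtain P p d where P: "proj_res Z P p d" "P 0 = Z" "\<forall>i>0. zero_module (P i)"
  using projective_resolution_projective[OF Z(1) zero_projective[OF modulesD[OF Z(1)] zZ]] by blast
 have "no_top (P i)" for i using no_top_zero[OF modulesD] projective_resolutionD(1)[OF P(1)] P(2,3) zZ by (cases "i = 0") auto
 then show ?case using projective_resolution_iso[OF modulesD[OF Z(1)] aA_fd mod_iso_sym[OF Z(2)] P(1)] by blast
next
 case (Suc m)
 then have k: "1 \<le> k" "k < n" "m = n - Suc k" by auto
 obtain P p d where P: "proj_res (aA (Suc k)) P p d" "\<forall>i. no_top (P i)" using Suc.hyps(1)[OF k(3)] k by auto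
 obtain F h h' where F: "(F :: ('k, 'a) umodule) \<in> modules A" "mod_iso (eA (Suc k)) F h h'" using universe_copy[OF eA_fd] by blast
 note r = projective_resolution_splice[OF ses_iso_middle[OF aA_ses[OF k(1,2)] modulesD[OF F(1)] F(2)] F(1)
   projective_iso[OF eA_projective modulesD[OF F(1)] F(2)] P(1)]
 have "\<forall>i. no_top (case_nat F P i)" using P(2) no_top_iso[OF no_top_eA[OF k(1)] F(2)] by (auto split: nat.split)
 then show ?case using r by blast
qed

lemma simple_ses:
 assumes S: "cyc S s (Dann 1)" shows "ses (aA 1) (eA 1) S (\<lambda>x. x) (\<lambda>x. s *[S] x)"
proof -
 interpret S: amod A S by (rule amodI[OF cycD(1)[OF S]])
 note s = cycD(2)[OF S]
 have e: "s *[S] x = s *[S] (ee 1 \<otimes> x)" if "x \<in> $A" for x using that n2 by (simp add: simple_act[OF S] co_simps)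
 show ?thesis unfolding ses_def
 proof (intro conjI)
  show "mhom (aA 1) (eA 1) (\<lambda>x. x)" by (rule module_homI) (auto simp: aA_mem eA_mem)
  show "mhom (eA 1) S (\<lambda>x. s *[S] x)" using s by (intro module_homI) (auto simp: eA_mem S.ract_add_right S.ract_mult)
  show "(\<lambda>x. s *[S] x) ` $(eA 1) = $S" unfolding cycD(3)[OF S] idempotent_carrier using e by auto
  show "(\<lambda>x. x) ` $(aA 1) = {x \<in> $(eA 1). s *[S] x = \<zero>[S]}" using cycD(4)[OF S] by (auto simp: aA_mem eA_mem Dann_def)
 qed (auto simp: aA_fd eA_fd cycD(1)[OF S])
qed

text \<open>The resolution of \<open>J \<oplus> S\<close> begins with
  \<open>J \<oplus> e_1 A\<close> and continues with that of \<open>a_1 A\<close>. A cocycle has no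
  component in S, since no later term maps nontrivially to S, and its component in J is a coboundary
  by injectivity of J.\<close>

lemma add_Ext_vanishes:
 fixes J :: "('a, 'm) rmodule" and S :: "('a, 's) rmodule"
 assumes J: "injective J" "projective J" and S: "cyc S s (Dann 1)"
 shows "Ext_Suc_vanishes A i (direct_sum J S) (direct_sum J S)"
proof -
 note Jfd = injectiveD[OF J(1)] and Sfd = cycD(1)[OF S]
 interpret J: amod A J by (rule amodI[OF Jfd])
 interpret S: amod A S by (rule amodI[OF Sfd])
 note q = sesD[OF simple_ses[OF S]]
 note D = direct_sum_fd[OF Jfd eA_fd[of 1]] and T = direct_sum_fd[OF Jfd Sfd]
 have "ses (aA 1) (direct_sum J (eA 1)) (direct_sum J S) (\<lambda>x. (\<zero>[J], x)) (\<lambda>(x, y). (x, s *[S] y))" unfolding ses_def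
 proof (intro conjI)
  show "mhom (aA 1) (direct_sum J (eA 1)) (\<lambda>x. (\<zero>[J], x))" using module_hom_comp[OF q(4) hom_inr[OF Jfd]] by simp
  show "mhom (direct_sum J (eA 1)) (direct_sum J S) (\<lambda>(x, y). (x, s *[S] y))"
   using module_homD[OF q(5)] by (intro module_homI) auto
  show "(\<lambda>(x, y). (x, s *[S] y)) ` $(direct_sum J (eA 1)) = $(direct_sum J S)" unfolding direct_sum_simps q(7)[symmetric] by auto
  show "(\<lambda>x. (\<zero>[J], x)) ` $(aA 1) =
    {x \<in> $(direct_sum J (eA 1)). (\<lambda>(x, y). (x, s *[S] y)) x = \<zero>[direct_sum J S]}" using q(8) by (auto simp: image_iff)
 qed (use D T in \<open>auto simp: aA_fd inj_on_def\<close>)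
 note ss = this
 obtain F h h' where F: "(F :: ('k, 'a) umodule) \<in> modules A" "mod_iso (direct_sum J (eA 1)) F h h'" using universe_copy[OF D] by blast
 have "\<exists>P p d. proj_res (aA 1) P p d \<and> (\<forall>i. no_top (P i))" using resolution_aA[of 1] n2 by simp
 then obtain P p d where P: "proj_res (aA 1) P p d" "\<forall>i. no_top (P i)" by blast
 obtain P' p' d' where r: "proj_res (direct_sum J S) P' p' d'" and P': "\<And>i. P' (Suc i) = P i"
  using projective_resolution_splice[OF ses_iso_middle[OF ss modulesD[OF F(1)] F(2)] F(1)
   projective_iso[OF projective_direct_sum[OF J(2) eA_projective] modulesD[OF F(1)] F(2)] P(1)] by (metis nat.case(2))
 note rD = projective_resolutionD[OF r]
 show ?thesis unfolding Ext_Suc_vanishes_def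
 proof (rule exI[of _ P'], rule exI[of _ p'], rule exI[of _ d'], intro conjI allI impI)
  show "proj_res (direct_sum J S) P' p' d'" by (rule r)
  fix f assume "mhom (P' (Suc i)) (direct_sum J S) f \<and>
    (\<forall>x\<in>$(P' (Suc (Suc i))). f (d' (Suc i) x) = \<zero>[direct_sum J S])"
  then have f: "mhom (P' (Suc i)) (direct_sum J S) f"
   and fd: "\<And>x. x \<in> $(P' (Suc (Suc i))) ==> f (d' (Suc i) x) = \<zero>[direct_sum J S]" by auto
  note Q = modulesD[OF rD(1)[rule_format]]
  interpret Q: amod A "P' (Suc i)" by (rule amodI[OF Q])
  \<comment> \<open>Vectors at the vertex 1 in a term of positive degree are multiples of
    \<open>b_1\<close>, and \<open>b_1\<close> acts as zero on S.\<close>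
  have fS: "snd (f x) = \<zero>[S]" if x: "x \<in> $(P' (Suc i))" for x
  proof -
   note g = module_homD[OF module_hom_comp[OF f hom_snd]]
   have nt: "no_top (P' (Suc i))" using P(2) P' by simp
   obtain w where w: "w \<in> $(P' (Suc i))" "x *[P' (Suc i)] ee 1 = w *[P' (Suc i)] bb 1"
    by (rule no_topE[OF nt, of "x *[P' (Suc i)] ee 1"]) (use x in \<open>auto simp: Q.ract_mult[symmetric]\<close>)
   have "snd (f x) *[S] ee 1 = snd (f w) *[S] bb 1" using g(3)[OF x, of "ee 1"] g(3)[OF w(1), of "bb 1"] w(2) by simp
   also have "\<dots> = \<zero>[S]" by (rule simple_zero[OF S]) (use g(1)[OF w(1)] in simp_all)
   finally have z: "snd (f x) *[S] ee 1 = \<zero>[S]" .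
   obtain c where c: "snd (f x) = sc S c s" using simple_elim[OF S g(1)[OF x]] by blast
   then have "snd (f x) *[S] ee 1 = snd (f x)" using cycD(2)[OF S] n2 by (simp add: S.sc_act simple_act[OF S])
   then show ?thesis using z by simp
  qed
  \<comment> \<open>The cocycle factors through the image of the differential, and injectivity of J
    extends it from this submodule to \<open>P' i\<close>.\<close>
  define N where "N = (P' i)\<lparr>carrier := d' i ` $(P' (Suc i))\<rparr>"
  have N: "submod (d' i ` $(P' (Suc i))) (P' i)" by (rule image_submodule[OF Q Q rD(3)[rule_format] Q.submodule_carrier])
  have Nfd: "fdm N" unfolding N_def by (rule submodule_module[OF Q N])
  have dN: "mhom (P' (Suc i)) N (d' i)" using module_homD[OF rD(3)[rule_format, of i]] unfolding N_def by (intro module_homI) auto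
  have k: "fst (f x) = \<zero>[J]" if x: "x \<in> $(P' (Suc i))" "d' i x = \<zero>[N]" for x
  proof -
   have "x \<in> d' (Suc i) ` $(P' (Suc (Suc i)))" using rD(6)[rule_format, of i] x by (simp add: N_def)
   then show ?thesis using fd by auto
  qed
  have dsurj: "d' i ` $(P' (Suc i)) = $N" by (simp add: N_def)
  obtain g where g: "mhom N J g" "\<And>x. x \<in> $(P' (Suc i)) ==> g (d' i x) = fst (f x)"
   using factor_hom[OF Q Nfd Jfd dN dsurj module_hom_comp[OF f hom_fst] k] by blast
  have "mhom N (P' i) (\<lambda>x. x)" unfolding N_def by (rule submodule_inclusion[OF N])
  then obtain g' where g': "mhom (P' i) J g'" "\<And>x. x \<in> $N ==> g' x = g x"
   using inj_extend[OF J(1) Nfd Q _ _ g(1)] by (metis inj_on_id2)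
  show "\<exists>g. mhom (P' i) (direct_sum J S) g \<and> (\<forall>x\<in>$(P' (Suc i)). f x = g (d' i x))"
  proof (intro exI conjI ballI)
   show "mhom (P' i) (direct_sum J S) (\<lambda>x. (g' x, \<zero>[S]))" by (rule module_hom_comp[OF g'(1) hom_inl[OF Sfd]])
   fix x assume x: "x \<in> $(P' (Suc i))"
   then have "d' i x \<in> $N" by (simp add: N_def)
   then show "f x = (g' (d' i x), \<zero>[S])" using g'(2) g(2)[OF x] fS[OF x] by (simp add: prod_eq_iff)
  qed
 qed
qed

end

section \<open>Mutual retracts and basic modules\<close>

context fd_algebra
begin

text \<open>The composite of the two embeddings is an injective endomorphism, hence onto; so already
  the second embedding is onto.\<close>

lemma retract_antisym:
 assumes L: "fdm L" and M: "fdm M" and r: "retract L M" "retract M L"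
 obtains f g where "mod_iso L M f g"
proof -
 obtain p s where s: "mhom M L p" "mhom L M s" "\<And>x. x \<in> $L ==> p (s x) = x" using r(1) by (rule retractE) blast
 obtain q t where t: "mhom L M q" "mhom M L t" "\<And>x. x \<in> $M ==> q (t x) = x" using r(2) by (rule retractE) blast
 note sc = module_homD(1)[OF s(2)] and tc = module_homD(1)[OF t(2)]
 have si: "inj_on s ($L)" using s(3) by (metis inj_onI)
 have "inj_on t ($M)" using t(3) by (metis inj_onI)
 then have "inj_on (\<lambda>x. s (t x)) ($M)" using si tc by (auto simp: inj_on_def)
 from injective_endo_surj[OF M module_hom_comp[OF t(2) s(2)] this]
 have eq: "(\<lambda>x. s (t x)) ` $M = $M" .
 have "x \<in> s ` $L" if x: "x \<in> $M" for x
 proof -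
  have "x \<in> (\<lambda>x. s (t x)) ` $M" unfolding eq by (rule x)
  then show ?thesis using tc by blast
 qed
 then have "s ` $L = $M" using sc by blast
 then show ?thesis using that bij_hom_mod_iso[OF L s(2)] si unfolding bij_betw_def by blast
qed

lemma mod_iso_zero:
 assumes "fdm Z" "zero_module Z" shows "mod_iso (direct_sum M Z) M fst (\<lambda>x. (x, \<zero>[Z]))"
 using assms hom_fst hom_inl[OF assms(1)] unfolding mod_iso_def by (auto simp: zero_module_def)

lemma zero_module_iso:
 assumes "fdm M" "fdm N" "mod_iso M N f g" "zero_module M" shows "zero_module N"
 using mod_isoD(5)[OF assms(3)] hom_zero[OF assms(1,2) mod_isoD(1)[OF assms(3)]] assms(4) by (simp add: zero_module_def)

lemma retract_copy:
 assumes P: "fdm P" "\<not> zero_module P" "retract P N" "retract P T"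
 obtains P' where "P' \<in> modules A" "\<not> zero_module P'" "retract P' N" "retract P' T"
proof -
 obtain P' f g where P': "P' \<in> modules A" "mod_iso P P' f g" using universe_copy[OF P(1)] by blast
 note t = retract_trans[OF retract_iso(2)[OF P'(2)]]
 have "\<not> zero_module P'" using zero_module_iso[OF modulesD[OF P'(1)] P(1) mod_iso_sym[OF P'(2)]] P(2) by blast
 then show ?thesis by (rule that[OF P'(1) _ t[OF P(3)] t[OF P(4)]])
qed

lemma basicD:
 assumes b: "basic_module A T" and T: "fdm T" and P: "fdm P" "indecomposable A P"
 shows "\<not> retract (direct_sum P P) T"
proof
 assume r: "retract (direct_sum P P) T"
 obtain L f g where L: "L \<in> modules A" "mod_iso P L f g" using universe_copy[OF P(1)] by blast
 note Lfd = modulesD[OF L(1)]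
 have "indecomposable A L" unfolding indecomposable_def
 proof (intro conjI ballI impI)
  have "\<not> zero_module P" using P(2) by (simp add: indecomposable_def)
  then show "\<not> zero_module L" using zero_module_iso[OF Lfd P(1) mod_iso_sym[OF L(2)]] by blast
  fix U V :: "('k, 'a) umodule" assume UV: "U \<in> modules A" "V \<in> modules A" "module_iso A L (direct_sum U V)"
  then obtain h k where "mod_iso L (direct_sum U V) h k" using module_iso_iff[OF Lfd] by blast
  then have "module_iso A P (direct_sum U V)" by (rule module_isoI[OF mod_iso_trans[OF L(2)]])
  then show "zero_module U \<or> zero_module V" using P(2) UV by (auto simp: indecomposable_def)
 qed
 moreover have "retract (direct_sum L L) T" by (rule retract_trans[OF retract_sum[OF retract_iso(2)[OF L(2)] retract_iso(2)[OF L(2)]] r])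
 then have "direct_summand A (direct_sum L L) T" using direct_summand_iff[OF direct_sum_fd[OF Lfd Lfd] T] by simp
 ultimately show False using b L(1) unfolding basic_module_def by blast
qed

end

section \<open>The additive closure and the minimal faithful module\<close>

context coordinate_algebra
begin

lemma peel_retract:
 assumes M: "fdm M" and i: "1 \<le> i" "i < n" and t: "t \<in> $M" "t *[M] cc i \<noteq> \<zero>[M]"
 shows "retract (eA i) M"
proof -
 obtain K g h where K: "submod K M" "mod_iso M (direct_sum (eA i) (M |. K)) g h" by (rule peel[OF M i t])
 show ?thesis by (rule retract_trans[OF retract_fst[OF submodule_module[OF M K(1)]] retract_iso(2)[OF K(2)]])
qed

text \<open>Induction over submodules: a nonzero module that is exact in both halves has some
  \<open>e_i A\<close> with i < n as a retract, or S if all \<open>c_i\<close> act as zero. The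
  complement is smaller and still exact in both halves.\<close>

lemma both_exact_add:
 assumes S: "cyc S s (Dann 1)" and eT: "\<And>i. 1 \<le> i ==> i < n ==> retract (eA i) T" and ST: "retract S T"
  and T: "fdm T" and M: "fdm M" "both_exact M"
 shows "\<exists>k. retract M (direct_power k T)"
proof -
 interpret M: amod A M by (rule amodI[OF M(1)])
 define \<Phi> where "\<Phi> U \<longleftrightarrow> (both_exact (M |. U) \<longrightarrow> (\<exists>k. retract (M |. U) (direct_power k T)))" for U
 have "\<Phi> ($M)"
 proof (rule submodule_induct[OF M(1)])
  fix U assume U: "submod U M" and IH: "\<And>K. submod K M ==> K \<subset> U ==> \<Phi> K"
  define N where "N = (M |. U)"
  have N: "fdm N" unfolding N_def by (rule submodule_module[OF M(1) U])
  have *: "\<exists>k. retract N (direct_power k T)"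
   if P: "P \<in> modules A" "\<not> zero_module P" "retract P N" "retract P T" and b: "both_exact N" for P
  proof -
   note Pfd = modulesD[OF P(1)]
   interpret P: amod A P by (rule amodI[OF Pfd])
   obtain p s where p: "mhom N P p" "mhom P N s" "\<And>x. x \<in> $P ==> p (s x) = x" using P(3) by (rule retractE) blast
   define K where "K = {x \<in> $N. p x = \<zero>[P]}"
   have K: "submod K N" unfolding K_def by (rule kernel_submodule[OF N Pfd p(1)])
   obtain x where x: "x \<in> $P" "x \<noteq> \<zero>[P]" using P(2) P.M.zero_closed by (auto simp: zero_module_def)
   then have "s x \<in> $N" "s x \<notin> K" using module_homD(1)[OF p(2)] p(3)[OF x(1)] by (auto simp: K_def)
   then have Ks: "submod K M" "K \<subset> U" "(N |. K) = (M |. K)" using K submodule_trans[OF U] by (auto simp: N_def rsubmodule_def)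
   obtain f g where i: "mod_iso N (direct_sum P (N |. K)) f g" using split_iso[OF N Pfd p] unfolding K_def by blast
   have "both_exact (N |. K)"
    by (rule both_exact_retract[OF N submodule_module[OF N K] retract_trans[OF retract_snd[OF Pfd] retract_iso(2)[OF i]] b])
   then obtain k where "retract (N |. K) (direct_power k T)" using IH[OF Ks(1,2)] Ks(3) by (auto simp: \<Phi>_def)
   then show ?thesis using retract_trans[OF retract_iso(1)[OF i] retract_power_sum[OF P(4)]] by blast
  qed
  have "\<exists>k. retract N (direct_power k T)" if b: "both_exact N"
  proof (cases "zero_module N")
   case True then show ?thesis using retract_power_zero[OF T _ N] by blast
  next
   case nz: False
   show ?thesis
   proof (cases "\<exists>i t. 1 \<le> i \<and> i < n \<and> t \<in> $N \<and> t *[N] cc i \<noteq> \<zero>[N]")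
    case True
    then obtain i t where t: "1 \<le> i" "i < n" "t \<in> $N" "t *[N] cc i \<noteq> \<zero>[N]" by blast
    have nz: "\<not> zero_module (eA i)" using eA_indecomposable[OF t(1,2)] by (simp add: indecomposable_def)
    show ?thesis using retract_copy[OF eA_fd nz peel_retract[OF N t] eT[OF t(1,2)]] *[OF _ _ _ _ b] by blast
   next
    case False
    then have c: "t *[N] cc i = \<zero>[N]" if "1 \<le> i" "i < n" "t \<in> $N" for i t using that by blast
    have H: "\<And>j. j < n - 1 ==> H j N" "\<And>j. n < j ==> j < 2 * n ==> H j N" using b by (auto simp: both_exact_def)
    have r: "retract S N" by (rule semisimple_split[OF N S both_exact_semisimple[OF N H c] nz])
    have nS: "\<not> zero_module S" using simple_indecomposable[OF S] by (simp add: indecomposable_def)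
    show ?thesis using retract_copy[OF cycD(1)[OF S] nS r ST] *[OF _ _ _ _ b] by blast
   qed
  qed
  then show "\<Phi> U" unfolding \<Phi>_def N_def by blast
 qed
 then show ?thesis using M(2) by (simp add: \<Phi>_def)
qed

text \<open>The idempotents \<open>e_i\<close> with i < n detect everything in a except
  \<open>e_n a\<close>. The module also contains \<open>a_{n-1}\<close>, and the product
  \<open>a_{n-1} a\<close> shows the coordinates of \<open>e_n a\<close> at \<open>e_n\<close> and
  \<open>b_{n-1}\<close>, the only ones it has.\<close>

lemma E_faithful: "faithful_module A (E (n - 1))" unfolding faithful_module_def
proof (intro ballI impI)
 fix a assume a: "a \<in> $A" and "\<forall>x\<in>$(E (n - 1)). x *[E (n - 1)] a = \<zero>[E (n - 1)]"
 then have z: "x \<otimes> a = \<zero>" if "x \<in> $A" "esum (n - 1) \<otimes> x = x" for x using that by (simp add: E_mem)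
 have "ee i \<otimes> a = \<zero>" if i: "i < n" for i
  by (rule z) (use esum(1) i in \<open>auto intro!: alg_eqI simp: co_simps esum(2-)\<close>)
 then have c: "co t (ee i \<otimes> a) = 0" if "i < n" for i t using that by simp
 have "aa (n - 1) \<otimes> a = \<zero>" by (rule z) (use esum(1) in \<open>auto intro!: alg_eqI simp: co_simps esum(2-)\<close>)
 then have an: "co t (aa (n - 1) \<otimes> a) = 0" for t by simp
 have e: "co (Ix_e n) a = 0" and b: "co (Ix_b (n - 1)) a = 0"
  using an[of "Ix_a (n - 1)"] an[of "Ix_c (n - 1)"] a n2 Suc_le_mono[of 1 "n - 1"] by (simp_all add: co_simps)
 show "a = \<zero>"
 proof (rule alg_eqI)
  fix i
  show "co (Ix_e i) a = co (Ix_e i) \<zero>"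
   using c[of i "Ix_e i"] e a by (cases "i < n"; cases "i = n"; cases "i = 0") (auto simp: co_simps)
  show "co (Ix_a i) a = co (Ix_a i) \<zero>" using c[of i "Ix_a i"] a by (cases "i < n"; cases "i = 0") (auto simp: co_simps)
  show "co (Ix_c i) a = co (Ix_c i) \<zero>" using c[of i "Ix_c i"] a by (cases "i < n"; cases "i = 0") (auto simp: co_simps)
  show "co (Ix_b i) a = co (Ix_b i) \<zero>"
  proof (cases "Suc i < n")
   case True then show ?thesis using c[OF True, of "Ix_b i"] a by (simp add: co_simps)
  next
   case False then show ?thesis using b a by (cases "i = n - 1") auto
  qed
 qed (use a in auto)
qed

lemma faithful_E_retract:
 assumes M: "fdm M" and f: "faithful_module A M" shows "retract (E (n - 1)) M"
proof (rule E_retract[OF M])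
 fix i assume i: "1 \<le> i" "i < n"
 have "co (Ix_c i) (cc i) = 1" using i by simp
 then have "cc i \<noteq> \<zero>" by (metis co_zero zero_neq_one)
 then show "\<exists>t\<in>$M. t *[M] cc i \<noteq> \<zero>[M]" using f unfolding faithful_module_def by auto
qed (use n2 in simp)

lemma faithful_iso:
 assumes M: "fdm M" "faithful_module A M" and N: "fdm N" and i: "mod_iso M N f g"
 shows "faithful_module A N" unfolding faithful_module_def
proof (intro ballI impI)
 note f = module_homD[OF mod_isoD(1)[OF i]]
 fix a assume a: "a \<in> $A" and z: "\<forall>x\<in>$N. x *[N] a = \<zero>[N]"
 have "x *[M] a = \<zero>[M]" if x: "x \<in> $M" for x
  using iso_zero_iff[OF M(1) N i fd_right_module.ract_closed[OF M(1) x a]] f(3)[OF x a] f(1)[OF x] z by simp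
 then show "a = \<zero>" using M(2) a unfolding faithful_module_def by blast
qed

text \<open>No extension problem is solved here: the injective hull of a faithful module is
  faithful, hence has \<open>E (n - 1)\<close> as a retract, and retracts of injective modules are
  injective.\<close>

lemma E_injective: "injective (E (n - 1))"
proof -
 obtain I j where I: "I \<in> modules A" "injective I" "mhom (E (n - 1)) I j" "inj_on j ($(E (n - 1)))"
  by (rule injective_hull_ex[OF E_fd])
 note Ifd = modulesD[OF I(1)]
 have "faithful_module A I" unfolding faithful_module_def
 proof (intro ballI impI)
  interpret E: amod A "E (n - 1)" by (rule amodI[OF E_fd])
  fix a assume a: "a \<in> $A" and z: "\<forall>x\<in>$I. x *[I] a = \<zero>[I]"
  have "x *[E (n - 1)] a = \<zero>[E (n - 1)]" if x: "x \<in> $(E (n - 1))" for x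
   using inj_onD[OF I(4), of "x *[E (n - 1)] a" "\<zero>[E (n - 1)]"] module_homD(1,3)[OF I(3), OF x] hom_zero[OF E_fd Ifd I(3)] z a
    E.act_closed[OF x a] E.M.zero_closed by simp
  then show "a = \<zero>" using E_faithful a unfolding faithful_module_def by blast
 qed
 from faithful_E_retract[OF Ifd this] obtain p s where p: "mhom I (E (n - 1)) p" "mhom (E (n - 1)) I s"
  "\<And>x. x \<in> $(E (n - 1)) ==> p (s x) = x" by (rule retractE) blast
 show ?thesis by (rule injective_retract[OF I(2) E_fd p(1,2)]) (rule p(3))
qed

lemma E_projective: "projective (E k)" by (rule idempotent_projective[OF esum(1) esum_idem])

lemma E_minimal: "minimal_faithful_projective_injective A (E (n - 1))" unfolding minimal_faithful_projective_injective_def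
 using E_faithful E_projective E_injective faithful_E_retract[OF modulesD] direct_summand_iff[OF E_fd modulesD] by blast

text \<open>Any module with the minimality property is compared with \<open>E (n - 1)\<close> in
  both directions, which identifies the two up to isomorphism.\<close>

lemma minimal_retracts:
 assumes "minimal_faithful_projective_injective A J"
 shows "retract (E (n - 1)) J" "retract J (E (n - 1))"
proof -
 have J: "fdm J" "faithful_module A J"
  and m: "\<And>N. N \<in> modules A ==> faithful_module A N ==> direct_summand A J N"
  using assms injectiveD unfolding minimal_faithful_projective_injective_def by blast+
 show "retract (E (n - 1)) J" by (rule faithful_E_retract[OF J])
 obtain E' f g where E': "E' \<in> modules A" "mod_iso (E (n - 1)) E' f g" using universe_copy[OF E_fd] by blast
 have "direct_summand A J E'" by (rule m[OF E'(1) faithful_iso[OF E_fd E_faithful modulesD[OF E'(1)] E'(2)]])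
 then show "retract J (E (n - 1))"
  using direct_summand_iff[OF J(1) modulesD[OF E'(1)]] retract_trans[OF _ retract_iso(2)[OF E'(2)]] by blast
qed

text \<open>A repeated summand L would double certain spaces that are at most one-dimensional in
  \<open>E (n - 1) \<oplus> S\<close>. The image of \<open>c_i\<close> shows that every
  \<open>c_i\<close> kills L; then L is a sum of copies of S, and the vectors at 1 killed by
  \<open>a_1\<close> give the contradiction.\<close>

lemma sum_basic:
 assumes S: "cyc S s (Dann 1)" and T: "fdm T" and r: "retract T (direct_sum (E (n - 1)) S)"
 shows "basic_module A T" unfolding basic_module_def
proof (intro ballI impI notI)
 fix L :: "('k, 'a) umodule" assume L: "L \<in> modules A" and ind: "indecomposable A L" and d: "direct_summand A (direct_sum L L) T"
 let ?T = "direct_sum (E (n - 1)) S" and ?D = "direct_sum L L"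
 note Lfd = modulesD[OF L] and Sfd = cycD(1)[OF S] and sS = cycD(2)[OF S]
 note D = direct_sum_fd[OF Lfd Lfd] and T0 = direct_sum_fd[OF E_fd[of "n-1"] Sfd]
 interpret L: amod A L by (rule amodI[OF Lfd])
 interpret S: amod A S by (rule amodI[OF Sfd])
 interpret D: amod A ?D by (rule amodI[OF D])
 interpret T: amod A ?T by (rule amodI[OF T0])
 interpret E: amod A "E (n - 1)" by (rule amodI[OF E_fd])
 have rD: "retract ?D ?T" using d direct_summand_iff[OF D T] retract_trans[OF _ r] by blast
 obtain p t where p: "mhom ?T ?D p" "mhom ?D ?T t" "\<And>x. x \<in> $?D ==> p (t x) = x" using rD by (rule retractE) blast
 note ph = module_homD[OF p(1)] and th = module_homD[OF p(2)]
 have "both_exact ?T" using both_exact_sum[OF E_fd Sfd] both_exact_injective[OF E_injective E_projective] simple_both_exact[OF S] by blast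
 then have b: "both_exact L" by (rule both_exact_retract[OF T0 Lfd retract_trans[OF retract_fst[OF Lfd] rD]])
 have c0: "v *[L] cc i = \<zero>[L]" if i: "1 \<le> i" "i < n" and v: "v \<in> $L" for i v
 proof -
  have cE: "cc i \<in> $(E (n - 1))" using i esum(1) by (auto simp: E_mem intro!: alg_eqI simp: co_simps esum(2-))
  let ?z = "(cc i, \<zero>[S])"
  have z: "?z \<in> $?T" using cE by simp
  \<comment> \<open>On \<open>?T\<close> the element \<open>c_i\<close> has rank one, while a
    nonzero \<open>v c_i\<close> would give it rank two on \<open>?D\<close>.\<close>
  have *: "\<exists>c. u *[?D] cc i = sc ?D c (p ?z)" if u: "u \<in> $?D" for u
  proof -
   obtain y w where yw: "t u = (y, w)" "y \<in> $(E (n - 1))" "w \<in> $S" using th(1)[OF u] by auto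
   have yA: "y \<in> $A" using yw(2) by (simp add: E_mem)
   have "sc (E (n - 1)) d (cc i) = d \<odot> cc i" for d by (simp add: sc_def scalar_unit_right)
   then have "t u *[?T] cc i = sc ?T (co (Ix_e i) y) ?z"
    using yw yA simple_zero[OF S _ _ yw(3), of "cc i"] by (simp add: sc_direct_sum mult_cc_expand)
   then have "p (t (u *[?D] cc i)) = sc ?D (co (Ix_e i) y) (p ?z)" using th(3)[OF u, of "cc i"] ph(4)[OF z] by simp
   then show ?thesis using p(3)[OF D.act_closed[OF u bas_closed]] by auto
  qed
  obtain c where c: "(v, \<zero>[L]) *[?D] cc i = sc ?D c (p ?z)" using *[of "(v, \<zero>[L])"] v by auto
  obtain d where d: "(\<zero>[L], v) *[?D] cc i = sc ?D d (p ?z)" using *[of "(\<zero>[L], v)"] v by auto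
  have vc: "v *[L] cc i \<in> $L" using v by simp
  show ?thesis using pair_line[OF Lfd Lfd vc vc ph(1)[OF z], of c d] c d by simp
 qed
 have HL: "\<And>j. j < n - 1 ==> H j L" "\<And>j. n < j ==> j < 2 * n ==> H j L" using b by (auto simp: both_exact_def)
 have ss: "u *[L] ee 1 = u" "u *[L] aa 1 = \<zero>[L]" if u: "u \<in> $L" for u
  by (rule both_exact_semisimple[OF Lfd HL c0 u]; assumption)+
 have "\<not> zero_module L" using ind by (simp add: indecomposable_def)
 then obtain v where v: "v \<in> $L" "v \<noteq> \<zero>[L]" using L.M.zero_closed by (auto simp: zero_module_def)
 let ?z = "(\<zero>, s)"
 have z: "?z \<in> $?T" using sS E.M.zero_closed by simp
 \<comment> \<open>A vector of \<open>?T\<close> at the vertex 1 that \<open>a_1\<close> kills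
   combines \<open>c_1\<close> with s. The first part is in the image of \<open>c_1\<close>, and p
   sends this image to zero because \<open>c_1\<close> kills L.\<close>
 have *: "\<exists>c. u = sc ?D c (p ?z)" if u: "u \<in> $?D" and e: "u *[?D] ee 1 = u" "u *[?D] aa 1 = \<zero>[?D]" for u
 proof -
  obtain y w where yw: "t u = (y, w)" "y \<in> $(E (n - 1))" "w \<in> $S" using th(1)[OF u] by auto
  have y: "y \<in> $A" "esum (n - 1) \<otimes> y = y" using yw(2) by (auto simp: E_mem)
  have "t u *[?T] ee 1 = t u" "t u *[?T] aa 1 = \<zero>[?T]"
   using th(3)[OF u, of "ee 1"] th(3)[OF u, of "aa 1"] e hom_zero[OF D T0 p(2)] by simp_all
  then have ya: "y \<otimes> ee 1 = y" "y \<otimes> aa 1 = \<zero>" using yw(1) by auto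
  have "co t y = co t (esum (n - 1) \<otimes> y)" for t using y by simp
  \<comment> \<open>For n > 2 the product \<open>b_1 a_1 = c_2\<close> shows the
    \<open>b_1\<close>-coordinate of y; for n = 2 this coordinate vanishes, as y lies in
    \<open>e_1 A\<close>.\<close>
  from this[of "Ix_b 1"] have b2: "2 < n \<or> co (Ix_b 1) y = 0" using y(1) esum(1) by (auto simp: co_simps esum(2-) split: if_splits)
  have "co t (y \<otimes> aa 1) = 0" for t using ya by simp
  from this[of "Ix_a 1"] this[of "Ix_c 2"] have "co (Ix_e 1) y = 0" "co (Ix_b 1) y = 0"
   using y(1) n2 b2 by (auto simp: co_simps split: if_splits)
  then have "y = co (Ix_c 1) y \<odot> cc 1" using mult_ee_expand[OF y(1), of 1] ya(1) y(1) by simp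
  then have yc: "y = (co (Ix_c 1) y \<odot> ee 1) \<otimes> cc 1" by (simp add: smult_mult_left mult_ec)
  obtain c where c: "w = sc S c s" by (rule simple_elim[OF S yw(3)])
  let ?w = "(co (Ix_c 1) y \<odot> ee 1, \<zero>[S])"
  have wE: "?w \<in> $?T" using n2 esum(1) by (auto simp: E_mem intro!: alg_eqI simp: co_simps esum(2-))
  have "sc (E (n - 1)) c \<zero> = \<zero>" using E.sc_zero_right by simp
  then have "t u = ?w *[?T] cc 1 +[?T] sc ?T c ?z" using yw(1) yc c sS y(1) by (simp add: sc_direct_sum)
  then have "u = p (?w *[?T] cc 1 +[?T] sc ?T c ?z)" using p(3)[OF u] by simp
  also have "\<dots> = p ?w *[?D] cc 1 +[?D] sc ?D c (p ?z)"
   using ph(2)[OF T.act_closed[OF wE bas_closed] T.sc_closed[OF z]] ph(3)[OF wE bas_closed] ph(4)[OF z] by simp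
  also have "p ?w *[?D] cc 1 = \<zero>[?D]" using ph(1)[OF wE] c0[of 1] n2 by auto
  finally have "u = sc ?D c (p ?z)" using D.sc_closed[OF ph(1)[OF z]] D.M.l_zero by simp
  then show ?thesis by blast
 qed
 obtain c where c: "(v, \<zero>[L]) = sc ?D c (p ?z)" using *[of "(v, \<zero>[L])"] v ss[OF v(1)] by auto
 obtain d where d: "(\<zero>[L], v) = sc ?D d (p ?z)" using *[of "(\<zero>[L], v)"] v ss[OF v(1)] by auto
 show False using pair_line[OF Lfd Lfd v(1) v(1) ph(1)[OF z] c d] v(2) by simp
qed

section \<open>The tilting property\<close>

lemma eA_retract_sum:
 assumes J: "fdm J" "retract (E (n - 1)) J" and S: "fdm S" and i: "1 \<le> i" "i < n"
 shows "retract (eA i) (direct_sum J S)"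
 using retract_trans[OF eA_E[OF i(1), of "n - 1"] retract_trans[OF J(2) retract_fst[OF S]]] i by simp

lemma sum_add_closure:
 assumes S: "cyc S s (Dann 1)" and J: "injective J" "projective J" "retract (E (n - 1)) J"
 shows "add_closure A (direct_sum J S) = {M \<in> modules A. both_exact M}"
proof -
 note Jfd = injectiveD[OF J(1)] and Sfd = cycD(1)[OF S]
 note T = direct_sum_fd[OF Jfd Sfd]
 have bT: "both_exact (direct_sum J S)" using both_exact_sum[OF Jfd Sfd] both_exact_injective[OF J(1,2)] simple_both_exact[OF S] by blast
 have "both_exact M" if M: "M \<in> modules A" "retract M (direct_power k (direct_sum J S))" for M k
  by (rule both_exact_retract[OF direct_power_fd[OF T] modulesD[OF M(1)] M(2)])
   (use bT H_power[OF T] in \<open>auto simp: both_exact_def\<close>)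
 moreover have "\<exists>k. retract M (direct_power k (direct_sum J S))" if "M \<in> modules A" "both_exact M" for M
  by (rule both_exact_add[OF S eA_retract_sum[OF Jfd J(3) Sfd] retract_snd[OF Jfd] T modulesD[OF that(1)] that(2)])
 ultimately have "M \<in> add_closure A (direct_sum J S) \<longleftrightarrow> both_exact M" if "M \<in> modules A" for M
  using add_closure_iff[OF that T] that by blast
 moreover have "add_closure A (direct_sum J S) \<subseteq> modules A" by (auto simp: add_closure_def)
 ultimately show ?thesis by blast
qed

text \<open>The sequences \<open>aA_ses\<close> climb from one k to the next: the cokernel of
  \<open>a_k A\<close> in \<open>e_k A\<close> is \<open>a_{k-1} A\<close>, coresolved by the
  previous step, and for k = 1 it is the summand S of T itself.\<close>

lemma chain_coresolved:
 assumes T: "fdm T" and S: "cyc S s (Dann 1)" "retract S T" and eT: "\<And>i. 1 \<le> i ==> i < n ==> retract (eA i) T"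
 shows "1 \<le> k ==> k < n ==> \<exists>C q. (C :: ('k, 'a) umodule) \<in> modules A \<and> ses (aA k) (eA k) C (\<lambda>x. x) q \<and> coresolved T C"
proof (induction k rule: nat_induct_at_least)
 case base
 obtain C f g where C: "(C :: ('k, 'a) umodule) \<in> modules A" "mod_iso S C f g" using universe_copy[OF cycD(1)[OF S(1)]] by blast
 note Cfd = modulesD[OF C(1)]
 have "coresolved T C"
  by (rule coresolved_self[OF Cfd T retract_trans[OF retract_trans[OF retract_iso(2)[OF C(2)] S(2)] retract_power_one[OF T]]])
 then show ?case using C(1) ses_iso_right[OF simple_ses[OF S(1)] Cfd C(2)] by blast
next
 case (Suc k)
 then have k: "1 \<le> k" "k < n" by auto
 obtain C q where C: "(C :: ('k, 'a) umodule) \<in> modules A" "ses (aA k) (eA k) C (\<lambda>x. x) q" "coresolved T C" using Suc by auto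
 obtain C' f g where C': "(C' :: ('k, 'a) umodule) \<in> modules A" "mod_iso (aA k) C' f g" using universe_copy[OF aA_fd] by blast
 note Cfd = modulesD[OF C'(1)]
 have "coresolved T C'"
  by (rule coresolved_splice[OF ses_iso_left[OF C(2) Cfd mod_iso_sym[OF C'(2)]] T retract_trans[OF eT[OF k] retract_power_one[OF T]] C(3)])
 then show ?case using C'(1) ses_iso_right[OF aA_ses[OF k] Cfd C'(2)] by blast
qed

text \<open>A is the sum of \<open>E (n - 1)\<close>, already a summand of T, and
  \<open>e_n A\<close>, which left multiplication by \<open>a_{n-1}\<close> embeds into
  \<open>e_{n-1} A\<close> with image \<open>a_{n-1} A\<close>; the cokernel of this is
  coresolved.\<close>

lemma regular_coresolved:
 assumes T: "fdm T" and S: "cyc S s (Dann 1)" "retract S T" and ET: "retract (E (n - 1)) T"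
  and eT: "\<And>i. 1 \<le> i ==> i < n ==> retract (eA i) T"
 shows "coresolved T (regular)"
proof -
 have m: "1 \<le> n - 1" "n - 1 < n" using n2 by auto
 obtain C q where C: "(C :: ('k, 'a) umodule) \<in> modules A" "ses (aA (n - 1)) (eA (n - 1)) C (\<lambda>x. x) q" "coresolved T C"
  using chain_coresolved[OF T S eT m] by blast
 note c = sesD[OF C(2)]
 let ?D = "direct_sum (E (n - 1)) (eA (n - 1))"
 let ?f = "\<lambda>x. (esum (n - 1) \<otimes> x, aa (n - 1) \<otimes> x)"
 have id: "esum (n - 1) \<otimes> (esum (n - 1) \<otimes> x) = esum (n - 1) \<otimes> x" if "x \<in> $A" for x
  using that esum(1) by (simp add: A_assoc[symmetric] esum_idem)
 have ea: "ee (n - 1) \<otimes> (aa (n - 1) \<otimes> x) = aa (n - 1) \<otimes> x" if "x \<in> $A" for x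
  using that by (simp add: A_assoc[symmetric] mult_ea)
 have split: "x = esum (n - 1) \<otimes> x \<oplus> ee n \<otimes> x" if "x \<in> $A" for x
  using that esum(1) n2 by (intro alg_eqI) (auto simp: co_simps esum(2-) intro!: co_out)
 have fh: "mhom (regular) ?D ?f" using esum(1) id ea by (intro module_homI) (auto simp: E_mem eA_mem A_r_distr A_assoc)
 have qh: "mhom ?D C (\<lambda>x. q (snd x))" by (rule module_hom_comp[OF hom_snd c(5)])
 have "ses (regular) ?D C ?f (\<lambda>x. q (snd x))" unfolding ses_def
 proof (intro conjI)
  show "inj_on ?f ($(regular))"
  proof (rule hom_inj[OF regular_fd direct_sum_fd[OF E_fd eA_fd] fh])
   fix x assume x: "x \<in> $(regular)" and "?f x = \<zero>[?D]"
   then have z: "esum (n - 1) \<otimes> x = \<zero>" "aa (n - 1) \<otimes> x = \<zero>" and xA: "x \<in> $A" by auto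
   have y: "ee n \<otimes> x \<in> $(eA (Suc (n - 1)))" using n2 xA by (simp add: eA_mem A_assoc[symmetric])
   have "aa (n - 1) \<otimes> (ee n \<otimes> x) = \<zero>" using z(2) xA n2 by (simp add: A_assoc[symmetric] mult_ae)
   then have "ee n \<otimes> x \<in> $(aA (Suc (n - 1)))" using sesD(8)[OF aA_ses[OF m]] y by auto
   then have "ee n \<otimes> x = \<zero>" using bas_out[of "Ix_a n"] n2 by (auto simp: idempotent_carrier)
   then show "x = \<zero>[regular]" using split[OF xA] z(1) by simp
  qed
  have "$(E (n - 1)) \<noteq> {}" using one_A by (auto simp: idempotent_carrier)
  then show "(\<lambda>x. q (snd x)) ` $?D = $C" unfolding c(7)[symmetric] by (simp add: image_image[of q snd, symmetric] snd_image_times)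
  show "?f ` $(regular) = {x \<in> $?D. q (snd x) = \<zero>[C]}"
  proof (intro equalityI subsetI)
   fix u assume "u \<in> ?f ` $(regular)"
   then obtain x where x: "x \<in> $A" "u = ?f x" by auto
   have "aa (n - 1) \<otimes> x \<in> $(aA (n - 1))" using x by (auto simp: idempotent_carrier)
   then have "q (aa (n - 1) \<otimes> x) = \<zero>[C]" using c(8) by auto
   then show "u \<in> {x \<in> $?D. q (snd x) = \<zero>[C]}" using x module_homD(1)[OF fh, of x] by auto
  next
   fix u assume "u \<in> {x \<in> $?D. q (snd x) = \<zero>[C]}"
   then obtain y z where yz: "u = (y, z)" "y \<in> $(E (n - 1))" "z \<in> $(eA (n - 1))" "q z = \<zero>[C]" by auto
   then have "z \<in> $(aA (n - 1))" using c(8) by auto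
   then obtain w where w: "w \<in> $A" "z = aa (n - 1) \<otimes> w" by (auto simp: idempotent_carrier)
   have y: "y \<in> $A" "esum (n - 1) \<otimes> y = y" using yz(2) by (auto simp: E_mem)
   \<comment> \<open>Each component of \<open>?f\<close> kills the part of A that the other one
     sees, so preimages of y and z can simply be added.\<close>
   have 1: "aa (n - 1) \<otimes> esum (n - 1) = \<zero>" "esum (n - 1) \<otimes> ee n = \<zero>"
    using esum(1) n2 by (intro alg_eqI; auto simp: co_simps esum(2-))+
   have "aa (n - 1) \<otimes> y = (aa (n - 1) \<otimes> esum (n - 1)) \<otimes> y" using y esum(1) by (simp add: A_assoc)
   then have 2: "aa (n - 1) \<otimes> y = \<zero>" using 1 y by simp
   have "esum (n - 1) \<otimes> (ee n \<otimes> w) = \<zero>" using 1 w esum(1) by (simp add: A_assoc[symmetric])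
   moreover have "aa (n - 1) \<otimes> (ee n \<otimes> w) = z" using w n2 by (simp add: A_assoc[symmetric] mult_ae)
   ultimately have "?f (y \<oplus> ee n \<otimes> w) = u" using y w esum(1) 2 yz(1) by (simp add: A_r_distr)
   then show "u \<in> ?f ` $(regular)" using y w by (intro image_eqI[of _ _ "y \<oplus> ee n \<otimes> w"]) auto
  qed
 qed (use fh qh in \<open>auto simp: regular_fd direct_sum_fd E_fd eA_fd c(3)\<close>)
 then show ?thesis by (rule coresolved_splice[OF _ T retract_power_sum[OF ET retract_trans[OF eT[OF m] retract_power_one[OF T]]] C(3)])
qed

lemma sum_tilting:
 assumes S: "cyc S s (Dann 1)" and J: "injective J" "projective J" "retract (E (n - 1)) J"
 shows "tilting_module A (direct_sum J S)"
proof -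
 note Jfd = injectiveD[OF J(1)] and Sfd = cycD(1)[OF S]
 note T = direct_sum_fd[OF Jfd Sfd]
 have "projdim A (direct_sum J S) \<le> enat (2 * n - 2)" by (rule resolution_upper[OF T]) simp
 then have "projdim A (direct_sum J S) \<noteq> \<infinity>" by (cases "projdim A (direct_sum J S)") auto
 moreover have "coresolved (direct_sum J S) (regular)"
  by (rule regular_coresolved[OF T S retract_snd[OF Jfd] retract_trans[OF J(3) retract_fst[OF Sfd]] eA_retract_sum[OF Jfd J(3) Sfd]])
 ultimately show ?thesis unfolding tilting_module_def using T add_Ext_vanishes[OF J(1,2) S] unfolding coresolved_def by blast
qed

section \<open>Uniqueness of the characteristic tilting module\<close>

lemma add_member:
 assumes T: "fdm T" and add: "add_closure A T = {M \<in> modules A. both_exact M}"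
  and M: "fdm M" "both_exact M"
 obtains k where "retract M (direct_power k T)"
proof -
 obtain M' f g where M': "M' \<in> modules A" "mod_iso M M' f g" using universe_copy[OF M(1)] by blast
 have "both_exact M'" by (rule both_exact_retract[OF M(1) modulesD[OF M'(1)] retract_iso(2)[OF M'(2)] M(2)])
 then have "M' \<in> add_closure A T" using add M'(1) by simp
 then show ?thesis using that add_closure_iff[OF M'(1) T] retract_trans[OF retract_iso(1)[OF M'(2)]] by blast
qed

text \<open>Separates S from the projective modules, which are exact at n - 1 because n - 1 < 2n -
  2.\<close>

lemma not_H_simple: assumes S: "cyc S s (Dann 1)" shows "\<not> H (n - 1) S"
proof
 assume H: "H (n - 1) S"
 have m: "eps (n - 1) = ee 1" "yy (Suc (n - 1)) = cc 1" "yy (n - 1) = bb 1" using n2 by (auto simp: eps_def yy_def)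
 have "s *[S] eps (n - 1) = s" "s *[S] yy (Suc (n - 1)) = \<zero>[S]"
  unfolding m using cyc_unit[OF S, of 1] cycD(4)[OF S, of "cc 1"] n2 by (auto simp: Dann_def co_simps)
 then obtain w where "w \<in> $S" "s = w *[S] yy (n - 1)" using HD[OF H cycD(2)[OF S]] by blast
 then show False using simple_zero[OF S, of "bb 1" w] simple_ne[OF S] unfolding m by simp
qed

text \<open>The additive closure forces \<open>E (n - 1)\<close> and S to be summands of T, and
  basicness forbids a second copy of any \<open>e_i A\<close> or of S, so nothing else is
  left.\<close>

lemma basic_unique:
 assumes S: "cyc S s (Dann 1)" and T: "T \<in> modules A" and b: "basic_module A T"
  and add: "add_closure A T = {M \<in> modules A. both_exact M}"
 obtains f g where "mod_iso T (direct_sum (E (n - 1)) S) f g"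
proof -
 note Tfd = modulesD[OF T] and Sfd = cycD(1)[OF S]
 have Tb: "both_exact T" using add_closure_iff[OF T Tfd] retract_power_one[OF Tfd] T add by blast
 have Eb: "both_exact (E (n - 1))" by (rule both_exact_injective[OF E_injective E_projective])
 have rE: "retract (E (n - 1)) T"
 proof (rule E_retract[OF Tfd])
  fix i assume i: "1 \<le> i" "i < n"
  have "both_exact (eA i)" by (rule both_exact_retract[OF E_fd eA_fd eA_E[OF i(1)] Eb]) (use i in simp)
  then obtain k where "retract (eA i) (direct_power k T)" by (rule add_member[OF Tfd add eA_fd])
  then obtain p t where p: "mhom (direct_power k T) (eA i) p" "mhom (eA i) (direct_power k T) t"
   "\<And>x. x \<in> $(eA i) ==> p (t x) = x" by (rule retractE) blast
  have e: "ee i \<in> $(eA i)" "cc i \<in> $(eA i)" by (simp_all add: eA_mem mult_ec)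
  show "\<exists>t\<in>$T. t *[T] cc i \<noteq> \<zero>[T]"
  proof (rule ccontr)
   assume "\<not> (\<exists>t\<in>$T. t *[T] cc i \<noteq> \<zero>[T])"
   then have "t (ee i) *[direct_power k T] cc i = \<zero>[direct_power k T]"
    using module_homD(1)[OF p(2) e(1)] by (auto simp: direct_power_def fun_eq_iff)
   then have "t (cc i) = \<zero>[direct_power k T]" using module_homD(3)[OF p(2) e(1), of "cc i"] by (simp add: mult_ec)
   then have "cc i = \<zero>" using p(3)[OF e(2)] hom_zero[OF direct_power_fd[OF Tfd] eA_fd p(1)] by simp
   then have "co (Ix_c i) (cc i) = 0" by (metis co_zero)
   then show False using i by simp
  qed
 qed (use n2 in simp)
 obtain Y f g where Y: "Y \<in> modules A" "mod_iso T (direct_sum (E (n - 1)) Y) f g" by (rule retract_split[OF E_fd Tfd rE])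
 note Yfd = modulesD[OF Y(1)]
 have rY: "retract Y T" by (rule retract_trans[OF retract_snd[OF E_fd] retract_iso(2)[OF Y(2)]])
 have c0: "y *[Y] cc i = \<zero>[Y]" if i: "1 \<le> i" "i < n" and y: "y \<in> $Y" for i y
 proof (rule ccontr)
  assume "y *[Y] cc i \<noteq> \<zero>[Y]"
  then have "retract (eA i) Y" by (rule peel_retract[OF Yfd i y])
  moreover have "retract (eA i) (E (n - 1))" by (rule eA_E[OF i(1)]) (use i in simp)
  ultimately have "retract (direct_sum (eA i) (eA i)) T" using retract_trans[OF retract_sum retract_iso(2)[OF Y(2)]] by blast
  then show False using basicD[OF b Tfd eA_fd eA_indecomposable[OF i]] by blast
 qed
 have Yb: "both_exact Y" by (rule both_exact_retract[OF Tfd Yfd rY Tb])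
 have HY: "\<And>j. j < n - 1 ==> H j Y" "\<And>j. n < j ==> j < 2 * n ==> H j Y" using Yb by (auto simp: both_exact_def)
 have ss: "u *[Y] ee 1 = u" "u *[Y] aa 1 = \<zero>[Y]" if u: "u \<in> $Y" for u
  by (rule both_exact_semisimple[OF Yfd HY c0 u]; assumption)+
 \<comment> \<open>Otherwise T would be isomorphic to \<open>E (n - 1)\<close>, hence exact at the
   place n - 1, and S, a retract of a power of T, would be so too.\<close>
 have "\<not> zero_module Y"
 proof
  assume z: "zero_module Y"
  have "n - 1 < 2 * n - 2" using n2 by simp
  from projective_H[OF E_projective this] have "H (n - 1) (direct_sum (E (n - 1)) Y)"
   using H_direct_sum[OF E_fd Yfd] H_zero[OF Yfd z] by blast
  from H_iso[OF direct_sum_fd[OF E_fd Yfd] Tfd mod_iso_sym[OF Y(2)] this] have HT: "H (n - 1) T" .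
  obtain k where "retract S (direct_power k T)" by (rule add_member[OF Tfd add Sfd simple_both_exact[OF S]])
  then obtain p t where p: "mhom (direct_power k T) S p" "mhom S (direct_power k T) t"
   "\<And>x. x \<in> $S ==> p (t x) = x" by (rule retractE) blast
  have "H (n - 1) S" by (rule H_retract[OF direct_power_fd[OF Tfd] Sfd p H_power[OF Tfd HT]])
  then show False using not_H_simple[OF S] by blast
 qed
 from semisimple_split[OF Yfd S ss this] have "retract S Y" .
 then obtain Y2 h k where Y2: "Y2 \<in> modules A" "mod_iso Y (direct_sum S Y2) h k" by (rule retract_split[OF Sfd Yfd])
 note Y2fd = modulesD[OF Y2(1)]
 \<comment> \<open>A nonzero rest would again be a sum of copies of S, so S would occur twice in
   T.\<close>
 have "zero_module Y2"
 proof (rule ccontr)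
  assume nz: "\<not> zero_module Y2"
  have "retract Y2 Y" by (rule retract_trans[OF retract_snd[OF Sfd] retract_iso(2)[OF Y2(2)]])
  then obtain p t where p: "mhom Y Y2 p" "mhom Y2 Y t" "\<And>x. x \<in> $Y2 ==> p (t x) = x" by (rule retractE) blast
  note ph = module_homD[OF p(1)] and th = module_homD[OF p(2)]
  have "retract S Y2"
  proof (rule semisimple_split[OF Y2fd S _ _ nz])
   fix v assume v: "v \<in> $Y2"
   show "v *[Y2] ee 1 = v" using ph(3)[OF th(1)[OF v], of "ee 1"] ss(1)[OF th(1)[OF v]] p(3)[OF v] by simp
   show "v *[Y2] aa 1 = \<zero>[Y2]"
    using ph(3)[OF th(1)[OF v], of "aa 1"] ss(2)[OF th(1)[OF v]] p(3)[OF v] hom_zero[OF Yfd Y2fd p(1)] by simp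
  qed
  from retract_trans[OF retract_trans[OF retract_sum[OF retract_refl this] retract_iso(2)[OF Y2(2)]] rY]
  show False using basicD[OF b Tfd Sfd simple_indecomposable[OF S]] by blast
 qed
 from that[OF mod_iso_trans[OF Y(2) mod_iso_direct_sum[OF mod_iso_refl mod_iso_trans[OF Y2(2) mod_iso_zero[OF Y2fd this]]]]]
 show ?thesis .
qed

lemma characteristic:
 assumes e: "\<And>j. 1 \<le> j ==> j \<le> n ==> e j = ee j" and J: "minimal_faithful_projective_injective A J"
 shows "characteristic_tilting_module A n e (direct_sum J (simple_module A e 1))"
proof -
 let ?S = "simple_module A e 1"
 have "e 1 = ee 1" using e n2 by simp
 then obtain s where S: "cyc ?S s (Dann 1)" using simple_cyc by blast
 note Sfd = cycD(1)[OF S]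
 have J': "injective J" "projective J" using J by (auto simp: minimal_faithful_projective_injective_def)
 note Jfd = injectiveD[OF J'(1)] and r = minimal_retracts[OF J]
 let ?T = "direct_sum J ?S"
 note T = direct_sum_fd[OF Jfd Sfd] and T0 = direct_sum_fd[OF E_fd[of "n-1"] Sfd]
 have cap: "filtered_modules A n (standard_module A n e) \<inter> filtered_modules A n (costandard_module A n e)
   = {M \<in> modules A. both_exact M}" using filtered_standard[OF standard_cyc[OF e]] filtered_costandard[OF costandard_cyc[OF e]]
  by (auto simp: both_exact_def)
 have bT: "basic_module A ?T" by (rule sum_basic[OF S T retract_sum[OF r(2) retract_refl]])
 have "is_characteristic_tilting A n e ?T"
  unfolding is_characteristic_tilting_def cap using sum_tilting[OF S J' r(1)] bT sum_add_closure[OF S J' r(1)] by blast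
 moreover have "module_iso A T' ?T" if T': "T' \<in> modules A" "is_characteristic_tilting A n e T'" for T'
 proof -
  have "basic_module A T'" "add_closure A T' = {M \<in> modules A. both_exact M}"
   using T'(2) cap by (auto simp: is_characteristic_tilting_def)
  from basic_unique[OF S T'(1) this] obtain f g where 1: "mod_iso T' (direct_sum (E (n - 1)) ?S) f g" by blast
  obtain h k where "mod_iso (E (n - 1)) J h k" by (rule retract_antisym[OF E_fd Jfd r])
  from module_isoI[OF mod_iso_trans[OF 1 mod_iso_direct_sum[OF this mod_iso_refl]]] show ?thesis .
 qed
 ultimately show ?thesis unfolding characteristic_tilting_module_def by blast
qed

end

section \<open>Path algebras\<close>

definition splits :: "'e list \<Rightarrow> ('e list \<times> 'e list) set" where
 "splits p = {(q, r). q @ r = p}"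

lemma finite_splits [simp]: "finite (splits p)"
proof (rule finite_subset)
 show "splits p \<subseteq> (\<lambda>k. (take k p, drop k p)) ` {..length p}"
 proof clarify
  fix q r assume "(q, r) \<in> splits p"
  then have "(q, r) = (take (length q) p, drop (length q) p)" "length q \<in> {..length p}" by (auto simp: splits_def)
  then show "(q, r) \<in> (\<lambda>k. (take k p, drop k p)) ` {..length p}" by (rule image_eqI)
 qed
qed simp

lemma path_mult:
 "(f \<otimes>[path_algebra Q] g) (u, p, v) = (\<Sum>(q, r)\<in>splits p. \<Sum>w\<in>verts Q. f (u, q, w) * g (w, r, v))"
 by (simp add: path_algebra_def splits_def)

lemma path_simps [simp]:
 "\<zero>[path_algebra Q] = (\<lambda>_. 0)" "f +[path_algebra Q] g = (\<lambda>p. f p + g p)" "c \<odot>[path_algebra Q] f = (\<lambda>p. c * f p)"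
 by (simp_all add: path_algebra_def)

lemma path_one: "\<one>\<^bsub>path_algebra Q\<^esub> (u, p, v) = (if u \<in> verts Q \<and> p = [] \<and> u = v then 1 else 0)"
 by (simp add: path_algebra_def)

lemma path_carrier: "f \<in> $(path_algebra Q) \<longleftrightarrow> finite {p. f p \<noteq> 0} \<and> {p. f p \<noteq> 0} \<subseteq> paths Q"
 by (simp add: path_algebra_def)

lemma path_supp: "f \<in> $(path_algebra Q) ==> f (u, p, v) \<noteq> 0 ==> pre_digraph.awalk Q u p v"
 by (auto simp: path_carrier paths_def)

lemma cas_append: "pre_digraph.cas Q u p w ==> pre_digraph.cas Q w q v ==> pre_digraph.cas Q u (p @ q) v"
 by (induction p arbitrary: u) (auto simp: pre_digraph.cas.simps)

lemma cas_last: "pre_digraph.cas Q u p v ==> u \<in> verts Q ==> head Q ` set p \<subseteq> verts Q ==> v \<in> verts Q"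
 by (induction p arbitrary: u) (auto simp: pre_digraph.cas.simps)

lemma path_scaled: "f \<in> $(path_algebra Q) ==> (\<lambda>p. c * f p) \<in> $(path_algebra Q)"
 unfolding path_carrier by (auto elim!: rev_finite_subset)

lemma path_zero: "(\<lambda>_. 0) \<in> $(path_algebra Q)" by (simp add: path_carrier)

lemma path_sum:
 assumes "f \<in> $(path_algebra Q)" "g \<in> $(path_algebra Q)"
 shows "(\<lambda>p. f p + g p) \<in> $(path_algebra Q)"
proof -
 have "{p. f p + g p \<noteq> 0} \<subseteq> {p. f p \<noteq> 0} \<union> {p. g p \<noteq> 0}" by auto
 then show ?thesis using assms finite_subset unfolding path_carrier by blast
qed

lemma path_prod:
 assumes f: "f \<in> $(path_algebra Q)" and g: "g \<in> $(path_algebra Q)"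
 shows "f \<otimes>[path_algebra Q] g \<in> $(path_algebra Q)"
proof -
 let ?h = "f \<otimes>[path_algebra Q] g"
 have *: "\<exists>q r w. p = q @ r \<and> f (u, q, w) \<noteq> 0 \<and> g (w, r, v) \<noteq> 0" if "?h (u, p, v) \<noteq> 0" for u p v
 proof (rule ccontr)
  assume n: "\<not> ?thesis"
  have "?h (u, p, v) = 0" unfolding path_mult
  proof (rule sum.neutral, clarify)
   fix q r assume "(q, r) \<in> splits p"
   then have "p = q @ r" by (simp add: splits_def)
   then show "(\<Sum>w\<in>verts Q. f (u, q, w) * g (w, r, v)) = 0" using n by (auto intro!: sum.neutral)
  qed
  then show False using that by simp
 qed
 have "{x. ?h x \<noteq> 0} \<subseteq> (\<lambda>((u, q, w), (w', r, v)). (u, q @ r, v)) ` ({p. f p \<noteq> 0} \<times> {p. g p \<noteq> 0})"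
  using * by (force simp: image_iff)
 then have "finite {x. ?h x \<noteq> 0}" by (rule finite_subset) (use f g in \<open>simp add: path_carrier\<close>)
 moreover have "x \<in> paths Q" if h: "?h x \<noteq> 0" for x
 proof -
  obtain u p v where x: "x = (u, p, v)" by (cases x)
  obtain q r w where w: "p = q @ r" "f (u, q, w) \<noteq> 0" "g (w, r, v) \<noteq> 0" using * h x by blast
  show ?thesis using path_supp[OF f w(2)] path_supp[OF g w(3)] cas_append by (auto simp: x w(1) paths_def pre_digraph.awalk_def)
 qed
 ultimately show ?thesis by (auto simp: path_carrier)
qed

text \<open>Both sides sum over the ways to cut p into three consecutive pieces and differ only in
  which cut is made first.\<close>

lemma path_assoc:
 "(f \<otimes>[path_algebra Q] g) \<otimes>[path_algebra Q] h = f \<otimes>[path_algebra Q] (g \<otimes>[path_algebra Q] h)"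
proof (rule ext, clarify)
 fix u p v
 let ?V = "verts Q" and ?K = "path_algebra Q"
 let ?F = "\<lambda>q z s w r. f (u, q, z) * g (z, s, w) * h (w, r, v)"
 have 1: "(\<Sum>w\<in>?V. (\<Sum>y\<in>splits q. \<Sum>z\<in>?V. f (u, fst y, z) * g (z, snd y, w)) * h (w, r, v)) =
   (\<Sum>y\<in>splits q. \<Sum>z\<in>?V. \<Sum>w\<in>?V. ?F (fst y) z (snd y) w r)" for q r
  unfolding sum_distrib_right by (subst sum.swap, rule sum.cong[OF refl], rule sum.swap)
 have 2: "(\<Sum>z\<in>?V. f (u, q, z) * (\<Sum>y\<in>splits r. \<Sum>w\<in>?V. g (z, fst y, w) * h (w, snd y, v))) =
   (\<Sum>y\<in>splits r. \<Sum>z\<in>?V. \<Sum>w\<in>?V. ?F q z (fst y) w (snd y))" for q r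
  unfolding sum_distrib_left mult.assoc by (rule sum.swap)
 have "((f \<otimes>[?K] g) \<otimes>[?K] h) (u, p, v) =
  (\<Sum>x\<in>(SIGMA x:splits p. splits (fst x)). \<Sum>z\<in>?V. \<Sum>w\<in>?V. ?F (fst (snd x)) z (snd (snd x)) w (snd (fst x)))"
  unfolding path_mult split_def 1 by (subst sum.Sigma) (simp_all add: split_def)
 also have "\<dots> = (\<Sum>x\<in>(SIGMA x:splits p. splits (snd x)). \<Sum>z\<in>?V. \<Sum>w\<in>?V. ?F (fst (fst x)) z (fst (snd x)) w (snd (snd x)))"
  by (rule sum.reindex_bij_witness[of _ "\<lambda>((q, r), (s, t)). ((q @ s, t), (q, s))" "\<lambda>((q, r), (s, t)). ((s, t @ r), (t, r))"])
   (auto simp: splits_def)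
 also have "\<dots> = (f \<otimes>[?K] (g \<otimes>[?K] h)) (u, p, v)"
  unfolding path_mult split_def 2 by (subst sum.Sigma) (simp_all add: split_def)
 finally show "((f \<otimes>[path_algebra Q] g) \<otimes>[path_algebra Q] h) (u, p, v) = (f \<otimes>[path_algebra Q] (g \<otimes>[path_algebra Q] h)) (u, p, v)" .
qed

lemma path_algebra_ring:
 assumes V: "finite (verts Q)" and hd: "head Q ` arcs Q \<subseteq> verts Q"
 shows "ring (path_algebra Q :: ('k::field, _) module)"
proof (rule ringI)
 let ?K = "path_algebra Q :: ('k, _) module"
 show "abelian_group ?K"
 proof (rule abelian_groupI)
  fix f assume "f \<in> $?K"
  then show "\<exists>g\<in>$?K. g +[?K] f = \<zero>[?K]" using path_scaled[of f Q "-1"] by (intro bexI[of _ "\<lambda>p. -1 * f p"]) auto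
 qed (auto simp: path_sum path_zero add.assoc add.commute)
 have "\<one>\<^bsub>?K\<^esub> \<in> $?K" unfolding path_carrier
 proof
  have "{p. \<one>\<^bsub>?K\<^esub> p \<noteq> 0} \<subseteq> (\<lambda>u. (u, [], u)) ` verts Q" by (auto simp: path_one split: if_splits)
  then show "finite {p. \<one>\<^bsub>?K\<^esub> p \<noteq> 0}" by (rule finite_subset) (use V in simp)
  show "{p. \<one>\<^bsub>?K\<^esub> p \<noteq> 0} \<subseteq> paths Q"
   by (auto simp: path_one paths_def pre_digraph.awalk_def pre_digraph.cas.simps split: if_splits)
 qed
 moreover have "\<one>\<^bsub>?K\<^esub> \<otimes>[?K] f = f" if f: "f \<in> $?K" for f
 proof (rule ext, clarify)
  fix u p v
  have i: "(\<Sum>w\<in>verts Q. \<one>\<^bsub>?K\<^esub> (u, q, w) * f (w, r, v)) = (if q = [] then f (u, r, v) else 0)" for q r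
  proof (cases "u \<in> verts Q")
   case True then show ?thesis using V by (simp add: path_one if_distrib[of "\<lambda>x. x * _"] sum.delta cong: if_cong)
  next
   case False
   then show ?thesis using path_supp[OF f, of u r v] by (auto simp: path_one pre_digraph.awalk_def)
  qed
  have "(\<one>\<^bsub>?K\<^esub> \<otimes>[?K] f) (u, p, v) = (\<Sum>x\<in>splits p. if fst x = [] then f (u, snd x, v) else 0)"
   unfolding path_mult i by (simp add: split_def)
  also have "\<dots> = (\<Sum>x\<in>splits p. if x = ([], p) then f (u, p, v) else 0)" by (rule sum.cong) (auto simp: splits_def)
  finally show "(\<one>\<^bsub>?K\<^esub> \<otimes>[?K] f) (u, p, v) = f (u, p, v)"
   using finite_splits[of p] by (simp add: splits_def[of p])
 qed
 moreover have "f \<otimes>[?K] \<one>\<^bsub>?K\<^esub> = f" if f: "f \<in> $?K" for f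
 proof (rule ext, clarify)
  fix u p v
  have i: "(\<Sum>w\<in>verts Q. f (u, q, w) * \<one>\<^bsub>?K\<^esub> (w, r, v)) = (if r = [] \<and> v \<in> verts Q then f (u, q, v) else 0)" for q r
   using V by (cases "r = []") (simp_all add: path_one if_distrib[of "\<lambda>x. _ * x"] sum.delta' cong: if_cong conj_cong)
  have "(f \<otimes>[?K] \<one>\<^bsub>?K\<^esub>) (u, p, v) = (\<Sum>x\<in>splits p. if snd x = [] \<and> v \<in> verts Q then f (u, fst x, v) else 0)"
   unfolding path_mult i by (simp add: split_def)
  also have "\<dots> = (\<Sum>x\<in>splits p. if x = (p, []) then if v \<in> verts Q then f (u, p, v) else 0 else 0)"
   by (rule sum.cong) (auto simp: splits_def)
  also have "\<dots> = (if v \<in> verts Q then f (u, p, v) else 0)" using finite_splits[of p] by (simp add: splits_def[of p])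
  also have "\<dots> = f (u, p, v)" using path_supp[OF f, of u p v] cas_last[of Q u p v] hd by (auto simp: pre_digraph.awalk_def)
  finally show "(f \<otimes>[?K] \<one>\<^bsub>?K\<^esub>) (u, p, v) = f (u, p, v)" .
 qed
 ultimately show "monoid ?K" by (intro monoidI) (auto simp: path_prod path_assoc)
 fix f g h :: "_ \<Rightarrow> 'k"
 show "(f +[?K] g) \<otimes>[?K] h = f \<otimes>[?K] h +[?K] g \<otimes>[?K] h"
  by (rule ext) (auto simp: path_mult distrib_right sum.distrib split_def)
 show "h \<otimes>[?K] (f +[?K] g) = h \<otimes>[?K] f +[?K] h \<otimes>[?K] g"
  by (rule ext) (auto simp: path_mult distrib_left sum.distrib split_def)
qed

section \<open>Products of path elements\<close>

lemma cas_end: "pre_digraph.cas Q u p v ==> v = (if p = [] then u else head Q (last p))"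
 by (induction p arbitrary: u) (auto simp: pre_digraph.cas.simps)

text \<open>The middle vertex of a nonzero term is the end of the first piece, so the sum over all
  vertices collapses and products can be evaluated on explicit paths.\<close>

lemma path_mult_end:
 assumes V: "finite (verts Q)" and hd: "head Q ` arcs Q \<subseteq> verts Q" and f: "f \<in> $(path_algebra Q)"
 shows "(f \<otimes>[path_algebra Q] g) (u, p, v) =
  (\<Sum>(q, r)\<in>splits p. let w = if q = [] then u else head Q (last q) in f (u, q, w) * g (w, r, v))"
proof -
 have "(\<Sum>w\<in>verts Q. f (u, q, w) * g (w, r, v)) =
   (let w = if q = [] then u else head Q (last q) in f (u, q, w) * g (w, r, v))" for q r
 proof -
  define x where "x = (if q = [] then u else head Q (last q))"
  have z: "f (u, q, w) = 0" if "w \<noteq> x" for w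
   using path_supp[OF f, of u q w] cas_end[of Q u q w] that by (auto simp: pre_digraph.awalk_def x_def)
  have "x \<in> verts Q" if "f (u, q, x) \<noteq> 0"
   using path_supp[OF f that] cas_last[of Q u q x] hd by (auto simp: pre_digraph.awalk_def)
  then have x: "f (u, q, x) = 0 \<or> x \<in> verts Q" by blast
  have eq: "f (u, q, w) * g (w, r, v) = (if w = x then f (u, q, x) * g (x, r, v) else 0)" for w using z[of w] by (cases "w = x") simp_all
  have "(\<Sum>w\<in>verts Q. f (u, q, w) * g (w, r, v)) = (\<Sum>w\<in>verts Q. if w = x then f (u, q, x) * g (x, r, v) else 0)"
   by (rule sum.cong[OF refl eq])
  then have "(\<Sum>w\<in>verts Q. f (u, q, w) * g (w, r, v)) = f (u, q, x) * g (x, r, v)" using V x by auto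
  then show ?thesis by (simp add: x_def Let_def)
 qed
 then show ?thesis unfolding path_mult by simp
qed

lemma splits_simps:
 "splits [] = {([], [])}" "splits [x] = {([], [x]), ([x], [])}"
 "splits [x, y] = {([], [x, y]), ([x], [y]), ([x, y], [])}" by (auto simp: splits_def append_eq_Cons_conv)

lemma path_element_carrier: "p \<in> paths Q ==> path_element p \<in> $(path_algebra Q)"
 by (auto simp: path_carrier path_element_def)

lemma path_element_mult:
 assumes "finite (verts Q)" "w \<in> verts Q"
 shows "path_element (u, q, w) \<otimes>[path_algebra Q] path_element (w, r, v) = (path_element (u, q @ r, v) :: _ \<Rightarrow> 'k::field)"
proof (rule ext, clarify)
 fix u' p v'
 let ?a = "path_element (u, q, w) :: _ \<Rightarrow> 'k" and ?b = "path_element (w, r, v) :: _ \<Rightarrow> 'k" and ?c = "path_element (u, q @ r, v) :: _ \<Rightarrow> 'k"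
 have "(\<Sum>z\<in>verts Q. ?a (u', q', z) * ?b (z, r', v')) =
   (if u' = u \<and> q' = q \<and> r' = r \<and> v' = v then 1 else 0)" for q' r'
 proof -
  have "(\<Sum>z\<in>verts Q. ?a (u', q', z) * ?b (z, r', v')) =
    (\<Sum>z\<in>verts Q. if z = w then if u' = u \<and> q' = q \<and> r' = r \<and> v' = v then 1 else 0 else 0)"
   by (rule sum.cong) (auto simp: path_element_def)
  then show ?thesis using assms by simp
 qed
 moreover have m: "(q, r) \<in> splits p \<longleftrightarrow> p = q @ r" by (auto simp: splits_def)
 ultimately have "(?a \<otimes>[path_algebra Q] ?b) (u', p, v') =
   (\<Sum>x\<in>splits p. if u' = u \<and> fst x = q \<and> snd x = r \<and> v' = v then 1 else 0)"
  unfolding path_mult by (simp add: split_def)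
 also have "\<dots> = (\<Sum>x\<in>splits p. if x = (q, r) then if u' = u \<and> v' = v then 1 else 0 else 0)" by (rule sum.cong) auto
 also have "\<dots> = ?c (u', p, v')" using finite_splits[of p] m by (simp add: path_element_def)
 finally show "(?a \<otimes>[path_algebra Q] ?b) (u', p, v') =
   ?c (u', p, v')" .
qed

lemma path_smult_mult:
 "(\<lambda>p. c * f p) \<otimes>[path_algebra Q] g = (\<lambda>p. c * (f \<otimes>[path_algebra Q] g) p)"
 "f \<otimes>[path_algebra Q] (\<lambda>p. c * g p) = (\<lambda>p. c * (f \<otimes>[path_algebra Q] g) p)"
 by (auto simp: fun_eq_iff path_mult sum_distrib_left mult_ac split_def)

lemma path_minus:
 fixes f g :: "'v \<times> 'e list \<times> 'v \<Rightarrow> 'k::field"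
 assumes V: "finite (verts Q)" "head Q ` arcs Q \<subseteq> verts Q"
  and f: "f \<in> $(path_algebra Q)" "g \<in> $(path_algebra Q)"
 shows "-[path_algebra Q] g = (\<lambda>p. - g p)" "f -[path_algebra Q] g = (\<lambda>p. f p - g p)"
proof -
 note R = ring.is_abelian_group[OF path_algebra_ring[OF V, where 'k = 'k]]
 have c: "(\<lambda>p. - g p) \<in> $(path_algebra Q)" using path_scaled[OF f(2), of "-1"] by simp
 show m: "-[path_algebra Q] g = (\<lambda>p. - g p)" by (rule abelian_group.minus_equality[OF R _ f(2) c]) simp
 show "f -[path_algebra Q] g = (\<lambda>p. f p - g p)" unfolding a_minus_def m by simp
qed

section \<open>The quiver algebra in coordinates\<close>

text \<open>In the quotient \<open>a_i b_i\<close> and \<open>b_{i-1} a_{i-1}\<close> become equal,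
  so their coefficients are added for \<open>c_i\<close>. The bound i < n reflects the relation
  \<open>b_{n-1} a_{n-1} = 0\<close>, and for i = 1 there is only one such path.\<close>

fun coords :: "nat \<Rightarrow> 'k::field B_path \<Rightarrow> idx \<Rightarrow> 'k" where
 "coords n f (Ix_e i) = f (i, [], i)"
| "coords n f (Ix_a i) = f (i, [Arrow_a i], Suc i)"
| "coords n f (Ix_b i) = f (Suc i, [Arrow_b i], i)"
| "coords n f (Ix_c i) = (if 1 \<le> i \<and> i < n then f (i, [Arrow_a i, Arrow_b i], i) +
   (if 2 \<le> i then f (i, [Arrow_b (i-1), Arrow_a (i-1)], i) else 0) else 0)"

fun idx_path :: "idx \<Rightarrow> nat \<times> arrow list \<times> nat" where
 "idx_path (Ix_e i) = (i, [], i)"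
| "idx_path (Ix_a i) = (i, [Arrow_a i], Suc i)"
| "idx_path (Ix_b i) = (Suc i, [Arrow_b i], i)"
| "idx_path (Ix_c i) = (i, [Arrow_a i, Arrow_b i], i)"

lemma inj_idx_path: "inj idx_path"
proof (rule injI)
 show "s = t" if "idx_path s = idx_path t" for s t using that by (cases s; cases t) auto
qed

text \<open>A linear section of \<open>coords\<close>, supported on one chosen path for each basis
  element; \<open>c_i\<close> is represented by \<open>a_i b_i\<close>.\<close>

definition normal_form :: "nat \<Rightarrow> (idx \<Rightarrow> 'k::field) \<Rightarrow> 'k B_path" where
 "normal_form n \<phi> p = (if p \<in> idx_path ` {t. idx_ok n t} then \<phi> (inv_into UNIV idx_path p) else 0)"

lemma normal_form_path [simp]: "normal_form n \<phi> (idx_path t) = (if idx_ok n t then \<phi> t else 0)"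
 by (auto simp: normal_form_def inj_image_mem_iff[OF inj_idx_path] inv_f_f[OF inj_idx_path])

lemma normal_form_other: "(\<And>t. p \<noteq> idx_path t) ==> normal_form n \<phi> p = 0" by (auto simp: normal_form_def)

lemma finite_idx: "finite {t. idx_ok n t}"
proof (rule finite_subset)
 show "{t. idx_ok n t} \<subseteq> Ix_e ` {..n} \<union> Ix_a ` {..n} \<union> Ix_b ` {..n} \<union> Ix_c ` {..n}"
 proof
  fix t assume "t \<in> {t. idx_ok n t}"
  then show "t \<in> Ix_e ` {..n} \<union> Ix_a ` {..n} \<union> Ix_b ` {..n} \<union> Ix_c ` {..n}" by (cases t) auto
 qed
qed simp

lemma B_simps [simp]:
 "verts (B_quiver n) = {1..n}" "arcs (B_quiver n) = Arrow_a ` {1..n-1} \<union> Arrow_b ` {1..n-1}"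
 "tail (B_quiver n) (Arrow_a i) = i" "head (B_quiver n) (Arrow_a i) = Suc i"
 "tail (B_quiver n) (Arrow_b i) = Suc i" "head (B_quiver n) (Arrow_b i) = i" by (simp_all add: B_quiver_def)

lemma arrow_image [simp]:
 "Arrow_a i \<in> Arrow_a ` I \<longleftrightarrow> i \<in> I" "Arrow_b i \<in> Arrow_b ` I \<longleftrightarrow> i \<in> I"
 "Arrow_a i \<notin> Arrow_b ` I" "Arrow_b i \<notin> Arrow_a ` I" by auto

lemma B_wf: "finite (verts (B_quiver n))" "head (B_quiver n) ` arcs (B_quiver n) \<subseteq> verts (B_quiver n)" by auto

abbreviation KB :: "nat \<Rightarrow> ('k::field, 'k B_path) module" where "KB n \<equiv> path_algebra (B_quiver n)"

lemmas B_walk = pre_digraph.awalk_def pre_digraph.cas.simps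

lemma coords_out:
 assumes f: "f \<in> $(KB n)" and t: "\<not> idx_ok n t" shows "coords n f t = 0"
 using path_supp[OF f] t by (cases t) (force simp: B_walk)+

lemma coords_mult:
 assumes f: "f \<in> $(KB n)"
 shows "coords n (f \<otimes>[KB n] g) (Ix_e i) = coords n f (Ix_e i) * coords n g (Ix_e i)"
  "coords n (f \<otimes>[KB n] g) (Ix_a i) =
   coords n f (Ix_e i) * coords n g (Ix_a i) + coords n f (Ix_a i) * coords n g (Ix_e (Suc i))"
  "coords n (f \<otimes>[KB n] g) (Ix_b i) =
   coords n f (Ix_e (Suc i)) * coords n g (Ix_b i) + coords n f (Ix_b i) * coords n g (Ix_e i)"
  "coords n (f \<otimes>[KB n] g) (Ix_c i) = (if 1 \<le> i \<and> i < n then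
   coords n f (Ix_e i) * coords n g (Ix_c i) + coords n f (Ix_c i) * coords n g (Ix_e i) +
   coords n f (Ix_a i) * coords n g (Ix_b i) + coords n f (Ix_b (i-1)) * coords n g (Ix_a (i-1)) else 0)"
proof -
 \<comment> \<open>For i = 1 the last formula refers to \<open>b_0\<close>, which is not an arrow,
   so its coefficient has to be shown to vanish.\<close>
 have "Arrow_b 0 \<notin> arcs (B_quiver n)" by auto
 then have "f (Suc 0, [Arrow_b 0], 0) = 0" using path_supp[OF f, of "Suc 0" "[Arrow_b 0]" 0] unfolding B_walk by force
 then have z: "f (i, [Arrow_b (i - Suc 0)], i - Suc 0) = 0" if "i = Suc 0" using that by simp
 show "coords n (f \<otimes>[KB n] g) (Ix_e i) = coords n f (Ix_e i) * coords n g (Ix_e i)"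
  "coords n (f \<otimes>[KB n] g) (Ix_a i) =
   coords n f (Ix_e i) * coords n g (Ix_a i) + coords n f (Ix_a i) * coords n g (Ix_e (Suc i))"
  "coords n (f \<otimes>[KB n] g) (Ix_b i) =
   coords n f (Ix_e (Suc i)) * coords n g (Ix_b i) + coords n f (Ix_b i) * coords n g (Ix_e i)"
  by (simp_all add: path_mult_end[OF B_wf f] splits_simps)
 show "coords n (f \<otimes>[KB n] g) (Ix_c i) = (if 1 \<le> i \<and> i < n then
   coords n f (Ix_e i) * coords n g (Ix_c i) + coords n f (Ix_c i) * coords n g (Ix_e i) +
   coords n f (Ix_a i) * coords n g (Ix_b i) + coords n f (Ix_b (i-1)) * coords n g (Ix_a (i-1)) else 0)"
  using z by (cases "2 \<le> i") (simp_all add: path_mult_end[OF B_wf f] splits_simps Let_def algebra_simps)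
qed

lemma coords_linear:
 "coords n (\<lambda>p. f p + g p) t = coords n f t + coords n g t" "coords n (\<lambda>p. c * f p) t = c * coords n f t"
 by (cases t; simp add: algebra_simps)+

lemma coords_zero [simp]: "coords n (\<lambda>_. 0) t = 0" by (cases t) simp_all

lemma normal_form_linear:
 "normal_form n (\<lambda>t. \<phi> t + \<psi> t) p = normal_form n \<phi> p + normal_form n \<psi> p"
 "normal_form n (\<lambda>t. c * \<phi> t) p = c * normal_form n \<phi> p" by (simp_all add: normal_form_def)

lemma idx_path_paths: "idx_ok n t ==> idx_path t \<in> paths (B_quiver n)" by (cases t) (auto simp: paths_def B_walk)

lemma normal_form_carrier: "normal_form n \<phi> \<in> $(KB n)"
proof -
 have "{p. normal_form n \<phi> p \<noteq> 0} \<subseteq> idx_path ` {t. idx_ok n t}" by (auto simp: normal_form_def)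
 then show ?thesis unfolding path_carrier using finite_subset[OF _ finite_imageI[OF finite_idx]] idx_path_paths by blast
qed

lemma coords_normal_form: "coords n (normal_form n \<phi>) t = (if idx_ok n t then \<phi> t else 0)"
proof -
 have "normal_form n \<phi> (i, [Arrow_b j, x], k) = 0" for i j k x
 proof (rule normal_form_other)
  show "(i, [Arrow_b j, x], k) \<noteq> idx_path t" for t by (cases t) auto
 qed
 then show ?thesis using normal_form_path[of n \<phi> t] by (cases t) simp_all
qed

lemma B_ring: "ring (KB n :: ('k::field, 'k B_path) module)" by (rule path_algebra_ring[OF B_wf])

lemma two_arrows:
 assumes "set [x, y] \<subseteq> arcs (B_quiver n)" "head (B_quiver n) x = tail (B_quiver n) y"
 shows "arrow_element (B_quiver n) x \<otimes>[KB n] arrow_element (B_quiver n) y =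
   (path_element (tail (B_quiver n) x, [x, y], head (B_quiver n) y) :: 'k::field B_path)"
  "(path_element (tail (B_quiver n) x, [x, y], head (B_quiver n) y) :: 'k B_path) \<in> $(KB n)"
proof -
 have "head (B_quiver n) x \<in> verts (B_quiver n)" "tail (B_quiver n) x \<in> verts (B_quiver n)" using assms by auto
 then show "arrow_element (B_quiver n) x \<otimes>[KB n] arrow_element (B_quiver n) y =
   (path_element (tail (B_quiver n) x, [x, y], head (B_quiver n) y) :: 'k::field B_path)"
  "(path_element (tail (B_quiver n) x, [x, y], head (B_quiver n) y) :: 'k B_path) \<in> $(KB n)"
  using path_element_mult[OF B_wf(1), of "head (B_quiver n) x" n "tail (B_quiver n) x" "[x]" "[y]" "head (B_quiver n) y"] assms
  by (auto simp: arrow_element_def paths_def B_walk intro!: path_element_carrier)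
qed

section \<open>The ideal generated by the relations\<close>

definition kernel_B :: "nat \<Rightarrow> 'k::field B_path set" where
 "kernel_B n = {f \<in> $(KB n). \<forall>t. coords n f t = 0}"

lemma B_relations_eq:
 assumes n: "2 \<le> n"
 shows "(B_relations n :: 'k::field B_path set) =
  {path_element (n, [Arrow_b (n-1), Arrow_a (n-1)], n)} \<union>
  {(\<lambda>p. path_element (i, [Arrow_b (i-1), Arrow_a (i-1)], i) p - path_element (i, [Arrow_a i, Arrow_b i], i) p) |i. i \<in> {2..n-1}} \<union>
  {path_element (i-1, [Arrow_a (i-1), Arrow_a i], Suc i) |i. i \<in> {2..n-1}} \<union>
  {path_element (Suc i, [Arrow_b i, Arrow_b (i-1)], i-1) |i. i \<in> {2..n-1}}" (is "_ = {?r} \<union> ?R2 \<union> ?R3 \<union> ?R4")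
proof -
 let ?ae = "\<lambda>x. arrow_element (B_quiver n) x :: 'k B_path"
 have A: "Arrow_a i \<in> arcs (B_quiver n) \<and> Arrow_b i \<in> arcs (B_quiver n)" if "1 \<le> i" "i \<le> n - 1" for i using that by auto
 have 1: "?ae (Arrow_b (n-1)) \<otimes>[KB n] ?ae (Arrow_a (n-1)) = ?r"
  using two_arrows(1)[where 'k='k, of "Arrow_b (n-1)" "Arrow_a (n-1)" n] A[of "n-1"] n by simp
 have 2: "?ae (Arrow_b (i-1)) \<otimes>[KB n] ?ae (Arrow_a (i-1)) -[KB n] ?ae (Arrow_a i) \<otimes>[KB n] ?ae (Arrow_b i) =
   (\<lambda>p. path_element (i, [Arrow_b (i-1), Arrow_a (i-1)], i) p - path_element (i, [Arrow_a i, Arrow_b i], i) p)"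
  if i: "i \<in> {2..n-1}" for i
 proof -
  obtain k where k: "i = Suc k" "1 \<le> k" "k \<le> n - 1" "Suc k \<le> n - 1" using i by (cases i) auto
  show ?thesis
   using two_arrows[where 'k='k, of "Arrow_b k" "Arrow_a k" n] two_arrows[where 'k='k, of "Arrow_a i" "Arrow_b i" n] A[of k] A[of i] k
   by (simp add: path_minus(2)[OF B_wf])
 qed
 have 3: "?ae (Arrow_a (i-1)) \<otimes>[KB n] ?ae (Arrow_a i) = path_element (i-1, [Arrow_a (i-1), Arrow_a i], Suc i)"
  if i: "i \<in> {2..n-1}" for i
  using two_arrows(1)[where 'k='k, of "Arrow_a (i-1)" "Arrow_a i" n] A[of i] A[of "i-1"] i by (cases i) auto
 have 4: "?ae (Arrow_b i) \<otimes>[KB n] ?ae (Arrow_b (i-1)) = path_element (Suc i, [Arrow_b i, Arrow_b (i-1)], i-1)"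
  if i: "i \<in> {2..n-1}" for i
  using two_arrows(1)[where 'k='k, of "Arrow_b i" "Arrow_b (i-1)" n] A[of i] A[of "i-1"] i by (cases i) auto
 have c: "{F i |i. i \<in> {2..n-1}} = {G i |i. i \<in> {2..n-1}}" if "\<And>i. i \<in> {2..n-1} ==> F i = G i" for F G :: "nat \<Rightarrow> 'k B_path"
  unfolding set_eq_iff mem_Collect_eq using that by metis
 show ?thesis unfolding B_relations_def Let_def 1 by (intro arg_cong2[of _ _ _ _ "(\<union>)"] c 2 3 4 refl)
qed

lemma kernel_ideal: "ideal (kernel_B n) (KB n :: ('k::field, 'k B_path) module)"
proof (rule idealI[OF B_ring])
 let ?N = "kernel_B n :: 'k B_path set" and ?K = "KB n :: ('k, 'k B_path) module"
 show "subgroup ?N (add_monoid ?K)"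
 proof
  show "?N \<subseteq> $(add_monoid ?K)" by (auto simp: kernel_B_def)
  show "x \<otimes>[add_monoid ?K] y \<in> ?N" if "x \<in> ?N" "y \<in> ?N" for x y
   using that by (auto simp: kernel_B_def path_sum coords_linear)
  show "\<one>\<^bsub>add_monoid ?K\<^esub> \<in> ?N" by (simp add: kernel_B_def path_zero)
  show "inv\<^bsub>add_monoid ?K\<^esub> x \<in> ?N" if "x \<in> ?N" for x
   unfolding a_inv_def[symmetric] using that path_minus(1)[OF B_wf path_zero, of x] path_scaled[of x _ "-1"] coords_linear(2)[of n "-1" x]
   by (simp add: kernel_B_def)
 qed
 fix a x assume a: "a \<in> ?N" and x: "x \<in> $?K"
 then have aK: "a \<in> $?K" by (simp add: kernel_B_def)
 have z: "coords n a t = 0" for t using a by (simp add: kernel_B_def)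
 have "coords n (x \<otimes>[?K] a) t = 0" "coords n (a \<otimes>[?K] x) t = 0" for t
  using coords_mult[OF x, of a] coords_mult[OF aK, of x] z by (cases t; simp del: coords.simps)+
 then show "x \<otimes>[?K] a \<in> ?N" "a \<otimes>[?K] x \<in> ?N" using path_prod[OF x aK] path_prod[OF aK x] by (auto simp: kernel_B_def)
qed

lemma path_elementI: "pre_digraph.awalk (B_quiver n) u p v ==> path_element (u, p, v) \<in> $(KB n)"
 by (rule path_element_carrier) (simp add: paths_def)

lemma relations_kernel:
 assumes n: "2 \<le> n" shows "(B_relations n :: 'k::field B_path set) \<subseteq> kernel_B n"
proof
 fix f :: "'k B_path" assume f: "f \<in> B_relations n"
 have b: "path_element (i, [Arrow_b (i-1), Arrow_a (i-1)], i) \<in> $(KB n)" if "2 \<le> i" "i \<le> n" for i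
  by (rule path_elementI) (use that in \<open>auto simp: B_walk\<close>)
 have a: "path_element (i, [Arrow_a i, Arrow_b i], i) \<in> $(KB n)" if "2 \<le> i" "i \<le> n - 1" for i
  by (rule path_elementI) (use that in \<open>auto simp: B_walk\<close>)
 consider "f = path_element (n, [Arrow_b (n-1), Arrow_a (n-1)], n)"
  | i where "2 \<le> i" "i \<le> n - 1" "f = (\<lambda>p. path_element (i, [Arrow_b (i-1), Arrow_a (i-1)], i) p - path_element (i, [Arrow_a i, Arrow_b i], i) p)"
  | i where "2 \<le> i" "i \<le> n - 1" "f = path_element (i-1, [Arrow_a (i-1), Arrow_a i], Suc i)"
  | i where "2 \<le> i" "i \<le> n - 1" "f = path_element (Suc i, [Arrow_b i, Arrow_b (i-1)], i-1)"
  using f unfolding B_relations_eq[OF n] by auto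
 then show "f \<in> kernel_B n"
 proof cases
  case 1
  have "coords n f t = 0" for t unfolding 1 by (cases t) (auto simp: path_element_def)
  then show ?thesis using b[of n] n by (simp add: kernel_B_def 1)
 next
  case (2 i)
  have "coords n f t = 0" for t unfolding 2 using 2(1,2) by (cases t) (auto simp: path_element_def)
  moreover have "f \<in> $(KB n)"
   unfolding 2 using path_sum[OF b[OF 2(1) le_trans[OF 2(2) diff_le_self]] path_scaled[OF a[OF 2(1,2)], of "-1"]] by simp
  ultimately show ?thesis by (simp add: kernel_B_def)
 next
  case (3 i)
  have "coords n f t = 0" for t unfolding 3 by (cases t) (auto simp: path_element_def)
  moreover have "f \<in> $(KB n)" unfolding 3 by (rule path_elementI) (use 3 in \<open>auto simp: B_walk\<close>)
  ultimately show ?thesis by (simp add: kernel_B_def)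
 next
  case (4 i)
  have "coords n f t = 0" for t unfolding 4 by (cases t) (auto simp: path_element_def)
  moreover have "f \<in> $(KB n)" unfolding 4 by (rule path_elementI) (use 4 in \<open>auto simp: B_walk\<close>)
  ultimately show ?thesis by (simp add: kernel_B_def)
 qed
qed

lemma path_diff_mult:
 "(\<lambda>p. f p - g p) \<otimes>[path_algebra Q] h = (\<lambda>p. (f \<otimes>[path_algebra Q] h) p - (g \<otimes>[path_algebra Q] h) p)"
 "h \<otimes>[path_algebra Q] (\<lambda>p. f p - g p) = (\<lambda>p. (h \<otimes>[path_algebra Q] f) p - (h \<otimes>[path_algebra Q] g) p)"
 by (auto simp: fun_eq_iff path_mult algebra_simps sum_subtractf split_def)

lemma coords_idx_path: "idx_ok n t ==> coords n (path_element (idx_path t)) = (\<lambda>s. if s = t then 1 else 0)"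
proof
 show "coords n (path_element (idx_path t)) s = (if s = t then 1 else 0)" if "idx_ok n t" for s
  using that by (cases s; cases t) (auto simp: path_element_def)
qed

lemma normal_form_unit:
 assumes "idx_ok n t" shows "normal_form n (\<lambda>s. if s = t then 1 else 0) = path_element (idx_path t)"
proof
 fix p
 show "normal_form n (\<lambda>s. if s = t then 1 else 0) p = path_element (idx_path t) p"
 proof (cases "\<exists>s. p = idx_path s")
  case True
  then obtain s where "p = idx_path s" by blast
  then show ?thesis using assms inj_eq[OF inj_idx_path, of s t] by (auto simp: path_element_def)
 next
  case False
  then show ?thesis using normal_form_other[of p n] by (auto simp: path_element_def)
 qed
qed

text \<open>One inclusion is checked on the generators. For the other, every path is congruent
  modulo the relations to the normal form of its coordinates, so an element without coordinates is
  congruent to zero.\<close>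

lemma ideal_kernel:
 assumes n: "2 \<le> n" shows "(B_ideal n :: 'k::field B_path set) = kernel_B n"
proof
 let ?K = "KB n :: ('k, 'k B_path) module" and ?I = "B_ideal n :: 'k B_path set"
 let ?\<delta> = "path_element :: _ \<Rightarrow> 'k B_path"
 note R = relations_kernel[OF n, where 'k = 'k]
 show "?I \<subseteq> kernel_B n" unfolding B_ideal_def by (rule ring.genideal_minimal[OF B_ring kernel_ideal R])
 have RK: "B_relations n \<subseteq> $?K" using R by (auto simp: kernel_B_def)
 have I: "ideal ?I ?K" unfolding B_ideal_def by (rule ring.genideal_ideal[OF B_ring RK])
 interpret I: ideal ?I ?K by (rule I)
 have rel: "f \<in> ?I" if "f \<in> B_relations n" for f using ring.genideal_self[OF B_ring RK] that unfolding B_ideal_def by blast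
 have add: "(\<lambda>p. f p + g p) \<in> ?I" if "f \<in> ?I" "g \<in> ?I" for f g
  using additive_subgroup.a_closed[OF I.is_additive_subgroup that] by simp
 have z0: "(\<lambda>_. 0) \<in> ?I" using additive_subgroup.zero_closed[OF I.is_additive_subgroup] by simp
 have scale: "(\<lambda>p. c * f p) \<in> ?I" if f: "f \<in> ?I" for c f
 proof -
  have "(\<lambda>p. c * \<one>\<^bsub>?K\<^esub> p) \<otimes>[?K] f \<in> ?I" by (rule I.I_l_closed[OF f path_scaled[OF I.one_closed]])
  then show ?thesis using f I.a_subset by (simp add: path_smult_mult(1) subset_eq)
 qed
 have diff: "f \<in> ?I" if "(\<lambda>p. f p - g p) \<in> ?I" "g \<in> ?I" for f g using add[OF that] by simp
 have right: "?\<delta> (u, q @ r, v) \<in> ?I" if "?\<delta> (u, q, w) \<in> ?I" "pre_digraph.awalk (B_quiver n) w r v" for u q w r v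
  using I.I_r_closed[OF that(1) path_elementI[OF that(2)]] path_element_mult[OF B_wf(1), of w n u q r v, where 'k = 'k] that(2)
  by (simp add: pre_digraph.awalk_def)
 have left: "?\<delta> (u, q @ r, v) \<in> ?I" if "?\<delta> (w, r, v) \<in> ?I" "pre_digraph.awalk (B_quiver n) u q w" "1 \<le> w" "w \<le> n" for u q w r v
  using I.I_l_closed[OF that(1) path_elementI[OF that(2)]] path_element_mult[OF B_wf(1), of w n u q r v, where 'k = 'k] that(3,4) by simp
 have aa: "?\<delta> (i, [Arrow_a i, Arrow_a (Suc i)], Suc (Suc i)) \<in> ?I" if "1 \<le> i" "Suc i \<le> n - 1" for i
  by (rule rel, unfold B_relations_eq[OF n], rule UnI1, rule UnI2) (use that in \<open>auto intro!: exI[of _ "Suc i"]\<close>)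
 have bb: "?\<delta> (Suc (Suc i), [Arrow_b (Suc i), Arrow_b i], i) \<in> ?I" if "1 \<le> i" "Suc i \<le> n - 1" for i
  by (rule rel, unfold B_relations_eq[OF n], rule UnI2) (use that in \<open>auto intro!: exI[of _ "Suc i"]\<close>)
 have ba_last: "?\<delta> (n, [Arrow_b (n-1), Arrow_a (n-1)], n) \<in> ?I" by (rule rel, unfold B_relations_eq[OF n]) simp
 have ba: "(\<lambda>p. ?\<delta> (Suc i, [Arrow_b i, Arrow_a i], Suc i) p - ?\<delta> (Suc i, [Arrow_a (Suc i), Arrow_b (Suc i)], Suc i) p) \<in> ?I"
  if "1 \<le> i" "Suc i \<le> n - 1" for i
  by (rule rel, unfold B_relations_eq[OF n], rule UnI1, rule UnI1, rule UnI2) (use that in \<open>auto intro!: exI[of _ "Suc i"]\<close>)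
 have w1: "pre_digraph.awalk (B_quiver n) (tail (B_quiver n) x) [x] (head (B_quiver n) x)" if "x \<in> arcs (B_quiver n)" for x
  using that by (auto simp: B_walk)
 \<comment> \<open>\<open>a_i b_i a_i\<close> is congruent to \<open>a_i a_{i+1} b_{i+1}\<close>,
   which starts with a forbidden pair; for i = n - 1 the relation at the vertex n applies
   directly.\<close>
 have aba: "?\<delta> (i, [Arrow_a i, Arrow_b i, Arrow_a i], Suc i) \<in> ?I" if i: "1 \<le> i" "i \<le> n - 1" for i
 proof (cases "i = n - 1")
  case True
  then show ?thesis using left[of n "[Arrow_b i, Arrow_a i]" n i "[Arrow_a i]"] ba_last i n by (simp add: B_walk)
 next
  case False
  then have i': "Suc i \<le> n - 1" using i by simp
  have a: "pre_digraph.awalk (B_quiver n) i [Arrow_a i] (Suc i)" using i by (simp add: B_walk)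
  have v: "Suc i \<in> verts (B_quiver n)" using i by auto
  note m = path_element_mult[OF B_wf(1) v, where 'k = 'k, of i "[Arrow_a i]" _ "Suc i"]
  have "?\<delta> (i, [Arrow_a i, Arrow_a (Suc i), Arrow_b (Suc i)], Suc i) \<in> ?I"
   using right[OF aa[OF i(1) i'], of "[Arrow_b (Suc i)]" "Suc i"] i' by (simp add: B_walk)
  then show ?thesis using I.I_l_closed[OF ba[OF i(1) i'] path_elementI[OF a]] diff unfolding path_diff_mult m by simp
 qed
 have bab: "?\<delta> (Suc i, [Arrow_b i, Arrow_a i, Arrow_b i], i) \<in> ?I" if i: "1 \<le> i" "i \<le> n - 1" for i
 proof (cases "i = n - 1")
  case True
  then show ?thesis using right[of n "[Arrow_b i, Arrow_a i]" n "[Arrow_b i]" i] ba_last i n by (simp add: B_walk)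
 next
  case False
  then have i': "Suc i \<le> n - 1" using i by simp
  have a: "pre_digraph.awalk (B_quiver n) (Suc i) [Arrow_b i] i" using i by (simp add: B_walk)
  have v: "Suc i \<in> verts (B_quiver n)" using i by auto
  note m = path_element_mult[OF B_wf(1) v, where 'k = 'k, of "Suc i" _ "[Arrow_b i]" i]
  have "?\<delta> (Suc i, [Arrow_a (Suc i), Arrow_b (Suc i), Arrow_b i], i) \<in> ?I"
   using left[OF bb[OF i(1) i'], of "Suc i" "[Arrow_a (Suc i)]"] i' by (simp add: B_walk)
  then show ?thesis using I.I_r_closed[OF ba[OF i(1) i'] path_elementI[OF a]] diff unfolding path_diff_mult m by simp
 qed
 \<comment> \<open>A path of length three contains a pair of consecutive arrows a or of consecutive
   arrows b, or it alternates and is one of the two kinds just treated.\<close>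
 have three: "?\<delta> (u, [x, y, z], v) \<in> ?I" if w: "pre_digraph.awalk (B_quiver n) u [x, y, z] v" for u x y z v
 proof (cases x)
  case x: (Arrow_a i)
  show ?thesis
  proof (cases y)
   case y: (Arrow_a j)
   have "?\<delta> (u, [x, y], Suc j) \<in> ?I" using aa[of i] w unfolding x y by (auto simp: B_walk)
   then show ?thesis using right[of u "[x, y]" "Suc j" "[z]" v] w unfolding x y by (auto simp: B_walk)
  next
   case y: (Arrow_b j)
   show ?thesis
   proof (cases z)
    case z: (Arrow_a k)
    show ?thesis using aba[of i] w unfolding x y z by (auto simp: B_walk)
   next
    case z: (Arrow_b k)
    have "j = Suc k \<and> u = Suc k \<and> v = k \<and> i = j \<and> 1 \<le> k \<and> Suc k \<le> n - 1 \<and> Suc (Suc k) \<le> n" using w unfolding x y z by (auto simp: B_walk)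
    then show ?thesis using left[OF bb[of k], of "Suc k" "[x]"] w unfolding x y z by (simp add: B_walk)
   qed
  qed
 next
  case x: (Arrow_b i)
  show ?thesis
  proof (cases y)
   case y: (Arrow_b j)
   have "?\<delta> (u, [x, y], j) \<in> ?I" using bb[of j] w unfolding x y by (auto simp: B_walk)
   then show ?thesis using right[of u "[x, y]" j "[z]" v] w unfolding x y by (auto simp: B_walk)
  next
   case y: (Arrow_a j)
   show ?thesis
   proof (cases z)
    case z: (Arrow_b k)
    show ?thesis using bab[of i] w unfolding x y z by (auto simp: B_walk)
   next
    case z: (Arrow_a k)
    have "j = i \<and> u = Suc i \<and> v = Suc k \<and> k = Suc i \<and> 1 \<le> i \<and> Suc i \<le> n - 1" using w unfolding x y z by (auto simp: B_walk)
    then show ?thesis using left[OF aa[of i], of "Suc i" "[x]"] w unfolding x y z by (simp add: B_walk)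
   qed
  qed
 qed
 \<comment> \<open>\<open>W f\<close> says that f is congruent to its normal form; when all
   coordinates of f vanish, this means that f lies in the ideal.\<close>
 define W where "W f \<longleftrightarrow> (\<lambda>p. f p - normal_form n (coords n f) p) \<in> ?I" for f
 have W_idx: "W (?\<delta> (idx_path t))" if "idx_ok n t" for t
  using z0 unfolding W_def coords_idx_path[OF that] normal_form_unit[OF that] by simp
 have nf0: "normal_form n (coords n f) = (\<lambda>_. 0)" if "\<And>t. coords n f t = (0::'k)" for f
  using that by (auto simp: normal_form_def)
 have W_I: "W f" if "f \<in> ?I" "\<And>t. coords n f t = 0" for f using that(1) nf0[OF that(2)] unfolding W_def by simp
 have W_path: "W (?\<delta> (u, l, v))" if w: "pre_digraph.awalk (B_quiver n) u l v" for u l v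
 proof -
  consider "l = []" | x where "l = [x]" | x y where "l = [x, y]" | x y z l' where "l = x # y # z # l'" by (metis list.exhaust)
  then show ?thesis
  proof cases
   case 1
   then show ?thesis using W_idx[of "Ix_e u"] w by (auto simp: B_walk)
  next
   case (2 x)
   then show ?thesis using W_idx[of "Ix_a u"] W_idx[of "Ix_b v"] w by (cases x) (auto simp: B_walk)
  next
   case l: (3 x y)
   show ?thesis
   proof (cases x)
    case x: (Arrow_a i)
    show ?thesis
    proof (cases y)
     case y: (Arrow_b j)
     show ?thesis using W_idx[of "Ix_c i"] w unfolding l x y by (auto simp: B_walk)
    next
     case y: (Arrow_a j)
     have e: "j = Suc i" "u = i" "v = Suc (Suc i)" "1 \<le> i" "Suc i \<le> n - 1" using w unfolding l x y by (auto simp: B_walk)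
     have "coords n (?\<delta> (u, l, v)) t = 0" for t unfolding l x y by (cases t) (auto simp: path_element_def)
     then show ?thesis using aa[OF e(4,5)] by (intro W_I) (simp_all add: l x y e)
    qed
   next
    case x: (Arrow_b i)
    show ?thesis
    proof (cases y)
     case y: (Arrow_b j)
     have e: "i = Suc j" "v = j" "u = Suc (Suc j)" "1 \<le> j" "Suc j \<le> n - 1" using w unfolding l x y by (auto simp: B_walk)
     have "coords n (?\<delta> (u, l, v)) t = 0" for t unfolding l x y by (cases t) (auto simp: path_element_def)
     then show ?thesis using bb[OF e(4,5)] by (intro W_I) (simp_all add: l x y e)
    next
     case y: (Arrow_a j)
     have e: "j = i" "v = Suc i" "u = Suc i" "1 \<le> i" "i \<le> n - 1" using w unfolding l x y by (auto simp: B_walk)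
     show ?thesis
     proof (cases "i = n - 1")
      case True
      have "coords n (?\<delta> (u, l, v)) t = 0" for t unfolding l x y e using True by (cases t) (auto simp: path_element_def)
      then show ?thesis using ba_last True n by (intro W_I) (simp_all add: l x y e)
     next
      case False
      then have i: "Suc i \<le> n - 1" using e by simp
      \<comment> \<open>The normal form of \<open>b_i a_i\<close> is the path
        \<open>a_{i+1} b_{i+1}\<close>, so the congruence is the commutativity relation
        itself.\<close>
      have "coords n (?\<delta> (u, l, v)) = (\<lambda>s. if s = Ix_c (Suc i) then 1 else 0)"
      proof
       show "coords n (?\<delta> (u, l, v)) s = (if s = Ix_c (Suc i) then 1 else 0)" for s
        unfolding l x y e using i e(4) by (cases s) (auto simp: path_element_def)
      qed
      moreover have "idx_ok n (Ix_c (Suc i))" using i by auto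
      ultimately show ?thesis using ba[OF e(4) i] unfolding W_def by (simp add: normal_form_unit l x y e)
     qed
    qed
   qed
  next
   case l: (4 x y z l')
   \<comment> \<open>The prefix of length three already puts a longer path into the ideal, and such
     a path has no coordinates.\<close>
   define w' where "w' = head (B_quiver n) z"
   have "z \<in> arcs (B_quiver n)" using w unfolding l pre_digraph.awalk_def by simp
   then have "w' \<in> verts (B_quiver n)" using B_wf(2) unfolding w'_def by blast
   then have w': "pre_digraph.awalk (B_quiver n) u [x, y, z] w'" "pre_digraph.awalk (B_quiver n) w' l' v"
    using w unfolding l by (simp_all add: B_walk w'_def del: B_simps)
   have "?\<delta> (u, l, v) \<in> ?I" using right[OF three[OF w'(1)] w'(2)] by (simp add: l)
   moreover have "coords n (?\<delta> (u, l, v)) t = 0" for t unfolding l by (cases t) (auto simp: path_element_def)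
   ultimately show ?thesis by (rule W_I)
  qed
 qed
 have W_all: "W f" if "finite P" "f \<in> $?K" "{p. f p \<noteq> 0} \<subseteq> P" for P f using that
 proof (induction P arbitrary: f)
  case empty
  then have "f = (\<lambda>_. 0)" by auto
  then show ?case using W_I[of f] z0 by simp
 next
  case (insert x P)
  define g where "g = f(x := 0)"
  have g: "g \<in> $?K" "{p. g p \<noteq> 0} \<subseteq> P" using insert.prems by (auto simp: g_def path_carrier elim: rev_finite_subset)
  have eq: "f = (\<lambda>p. g p + f x * ?\<delta> x p)" by (auto simp: g_def path_element_def)
  show ?case
  proof (cases "f x = 0")
   case True
   then have "f = g" by (auto simp: g_def)
   then show ?thesis using insert.IH[OF g] by simp
  next
   case False
   then have "x \<in> paths (B_quiver n)" using insert.prems(1) by (auto simp: path_carrier)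
   then have "W (?\<delta> x)" using W_path by (cases x) (auto simp: paths_def)
   then have "(\<lambda>p. (g p - normal_form n (coords n g) p) + f x * (?\<delta> x p - normal_form n (coords n (?\<delta> x)) p)) \<in> ?I"
    using insert.IH[OF g] add scale unfolding W_def by blast
   moreover have "(\<lambda>p. f p - normal_form n (coords n f) p) =
     (\<lambda>p. (g p - normal_form n (coords n g) p) + f x * (?\<delta> x p - normal_form n (coords n (?\<delta> x)) p))"
   proof
    fix p
    have "coords n f = (\<lambda>t. coords n g t + f x * coords n (?\<delta> x) t)" by (subst eq) (simp add: fun_eq_iff coords_linear)
    then have "normal_form n (coords n f) p = normal_form n (coords n g) p + f x * normal_form n (coords n (?\<delta> x)) p"
     by (simp only: normal_form_linear)
    moreover have "f p = g p + f x * ?\<delta> x p" by (auto simp: g_def path_element_def)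
    ultimately show "f p - normal_form n (coords n f) p =
     (g p - normal_form n (coords n g) p) + f x * (?\<delta> x p - normal_form n (coords n (?\<delta> x)) p)"
     by (simp only: right_diff_distrib) (simp only: algebra_simps)
   qed
   ultimately show ?thesis unfolding W_def by simp
  qed
 qed
 show "kernel_B n \<subseteq> ?I"
 proof
  fix f :: "'k B_path" assume f: "f \<in> kernel_B n"
  then have "W f" using W_all[of "{p. f p \<noteq> 0}" f] by (simp add: kernel_B_def path_carrier)
  then show "f \<in> ?I" using f nf0[of f] unfolding W_def by (simp add: kernel_B_def)
 qed
qed

section \<open>The quotient algebra in coordinates\<close>

context
 fixes n :: nat
 assumes n: "2 \<le> n"
begin

text \<open>A coset of the ideal, described as a fibre of the coordinate map; this form makes
  equality of cosets a matter of coordinates.\<close>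

definition coset :: "'k::field B_path \<Rightarrow> 'k B_path set" where
 "coset f = {g \<in> $(KB n). coords n g = coords n f}"

text \<open>The choice of a representative is immaterial, since all elements of a coset have the
  same coordinates.\<close>

definition coset_co :: "idx \<Rightarrow> 'k::field B_path set \<Rightarrow> 'k" where
 "coset_co t L = coords n (SOME f. f \<in> L) t"

lemma coset_eq: "f \<in> $(KB n) ==> B_ideal n +>\<^bsub>KB n\<^esub> f = coset f"
proof -
 assume f: "f \<in> $(KB n)"
 have "g \<in> B_ideal n +>\<^bsub>KB n\<^esub> f \<longleftrightarrow> g \<in> coset f" for g
 proof
  assume "g \<in> B_ideal n +>\<^bsub>KB n\<^esub> f"
  then obtain h where h: "h \<in> kernel_B n" "g = (\<lambda>p. h p + f p)" unfolding a_r_coset_def' ideal_kernel[OF n] by auto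
  have "coords n g t = coords n f t" for t using h(1) unfolding h(2) by (simp add: coords_linear kernel_B_def)
  then show "g \<in> coset f" using f path_sum h by (auto simp: coset_def kernel_B_def)
 next
  assume g: "g \<in> coset f"
  define h where "h = (\<lambda>p. g p + (-1) * f p)"
  have "coords n h t = 0" for t using g unfolding h_def coords_linear by (simp add: coset_def)
  then have "h \<in> kernel_B n" using g f path_sum[OF _ path_scaled, of g _ f "-1"] by (simp add: coset_def kernel_B_def h_def)
  moreover have "g = (\<lambda>p. h p + f p)" by (simp add: h_def)
  ultimately show "g \<in> B_ideal n +>\<^bsub>KB n\<^esub> f" unfolding a_r_coset_def' ideal_kernel[OF n] by auto
 qed
 then show ?thesis by blast
qed

lemma coset_co: assumes f: "f \<in> $(KB n)" shows "coset_co t (coset f) = coords n f t"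
proof -
 have "f \<in> coset f" using f by (simp add: coset_def)
 then have "(SOME g. g \<in> coset f) \<in> coset f" by (rule someI[of "\<lambda>g. g \<in> coset f"])
 then show ?thesis by (simp add: coset_co_def coset_def)
qed

lemma coset_cong: "coords n f = coords n g ==> coset f = coset g" by (simp add: coset_def)

interpretation I: ideal "B_ideal n :: 'k::field B_path set" "KB n" using kernel_ideal unfolding ideal_kernel[OF n] .

abbreviation B :: "('k::field, 'k B_path set) module" where "B \<equiv> B_algebra n"

lemma B_carrier: "$B = coset ` $(KB n)" by (auto simp: B_algebra_def quotient_algebra_def FactRing_def A_RCOSETS_def' coset_eq)

lemma B_ops:
 assumes f: "f \<in> $(KB n)" and g: "g \<in> $(KB n)"
 shows "coset f +[B] coset g = coset (\<lambda>p. f p + g p)" "coset f \<otimes>[B] coset g = coset (f \<otimes>[KB n] g)"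
  "c \<odot>[B] coset f = coset (\<lambda>p. c * f p)"
proof -
 show "coset f +[B] coset g = coset (\<lambda>p. f p + g p)"
  using I.a_rcos_sum[OF f g] coset_eq[OF f] coset_eq[OF g] coset_eq[OF path_sum[OF f g]]
  by (simp add: B_algebra_def quotient_algebra_def FactRing_def)
 show "coset f \<otimes>[B] coset g = coset (f \<otimes>[KB n] g)"
  using I.rcoset_mult_add[OF f g] coset_eq[OF f] coset_eq[OF g] coset_eq[OF path_prod[OF f g]]
  by (simp add: B_algebra_def quotient_algebra_def FactRing_def)
 \<comment> \<open>Scalar multiplication on the quotient is a union over representatives, all of
   which give the same coset.\<close>
 have "B_ideal n +>\<^bsub>KB n\<^esub> (\<lambda>p. c * h p) = coset (\<lambda>p. c * f p)" if "h \<in> coset f" for h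
  using that coset_eq[OF path_scaled, of h c] by (auto simp: coset_def coords_linear fun_eq_iff)
 moreover have "f \<in> coset f" using f by (simp add: coset_def)
 ultimately show "c \<odot>[B] coset f = coset (\<lambda>p. c * f p)" by (auto simp: B_algebra_def quotient_algebra_def)
qed

lemma B_consts: "\<one>\<^bsub>B\<^esub> = (coset \<one>\<^bsub>KB n\<^esub> :: 'k::field B_path set)" "\<zero>[B] = (coset (\<lambda>_. 0) :: 'k B_path set)"
proof -
 have z: "B_ideal n +>\<^bsub>KB n\<^esub> (\<lambda>_. 0) = (B_ideal n :: 'k B_path set)" using I.a_coset_add_zero[OF I.a_subset] by simp
 show "\<zero>[B] = (coset (\<lambda>_. 0) :: 'k B_path set)"
  using trans[OF z[symmetric] coset_eq[OF path_zero]] by (simp add: B_algebra_def quotient_algebra_def FactRing_def)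
 show "\<one>\<^bsub>B\<^esub> = (coset \<one>\<^bsub>KB n\<^esub> :: 'k B_path set)"
  by (simp add: B_algebra_def quotient_algebra_def FactRing_def coset_eq)
qed

lemma coords_one: "coords n \<one>\<^bsub>KB n\<^esub> (Ix_e i) = (if 1 \<le> i \<and> i \<le> n then 1 else 0)"
 "coords n \<one>\<^bsub>KB n\<^esub> (Ix_a i) = 0" "coords n \<one>\<^bsub>KB n\<^esub> (Ix_b i) = 0" "coords n \<one>\<^bsub>KB n\<^esub> (Ix_c i) = 0"
 by (auto simp: path_one)

lemma KB_closed: "f \<in> $(KB n) ==> g \<in> $(KB n) ==> f \<otimes>[KB n] g \<in> $(KB n)"
 "\<one>\<^bsub>KB n\<^esub> \<in> $(KB n)" using path_prod I.one_closed by blast+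

lemma B_algebra_ring: "ring (B :: ('k::field, 'k B_path set) module)"
proof (rule ringI)
 let ?B = "B :: ('k, 'k B_path set) module"
 show "abelian_group ?B"
 proof (rule abelian_groupI)
  fix x assume "x \<in> $?B"
  then obtain f where f: "f \<in> $(KB n)" "x = coset f" unfolding B_carrier by blast
  have m: "(\<lambda>p. -1 * f p) \<in> $(KB n)" by (rule path_scaled[OF f(1)])
  show "\<exists>y\<in>$?B. y +[?B] x = \<zero>[?B]"
   by (rule bexI[of _ "coset (\<lambda>p. -1 * f p)"]) (use m f in \<open>simp_all add: B_ops B_consts B_carrier\<close>)
 qed (auto simp: B_carrier B_ops B_consts path_sum path_zero add_ac)
 show "monoid ?B" by (rule monoidI) (auto simp: B_carrier B_ops B_consts KB_closed path_assoc)
qed (auto simp: B_carrier B_ops path_sum KB_closed I.l_distr[simplified] I.r_distr[simplified])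

lemma B_algebra_module: "Module.module ring_of_type_algebra (B :: ('k::field, 'k B_path set) module)"
 using ring.is_abelian_group[OF B_algebra_ring] comm_ring_1_class.cring_from_type_algebra by (intro moduleI)
  (auto simp: ring_of_type_algebra_def abelian_group_def B_carrier B_ops path_scaled path_sum algebra_simps)

lemma coset_co_finsum:
 assumes "finite T" "\<And>s. s \<in> T ==> h s \<in> $B"
 shows "finsum B h T \<in> $B \<and> coset_co t (finsum B h T) = (\<Sum>s\<in>T. coset_co t (h s))" using assms
proof (induction T rule: finite_induct)
 case empty
 interpret R: ring B by (rule B_algebra_ring)
 show ?case by (simp add: B_consts coset_co path_zero B_carrier)
next
 case (insert s T)
 interpret R: ring B by (rule B_algebra_ring)
 obtain f g where "f \<in> $(KB n)" "h s = coset f" "g \<in> $(KB n)" "finsum B h T = coset g" using insert unfolding B_carrier by blast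
 then show ?case using insert by (auto simp: Pi_iff R.finsum_insert B_ops coset_co path_sum coords_linear B_carrier)
qed

lemma B_ext: "x \<in> $B ==> y \<in> $B ==> (\<And>t. coset_co t x = coset_co t y) ==> x = y"
 unfolding B_carrier by (auto simp: coset_co intro!: coset_cong)

theorem B_coordinate_algebra: "coordinate_algebra (B :: ('k::field, 'k B_path set) module) n coset_co"
proof -
 let ?B = "B :: ('k, 'k B_path set) module"
 interpret R: ring ?B by (rule B_algebra_ring)
 \<comment> \<open>The cosets of the basis paths; expanding an element in its coordinates along them
   gives finite dimension.\<close>
 define \<beta> where "\<beta> t = (coset (path_element (idx_path t)) :: 'k B_path set)" for t
 let ?T = "{t. idx_ok n t}"
 have \<beta>B: "\<beta> t \<in> $?B" and \<beta>c: "coset_co s (\<beta> t) = (if s = t then 1 else 0)" if "idx_ok n t" for s t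
  using that path_element_carrier[OF idx_path_paths[OF that], where 'c = 'k] unfolding \<beta>_def
  by (auto simp: B_carrier coset_co coords_idx_path)
 have smc: "c \<odot>[?B] x \<in> $?B" "coset_co t (c \<odot>[?B] x) = c * coset_co t x" if "x \<in> $?B" for c x t
  using that by (auto simp: B_carrier B_ops path_scaled coset_co coords_linear)
 have out: "coset_co t x = 0" if "x \<in> $?B" "\<not> idx_ok n t" for t x using that coords_out by (auto simp: B_carrier coset_co)
 have inj: "inj_on \<beta> ?T" using \<beta>c by (auto intro!: inj_onI) (metis zero_neq_one)
 have fin: "\<exists>c. x = finsum ?B (\<lambda>s. c s \<odot>[?B] s) (\<beta> ` ?T)" if x: "x \<in> $?B" for x
 proof (intro exI)
  let ?c = "\<lambda>s. coset_co (the_inv_into ?T \<beta> s) x"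
  have "finsum ?B (\<lambda>s. ?c s \<odot>[?B] s) (\<beta> ` ?T) = finsum ?B (\<lambda>t. ?c (\<beta> t) \<odot>[?B] \<beta> t) ?T"
   by (rule R.finsum_reindex) (use inj \<beta>B smc in auto)
  also have "\<dots> = finsum ?B (\<lambda>t. coset_co t x \<odot>[?B] \<beta> t) ?T"
   by (rule R.finsum_cong') (use inj \<beta>B smc in \<open>auto simp: the_inv_into_f_f\<close>)
  also have "\<dots> = x"
  proof (rule B_ext)
   have m: "coset_co t x \<odot>[?B] \<beta> t \<in> $?B" if "t \<in> ?T" for t using smc \<beta>B that by simp
   note F = coset_co_finsum[OF finite_idx[of n], of "\<lambda>t. coset_co t x \<odot>[?B] \<beta> t", OF m]
   show "finsum ?B (\<lambda>t. coset_co t x \<odot>[?B] \<beta> t) ?T \<in> $?B" using F by blast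
   fix s
   have "(\<Sum>t\<in>?T. coset_co s (coset_co t x \<odot>[?B] \<beta> t)) = (\<Sum>t\<in>?T. if s = t then coset_co t x else 0)"
    by (rule sum.cong) (use smc \<beta>B \<beta>c in auto)
   then show "coset_co s (finsum ?B (\<lambda>t. coset_co t x \<odot>[?B] \<beta> t) ?T) = coset_co s x"
    using F out[OF x, of s] finite_idx[of n] by auto
  qed (rule x)
  finally show "x = finsum ?B (\<lambda>s. ?c s \<odot>[?B] s) (\<beta> ` ?T)" by simp
 qed
 have fd: "fd_algebra ?B"
 proof (intro fd_algebra.intro fd_algebra_axioms.intro B_algebra_ring B_algebra_module)
  show "\<exists>S. finite S \<and> S \<subseteq> $?B \<and> (\<forall>x\<in>$?B. \<exists>c. x = finsum ?B (\<lambda>s. c s \<odot>[?B] s) S)"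
   using fin finite_idx[of n] \<beta>B by (intro exI[of _ "\<beta> ` ?T"]) auto
 qed (auto simp: B_carrier B_ops path_scaled KB_closed path_smult_mult)
 show ?thesis
 proof (intro coordinate_algebra.intro coordinate_algebra_axioms.intro fd n)
  show "\<exists>x\<in>$?B. \<forall>t. coset_co t x = (if idx_ok n t then \<phi> t else 0)" for \<phi>
   using normal_form_carrier[of n \<phi>] by (intro bexI[of _ "coset (normal_form n \<phi>)"]) (auto simp: B_carrier coset_co coords_normal_form)
 qed (auto simp: B_carrier B_ops B_consts coset_co coords_linear coords_mult coords_one path_sum path_scaled KB_closed coords_out
   intro!: coset_cong simp del: coords.simps)
qed

lemma B_idempotent_eq:
 assumes i: "1 \<le> i" "i \<le> n"
 shows "(B_idempotent n i :: 'k::field B_path set) = coordinate_algebra.bas B n coset_co (Ix_e i)"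
proof -
 have ok: "idx_ok n (Ix_e i)" using i by simp
 interpret C: coordinate_algebra "B :: ('k, 'k B_path set) module" n coset_co by (rule B_coordinate_algebra)
 have c: "(path_element (i, [], i) :: 'k B_path) \<in> $(KB n)" using path_element_carrier[OF idx_path_paths[OF ok]] by simp
 show ?thesis using C.bas_closed[of "Ix_e i"] C.co_bas[of _ "Ix_e i"] coords_idx_path[OF ok, where 'a = 'k] ok c
  by (intro B_ext) (auto simp: B_idempotent_def coset_eq B_carrier coset_co)
qed

end


theorem theorem4p6:
  fixes n :: nat
    and B :: "('k::alg_closed_field, 'k B_path set) module"
    and e :: "nat \<Rightarrow> 'k B_path set"
  assumes n: "n \<ge> 2"
    and B: "B = B_algebra n"
    and e: "e = B_idempotent n"
  shows "higher_Auslander_algebra B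
    \<and> gldim B = enat (2 * n - 2)
    \<and> domdim B (regular_module B) = enat (2 * n - 2)
    \<and> filtered_modules B n (standard_module B n e) = Dom B (n - 1)
    \<and> Dom B (n - 1) = Proj B (n - 1)
    \<and> (\<exists>\<epsilon>\<in>carrier B. \<epsilon> \<otimes>\<^bsub>B\<^esub> \<epsilon> = \<epsilon>
          \<and> minimal_faithful_projective_injective B (idempotent_module B \<epsilon>))
    \<and> (\<forall>\<epsilon>\<in>carrier B. \<epsilon> \<otimes>\<^bsub>B\<^esub> \<epsilon> = \<epsilon>
          \<and> minimal_faithful_projective_injective B (idempotent_module B \<epsilon>)
          \<longrightarrow> characteristic_tilting_module B n e
                (direct_sum (idempotent_module B \<epsilon>) (simple_module B e 1)))"
proof -
  interpret coordinate_algebra B n "coset_co n" unfolding B by (rule B_coordinate_algebra[OF n])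
  have e: "e j = ee j" if "1 \<le> j" "j \<le> n" for j unfolding e B by (rule B_idempotent_eq[OF n that])
  have "filtered_modules B n (standard_module B n e) = Dom B (n - 1)"
    unfolding Dom_eq_H by (rule filtered_standard[OF standard_cyc[OF e]])
  moreover have "Dom B (n - 1) = Proj B (n - 1)" unfolding Dom_eq_H Proj_eq_H by (rule refl)
  \<comment> \<open>The idempotent is \<open>e_1 + ... + e_{n-1}\<close>; the vertex n is omitted
    because \<open>e_n A\<close> is not injective.\<close>
  moreover have "\<exists>\<epsilon>\<in>carrier B. \<epsilon> \<otimes>\<^bsub>B\<^esub> \<epsilon> = \<epsilon> \<and> minimal_faithful_projective_injective B (idempotent_module B \<epsilon>)"
    using esum(1) esum_idem E_minimal by blast
  ultimately show ?thesis
    using higher_Auslander gldim_eq domdim_regular characteristic[OF e] by blast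
qed

end
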